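(* Let $p$ be a prime, $E$ a finite extension of $\mathbf{Q}_p$, $K$ a number field, and $\mathfrak{F}$ a pseudo-modulus of $K$ such that the set $\Sigma$ of primes $\mathfrak{p}$ of $K$ with $\mathfrak{p}^\infty \mid \mathfrak{F}$ is a subset of the set of primes of $K$ above $p$. Let $\Theta$ be a ray class distribution modulo $\mathfrak{F}$ with values in $E$ and growth parameter $(\alpha_{\mathfrak{p}})_{\mathfrak{p}\in\Sigma}$, and define \[ r = \sum_{\mathfrak{p} \in \Sigma} e_{\mathfrak{p}}\, v_p(\alpha_{\mathfrak{p}}), \] where $e_{\mathfrak{p}}$ is the absolute ramification index of $\mathfrak{p}$. Then $\Theta$, viewed as a locally constant distribution on $G_{\mathfrak{F}}$, has growth bounded by $r$. In particular, if $r < 1$, there is a unique element $\tilde\Theta \in D^r(G_{\mathfrak{F}}, E)$ whose restriction to $LC(G_{\mathfrak{F}},E)$ is $\Theta$.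
   Context: $v_p$ is the valuation with $v_p(p)=1$. A modulus of $K$ is a finite formal product $\prod v_i^{n_i}$ of finite primes and real places with $n_i\in\mathbf{Z}_{\ge 0}$, and $n_i\le 1$ at real places; a pseudo-modulus is the same but with $n_i=\infty$ allowed at finite primes. For a modulus $\mathfrak{f}$, $G_{\mathfrak{f}}$ is the ray class group modulo $\mathfrak{f}$; for a pseudo-modulus $\mathfrak{F}$, $G_{\mathfrak{F}}=\varprojlim_{\mathfrak{f}\mid\mathfrak{F}}G_{\mathfrak{f}}$ over moduli $\mathfrak{f}$ dividing $\mathfrak{F}$. When $\Sigma$ consists of primes above $p$, $G_{\mathfrak{F}}$ is a compact abelian $p$-adic analytic group. A growth parameter is a family $(\delta_{\mathfrak{p}})_{\mathfrak{p}\in\Sigma}$ of non-zero elements of $\mathcal{O}_E$. A ray class distribution modulo $\mathfrak{F}$ with growth parameter $(\delta_{\mathfrak{p}})$ and values in a finite-dimensional $E$-vector space $V$ is a family $\Phi_{\mathfrak{f}}\in E[G_{\mathfrak{f}}]\otimes_E V$, for all moduli $\mathfrak{f}\mid\mathfrak{F}$, such that (1) for $\mathfrak{f}\mid\mathfrak{f}'\mid\mathfrak{F}$, the map induced by the natural surjection $G_{\mathfrak{f}'}\to G_{\mathfrak{f}}$ sends $\Phi_{\mathfrak{f}'}$ to $\Phi_{\mathfrak{f}}$; (2) there is an $\mathcal{O}_E$-lattice $\Lambda\subseteq V$ such that $\Phi_{\mathfrak{f}}\in\mathcal{O}_E[G_{\mathfrak{f}}]\otimes_{\mathcal{O}_E}\delta_{\mathfrak{f}}^{-1}\Lambda$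 for every $\mathfrak{f}\mid\mathfrak{F}$, where $\delta_{\mathfrak{f}}=\prod_{\mathfrak{p}\in\Sigma}\delta_{\mathfrak{p}}^{v_{\mathfrak{p}}(\mathfrak{f})}$. It is viewed as a $V$-valued locally constant distribution $\mu$ on $G_{\mathfrak{F}}$: $\mu$ of the indicator function of the preimage of $c\in G_{\mathfrak{f}}$ is the coefficient of $c$ in $\Phi_{\mathfrak{f}}$. For a compact abelian $p$-adic analytic group $G$ (written additively) of dimension $d$, $LC(G,E)$ is the space of locally constant functions $G\to E$, and a locally constant distribution is a linear functional $\mu$ on $LC(G,E)$. It has growth bounded by $r$ if there are a constant $C$ and an open subgroup $H\cong\mathbf{Z}_p^d$ of $G$ with $\inf_{a\in G}v_p\,\mu(1_{a+p^mH})\ge C-rm$ for all $m\ge0$. For $0\le r<1$ and $G=\mathbf{Z}_p^d$, let $\varepsilon_m(f)=\inf_{x\in G,\,y\in p^mG}v_p(f(x+y)-f(x))$; $C^r(G,E)$ is the Banach space of continuous $f:G\to E$ with $\varepsilon_m(f)-rm\to\infty$, with valuation $\inf(\inf_x v_p(f(x)),\inf_{m\ge0}(\varepsilon_m(f)-rm))$. For general $G$ with open subgroup $H\cong\mathbf{Z}_p^d$, $C^r(G,E)$ is the space of functions whose pullback to $H$ along $h\mapsto a+h$ is in $C^r(H,E)$ for each $a\in G/H$, with the resulting topology (independent of $H$). $D^r(G,E)$ is the continuous dual of $C^r(G,E)$. *)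

theory Defs
  imports "HOL-Analysis.Analysis" "HOL-Algebra.Algebra" "HOL-Algebra.Algebraic_Closure_Type"
begin

section \<open>Topologies from valuations, topological groups\<close>

text \<open>
  Valuations take values in \<open>ereal\<close>, with \<open>\<infinity>\<close> as the valuation of zero.  In the following
  definition \<open>d x y\<close> is meant to be the valuation of \<open>x - y\<close>, so that \<^emph>\<open>large\<close> \<open>d x y\<close>
  means that \<open>x\<close> and \<open>y\<close> are close.
\<close>

definition val_topology :: "'a set \<Rightarrow> ('a \<Rightarrow> 'a \<Rightarrow> ereal) \<Rightarrow> 'a topology" where
  "val_topology S d =
     topology (\<lambda>U. U \<subseteq> S \<and> (\<forall>x\<in>U. \<exists>N::real. \<forall>y\<in>S. ereal N \<le> d x y \<longrightarrow> y \<in> U))"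

lemma openin_val_topology:
  "openin (val_topology S d) U \<longleftrightarrow>
     U \<subseteq> S \<and> (\<forall>x\<in>U. \<exists>N::real. \<forall>y\<in>S. ereal N \<le> d x y \<longrightarrow> y \<in> U)"
proof -
  let ?P = "\<lambda>U. U \<subseteq> S \<and> (\<forall>x\<in>U. \<exists>N::real. \<forall>y\<in>S. ereal N \<le> d x y \<longrightarrow> y \<in> U)"
  have "istopology ?P"
    unfolding istopology_def
  proof (intro conjI allI impI)
    fix U V assume U: "?P U" and V: "?P V"
    show "U \<inter> V \<subseteq> S" using U by blast
    show "\<forall>x\<in>U \<inter> V. \<exists>N::real. \<forall>y\<in>S. ereal N \<le> d x y \<longrightarrow> y \<in> U \<inter> V"
    proof
      fix x assume x: "x \<in> U \<inter> V"
      obtain M where M: "\<forall>y\<in>S. ereal M \<le> d x y \<longrightarrow> y \<in> U" using x U by blast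
      obtain N where N: "\<forall>y\<in>S. ereal N \<le> d x y \<longrightarrow> y \<in> V" using x V by blast
      have "\<forall>y\<in>S. ereal (max M N) \<le> d x y \<longrightarrow> y \<in> U \<inter> V"
        using M N by (auto intro: order_trans[rotated])
      then show "\<exists>N::real. \<forall>y\<in>S. ereal N \<le> d x y \<longrightarrow> y \<in> U \<inter> V" ..
    qed
  next
    fix \<U> assume "\<forall>U\<in>\<U>. ?P U"
    then show "\<Union>\<U> \<subseteq> S"
      and "\<forall>x\<in>\<Union>\<U>. \<exists>N::real. \<forall>y\<in>S. ereal N \<le> d x y \<longrightarrow> y \<in> \<Union>\<U>"
      by (blast, meson UnionE UnionI)
  qed
  then show ?thesis
    unfolding val_topology_def by (simp add: topology_inverse')
qed

record 'a topgroup = "'a monoid" +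
  topo :: "'a topology"

definition sub_topgroup :: "'a topgroup \<Rightarrow> 'a set \<Rightarrow> 'a topgroup" where
  "sub_topgroup G H = G\<lparr>carrier := H, topo := subtopology (topo G) H\<rparr>"

definition iso_topgroup :: "'a topgroup \<Rightarrow> 'b topgroup \<Rightarrow> bool" where
  "iso_topgroup G H \<longleftrightarrow> (\<exists>\<phi>\<in>iso G H. homeomorphic_map (topo G) (topo H) \<phi>)"


section \<open>The $p$-adic numbers and their finite extensions\<close>

definition rat_val :: "nat \<Rightarrow> rat \<Rightarrow> ereal" where
  "rat_val p q = (if q = 0 then \<infinity>
     else ereal (real (multiplicity (int p) (fst (quotient_of q)))
               - real (multiplicity (int p) (snd (quotient_of q)))))"

text \<open>
  \<open>Q\<^sub>p\<close> is the completion of the rationals: Cauchy sequences for the \<open>p\<close>-adic valuation,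
  modulo null sequences.
\<close>

definition padic_cauchy_ring :: "nat \<Rightarrow> (nat \<Rightarrow> rat) ring" where
  "padic_cauchy_ring p =
     \<lparr>carrier = {s. \<forall>N::real. \<exists>M. \<forall>m\<ge>M. \<forall>n\<ge>M. ereal N \<le> rat_val p (s m - s n)},
      monoid.mult = (\<lambda>s t n. s n * t n), one = (\<lambda>_. 1), ring.zero = (\<lambda>_. 0), add = (\<lambda>s t n. s n + t n)\<rparr>"

definition padic_null :: "nat \<Rightarrow> (nat \<Rightarrow> rat) set" where
  "padic_null p = {s. (\<lambda>n. rat_val p (s n)) \<longlonglongrightarrow> \<infinity>}"

definition Qp :: "nat \<Rightarrow> (nat \<Rightarrow> rat) set ring" where
  "Qp p = padic_cauchy_ring p Quot padic_null p"

definition Qp_val :: "nat \<Rightarrow> (nat \<Rightarrow> rat) set \<Rightarrow> ereal" where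
  "Qp_val p x = (THE l. \<forall>s\<in>x. (\<lambda>n. rat_val p (s n)) \<longlonglongrightarrow> l)"

definition Zp_set :: "nat \<Rightarrow> (nat \<Rightarrow> rat) set set" where
  "Zp_set p = {x \<in> carrier (Qp p). 0 \<le> Qp_val p x}"

definition Zp_power :: "nat \<Rightarrow> nat \<Rightarrow> (nat \<Rightarrow> (nat \<Rightarrow> rat) set) topgroup" where
  "Zp_power p d =
     \<lparr>carrier = ({..<d} \<rightarrow>\<^sub>E Zp_set p),
      monoid.mult = (\<lambda>x y. \<lambda>i\<in>{..<d}. x i \<oplus>\<^bsub>Qp p\<^esub> y i),
      one = (\<lambda>i\<in>{..<d}. \<zero>\<^bsub>Qp p\<^esub>),
      topo = product_topology
        (\<lambda>_. val_topology (Zp_set p) (\<lambda>x y. Qp_val p (x \<ominus>\<^bsub>Qp p\<^esub> y))) {..<d}\<rparr>"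

definition valuation :: "('e::field \<Rightarrow> ereal) \<Rightarrow> bool" where
  "valuation v \<longleftrightarrow> v 0 = \<infinity> \<and> (\<forall>x. x \<noteq> 0 \<longrightarrow> \<bar>v x\<bar> \<noteq> \<infinity>) \<and>
     (\<forall>x y. v (x * y) = v x + v y) \<and> (\<forall>x y. min (v x) (v y) \<le> v (x + y))"

text \<open>
  \<open>\<iota>\<close> makes the field \<open>'e\<close> a finite extension of \<open>Q\<^sub>p\<close>, and \<open>v\<close> is the (unique) extension of the
  normalised valuation of \<open>Q\<^sub>p\<close>.
\<close>

definition padic_extension ::
    "nat \<Rightarrow> ((nat \<Rightarrow> rat) set \<Rightarrow> 'e::field) \<Rightarrow> ('e \<Rightarrow> ereal) \<Rightarrow> bool" where
  "padic_extension p \<iota> v \<longleftrightarrow>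
     \<iota> \<in> ring_hom (Qp p) (ring_of_type_algebra :: 'e ring) \<and>
     ring.finite_dimension (ring_of_type_algebra :: 'e ring) (\<iota> ` carrier (Qp p)) UNIV \<and>
     valuation v \<and> (\<forall>x\<in>carrier (Qp p). v (\<iota> x) = Qp_val p x)"

definition val_ring :: "('e::field \<Rightarrow> ereal) \<Rightarrow> 'e set" where
  "val_ring v = {x. 0 \<le> v x}"

abbreviation field_topology :: "('e::field \<Rightarrow> ereal) \<Rightarrow> 'e topology" where
  "field_topology v \<equiv> val_topology UNIV (\<lambda>x y. v (x - y))"

definition is_lattice :: "('e::field \<Rightarrow> ereal) \<Rightarrow> ('e \<Rightarrow> 'v::ab_group_add \<Rightarrow> 'v) \<Rightarrow> 'v set \<Rightarrow> bool" where
  "is_lattice v scl \<Lambda> \<longleftrightarrow>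
     (\<exists>B. finite B \<and> module.span scl B = UNIV \<and>
          \<Lambda> = {\<Sum>b\<in>B. scl (c b) b | c. c ` B \<subseteq> val_ring v})"


section \<open>Number fields\<close>

definition number_field :: "'k::field_char_0 itself \<Rightarrow> bool" where
  "number_field _ \<longleftrightarrow>
     ring.finite_dimension (ring_of_type_algebra :: 'k ring) (range of_rat) UNIV"

definition ring_of_integers :: "'k::field_char_0 ring" where
  "ring_of_integers = ring_of_type_algebra\<lparr>carrier := {x. algebraic_int x}\<rparr>"

definition finite_primes :: "'k::field_char_0 set set" where
  "finite_primes = {P. primeideal P ring_of_integers \<and> P \<noteq> {0}}"

definition real_places :: "('k::field_char_0 \<Rightarrow> real) set" where
  "real_places = ring_hom ring_of_type_algebra ring_of_type_algebra"

text \<open>The exponent of \<open>P\<close> in the factorisation of the ideal generated by a nonzero integer \<open>a\<close>.\<close>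

definition prime_exponent :: "'k::field_char_0 set \<Rightarrow> 'k \<Rightarrow> nat" where
  "prime_exponent P a = (GREATEST n. a \<in> P [^]\<^bsub>ideals_set ring_of_integers\<^esub> n)"

text \<open>The normalised \<open>P\<close>-adic valuation on the nonzero elements of the number field.\<close>

definition prime_val :: "'k::field_char_0 set \<Rightarrow> 'k \<Rightarrow> int" where
  "prime_val P x = (THE n. \<exists>a b. algebraic_int a \<and> a \<noteq> 0 \<and> algebraic_int b \<and> b \<noteq> 0 \<and>
     x = a / b \<and> n = int (prime_exponent P a) - int (prime_exponent P b))"

definition primes_above :: "nat \<Rightarrow> 'k::field_char_0 set set" where
  "primes_above p = {P \<in> finite_primes. of_nat p \<in> P}"

definition ramification_index :: "nat \<Rightarrow> 'k::field_char_0 set \<Rightarrow> nat" where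
  "ramification_index p P = prime_exponent P (of_nat p)"

definition fractional_ideal :: "'k::field_char_0 set \<Rightarrow> bool" where
  "fractional_ideal I \<longleftrightarrow> additive_subgroup I ring_of_type_algebra \<and> I \<noteq> {0} \<and>
     (\<forall>a x. algebraic_int a \<longrightarrow> x \<in> I \<longrightarrow> a * x \<in> I) \<and>
     (\<exists>d. algebraic_int d \<and> d \<noteq> 0 \<and> (\<forall>x\<in>I. algebraic_int (d * x)))"

definition ideal_group :: "'k::field_char_0 set monoid" where
  "ideal_group = \<lparr>carrier = {I. fractional_ideal I},
     monoid.mult = ideal_prod ring_of_type_algebra, one = carrier ring_of_integers\<rparr>"


section \<open>Moduli and ray class groups\<close>

text \<open>
  The formal product of the \<open>P\<^sup>n\<close>, \<open>n = exponent \<FF> P\<close>, over the finite primes, and of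
  the real places in \<open>reals \<FF>\<close>.
\<close>

datatype 'k modulus = Modulus (exponent: "'k set \<Rightarrow> enat") (reals: "('k \<Rightarrow> real) set")

definition pseudo_modulus :: "'k::field_char_0 modulus \<Rightarrow> bool" where
  "pseudo_modulus \<FF> \<longleftrightarrow> {P. exponent \<FF> P \<noteq> 0} \<subseteq> finite_primes \<and> finite {P. exponent \<FF> P \<noteq> 0} \<and>
     reals \<FF> \<subseteq> real_places \<and> finite (reals \<FF>)"

definition modulus :: "'k::field_char_0 modulus \<Rightarrow> bool" where
  "modulus \<ff> \<longleftrightarrow> pseudo_modulus \<ff> \<and> (\<forall>P. exponent \<ff> P \<noteq> \<infinity>)"

definition mod_dvd :: "'k modulus \<Rightarrow> 'k modulus \<Rightarrow> bool" where
  "mod_dvd \<ff> \<FF> \<longleftrightarrow> (\<forall>P. exponent \<ff> P \<le> exponent \<FF> P) \<and> reals \<ff> \<subseteq> reals \<FF>"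

definition moduli :: "'k::field_char_0 modulus \<Rightarrow> 'k modulus set" where
  "moduli \<FF> = {\<ff>. modulus \<ff> \<and> mod_dvd \<ff> \<FF>}"

definition unbounded_primes :: "'k::field_char_0 modulus \<Rightarrow> 'k set set" where
  "unbounded_primes \<FF> = {P \<in> finite_primes. exponent \<FF> P = \<infinity>}"

definition prime_to_group :: "'k::field_char_0 modulus \<Rightarrow> 'k set monoid" where
  "prime_to_group \<ff> = subgroup_generated ideal_group {P \<in> finite_primes. exponent \<ff> P = 0}"

text \<open>The multiplicative congruence \<open>x \<equiv> 1\<close> modulo \<open>\<ff>\<close>, including positivity at the real places.\<close>

definition ray :: "'k::field_char_0 modulus \<Rightarrow> 'k set" where
  "ray \<ff> = {x. x \<noteq> 0 \<and>
     (\<forall>P\<in>finite_primes. exponent \<ff> P \<noteq> 0 \<longrightarrow>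
        x = 1 \<or> int (the_enat (exponent \<ff> P)) \<le> prime_val P (x - 1)) \<and>
     (\<forall>\<sigma>\<in>reals \<ff>. 0 < \<sigma> x)}"

definition principal_ray :: "'k::field_char_0 modulus \<Rightarrow> 'k set set" where
  "principal_ray \<ff> = (\<lambda>x. (*) x ` carrier ring_of_integers) ` ray \<ff>"

definition ray_class_group :: "'k::field_char_0 modulus \<Rightarrow> 'k set set monoid" where
  "ray_class_group \<ff> = prime_to_group \<ff> Mod principal_ray \<ff>"

text \<open>
  The natural surjection from the ray class group of a multiple of \<open>\<ff>\<close> to that of \<open>\<ff>\<close>: a coset
  \<open>c\<close> of the smaller ray is enlarged to the coset of \<open>principal_ray \<ff>\<close> containing it.
\<close>

definition ray_class_map :: "'k::field_char_0 modulus \<Rightarrow> 'k set set \<Rightarrow> 'k set set" where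
  "ray_class_map \<ff> c = principal_ray \<ff> <#>\<^bsub>prime_to_group \<ff>\<^esub> c"

definition pro_ray_class_group ::
    "'k::field_char_0 modulus \<Rightarrow> ('k modulus \<Rightarrow> 'k set set) topgroup" where
  "pro_ray_class_group \<FF> =
    (let S = {x \<in> (\<Pi>\<^sub>E \<ff>\<in>moduli \<FF>. carrier (ray_class_group \<ff>)).
               \<forall>\<ff>\<in>moduli \<FF>. \<forall>\<ff>'\<in>moduli \<FF>. mod_dvd \<ff> \<ff>' \<longrightarrow> ray_class_map \<ff> (x \<ff>') = x \<ff>}
     in \<lparr>carrier = S,
         monoid.mult = (\<lambda>x y. \<lambda>\<ff>\<in>moduli \<FF>. x \<ff> \<otimes>\<^bsub>ray_class_group \<ff>\<^esub> y \<ff>),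
         one = (\<lambda>\<ff>\<in>moduli \<FF>. \<one>\<^bsub>ray_class_group \<ff>\<^esub>),
         topo = subtopology
           (product_topology (\<lambda>\<ff>. discrete_topology (carrier (ray_class_group \<ff>))) (moduli \<FF>)) S\<rparr>)"


section \<open>Distributions on $p$-adic analytic groups\<close>

text \<open>
  Groups are written multiplicatively; \<open>p\<^sup>m H\<close> in additive notation is the set of \<open>p\<^sup>m\<close>-th powers.
  Function spaces on \<open>G\<close> consist of functions which are extensional on the carrier.
\<close>

definition p_multiples :: "nat \<Rightarrow> nat \<Rightarrow> 'g topgroup \<Rightarrow> 'g set \<Rightarrow> 'g set" where
  "p_multiples p m G H = (\<lambda>h. h [^]\<^bsub>G\<^esub> (p ^ m)) ` H"

definition char_fun :: "'g topgroup \<Rightarrow> 'g set \<Rightarrow> 'g \<Rightarrow> 'e::field" where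
  "char_fun G U = (\<lambda>x\<in>carrier G. if x \<in> U then 1 else 0)"

definition open_Zp_subgroup :: "nat \<Rightarrow> 'g topgroup \<Rightarrow> 'g set \<Rightarrow> bool" where
  "open_Zp_subgroup p G H \<longleftrightarrow> subgroup H G \<and> openin (topo G) H \<and>
     (\<exists>d. iso_topgroup (sub_topgroup G H) (Zp_power p d))"

definition linear_functional_on ::
    "'g topgroup \<Rightarrow> ('g \<Rightarrow> 'e::field) set \<Rightarrow> (('g \<Rightarrow> 'e) \<Rightarrow> 'e) \<Rightarrow> bool" where
  "linear_functional_on G S L \<longleftrightarrow> L \<in> extensional S \<and>
     (\<forall>f\<in>S. \<forall>g\<in>S. L (\<lambda>x\<in>carrier G. f x + g x) = L f + L g) \<and>
     (\<forall>c. \<forall>f\<in>S. L (\<lambda>x\<in>carrier G. c * f x) = c * L f)"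

definition LC :: "'g topgroup \<Rightarrow> ('g \<Rightarrow> 'e::field) set" where
  "LC G = {f \<in> extensional (carrier G).
     \<forall>x\<in>carrier G. \<exists>U. openin (topo G) U \<and> x \<in> U \<and> (\<forall>y\<in>U. f y = f x)}"

definition lc_distribution :: "'g topgroup \<Rightarrow> (('g \<Rightarrow> 'e::field) \<Rightarrow> 'e) \<Rightarrow> bool" where
  "lc_distribution G \<mu> \<longleftrightarrow> linear_functional_on G (LC G) \<mu>"

definition growth_bounded ::
    "nat \<Rightarrow> ('e::field \<Rightarrow> ereal) \<Rightarrow> 'g topgroup \<Rightarrow> real \<Rightarrow> (('g \<Rightarrow> 'e) \<Rightarrow> 'e) \<Rightarrow> bool" where
  "growth_bounded p v G r \<mu> \<longleftrightarrow> lc_distribution G \<mu> \<and>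
     (\<exists>(C::real) H. open_Zp_subgroup p G H \<and>
        (\<forall>m. ereal (C - r * real m)
             \<le> (INF a\<in>carrier G. v (\<mu> (char_fun G (a <#\<^bsub>G\<^esub> p_multiples p m G H))))))"

text \<open>The next three definitions are for a group \<open>A\<close> isomorphic to a power of \<open>Z\<^sub>p\<close>.\<close>

definition epsilon :: "nat \<Rightarrow> ('e::field \<Rightarrow> ereal) \<Rightarrow> 'g topgroup \<Rightarrow> nat \<Rightarrow> ('g \<Rightarrow> 'e) \<Rightarrow> ereal" where
  "epsilon p v A m f =
     (INF x\<in>carrier A. INF y\<in>p_multiples p m A (carrier A). v (f (x \<otimes>\<^bsub>A\<^esub> y) - f x))"

definition is_Cr :: "nat \<Rightarrow> ('e::field \<Rightarrow> ereal) \<Rightarrow> real \<Rightarrow> 'g topgroup \<Rightarrow> ('g \<Rightarrow> 'e) \<Rightarrow> bool" where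
  "is_Cr p v r A f \<longleftrightarrow> continuous_map (topo A) (field_topology v) f \<and>
     (\<lambda>m. epsilon p v A m f - ereal (r * real m)) \<longlonglongrightarrow> \<infinity>"

definition Cr_val :: "nat \<Rightarrow> ('e::field \<Rightarrow> ereal) \<Rightarrow> real \<Rightarrow> 'g topgroup \<Rightarrow> ('g \<Rightarrow> 'e) \<Rightarrow> ereal" where
  "Cr_val p v r A f =
     inf (INF x\<in>carrier A. v (f x)) (INF m. epsilon p v A m f - ereal (r * real m))"

text \<open>
  For general \<open>G\<close> with an open subgroup \<open>H\<close> isomorphic to a power of \<open>Z\<^sub>p\<close>.  Since \<open>is_Cr\<close> and
  \<open>Cr_val\<close> are translation invariant, letting \<open>a\<close> range over all of \<open>G\<close> is the same as
  letting it range over representatives of the cosets of \<open>H\<close>.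
\<close>

definition Cr_space ::
    "nat \<Rightarrow> ('e::field \<Rightarrow> ereal) \<Rightarrow> real \<Rightarrow> 'g topgroup \<Rightarrow> 'g set \<Rightarrow> ('g \<Rightarrow> 'e) set" where
  "Cr_space p v r G H = {f \<in> extensional (carrier G).
     \<forall>a\<in>carrier G. is_Cr p v r (sub_topgroup G H) (\<lambda>h. f (a \<otimes>\<^bsub>G\<^esub> h))}"

definition Cr_topology ::
    "nat \<Rightarrow> ('e::field \<Rightarrow> ereal) \<Rightarrow> real \<Rightarrow> 'g topgroup \<Rightarrow> 'g set \<Rightarrow> ('g \<Rightarrow> 'e) topology" where
  "Cr_topology p v r G H = val_topology (Cr_space p v r G H)
     (\<lambda>f g. INF a\<in>carrier G.
        Cr_val p v r (sub_topgroup G H) (\<lambda>h. f (a \<otimes>\<^bsub>G\<^esub> h) - g (a \<otimes>\<^bsub>G\<^esub> h)))"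

definition Dr_space ::
    "nat \<Rightarrow> ('e::field \<Rightarrow> ereal) \<Rightarrow> real \<Rightarrow> 'g topgroup \<Rightarrow> 'g set \<Rightarrow> (('g \<Rightarrow> 'e) \<Rightarrow> 'e) set" where
  "Dr_space p v r G H = {L. linear_functional_on G (Cr_space p v r G H) L \<and>
     continuous_map (Cr_topology p v r G H) (field_topology v) L}"


section \<open>Ray class distributions\<close>

definition growth_parameter ::
    "('e::field \<Rightarrow> ereal) \<Rightarrow> 'k::field_char_0 modulus \<Rightarrow> ('k set \<Rightarrow> 'e) \<Rightarrow> bool" where
  "growth_parameter v \<FF> \<delta> \<longleftrightarrow> (\<forall>P\<in>unbounded_primes \<FF>. \<delta> P \<noteq> 0 \<and> \<delta> P \<in> val_ring v)"

definition delta_at :: "'k::field_char_0 modulus \<Rightarrow> ('k set \<Rightarrow> 'e::field) \<Rightarrow> 'k modulus \<Rightarrow> 'e" where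
  "delta_at \<FF> \<delta> \<ff> = (\<Prod>P\<in>unbounded_primes \<FF>. \<delta> P ^ the_enat (exponent \<ff> P))"

text \<open>
  \<open>\<Phi> \<ff> c\<close> is the coefficient of \<open>c\<close> in the element \<open>\<Phi>\<^sub>\<ff>\<close> of the group algebra tensored with
  the vector space \<open>'v\<close>.
\<close>

definition ray_class_distribution ::
    "('e::field \<Rightarrow> ereal) \<Rightarrow> ('e \<Rightarrow> 'v::ab_group_add \<Rightarrow> 'v) \<Rightarrow> 'k::field_char_0 modulus \<Rightarrow>
     ('k set \<Rightarrow> 'e) \<Rightarrow> ('k modulus \<Rightarrow> 'k set set \<Rightarrow> 'v) \<Rightarrow> bool" where
  "ray_class_distribution v scl \<FF> \<delta> \<Phi> \<longleftrightarrow>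
     vector_space scl \<and> growth_parameter v \<FF> \<delta> \<and>
     (\<forall>\<ff>\<in>moduli \<FF>. finite {c \<in> carrier (ray_class_group \<ff>). \<Phi> \<ff> c \<noteq> 0}) \<and>
     (\<forall>\<ff>\<in>moduli \<FF>. \<forall>\<ff>'\<in>moduli \<FF>. mod_dvd \<ff> \<ff>' \<longrightarrow>
        (\<forall>c\<in>carrier (ray_class_group \<ff>).
           \<Phi> \<ff> c = (\<Sum>c' | c' \<in> carrier (ray_class_group \<ff>') \<and> \<Phi> \<ff>' c' \<noteq> 0 \<and>
                          ray_class_map \<ff> c' = c. \<Phi> \<ff>' c'))) \<and>
     (\<exists>\<Lambda>. is_lattice v scl \<Lambda> \<and>
        (\<forall>\<ff>\<in>moduli \<FF>. \<forall>c\<in>carrier (ray_class_group \<ff>).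
           \<Phi> \<ff> c \<in> scl (inverse (delta_at \<FF> \<delta> \<ff>)) ` \<Lambda>))"

text \<open>An \<open>E\<close>-valued ray class distribution, viewed as a locally constant distribution.\<close>

definition ray_lc_distribution ::
    "'k::field_char_0 modulus \<Rightarrow> ('k modulus \<Rightarrow> 'k set set \<Rightarrow> 'e::field) \<Rightarrow>
     (('k modulus \<Rightarrow> 'k set set) \<Rightarrow> 'e) \<Rightarrow> 'e" where
  "ray_lc_distribution \<FF> \<Phi> =
    (let G = pro_ray_class_group \<FF>
     in THE \<mu>. lc_distribution G \<mu> \<and>
          (\<forall>\<ff>\<in>moduli \<FF>. \<forall>c\<in>carrier (ray_class_group \<ff>).
             \<mu> (char_fun G {x \<in> carrier G. x \<ff> = c}) = \<Phi> \<ff> c))"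

end

theory Submission
  imports Defs "Jordan_Normal_Form.Char_Poly"
begin

text \<open>
  Let \<open>G\<close> be the group of the pseudo-modulus \<open>F\<close>, and let \<open>K m\<close> be the kernel of its projection to the
  ray class group of the modulus with exponent \<open>e P * (m + 2)\<close> at the primes \<open>P\<close> whose exponent in \<open>F\<close>
  is infinite and with the exponents of \<open>F\<close> elsewhere.  These moduli are cofinal, so the \<open>K m\<close> are
  a basis of neighbourhoods of the identity.  Since \<open>(1 + w)\<^sup>p\<close> is congruent to \<open>1 + p w\<close>,
  approximation at the finitely many primes and real places of \<open>F\<close> shows that the \<open>p\<close>-th power map
  sends \<open>K m\<close> onto \<open>K (m + 1)\<close>.  The ray class groups being finite, \<open>K t\<close> is then isomorphic to a power
  of the \<open>p\<close>-adic integers for large \<open>t\<close>, and its \<open>p\<^sup>m\<close>-th powers form \<open>K (t + m)\<close>.  The measure of a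
  coset of \<open>K m\<close> is a coefficient of the distribution at level \<open>m\<close>, and the valuation of the
  denominator allowed at this level is \<open>r (m + 2)\<close>; this is the growth bound.

  For the extension to \<open>C\<^sup>r\<close>, a function \<open>f\<close> is replaced by its values at representatives of the
  cosets of \<open>H\<^sup>q\<close> with \<open>q = p\<^sup>m\<close>.  Passing from \<open>m\<close> to \<open>m + 1\<close> changes the integral by an amount whose
  valuation is at least that of the oscillation of \<open>f\<close> minus \<open>r m\<close>, up to a constant, and
  this tends to infinity, so that the integrals converge.

  The finiteness of ray class groups and the invertibility of ideals are both derived from Hurwitz's
  lemma: some \<open>c > 0\<close> satisfies \<open>c I \<subseteq> (b)\<close> with a suitable \<open>b \<in> I\<close>, for every nonzero integral ideal \<open>I\<close>.
\<close>

section \<open>Valued fields and the p-adic numbers\<close>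

text \<open>The exponents of the tower are multiples of \<open>e P\<close> because multiplication by
  \<open>p\<close> raises the \<open>P\<close>-adic valuation by exactly \<open>e P\<close>: so one
  step of the tower matches one \<open>p\<close>-th power at all \<open>P\<close> simultaneously,
  and one step adds exactly \<open>r\<close> to the allowed denominator. The field has no exact
  \<open>p\<close>-th roots of ray elements; arithmetic supplies only roots up to the next level,
  and completeness of the inverse limit turns these into exact ones. At low levels the power map
  need not be injective on the quotients of \<open>K n\<close> by \<open>K (n + 1)\<close>, for
  instance because of torsion, which forces the passage to a large \<open>t\<close>. The dimension
  is then the size of a basis of \<open>K t\<close> modulo \<open>K (t + 1)\<close>; nothing about
  units enters. The extension is claimed for every open \<open>H\<close> isomorphic to a power of
  the p-adic integers, not just for \<open>K t\<close>. All that is used of \<open>H\<close> is a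
  comparison of filtrations: the \<open>p ^ m\<close>-th powers of \<open>H\<close> contain
  \<open>K (c + m)\<close> for a fixed \<open>c\<close>, and lie in any given \<open>K n\<close> for
  large \<open>m\<close>.\<close>

locale valued_field =
  fixes v :: "'e::field \<Rightarrow> ereal"
  assumes valuation: "valuation v"
begin

lemma v_0 [simp]: "v 0 = \<infinity>"
  and v_mult: "v (x * y) = v x + v y"
  and v_add: "min (v x) (v y) \<le> v (x + y)"
  using valuation by (auto simp: valuation_def)

lemma v_finite: "x \<noteq> 0 \<Longrightarrow> \<bar>v x\<bar> \<noteq> \<infinity>"
  using valuation by (auto simp: valuation_def)

lemma v_not_MInf [simp]: "v x \<noteq> -\<infinity>"
  using v_finite[of x] by (cases "x = 0") auto

lemma v_real: "x \<noteq> 0 \<Longrightarrow> \<exists>c. v x = ereal c"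
  using v_finite[of x] by (cases "v x") auto

lemma v_eq_infinity_iff [simp]: "v x = \<infinity> \<longleftrightarrow> x = 0"
  using v_finite[of x] by (cases "x = 0") auto

lemma v_1 [simp]: "v 1 = 0"
proof -
  obtain c where "v 1 = ereal c" using v_real[of 1] by auto
  with v_mult[of 1 1] show ?thesis by (simp add: zero_ereal_def)
qed

lemma v_minus [simp]: "v (- x) = v x"
proof -
  obtain c where c: "v (-1) = ereal c" using v_real[of "-1"] by auto
  with v_mult[of "-1" "-1"] have "v (-1) = 0" by (simp add: zero_ereal_def)
  with v_mult[of "-1" x] show ?thesis by simp
qed

lemma v_add_ge: "c \<le> v x \<Longrightarrow> c \<le> v y \<Longrightarrow> c \<le> v (x + y)"
  using v_add[of x y] by (meson min.boundedI order_trans)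

lemma v_diff_ge: "c \<le> v x \<Longrightarrow> c \<le> v y \<Longrightarrow> c \<le> v (x - y)"
  using v_add_ge[of c x "- y"] by simp

lemma v_diff_commute: "v (x - y) = v (y - x)"
  using v_minus[of "x - y"] by simp

lemma v_sum_ge: "(\<And>i. i \<in> A \<Longrightarrow> c \<le> v (f i)) \<Longrightarrow> c \<le> v (sum f A)"
  by (induction A rule: infinite_finite_induct) (auto intro: v_add_ge)

text \<open>Isosceles triangles: if \<open>v y\<close> exceeded \<open>v x\<close>, then
  \<open>x = y + (x - y)\<close> would be a sum of two terms of larger valuation. It makes the
  valuations along a Cauchy sequence that is not a null sequence eventually constant.\<close>

lemma v_eqI: assumes "v x < v (x - y)" shows "v y = v x"
proof (rule antisym)
  show "v x \<le> v y" using v_diff_ge[of "v x" x "x - y"] assms by simp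
  show "v y \<le> v x"
  proof (rule ccontr)
    assume "\<not> v y \<le> v x"
    then have "min (v y) (v (x - y)) > v x" using assms by simp
    with v_add[of y "x - y"] show False by (simp add: not_less[symmetric] del: min_less_iff_conj)
  qed
qed

lemma v_power: "x \<noteq> 0 \<Longrightarrow> v (x ^ n) = ereal (real n * real_of_ereal (v x))"
proof (induction n)
  case (Suc n)
  obtain c where "v x = ereal c" using v_real Suc.prems by auto
  with Suc show ?case by (simp add: v_mult algebra_simps)
qed (auto simp: zero_ereal_def)

lemma v_inverse: assumes "x \<noteq> 0" shows "v (inverse x) = - v x"
proof -
  obtain c d where cd: "v x = ereal c" "v (inverse x) = ereal d" using v_real assms by (metis inverse_nonzero_iff_nonzero)
  with v_mult[of x "inverse x"] assms show ?thesis by (simp add: zero_ereal_def)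
qed

lemma v_prod: "finite A \<Longrightarrow> (\<And>i. i \<in> A \<Longrightarrow> f i \<noteq> 0) \<Longrightarrow>
  v (prod f A) = ereal (\<Sum>i\<in>A. real_of_ereal (v (f i)))"
proof (induction A rule: finite_induct)
  case (insert x A)
  obtain c where "v (f x) = ereal c" using v_real insert.prems by blast
  with insert show ?case by (simp add: v_mult)
qed (auto simp: zero_ereal_def)

end

text \<open>\<open>rat_val\<close> is defined through the reduced fraction; cross multiplication
  carries the formula over to arbitrary representations, since sums and products of fractions are
  rarely reduced.\<close>

lemma rat_val_Fract:
  assumes "Factorial_Ring.prime p" "a \<noteq> 0" "b \<noteq> 0"
  shows "rat_val p (of_int a / of_int b) = ereal (real (multiplicity (int p) a) - real (multiplicity (int p) b))"
proof -
  define q where "q = (of_int a / of_int b :: rat)"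
  obtain n d where nd: "quotient_of q = (n, d)" by (cases "quotient_of q")
  have d: "d > 0" using quotient_of_denom_pos[OF nd] .
  have q: "q = of_int n / of_int d" using quotient_of_div[OF nd] .
  have q0: "q \<noteq> 0" using assms by (simp add: q_def)
  then have n: "n \<noteq> 0" using q by auto
  have "(of_int (a * d) :: rat) = of_int (n * b)"
    using q unfolding q_def using assms d by (simp add: field_simps)
  then have eq: "a * d = n * b" by (simp only: of_int_eq_iff)
  have P: "prime_elem (int p)" using assms by (simp add: prime_imp_prime_elem)
  have "multiplicity (int p) a + multiplicity (int p) d = multiplicity (int p) n + multiplicity (int p) b"
    using arg_cong[OF eq, of "multiplicity (int p)"] assms d n
    by (simp add: prime_elem_multiplicity_mult_distrib[OF P])
  then show ?thesis using nd q0 by (simp add: rat_val_def q_def)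
qed

lemma rat_val_of_int_ge_iff:
  assumes "Factorial_Ring.prime p"
  shows "ereal (real n) \<le> rat_val p (of_int a) \<longleftrightarrow> int p ^ n dvd a"
proof (cases "a = 0")
  case False
  have "Factorial_Ring.prime (int p)" using assms by simp
  then have "\<not> is_unit (int p)" using not_prime_unit by blast
  then show ?thesis using rat_val_Fract[OF assms False, of 1] False
    by (simp add: power_dvd_iff_le_multiplicity)
qed (auto simp: rat_val_def)

lemma valuation_rat_val:
  assumes "Factorial_Ring.prime p"
  shows "valuation (rat_val p)"
  unfolding valuation_def
proof (intro conjI allI impI)
  have rep: "\<exists>a b. b \<noteq> 0 \<and> x = of_int a / of_int b" for x :: rat
    using quotient_of_div[of x] quotient_of_denom_pos[of x] by (metis less_irrefl surj_pair)
  have P: "prime_elem (int p)" using assms by (simp add: prime_imp_prime_elem)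
  have nu: "\<not> is_unit (int p)" using P by (auto simp: prime_elem_def)
  show "rat_val p 0 = \<infinity>" by (simp add: rat_val_def)
  show "\<bar>rat_val p x\<bar> \<noteq> \<infinity>" if "x \<noteq> 0" for x using that by (simp add: rat_val_def)
  show "rat_val p (x * y) = rat_val p x + rat_val p y" for x y
  proof (cases "x = 0 \<or> y = 0")
    case True then show ?thesis by (auto simp: rat_val_def)
  next
    case False
    obtain a b c d where ab: "b \<noteq> 0" "x = of_int a / of_int b" and cd: "d \<noteq> 0" "y = of_int c / of_int d"
      using rep by meson
    have nz: "a \<noteq> 0" "c \<noteq> 0" using False ab cd by auto
    have "x * y = of_int (a * c) / of_int (b * d)" using ab cd by simp
    then have "rat_val p (x * y) = ereal (real (multiplicity (int p) (a * c)) - real (multiplicity (int p) (b * d)))"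
      using rat_val_Fract[OF assms, of "a * c" "b * d"] nz ab cd by simp
    then show ?thesis using ab cd nz
      by (simp add: rat_val_Fract[OF assms] prime_elem_multiplicity_mult_distrib[OF P])
  qed
  show "min (rat_val p x) (rat_val p y) \<le> rat_val p (x + y)" for x y
  proof (cases "x = 0 \<or> y = 0 \<or> x + y = 0")
    case True then show ?thesis by (auto simp: rat_val_def)
  next
    case False
    obtain a b c d where ab: "b \<noteq> 0" "x = of_int a / of_int b" and cd: "d \<noteq> 0" "y = of_int c / of_int d"
      using rep by meson
    have nz: "a \<noteq> 0" "c \<noteq> 0" using False ab cd by auto
    let ?m = "multiplicity (int p)"
    have s: "x + y = of_int (a * d + c * b) / of_int (b * d)" using ab cd by (simp add: field_simps)
    then have nzs: "a * d + c * b \<noteq> 0" using False by (metis div_0 of_int_0)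
    let ?k = "min (?m (a * d)) (?m (c * b))"
    have "int p ^ ?k dvd a * d + c * b"
      by (intro dvd_add) (meson dvd_trans le_imp_power_dvd min.cobounded1 min.cobounded2 multiplicity_dvd)+
    then have "?k \<le> ?m (a * d + c * b)"
      using nzs nu by (intro multiplicity_geI) auto
    moreover have "rat_val p (x + y) = ereal (real (?m (a * d + c * b)) - real (?m (b * d)))"
      unfolding s using rat_val_Fract[OF assms nzs, of "b * d"] ab cd by simp
    ultimately show ?thesis using ab cd nz
      by (simp add: rat_val_Fract[OF assms] prime_elem_multiplicity_mult_distrib[OF P] min_def split: if_splits)
  qed
qed

text \<open>The reduced denominator \<open>w\<close> is prime to \<open>p\<close>, so it has an
  inverse \<open>w'\<close> modulo \<open>p ^ n\<close>, and \<open>u * w'\<close> is the required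
  integer. This is the density of the integers in the p-adically integral rationals.\<close>

lemma rat_val_integer_approx:
  assumes "Factorial_Ring.prime p" "0 \<le> rat_val p q"
  shows "\<exists>a. ereal (real n) \<le> rat_val p (q - of_int a)"
proof (cases "q = 0")
  case True then show ?thesis by (intro exI[of _ 0]) (simp add: rat_val_def)
next
  case False
  interpret valued_field "rat_val p" using valuation_rat_val[OF assms(1)] by unfold_locales
  obtain u w where uw: "quotient_of q = (u, w)" by (cases "quotient_of q")
  have w: "w > 0" "q = of_int u / of_int w" "coprime u w"
    using quotient_of_denom_pos[OF uw] quotient_of_div[OF uw] quotient_of_coprime[OF uw] by auto
  have P: "Factorial_Ring.prime (int p)" using assms by simp
  have "\<not> int p dvd w"
  proof
    assume d: "int p dvd w"
    then have "\<not> int p dvd u" using w(3) P not_prime_unit by (meson coprime_common_divisor)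
    then have "multiplicity (int p) u = 0" by (rule not_dvd_imp_multiplicity_0)
    moreover have "multiplicity (int p) w > 0" using d w P by (intro multiplicity_gt_zero_iff[THEN iffD2]) (auto simp: not_prime_unit)
    ultimately show False using assms(2) False uw by (simp add: rat_val_def)
  qed
  then have "coprime (int p ^ n) w" using P by (simp add: prime_imp_coprime)
  then obtain k w' where "k * int p ^ n + w' * w = 1"
    using bezout_int[of "int p ^ n" w] by auto
  then have "1 - w * w' = k * int p ^ n" by (simp add: algebra_simps)
  then have "int p ^ n dvd u * (1 - w * w')" by simp
  then have 1: "ereal (real n) \<le> rat_val p (of_int (u * (1 - w * w')))"
    using rat_val_of_int_ge_iff[OF assms(1)] by blast
  have 2: "rat_val p (of_int w) = 0"
    using rat_val_Fract[OF assms(1), of w 1] w \<open>\<not> int p dvd w\<close> by (simp add: not_dvd_imp_multiplicity_0 zero_ereal_def)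
  have "(q - of_int (u * w')) * of_int w = of_int (u * (1 - w * w'))"
    using w by (simp add: field_simps)
  then have "rat_val p (of_int (u * (1 - w * w'))) = rat_val p (q - of_int (u * w')) + 0"
    using v_mult[of "q - of_int (u * w')" "of_int w"] 2 by simp
  then show ?thesis using 1 by (intro exI[of _ "u * w'"]) simp
qed


section \<open>The field of p-adic numbers from Cauchy sequences\<close>

locale padic =
  fixes p :: nat
  assumes prime_p: "Factorial_Ring.prime p"
begin

sublocale rat: valued_field "rat_val p"
  using valuation_rat_val[OF prime_p] by unfold_locales

abbreviation "CR \<equiv> padic_cauchy_ring p"
abbreviation "Null \<equiv> padic_null p"

definition cls :: "(nat \<Rightarrow> rat) \<Rightarrow> (nat \<Rightarrow> rat) set" where
  "cls s = Null +>\<^bsub>CR\<^esub> s"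

lemma cauchy_iff: "s \<in> carrier CR \<longleftrightarrow> (\<forall>N::real. \<exists>M. \<forall>m\<ge>M. \<forall>n\<ge>M. ereal N \<le> rat_val p (s m - s n))"
  by (simp add: padic_cauchy_ring_def)

lemma CR_simps [simp]:
  "s \<oplus>\<^bsub>CR\<^esub> t = (\<lambda>n. s n + t n)" "s \<otimes>\<^bsub>CR\<^esub> t = (\<lambda>n. s n * t n)"
  "\<zero>\<^bsub>CR\<^esub> = (\<lambda>_. 0)" "\<one>\<^bsub>CR\<^esub> = (\<lambda>_. 1)"
  by (simp_all add: padic_cauchy_ring_def)

lemma null_iff: "s \<in> Null \<longleftrightarrow> (\<forall>N::real. \<forall>\<^sub>F n in sequentially. ereal N \<le> rat_val p (s n))"
proof -
  have "s \<in> Null \<longleftrightarrow> (\<forall>N::real. \<forall>\<^sub>F n in sequentially. ereal N < rat_val p (s n))"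
    by (simp add: padic_null_def tendsto_PInfty)
  also have "\<dots> \<longleftrightarrow> (\<forall>N::real. \<forall>\<^sub>F n in sequentially. ereal N \<le> rat_val p (s n))"
  proof (intro iffI allI)
    fix N :: real
    assume "\<forall>N::real. \<forall>\<^sub>F n in sequentially. ereal N < rat_val p (s n)"
    then have "\<forall>\<^sub>F n in sequentially. ereal N < rat_val p (s n)" by blast
    then show "\<forall>\<^sub>F n in sequentially. ereal N \<le> rat_val p (s n)"
      by (rule eventually_mono) simp
  next
    fix N :: real
    assume "\<forall>N::real. \<forall>\<^sub>F n in sequentially. ereal N \<le> rat_val p (s n)"
    then have "\<forall>\<^sub>F n in sequentially. ereal (N + 1) \<le> rat_val p (s n)" by blast
    then show "\<forall>\<^sub>F n in sequentially. ereal N < rat_val p (s n)"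
      by (rule eventually_mono) (metis ereal_less_ereal_Ex less_add_one order_less_le_trans)
  qed
  finally show ?thesis .
qed

lemma const_cauchy [simp]: "(\<lambda>_. c) \<in> carrier CR"
  by (simp add: cauchy_iff)

lemma cauchy_add [simp]: "s \<in> carrier CR \<Longrightarrow> t \<in> carrier CR \<Longrightarrow> (\<lambda>n. s n + t n) \<in> carrier CR"
  unfolding cauchy_iff
proof
  fix N :: real
  assume s: "\<forall>N::real. \<exists>M. \<forall>m\<ge>M. \<forall>n\<ge>M. ereal N \<le> rat_val p (s m - s n)"
    and t: "\<forall>N::real. \<exists>M. \<forall>m\<ge>M. \<forall>n\<ge>M. ereal N \<le> rat_val p (t m - t n)"
  obtain M1 where M1: "\<forall>m\<ge>M1. \<forall>n\<ge>M1. ereal N \<le> rat_val p (s m - s n)" using s by blast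
  obtain M2 where M2: "\<forall>m\<ge>M2. \<forall>n\<ge>M2. ereal N \<le> rat_val p (t m - t n)" using t by blast
  have "ereal N \<le> rat_val p (s m + t m - (s n + t n))" if "m \<ge> max M1 M2" "n \<ge> max M1 M2" for m n
    using rat.v_add_ge[of "ereal N" "s m - s n" "t m - t n"] M1 M2 that by (simp add: algebra_simps)
  then show "\<exists>M. \<forall>m\<ge>M. \<forall>n\<ge>M. ereal N \<le> rat_val p (s m + t m - (s n + t n))" by blast
qed

lemma cauchy_bounded: assumes "s \<in> carrier CR" shows "\<exists>B::real. \<forall>n. ereal B \<le> rat_val p (s n)"
proof -
  obtain M where M: "\<forall>m\<ge>M. \<forall>n\<ge>M. ereal 0 \<le> rat_val p (s m - s n)" using assms cauchy_iff by blast
  \<comment> \<open>Zero terms have valuation infinity; the dummy value 0 keeps \<open>f\<close>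
    real-valued and is still a lower bound.\<close>
  define f where "f x = (if x = 0 then 0 else real_of_ereal (rat_val p x))" for x
  have f: "ereal (f x) \<le> rat_val p x" for x
    using rat.v_real[of x] by (auto simp: f_def)
  define B where "B = Min (insert 0 ((\<lambda>n. f (s n)) ` {..M}))"
  have B: "B \<le> 0" "n \<le> M \<Longrightarrow> B \<le> f (s n)" for n unfolding B_def by (rule Min_le; auto)+
  have "ereal B \<le> rat_val p (s n)" if "n \<le> M" for n using f[of "s n"] B(2)[OF that] by (meson ereal_less_eq(3) order_trans)
  moreover have "ereal B \<le> rat_val p (s n)" if "n > M" for n
  proof -
    have "ereal B \<le> rat_val p (s n - s M)" using M that B(1) by (meson ereal_less_eq(3) less_imp_le order_refl order_trans)
    moreover have "ereal B \<le> rat_val p (s M)" using f[of "s M"] B(2)[of M] by (meson ereal_less_eq(3) order_refl order_trans)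
    ultimately show ?thesis using rat.v_add_ge[of "ereal B" "s n - s M" "s M"] by simp
  qed
  ultimately show ?thesis by (meson not_le)
qed

lemma v_mult_ge: "ereal a \<le> rat_val p x \<Longrightarrow> ereal b \<le> rat_val p y \<Longrightarrow> ereal (a + b) \<le> rat_val p (x * y)"
  unfolding rat.v_mult by (metis add_mono plus_ereal.simps(1))

lemma cauchy_mult [simp]: assumes "s \<in> carrier CR" "t \<in> carrier CR" shows "(\<lambda>n. s n * t n) \<in> carrier CR"
  unfolding cauchy_iff
proof
  fix N :: real
  obtain A B where A: "\<And>n. ereal A \<le> rat_val p (s n)" and B: "\<And>n. ereal B \<le> rat_val p (t n)"
    using cauchy_bounded assms by meson
  obtain M1 where M1: "\<forall>m\<ge>M1. \<forall>n\<ge>M1. ereal (N - B) \<le> rat_val p (s m - s n)" using assms cauchy_iff by meson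
  obtain M2 where M2: "\<forall>m\<ge>M2. \<forall>n\<ge>M2. ereal (N - A) \<le> rat_val p (t m - t n)" using assms cauchy_iff by meson
  have "ereal N \<le> rat_val p (s m * t m - s n * t n)" if "m \<ge> max M1 M2" "n \<ge> max M1 M2" for m n
  proof -
    have "ereal N \<le> rat_val p ((s m - s n) * t m)" "ereal N \<le> rat_val p (s n * (t m - t n))"
      using v_mult_ge[of "N - B" "s m - s n" B "t m"] v_mult_ge[of A "s n" "N - A" "t m - t n"] M1 M2 A B that by auto
    then show ?thesis using rat.v_add_ge[of "ereal N" "(s m - s n) * t m" "s n * (t m - t n)"] by (simp add: algebra_simps)
  qed
  then show "\<exists>M. \<forall>m\<ge>M. \<forall>n\<ge>M. ereal N \<le> rat_val p (s m * t m - s n * t n)" by blast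
qed

lemma cauchy_minus [simp]: "s \<in> carrier CR \<Longrightarrow> (\<lambda>n. - s n) \<in> carrier CR"
  using cauchy_mult[of "\<lambda>_. -1" s] by simp

lemma cauchy_diff [simp]: "s \<in> carrier CR \<Longrightarrow> t \<in> carrier CR \<Longrightarrow> (\<lambda>n. s n - t n) \<in> carrier CR"
  using cauchy_add[of s "\<lambda>n. - t n"] by simp

lemma null_cauchy: assumes "s \<in> Null" shows "s \<in> carrier CR"
  unfolding cauchy_iff
proof
  fix N :: real
  obtain M where M: "\<forall>n\<ge>M. ereal N \<le> rat_val p (s n)" using assms null_iff eventually_sequentially by metis
  then show "\<exists>M. \<forall>m\<ge>M. \<forall>n\<ge>M. ereal N \<le> rat_val p (s m - s n)" using rat.v_diff_ge by blast
qed

lemma cring_CR: "cring CR"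
proof (rule cringI)
  show "abelian_group CR"
    by (rule abelian_groupI) (auto simp: algebra_simps intro!: bexI[of _ "\<lambda>n. - x n" for x])
  show "comm_monoid CR"
    by (rule comm_monoidI) (auto simp: algebra_simps)
qed (auto simp: algebra_simps)

sublocale CR: cring CR by (rule cring_CR)

lemma CR_minus [simp]: assumes "s \<in> carrier CR" shows "\<ominus>\<^bsub>CR\<^esub> s = (\<lambda>n. - s n)"
  by (rule CR.minus_equality) (use assms in auto)

lemma null_zero [simp]: "(\<lambda>_. 0) \<in> Null"
  by (simp add: null_iff)

lemma null_add: assumes "s \<in> Null" "t \<in> Null" shows "(\<lambda>n. s n + t n) \<in> Null"
  unfolding null_iff
proof
  fix N :: real
  have "\<forall>\<^sub>F n in sequentially. ereal N \<le> rat_val p (s n)" "\<forall>\<^sub>F n in sequentially. ereal N \<le> rat_val p (t n)"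
    using assms null_iff by blast+
  then show "\<forall>\<^sub>F n in sequentially. ereal N \<le> rat_val p (s n + t n)"
    by eventually_elim (rule rat.v_add_ge)
qed

lemma null_mult: assumes "s \<in> Null" "t \<in> carrier CR" shows "(\<lambda>n. t n * s n) \<in> Null"
  unfolding null_iff
proof
  fix N :: real
  obtain B where B: "\<And>n. ereal B \<le> rat_val p (t n)" using cauchy_bounded assms(2) by meson
  have "\<forall>\<^sub>F n in sequentially. ereal (N - B) \<le> rat_val p (s n)" using assms null_iff by blast
  then show "\<forall>\<^sub>F n in sequentially. ereal N \<le> rat_val p (t n * s n)"
    by eventually_elim (use v_mult_ge[OF B] in fastforce)
qed

lemma null_minus: "s \<in> Null \<Longrightarrow> (\<lambda>n. - s n) \<in> Null"
  using null_mult[of s "\<lambda>_. -1"] by simp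

lemma ideal_Null: "ideal Null CR"
proof (rule idealI)
  show "ring CR" by (rule CR.ring_axioms)
  show "subgroup Null (add_monoid CR)"
  proof (rule group.subgroupI)
    show "Group.group (add_monoid CR)" by (rule CR.add.is_group)
    show "Null \<subseteq> carrier (add_monoid CR)" using null_cauchy by auto
    show "Null \<noteq> {}" using null_zero by blast
    fix a assume a: "a \<in> Null"
    then show "inv\<^bsub>add_monoid CR\<^esub> a \<in> Null" using CR_minus[OF null_cauchy[OF a]] null_minus[OF a] by (simp add: a_inv_def)
    fix b assume "b \<in> Null" then show "a \<otimes>\<^bsub>add_monoid CR\<^esub> b \<in> Null" using null_add[OF a] by simp
  qed
qed (use null_mult in \<open>auto simp: mult.commute\<close>)

sublocale Null: ideal Null CR by (rule ideal_Null)

sublocale Q: cring "Qp p"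
  unfolding Qp_def by (rule Null.quotient_is_cring) (rule cring_CR)

lemma cls_hom: "cls \<in> Ring.ring_hom CR (Qp p)"
  using Null.rcos_ring_hom by (simp add: cls_def[abs_def] Qp_def)

lemma carrier_Qp: "carrier (Qp p) = cls ` carrier CR"
  by (auto simp: Qp_def FactRing_def A_RCOSETS_def' cls_def)

lemma QpE: assumes "x \<in> carrier (Qp p)" obtains s where "s \<in> carrier CR" "x = cls s"
  using assms carrier_Qp by auto

lemma cls_in [simp]: "s \<in> carrier CR \<Longrightarrow> cls s \<in> carrier (Qp p)"
  using carrier_Qp by blast

lemma cls_simps:
  assumes "s \<in> carrier CR" "t \<in> carrier CR"
  shows "cls s \<oplus>\<^bsub>Qp p\<^esub> cls t = cls (\<lambda>n. s n + t n)"
    and "cls s \<otimes>\<^bsub>Qp p\<^esub> cls t = cls (\<lambda>n. s n * t n)"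
    and "cls s \<ominus>\<^bsub>Qp p\<^esub> cls t = cls (\<lambda>n. s n - t n)"
    and "\<ominus>\<^bsub>Qp p\<^esub> cls t = cls (\<lambda>n. - t n)"
proof -
  interpret h: ring_hom_ring CR "Qp p" cls
    by (intro ring_hom_ringI2 CR.ring_axioms Q.ring_axioms cls_hom)
  show "cls s \<oplus>\<^bsub>Qp p\<^esub> cls t = cls (\<lambda>n. s n + t n)"
    "cls s \<otimes>\<^bsub>Qp p\<^esub> cls t = cls (\<lambda>n. s n * t n)"
    using h.hom_add[OF assms] h.hom_mult[OF assms] by auto
  show m: "\<ominus>\<^bsub>Qp p\<^esub> cls t = cls (\<lambda>n. - t n)" using h.hom_a_inv[OF assms(2)] assms by simp
  show "cls s \<ominus>\<^bsub>Qp p\<^esub> cls t = cls (\<lambda>n. s n - t n)"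
    unfolding a_minus_def m using h.hom_add[of s "\<lambda>n. - t n"] assms by simp
qed

lemma cls_0_1: "\<zero>\<^bsub>Qp p\<^esub> = cls (\<lambda>_. 0)" "\<one>\<^bsub>Qp p\<^esub> = cls (\<lambda>_. 1)"
proof -
  interpret h: ring_hom_ring CR "Qp p" cls
    by (intro ring_hom_ringI2 CR.ring_axioms Q.ring_axioms cls_hom)
  show "\<zero>\<^bsub>Qp p\<^esub> = cls (\<lambda>_. 0)" "\<one>\<^bsub>Qp p\<^esub> = cls (\<lambda>_. 1)"
    using h.hom_zero h.hom_one by auto
qed

lemma mem_cls: assumes "s \<in> carrier CR" shows "t \<in> cls s \<longleftrightarrow> (\<lambda>n. t n - s n) \<in> Null"
proof
  assume "t \<in> cls s"
  then obtain h where "h \<in> Null" "t = (\<lambda>n. h n + s n)" by (auto simp: cls_def a_r_coset_def')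
  then show "(\<lambda>n. t n - s n) \<in> Null" by simp
next
  assume "(\<lambda>n. t n - s n) \<in> Null"
  then show "t \<in> cls s" by (auto simp: cls_def a_r_coset_def' intro!: bexI[of _ "\<lambda>n. t n - s n"])
qed

text \<open>Gives a meaning to the definite description in \<open>Qp_val\<close>. Either all
  representatives are null sequences, or their valuations are eventually equal to one constant, by
  the isosceles principle.\<close>

lemma cauchy_lim_exists:
  assumes s: "s \<in> carrier CR"
  shows "\<exists>l. \<forall>t\<in>cls s. (\<lambda>n. rat_val p (t n)) \<longlonglongrightarrow> l"
proof (cases "s \<in> Null")
  case True
  have "t \<in> Null" if "t \<in> cls s" for t
    using null_add[OF True] mem_cls[OF s] that by fastforce
  then show ?thesis by (auto simp: padic_null_def)
next
  case False
  then obtain N :: real where N: "\<not> (\<forall>\<^sub>F n in sequentially. ereal N \<le> rat_val p (s n))" using null_iff by blast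
  obtain M where M: "\<forall>m\<ge>M. \<forall>n\<ge>M. ereal N \<le> rat_val p (s m - s n)" using s cauchy_iff by blast
  obtain k where k: "k \<ge> M" "rat_val p (s k) < ereal N" using N unfolding eventually_sequentially by (metis linorder_not_less)
  have eq: "rat_val p (s n) = rat_val p (s k)" if "n \<ge> M" for n
    by (rule rat.v_eqI) (use M k that in \<open>meson order_less_le_trans\<close>)
  have "(\<lambda>n. rat_val p (t n)) \<longlonglongrightarrow> rat_val p (s k)" if t: "t \<in> cls s" for t
  proof -
    have "(\<lambda>n. t n - s n) \<in> Null" using t mem_cls[OF s] by blast
    then have "\<forall>\<^sub>F n in sequentially. ereal N \<le> rat_val p (t n - s n)" by (simp add: null_iff)
    moreover have "\<forall>\<^sub>F n in sequentially. n \<ge> M" by (rule eventually_ge_at_top)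
    ultimately have "\<forall>\<^sub>F n in sequentially. rat_val p (t n) = rat_val p (s k)"
    proof eventually_elim
      case (elim n)
      have "rat_val p (t n) = rat_val p (s n)"
        by (rule rat.v_eqI) (use elim k eq[of n] rat.v_diff_commute[of "t n" "s n"] in auto)
      then show ?case using eq elim by simp
    qed
    then show ?thesis by (rule tendsto_eventually)
  qed
  then show ?thesis by blast
qed

lemma Qp_val_tendsto:
  assumes s: "s \<in> carrier CR"
  shows "(\<lambda>n. rat_val p (s n)) \<longlonglongrightarrow> Qp_val p (cls s)"
proof -
  have ss: "s \<in> cls s" by (simp add: mem_cls[OF s])
  obtain l where l: "\<forall>t\<in>cls s. (\<lambda>n. rat_val p (t n)) \<longlonglongrightarrow> l" using cauchy_lim_exists[OF s] by blast
  have "Qp_val p (cls s) = l" unfolding Qp_val_def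
    by (rule the_equality) (use l ss LIMSEQ_unique in blast)+
  then show ?thesis using l ss by blast
qed

text \<open>The nontrivial direction: if the valuation drops below \<open>c\<close> at some index
  from which on \<open>s\<close> varies only by valuation at least \<open>c\<close>, then it is
  constant from there on, and the limit is below \<open>c\<close> too.\<close>

lemma Qp_val_ge_iff:
  assumes s: "s \<in> carrier CR"
  shows "ereal c \<le> Qp_val p (cls s) \<longleftrightarrow> (\<forall>\<^sub>F n in sequentially. ereal c \<le> rat_val p (s n))"
proof
  assume "\<forall>\<^sub>F n in sequentially. ereal c \<le> rat_val p (s n)"
  then show "ereal c \<le> Qp_val p (cls s)"
    using tendsto_lowerbound[OF Qp_val_tendsto[OF s]] by simp
next
  assume c: "ereal c \<le> Qp_val p (cls s)"
  show "\<forall>\<^sub>F n in sequentially. ereal c \<le> rat_val p (s n)"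
  proof (rule ccontr)
    assume not_ev: "\<not> ?thesis"
    obtain M where M: "\<forall>m\<ge>M. \<forall>n\<ge>M. ereal c \<le> rat_val p (s m - s n)" using s cauchy_iff by blast
    obtain k where k: "k \<ge> M" "rat_val p (s k) < ereal c" using not_ev unfolding eventually_sequentially by (metis linorder_not_less)
    have eq: "rat_val p (s n) = rat_val p (s k)" if "n \<ge> M" for n
      by (rule rat.v_eqI) (use M k that in \<open>meson order_less_le_trans\<close>)
    then have "\<forall>\<^sub>F n in sequentially. rat_val p (s n) = rat_val p (s k)"
      unfolding eventually_sequentially by blast
    then have "(\<lambda>n. rat_val p (s n)) \<longlonglongrightarrow> rat_val p (s k)" by (rule tendsto_eventually)
    then have "Qp_val p (cls s) = rat_val p (s k)" using Qp_val_tendsto[OF s] LIMSEQ_unique by blast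
    then show False using c k by simp
  qed
qed

lemma cls_eq_iff:
  assumes "s \<in> carrier CR" "t \<in> carrier CR"
  shows "cls s = cls t \<longleftrightarrow> (\<lambda>n. s n - t n) \<in> Null"
proof
  assume "cls s = cls t"
  moreover have "s \<in> cls s" by (simp add: mem_cls[OF assms(1)])
  ultimately show "(\<lambda>n. s n - t n) \<in> Null" using mem_cls[OF assms(2), of s] by simp
next
  assume st: "(\<lambda>n. s n - t n) \<in> Null"
  have "u \<in> cls s \<longleftrightarrow> u \<in> cls t" for u
    using null_add[OF _ st, of "\<lambda>n. u n - s n"] null_add[OF _ null_minus[OF st], of "\<lambda>n. u n - t n"]
    by (auto simp: mem_cls assms)
  then show "cls s = cls t" by blast
qed

lemma Qp_eqI:
  assumes "x \<in> carrier (Qp p)" "y \<in> carrier (Qp p)" "\<And>n. ereal (real n) \<le> Qp_val p (x \<ominus>\<^bsub>Qp p\<^esub> y)"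
  shows "x = y"
proof -
  obtain s t where st: "s \<in> carrier CR" "x = cls s" "t \<in> carrier CR" "y = cls t" using assms QpE by metis
  have "(\<lambda>n. s n - t n) \<in> Null" unfolding null_iff
  proof
    fix N :: real
    obtain n where "N \<le> real n" using real_arch_simple by blast
    then have "ereal N \<le> Qp_val p (cls (\<lambda>n. s n - t n))"
      using assms(3)[of n] st by (simp add: cls_simps) (meson ereal_less_eq(3) order_trans)
    then show "\<forall>\<^sub>F n in sequentially. ereal N \<le> rat_val p (s n - t n)" using Qp_val_ge_iff st by simp
  qed
  then show ?thesis using st cls_eq_iff by simp
qed

lemma Qp_inverse:
  assumes "x \<in> carrier (Qp p)" "x \<noteq> \<zero>\<^bsub>Qp p\<^esub>"
  shows "\<exists>y\<in>carrier (Qp p). x \<otimes>\<^bsub>Qp p\<^esub> y = \<one>\<^bsub>Qp p\<^esub>"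
proof -
  obtain s where s: "s \<in> carrier CR" "x = cls s" using assms QpE by metis
  have "s \<notin> Null" using s assms(2) cls_eq_iff[of s "\<lambda>_. 0"] by (simp add: cls_0_1)
  then obtain N :: real where N: "\<not> (\<forall>\<^sub>F n in sequentially. ereal N \<le> rat_val p (s n))" using null_iff by blast
  obtain M where M: "\<forall>m\<ge>M. \<forall>n\<ge>M. ereal N \<le> rat_val p (s m - s n)" using s cauchy_iff by blast
  obtain k where k: "k \<ge> M" "rat_val p (s k) < ereal N" using N unfolding eventually_sequentially by (metis linorder_not_less)
  have eq: "rat_val p (s n) = rat_val p (s k)" if "n \<ge> M" for n
    by (rule rat.v_eqI) (use M k that in \<open>meson order_less_le_trans\<close>)
  have nz: "s n \<noteq> 0" if "n \<ge> M" for n using eq[OF that] k by auto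
  obtain c where c: "rat_val p (s k) = ereal c" using rat.v_real nz k by blast
  \<comment> \<open>The convention \<open>inverse 0 = 0\<close> fills in the finitely many indices
    before \<open>M\<close> at which \<open>s\<close> may vanish.\<close>
  define t where "t = (\<lambda>n. inverse (s n))"
  have t: "t \<in> carrier CR" unfolding cauchy_iff
  proof
    fix L :: real
    obtain M' where M': "\<forall>m\<ge>M'. \<forall>n\<ge>M'. ereal (L + 2 * c) \<le> rat_val p (s m - s n)" using s cauchy_iff by blast
    have "ereal L \<le> rat_val p (t m - t n)" if mn: "m \<ge> max M M'" "n \<ge> max M M'" for m n
    proof -
      have "t m - t n = (s n - s m) * (inverse (s m) * inverse (s n))" using nz mn by (simp add: t_def field_simps)
      moreover have "rat_val p (inverse (s m) * inverse (s n)) = ereal (- 2 * c)"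
        using mn nz eq c by (simp add: rat.v_mult rat.v_inverse)
      ultimately show ?thesis using v_mult_ge[of "L + 2 * c" "s n - s m" "- 2 * c" "inverse (s m) * inverse (s n)"] M' mn by simp
    qed
    then show "\<exists>M. \<forall>m\<ge>M. \<forall>n\<ge>M. ereal L \<le> rat_val p (t m - t n)" by blast
  qed
  have "(\<lambda>n. s n * t n - 1) \<in> Null" unfolding null_iff
  proof
    fix L :: real
    have "\<forall>\<^sub>F n in sequentially. n \<ge> M" by (rule eventually_ge_at_top)
    then show "\<forall>\<^sub>F n in sequentially. ereal L \<le> rat_val p (s n * t n - 1)"
      by eventually_elim (simp add: t_def nz)
  qed
  then have "cls (\<lambda>n. s n * t n) = cls (\<lambda>_. 1)" using cls_eq_iff[of "\<lambda>n. s n * t n" "\<lambda>_. 1"] s t by simp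
  then show ?thesis using s t cls_0_1 by (intro bexI[of _ "cls t"]) (simp_all add: cls_simps)
qed

text \<open>Diagonal argument: \<open>k n\<close> is an index from which the representative
  \<open>s n\<close> is constant up to valuation \<open>n\<close>, so the single rational
  \<open>q n = s n (k n)\<close> approximates the class \<open>x n\<close> to that order.\<close>

lemma Qp_complete:
  fixes x :: "nat \<Rightarrow> (nat \<Rightarrow> rat) set"
  assumes x: "\<And>n. x n \<in> carrier (Qp p)"
    and cauchy: "\<And>N::real. \<exists>M. \<forall>m\<ge>M. \<forall>n\<ge>M. ereal N \<le> Qp_val p (x m \<ominus>\<^bsub>Qp p\<^esub> x n)"
  shows "\<exists>y\<in>carrier (Qp p). \<forall>N::real. \<exists>M. \<forall>n\<ge>M. ereal N \<le> Qp_val p (x n \<ominus>\<^bsub>Qp p\<^esub> y)"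
proof -
  have "\<forall>n. \<exists>s. s \<in> carrier CR \<and> x n = cls s" using x QpE by metis
  then obtain s :: "nat \<Rightarrow> nat \<Rightarrow> rat" where s: "\<And>n. s n \<in> carrier CR" "\<And>n. x n = cls (s n)" by metis
  have "\<forall>n. \<exists>k. \<forall>i\<ge>k. \<forall>j\<ge>k. ereal (real n) \<le> rat_val p (s n i - s n j)" using s(1) cauchy_iff by blast
  then obtain k where k: "\<And>n i j. i \<ge> k n \<Longrightarrow> j \<ge> k n \<Longrightarrow> ereal (real n) \<le> rat_val p (s n i - s n j)" by metis
  define q where "q = (\<lambda>n. s n (k n))"
  have near: "ereal N \<le> rat_val p (q n - s n i)" if "real n \<ge> N" "i \<ge> k n" for n i N
    using k[of n "k n" i] that unfolding q_def by (meson ereal_less_eq(3) order_refl order_trans)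
  have qc: "\<exists>M. \<forall>m\<ge>M. \<forall>n\<ge>M. ereal N \<le> rat_val p (q m - q n)" for N :: real
  proof -
    obtain M where M: "\<forall>m\<ge>M. \<forall>n\<ge>M. ereal N \<le> Qp_val p (x m \<ominus>\<^bsub>Qp p\<^esub> x n)" using cauchy by blast
    obtain M0 :: nat where M0: "N \<le> real M0" using real_arch_simple by blast
    have "ereal N \<le> rat_val p (q m - q n)" if mn: "m \<ge> max M M0" "n \<ge> max M M0" for m n
    proof -
      have "ereal N \<le> Qp_val p (cls (\<lambda>i. s m i - s n i))" using M mn s by (auto simp: cls_simps)
      then have "\<forall>\<^sub>F i in sequentially. ereal N \<le> rat_val p (s m i - s n i)"
        using Qp_val_ge_iff s by simp
      moreover have "\<forall>\<^sub>F i in sequentially. i \<ge> k m" "\<forall>\<^sub>F i in sequentially. i \<ge> k n" by (rule eventually_ge_at_top)+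
      ultimately have "\<forall>\<^sub>F i in sequentially. ereal N \<le> rat_val p (s m i - s n i) \<and> i \<ge> k m \<and> i \<ge> k n"
        by (simp add: eventually_conj_iff)
      then obtain i where i: "ereal N \<le> rat_val p (s m i - s n i)" "i \<ge> k m" "i \<ge> k n"
        unfolding eventually_sequentially by blast
      have "ereal N \<le> rat_val p (q m - s m i)" "ereal N \<le> rat_val p (q n - s n i)"
        using near i mn M0 by auto
      then have "ereal N \<le> rat_val p ((q m - s m i) - (q n - s n i) + (s m i - s n i))"
        using rat.v_add_ge[OF rat.v_diff_ge i(1)] by blast
      then show ?thesis by (simp add: algebra_simps)
    qed
    then show ?thesis by blast
  qed
  then have q: "q \<in> carrier CR" by (simp add: cauchy_iff)
  have "\<exists>M. \<forall>n\<ge>M. ereal N \<le> Qp_val p (x n \<ominus>\<^bsub>Qp p\<^esub> cls q)" for N :: real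
  proof -
    obtain M where M: "\<forall>m\<ge>M. \<forall>n\<ge>M. ereal N \<le> rat_val p (q m - q n)" using qc by blast
    obtain M0 :: nat where M0: "N \<le> real M0" using real_arch_simple by blast
    have "ereal N \<le> Qp_val p (x n \<ominus>\<^bsub>Qp p\<^esub> cls q)" if n: "n \<ge> max M M0" for n
    proof -
      have "ereal N \<le> rat_val p (s n i - q i)" if i: "i \<ge> max M (k n)" for i
      proof -
        have "ereal N \<le> rat_val p ((q n - q i) - (q n - s n i))"
          by (rule rat.v_diff_ge) (use M near n i M0 in auto)
        then show ?thesis by (simp add: algebra_simps)
      qed
      then have "\<forall>\<^sub>F i in sequentially. ereal N \<le> rat_val p (s n i - q i)" unfolding eventually_sequentially by blast
      then show ?thesis using s q Qp_val_ge_iff[of "\<lambda>i. s n i - q i" N] by (simp add: cls_simps)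
    qed
    then show ?thesis by blast
  qed
  then show ?thesis using q by (intro bexI[of _ "cls q"]) auto
qed

text \<open>Congruence of \<open>x\<close> with the integer \<open>a\<close> modulo
  \<open>p ^ n\<close>. Keeping it a relation avoids choosing a residue map; \<open>a\<close> is
  determined by \<open>x\<close> only up to multiples of \<open>p ^ n\<close>.\<close>

definition zp_mod :: "(nat \<Rightarrow> rat) set \<Rightarrow> nat \<Rightarrow> int \<Rightarrow> bool" where
  "zp_mod x n a \<longleftrightarrow> ereal (real n) \<le> Qp_val p (x \<ominus>\<^bsub>Qp p\<^esub> cls (\<lambda>_. of_int a))"

lemma zp_mod_cls:
  "s \<in> carrier CR \<Longrightarrow> zp_mod (cls s) n a \<longleftrightarrow> (\<forall>\<^sub>F i in sequentially. ereal (real n) \<le> rat_val p (s i - of_int a))"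
  unfolding zp_mod_def by (simp add: cls_simps Qp_val_ge_iff)

lemma zp_mod_exists:
  assumes "x \<in> Zp_set p"
  shows "\<exists>a. zp_mod x n a"
proof -
  obtain s where s: "s \<in> carrier CR" "x = cls s" using assms QpE by (auto simp: Zp_set_def)
  have "ereal 0 \<le> Qp_val p (cls s)" using assms s by (simp add: Zp_set_def zero_ereal_def)
  then have "\<forall>\<^sub>F i in sequentially. ereal 0 \<le> rat_val p (s i)" using Qp_val_ge_iff s by blast
  then obtain M1 where M1: "\<forall>i\<ge>M1. ereal 0 \<le> rat_val p (s i)" unfolding eventually_sequentially by blast
  obtain M where M: "\<forall>i\<ge>M. \<forall>j\<ge>M. ereal (real n) \<le> rat_val p (s i - s j)" using s cauchy_iff by blast
  let ?k = "max M M1"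
  have "0 \<le> rat_val p (s ?k)" using M1 by (simp add: zero_ereal_def)
  then obtain a where a: "ereal (real n) \<le> rat_val p (s ?k - of_int a)" using rat_val_integer_approx[OF prime_p] by blast
  have "ereal (real n) \<le> rat_val p (s i - of_int a)" if "i \<ge> M" for i
    using rat.v_add_ge[OF _ a, of "s i - s ?k"] M that by simp
  then show ?thesis using s zp_mod_cls unfolding eventually_sequentially by blast
qed

lemma zp_mod_add:
  assumes "x \<in> carrier (Qp p)" "y \<in> carrier (Qp p)" "zp_mod x n a" "zp_mod y n b"
  shows "zp_mod (x \<oplus>\<^bsub>Qp p\<^esub> y) n (a + b)"
proof -
  obtain s t where st: "s \<in> carrier CR" "x = cls s" "t \<in> carrier CR" "y = cls t" using assms QpE by metis
  have "\<forall>\<^sub>F i in sequentially. ereal (real n) \<le> rat_val p (s i - of_int a)"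
    "\<forall>\<^sub>F i in sequentially. ereal (real n) \<le> rat_val p (t i - of_int b)"
    using assms st zp_mod_cls by blast+
  then have "\<forall>\<^sub>F i in sequentially. ereal (real n) \<le> rat_val p (s i + t i - of_int (a + b))"
  proof eventually_elim
    case (elim i) then show ?case using rat.v_add_ge[OF elim] by (simp add: algebra_simps)
  qed
  then show ?thesis using st by (simp add: cls_simps zp_mod_cls)
qed

lemma zp_mod_val_diff_iff:
  assumes "x \<in> carrier (Qp p)" "y \<in> carrier (Qp p)" "zp_mod x n a" "zp_mod y n b"
  shows "ereal (real n) \<le> Qp_val p (x \<ominus>\<^bsub>Qp p\<^esub> y) \<longleftrightarrow> int p ^ n dvd a - b"
proof -
  obtain s t where st: "s \<in> carrier CR" "x = cls s" "t \<in> carrier CR" "y = cls t" using assms QpE by metis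
  have "\<forall>\<^sub>F i in sequentially. ereal (real n) \<le> rat_val p (s i - of_int a)"
    "\<forall>\<^sub>F i in sequentially. ereal (real n) \<le> rat_val p (t i - of_int b)"
    using assms st zp_mod_cls by blast+
  then have "\<forall>\<^sub>F i in sequentially. ereal (real n) \<le> rat_val p (s i - t i) \<longleftrightarrow> ereal (real n) \<le> rat_val p (of_int (a - b))"
  proof eventually_elim
    case (elim i)
    have d: "ereal (real n) \<le> rat_val p ((s i - of_int a) - (t i - of_int b))" by (rule rat.v_diff_ge) fact+
    show ?case
      using rat.v_diff_ge[OF _ d, of "s i - t i"] rat.v_add_ge[OF _ d, of "of_int (a - b)"] by (auto simp: algebra_simps)
  qed
  then have "(\<forall>\<^sub>F i in sequentially. ereal (real n) \<le> rat_val p (s i - t i)) \<longleftrightarrow> (\<forall>\<^sub>F i in sequentially. ereal (real n) \<le> rat_val p (of_int (a - b)))"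
    by (rule eventually_subst)
  then show ?thesis using st by (simp add: cls_simps Qp_val_ge_iff rat_val_of_int_ge_iff[OF prime_p] del: of_int_diff)
qed

lemma zp_mod_cong_iff:
  assumes "x \<in> carrier (Qp p)" "zp_mod x n a"
  shows "zp_mod x n b \<longleftrightarrow> int p ^ n dvd a - b"
proof -
  have b: "zp_mod (cls (\<lambda>_. of_int b)) n b" by (simp add: zp_mod_cls)
  show ?thesis
    using zp_mod_val_diff_iff[OF assms(1) _ assms(2) b] by (simp add: zp_mod_def)
qed

lemma zp_mod_mono: "zp_mod x n a \<Longrightarrow> m \<le> n \<Longrightarrow> zp_mod x m a"
  unfolding zp_mod_def by (meson ereal_less_eq(3) of_nat_le_iff order_trans)

lemma Zp_carrier: "x \<in> Zp_set p \<Longrightarrow> x \<in> carrier (Qp p)"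
  by (simp add: Zp_set_def)

text \<open>Modulo \<open>p ^ 0\<close> every integer is congruent to 0, so a congruence at level 0
  says just that \<open>x\<close> is integral.\<close>

lemma Zp_setI: assumes "x \<in> carrier (Qp p)" "zp_mod x 0 a" shows "x \<in> Zp_set p"
proof -
  have "zp_mod x 0 0" using zp_mod_cong_iff[OF assms, of 0] by simp
  moreover have "x \<ominus>\<^bsub>Qp p\<^esub> cls (\<lambda>_. of_int 0) = x"
    using assms(1) by (simp add: cls_0_1[symmetric] a_minus_def)
  ultimately show ?thesis using assms(1) by (simp add: zp_mod_def Zp_set_def zero_ereal_def)
qed

lemma Zp_add [simp]: "x \<in> Zp_set p \<Longrightarrow> y \<in> Zp_set p \<Longrightarrow> x \<oplus>\<^bsub>Qp p\<^esub> y \<in> Zp_set p"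
  using zp_mod_exists[of x 0] zp_mod_exists[of y 0] by (meson Zp_carrier Zp_setI zp_mod_add Q.a_closed)

text \<open>The inverse limit description of the p-adic integers: compatible residues, read as
  rationals, form a Cauchy sequence.\<close>

lemma zp_mod_sequence:
  assumes b: "\<And>n. int p ^ n dvd b (Suc n) - b n"
  shows "\<exists>x\<in>Zp_set p. \<forall>n. zp_mod x n (b n)"
proof -
  have dvd: "int p ^ n dvd b m - b n" if "n \<le> m" for n m
    using that
  proof (induction m rule: dec_induct)
    case (step m)
    have "int p ^ n dvd b (Suc m) - b m" using b[of m] step by (meson dvd_trans le_imp_power_dvd)
    then have "int p ^ n dvd (b (Suc m) - b m) + (b m - b n)" using step by (intro dvd_add)
    then show ?case by simp
  qed simp
  have ge: "ereal (real n) \<le> rat_val p (of_int (b m) - of_int (b n))" if "n \<le> m" for n m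
    using dvd[OF that] rat_val_of_int_ge_iff[OF prime_p, of n "b m - b n"] by simp
  define s where "s = (\<lambda>n. of_int (b n) :: rat)"
  have s: "s \<in> carrier CR" unfolding cauchy_iff
  proof
    fix N :: real
    obtain M :: nat where M: "N \<le> real M" using real_arch_simple by blast
    have "ereal N \<le> rat_val p (s m - s n)" if "m \<ge> M" "n \<ge> M" for m n
    proof -
      have "ereal (real M) \<le> rat_val p ((s m - s M) - (s n - s M))"
        unfolding s_def by (rule rat.v_diff_ge) (use ge that in auto)
      then show ?thesis using M by (simp add: algebra_simps) (meson ereal_less_eq(3) order_trans)
    qed
    then show "\<exists>M. \<forall>m\<ge>M. \<forall>n\<ge>M. ereal N \<le> rat_val p (s m - s n)" by blast
  qed
  have z: "zp_mod (cls s) n (b n)" for n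
    unfolding zp_mod_cls[OF s] eventually_sequentially using ge by (auto simp: s_def)
  have "cls s \<in> Zp_set p" by (rule Zp_setI[of _ "b 0"]) (use s z in auto)
  with z show ?thesis by blast
qed

end

section \<open>Completeness of finite extensions\<close>

lemma ring_of_type_algebra_simps [simp]:
  "carrier (ring_of_type_algebra :: 'a::ring_1 ring) = UNIV"
  "x \<otimes>\<^bsub>(ring_of_type_algebra :: 'a ring)\<^esub> y = x * y"
  "x \<oplus>\<^bsub>(ring_of_type_algebra :: 'a ring)\<^esub> y = x + y"
  "\<one>\<^bsub>(ring_of_type_algebra :: 'a ring)\<^esub> = 1"
  "\<zero>\<^bsub>(ring_of_type_algebra :: 'a ring)\<^esub> = 0"
  by (simp_all add: ring_of_type_algebra_def)

lemma line_extension_type_algebra: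
  "ring.line_extension (ring_of_type_algebra :: 'a::comm_ring_1 ring) K b E = {k * b + e |k e. k \<in> K \<and> e \<in> E}"
  unfolding ring.line_extension_def[OF ring_from_type_algebra]
  by (force simp: r_coset_def set_add_def set_mult_def)

text \<open>Induction on the dimension: in \<open>K b + E\<close> with \<open>E\<close> complete, hence closed, the distance from \<open>b\<close>
  to \<open>E\<close> is positive, so the coefficients of \<open>b\<close> in a Cauchy sequence form a Cauchy sequence.\<close>

lemma padic_extension_complete:
  fixes v :: "'e::field \<Rightarrow> ereal" and x :: "nat \<Rightarrow> 'e"
  assumes p: "Factorial_Ring.prime p" and ext: "padic_extension p \<iota> v"
    and cauchy: "\<And>N::real. \<exists>M. \<forall>m\<ge>M. \<forall>n\<ge>M. ereal N \<le> v (x m - x n)"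
  shows "\<exists>y. \<forall>N::real. \<exists>M. \<forall>n\<ge>M. ereal N \<le> v (x n - y)"
proof -
  interpret padic p using p by unfold_locales
  interpret valued_field v using ext by (unfold_locales) (simp add: padic_extension_def)
  let ?R = "ring_of_type_algebra :: 'e ring"
  define F where "F = \<iota> ` carrier (Qp p)"
  interpret R: ring ?R by (rule ring_from_type_algebra)
  interpret \<iota>: ring_hom_ring "Qp p" ?R \<iota>
    using ext by (intro ring_hom_ringI2 Q.ring_axioms R.ring_axioms) (simp add: padic_extension_def)
  have val: "v (\<iota> a) = Qp_val p a" if "a \<in> carrier (Qp p)" for a
    using ext that by (simp add: padic_extension_def)
  have add: "\<iota> (a \<oplus>\<^bsub>Qp p\<^esub> b) = \<iota> a + \<iota> b" and mult: "\<iota> (a \<otimes>\<^bsub>Qp p\<^esub> b) = \<iota> a * \<iota> b"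
    if "a \<in> carrier (Qp p)" "b \<in> carrier (Qp p)" for a b
    using that by simp_all
  have diff: "\<iota> (a \<ominus>\<^bsub>Qp p\<^esub> b) = \<iota> a - \<iota> b" if "a \<in> carrier (Qp p)" "b \<in> carrier (Qp p)" for a b
  proof -
    have "a \<ominus>\<^bsub>Qp p\<^esub> b \<oplus>\<^bsub>Qp p\<^esub> b = a" using that by (simp add: a_minus_def Q.a_assoc Q.l_neg)
    then show ?thesis using add[of "a \<ominus>\<^bsub>Qp p\<^esub> b" b] that by (simp add: algebra_simps)
  qed
  \<comment> \<open>With closure under sums and products, -1 in \<open>F\<close> supplies all
    differences, both in \<open>F\<close> and in the subspaces over \<open>F\<close> below.\<close>
  have K1: "- 1 \<in> F" unfolding F_def
  proof (rule image_eqI)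
    show "- 1 = \<iota> (\<zero>\<^bsub>Qp p\<^esub> \<ominus>\<^bsub>Qp p\<^esub> \<one>\<^bsub>Qp p\<^esub>)"
      using diff[OF Q.zero_closed Q.one_closed] \<iota>.hom_zero \<iota>.hom_one by simp
  qed (rule Q.minus_closed[OF Q.zero_closed Q.one_closed])
  have K_mult: "a * b \<in> F" and K_add: "a + b \<in> F" if "a \<in> F" "b \<in> F" for a b
  proof -
    obtain c d where cd: "c \<in> carrier (Qp p)" "a = \<iota> c" "d \<in> carrier (Qp p)" "b = \<iota> d"
      using \<open>a \<in> F\<close> \<open>b \<in> F\<close> unfolding F_def by blast
    then have "a * b = \<iota> (c \<otimes>\<^bsub>Qp p\<^esub> d)" "a + b = \<iota> (c \<oplus>\<^bsub>Qp p\<^esub> d)" using add mult by auto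
    then show "a * b \<in> F" "a + b \<in> F" using Q.m_closed[OF cd(1,3)] Q.a_closed[OF cd(1,3)] unfolding F_def by (metis imageI)+
  qed
  have K_inv: "inverse a \<in> F" if "a \<in> F" "a \<noteq> 0" for a
  proof -
    from that(1)[unfolded F_def] obtain c where c: "a = \<iota> c" "c \<in> carrier (Qp p)" by (rule imageE)
    with that have "c \<noteq> \<zero>\<^bsub>Qp p\<^esub>" by auto
    then obtain d where d: "d \<in> carrier (Qp p)" "c \<otimes>\<^bsub>Qp p\<^esub> d = \<one>\<^bsub>Qp p\<^esub>" using Qp_inverse c by blast
    then have "a * \<iota> d = 1" using mult[of c d] c by simp
    then have "inverse a = \<iota> d" using inverse_unique by blast
    then show ?thesis using d F_def by blast
  qed
  define Cauchy where "Cauchy y \<longleftrightarrow> (\<forall>N::real. \<exists>M. \<forall>m\<ge>M. \<forall>n\<ge>M. ereal N \<le> v (y m - y n))" for y :: "nat \<Rightarrow> 'e"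
  define lim where "lim y l \<longleftrightarrow> (\<forall>N::real. \<exists>M. \<forall>n\<ge>M. ereal N \<le> v (y n - l))" for y :: "nat \<Rightarrow> 'e" and l
  have K_complete: "\<exists>l\<in>F. lim y l" if y: "\<And>n. y n \<in> F" and C: "Cauchy y" for y
  proof -
    have "\<forall>n. \<exists>a. a \<in> carrier (Qp p) \<and> y n = \<iota> a" using y F_def by blast
    then obtain a where a: "\<And>n. a n \<in> carrier (Qp p)" "\<And>n. y n = \<iota> (a n)" by metis
    have "\<exists>l\<in>carrier (Qp p). \<forall>N::real. \<exists>M. \<forall>n\<ge>M. ereal N \<le> Qp_val p (a n \<ominus>\<^bsub>Qp p\<^esub> l)"
    proof (rule Qp_complete)
      fix N :: real
      show "\<exists>M. \<forall>m\<ge>M. \<forall>n\<ge>M. ereal N \<le> Qp_val p (a m \<ominus>\<^bsub>Qp p\<^esub> a n)"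
        using C a by (simp add: Cauchy_def val[symmetric] diff)
    qed (use a in auto)
    then obtain l where l: "l \<in> carrier (Qp p)" "\<And>N::real. \<exists>M. \<forall>n\<ge>M. ereal N \<le> Qp_val p (a n \<ominus>\<^bsub>Qp p\<^esub> l)" by blast
    have "lim y (\<iota> l)" unfolding lim_def using l a by (simp add: diff[symmetric] val)
    then show ?thesis using l F_def by blast
  qed
  \<comment> \<open>Closure under sums and scalars is carried through the induction along with
    completeness, because the step forms differences in \<open>E\<close>. The equation
    \<open>K = F\<close> fixes the field parameter of \<open>dimension\<close>.\<close>
  have key: "0 \<in> E \<and> (\<forall>a\<in>E. \<forall>b\<in>E. a + b \<in> E) \<and> (\<forall>k\<in>F. \<forall>a\<in>E. k * a \<in> E) \<and>
      (\<forall>y. (\<forall>n. y n \<in> E) \<longrightarrow> Cauchy y \<longrightarrow> (\<exists>l\<in>E. lim y l))" if "R.dimension n K E" "K = F" for n K E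
    using that
  proof (induction rule: R.dimension.induct)
    case (zero_dim K)
    show ?case by (auto simp: lim_def)
  next
    case (Suc_dim b E n K)
    have E0: "0 \<in> E" and E_add: "\<And>a b. a \<in> E \<Longrightarrow> b \<in> E \<Longrightarrow> a + b \<in> E"
      and E_scale: "\<And>k a. k \<in> F \<Longrightarrow> a \<in> E \<Longrightarrow> k * a \<in> E"
      and E_complete: "\<And>y. (\<And>n. y n \<in> E) \<Longrightarrow> Cauchy y \<Longrightarrow> \<exists>l\<in>E. lim y l" using Suc_dim.IH[OF Suc_dim.prems] by blast+
    have E_diff: "a - c \<in> E" if "a \<in> E" "c \<in> E" for a c
      using E_add[OF that(1) E_scale[OF K1 that(2)]] by simp
    have "\<exists>M::real. \<forall>u\<in>E. v (b - u) \<le> ereal M"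
    proof (rule ccontr)
      assume "\<not> ?thesis"
      then have "\<forall>n. \<exists>u\<in>E. ereal (real n) < v (b - u)" by (meson not_le)
      then obtain u where u: "\<And>n. u n \<in> E" "\<And>n. ereal (real n) < v (b - u n)" by metis
      have lim_b: "lim u b" unfolding lim_def
      proof
        fix N :: real
        obtain M :: nat where M: "N \<le> real M" using real_arch_simple by blast
        have "ereal N \<le> v (u n - b)" if "n \<ge> M" for n
        proof -
          have "ereal N \<le> ereal (real n)" using M that by simp
          also have "\<dots> \<le> v (u n - b)" using u(2)[of n] v_diff_commute[of b "u n"] by simp
          finally show ?thesis .
        qed
        then show "\<exists>M. \<forall>n\<ge>M. ereal N \<le> v (u n - b)" by blast
      qed
      have "Cauchy u" unfolding Cauchy_def
      proof
        fix N :: real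
        obtain M where M: "\<forall>n\<ge>M. ereal N \<le> v (u n - b)" using lim_b lim_def by meson
        have "ereal N \<le> v (u m - u n)" if "m \<ge> M" "n \<ge> M" for m n
          using v_diff_ge[of "ereal N" "u m - b" "u n - b"] M that by simp
        then show "\<exists>M. \<forall>m\<ge>M. \<forall>n\<ge>M. ereal N \<le> v (u m - u n)" by blast
      qed
      then obtain l where l: "l \<in> E" "lim u l" using E_complete u by blast
      have "ereal N \<le> v (l - b)" for N :: real
      proof -
        obtain M1 M2 where "\<forall>n\<ge>M1. ereal N \<le> v (u n - b)" "\<forall>n\<ge>M2. ereal N \<le> v (u n - l)"
          using lim_b l(2) unfolding lim_def by meson
        then have "ereal N \<le> v (u (max M1 M2) - b)" "ereal N \<le> v (u (max M1 M2) - l)" by auto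
        then show ?thesis using v_diff_ge[of "ereal N" "u (max M1 M2) - b" "u (max M1 M2) - l"] by simp
      qed
      then have "v (l - b) = \<infinity>" using ereal_top by blast
      then show False using l(1) Suc_dim.hyps by simp
    qed
    then obtain M :: real where M: "\<And>u. u \<in> E \<Longrightarrow> v (b - u) \<le> ereal M" by blast
    \<comment> \<open>Factor out \<open>k\<close>: what remains is \<open>b\<close> minus an element
      of \<open>E\<close>, whose valuation is at most \<open>M\<close>. So the coefficient of
      \<open>b\<close> is controlled by the whole vector, with loss \<open>M\<close>.\<close>
    have coord: "v (k * b + u) \<le> v k + ereal M" if "k \<in> F" "u \<in> E" for k u
    proof (cases "k = 0")
      case False
      have "inverse k * u \<in> E" using K_inv[OF that(1) False] E_scale that by blast
      then have "- 1 * (inverse k * u) \<in> E" using E_scale K1 by blast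
      moreover have "k * b + u = k * (b - (- 1 * (inverse k * u)))" using False by (simp add: field_simps)
      ultimately show ?thesis using M v_mult by (metis add_left_mono)
    qed simp
    show ?case unfolding line_extension_type_algebra Suc_dim.prems
    proof (intro conjI ballI allI impI)
      have K0: "0 \<in> F" using K_add[OF K1, of 1] K_mult[OF K1 K1] by simp
      show "0 \<in> {k * b + e |k e. k \<in> F \<and> e \<in> E}" using K0 E0 by force
      fix a c assume a: "a \<in> {k * b + e |k e. k \<in> F \<and> e \<in> E}" and c: "c \<in> {k * b + e |k e. k \<in> F \<and> e \<in> E}"
      obtain k1 e1 k2 e2 where "a = k1 * b + e1" "c = k2 * b + e2" "k1 \<in> F" "e1 \<in> E" "k2 \<in> F" "e2 \<in> E" using a c by blast
      then have "a + c = (k1 + k2) * b + (e1 + e2)" "k1 + k2 \<in> F" "e1 + e2 \<in> E"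
        using K_add E_add by (auto simp: algebra_simps)
      then show "a + c \<in> {k * b + e |k e. k \<in> F \<and> e \<in> E}" by blast
    next
      fix k a assume k: "k \<in> F" and a: "a \<in> {k * b + e |k e. k \<in> F \<and> e \<in> E}"
      obtain k1 e1 where "a = k1 * b + e1" "k1 \<in> F" "e1 \<in> E" using a by blast
      then have "k * a = (k * k1) * b + k * e1" "k * k1 \<in> F" "k * e1 \<in> E"
        using K_mult[OF k] E_scale[OF k] by (simp_all add: distrib_left mult.assoc)
      then show "k * a \<in> {k * b + e |k e. k \<in> F \<and> e \<in> E}" by blast
    next
      fix y assume "\<forall>n. y n \<in> {k * b + e |k e. k \<in> F \<and> e \<in> E}" and C: "Cauchy y"
      then have "\<forall>n. \<exists>k e. y n = k * b + e \<and> k \<in> F \<and> e \<in> E" by blast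
      then obtain k e where ke: "\<And>n. y n = k n * b + e n" "\<And>n. k n \<in> F" "\<And>n. e n \<in> E" by metis
      have dK: "k m - k n \<in> F" for m n using K_add[OF ke(2)[of m] K_mult[OF K1 ke(2)[of n]]] by simp
      have "Cauchy k" unfolding Cauchy_def
      proof
        fix N :: real
        obtain M' where M': "\<forall>m\<ge>M'. \<forall>n\<ge>M'. ereal (N + M) \<le> v (y m - y n)" using C Cauchy_def by meson
        have "ereal N \<le> v (k m - k n)" if "m \<ge> M'" "n \<ge> M'" for m n
        proof -
          have "y m - y n = (k m - k n) * b + (e m - e n)" using ke by (simp add: algebra_simps)
          then have "ereal (N + M) \<le> v (k m - k n) + ereal M" using coord[OF dK E_diff[OF ke(3) ke(3)]] M' that by (metis order_trans)
          then show ?thesis by (cases "v (k m - k n)") auto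
        qed
        then show "\<exists>M. \<forall>m\<ge>M. \<forall>n\<ge>M. ereal N \<le> v (k m - k n)" by blast
      qed
      then obtain k0 where k0: "k0 \<in> F" "lim k k0" using K_complete ke(2) by blast
      have b0: "b \<noteq> 0" using Suc_dim.hyps E0 by auto
      obtain B where B: "v b = ereal B" using v_real b0 by blast
      have kb: "lim (\<lambda>n. k n * b) (k0 * b)" unfolding lim_def
      proof
        fix N :: real
        obtain M' where M': "\<forall>n\<ge>M'. ereal (N - B) \<le> v (k n - k0)" using k0(2) lim_def by meson
        have "ereal N \<le> v (k n * b - k0 * b)" if "n \<ge> M'" for n
        proof -
          have "v (k n * b - k0 * b) = v (k n - k0) + ereal B" using v_mult[of "k n - k0" b] B by (simp add: algebra_simps)
          moreover have "ereal (N - B) \<le> v (k n - k0)" using M' that by blast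
          ultimately show ?thesis by (cases "v (k n - k0)") auto
        qed
        then show "\<exists>M. \<forall>n\<ge>M. ereal N \<le> v (k n * b - k0 * b)" by blast
      qed
      have "Cauchy e" unfolding Cauchy_def
      proof
        fix N :: real
        obtain M1 where M1: "\<forall>m\<ge>M1. \<forall>n\<ge>M1. ereal N \<le> v (y m - y n)" using C Cauchy_def by meson
        obtain M2 where M2: "\<forall>n\<ge>M2. ereal N \<le> v (k n * b - k0 * b)" using kb lim_def by meson
        have "ereal N \<le> v (e m - e n)" if "m \<ge> max M1 M2" "n \<ge> max M1 M2" for m n
        proof -
          have "e m - e n = (y m - y n) - (k m * b - k0 * b) + (k n * b - k0 * b)" using ke(1) by simp
          moreover have "ereal N \<le> v (y m - y n)" "ereal N \<le> v (k m * b - k0 * b)" "ereal N \<le> v (k n * b - k0 * b)" using M1 M2 that by auto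
          ultimately show ?thesis using v_add_ge v_diff_ge by metis
        qed
        then show "\<exists>M. \<forall>m\<ge>M. \<forall>n\<ge>M. ereal N \<le> v (e m - e n)" by blast
      qed
      then obtain e0 where e0: "e0 \<in> E" "lim e e0" using E_complete ke(3) by blast
      have "lim y (k0 * b + e0)" unfolding lim_def
      proof
        fix N :: real
        obtain M1 M2 where M: "\<forall>n\<ge>M1. ereal N \<le> v (e n - e0)" "\<forall>n\<ge>M2. ereal N \<le> v (k n * b - k0 * b)"
          using e0(2) kb unfolding lim_def by meson
        have "ereal N \<le> v (y n - (k0 * b + e0))" if "n \<ge> max M1 M2" for n
          using v_add_ge[of "ereal N" "k n * b - k0 * b" "e n - e0"] M that ke(1)[of n] by (simp add: algebra_simps)
        then show "\<exists>M. \<forall>n\<ge>M. ereal N \<le> v (y n - (k0 * b + e0))" by blast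
      qed
      then show "\<exists>l\<in>{k * b + e |k e. k \<in> F \<and> e \<in> E}. lim y l" using k0 e0 by blast
    qed
  qed
  obtain n where n: "R.dimension n F UNIV"
    using ext by (auto simp: padic_extension_def R.finite_dimension_def F_def)
  have "Cauchy x" using cauchy by (simp add: Cauchy_def)
  then have "\<exists>l. lim x l" using key[OF n refl] by simp
  then show ?thesis by (simp add: lim_def)
qed

section \<open>Groups filtered by p-th powers\<close>

text \<open>The \<open>K n\<close> are a countable basis of neighbourhoods of the identity. Finite
  index and completeness together are compactness in the form used below: nested cosets shrink to a
  point, and each level has finitely many cosets. Completeness compares only consecutive
  \<open>y n\<close>, as the filtration is decreasing.\<close>

locale filtered_group = comm_group G for G :: "'g topgroup" (structure) +
  fixes K :: "nat \<Rightarrow> 'g set"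
  assumes K_subgroup: "subgroup (K n) G"
    and K_Suc: "K (Suc n) \<subseteq> K n"
    and K_sep: "(\<Inter>n. K n) \<subseteq> {\<one>}"
    and K_finite: "finite (rcosets (K n))"
    and K_complete: "\<lbrakk>\<And>n. y n \<in> carrier G; \<And>n. y (Suc n) \<otimes> inv (y n) \<in> K n\<rbrakk>
          \<Longrightarrow> \<exists>x\<in>carrier G. \<forall>n. x \<otimes> inv (y n) \<in> K n"
    and K_open: "openin (topo G) U \<longleftrightarrow>
          U \<subseteq> carrier G \<and> (\<forall>x\<in>U. \<exists>n. \<forall>y\<in>carrier G. y \<otimes> inv x \<in> K n \<longrightarrow> y \<in> U)"
begin

text \<open>Congruence modulo \<open>K n\<close>. Membership of both sides in the carrier is part of
  the relation, so that most of the calculus below runs without carrier premises.\<close>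

definition eqv :: "nat \<Rightarrow> 'g \<Rightarrow> 'g \<Rightarrow> bool" where
  "eqv n x y \<longleftrightarrow> x \<in> carrier G \<and> y \<in> carrier G \<and> x \<otimes> inv y \<in> K n"

lemma eqv_carrier: "eqv n x y \<Longrightarrow> x \<in> carrier G" "eqv n x y \<Longrightarrow> y \<in> carrier G"
  by (auto simp: eqv_def)

lemma K_carrier: "x \<in> K n \<Longrightarrow> x \<in> carrier G"
  using subgroup.mem_carrier[OF K_subgroup] .

lemma K_one [simp]: "\<one> \<in> K n"
  using subgroup.one_closed[OF K_subgroup] .

lemma K_m_closed: "x \<in> K n \<Longrightarrow> y \<in> K n \<Longrightarrow> x \<otimes> y \<in> K n"
  using subgroup.m_closed[OF K_subgroup] .

lemma K_inv_closed: "x \<in> K n \<Longrightarrow> inv x \<in> K n"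
  using subgroup.m_inv_closed[OF K_subgroup] .

lemma K_mono: "m \<le> n \<Longrightarrow> K n \<subseteq> K m"
  using lift_Suc_antimono_le[of K, OF K_Suc] .

lemma eqv_mono: "eqv n x y \<Longrightarrow> m \<le> n \<Longrightarrow> eqv m x y"
  using K_mono by (auto simp: eqv_def)

lemma eqv_refl [simp]: "x \<in> carrier G \<Longrightarrow> eqv n x x"
  by (simp add: eqv_def)

lemma eqv_sym: "eqv n x y \<Longrightarrow> eqv n y x"
  using K_inv_closed[of "x \<otimes> inv y" n] by (auto simp: eqv_def inv_mult_group)

lemma eqv_mult: assumes "eqv n x y" "eqv n x' y'" shows "eqv n (x \<otimes> x') (y \<otimes> y')"
proof -
  have c: "x \<in> carrier G" "y \<in> carrier G" "x' \<in> carrier G" "y' \<in> carrier G" using assms by (auto simp: eqv_def)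
  have "(x \<otimes> x') \<otimes> inv (y \<otimes> y') = (x \<otimes> inv y) \<otimes> (x' \<otimes> inv y')"
    using c by (simp add: inv_mult m_ac)
  then show ?thesis using assms K_m_closed c by (simp add: eqv_def)
qed

lemma eqv_inv: assumes "eqv n x y" shows "eqv n (inv x) (inv y)"
proof -
  have "inv x \<otimes> inv (inv y) = inv (x \<otimes> inv y)" using assms by (simp add: eqv_def inv_mult)
  then show ?thesis using assms K_inv_closed by (simp add: eqv_def)
qed

lemma eqv_trans: assumes "eqv n x y" "eqv n y z" shows "eqv n x z"
proof -
  have c: "x \<in> carrier G" "y \<in> carrier G" "z \<in> carrier G" using assms by (auto simp: eqv_def)
  have "(x \<otimes> inv y) \<otimes> (y \<otimes> inv z) = x \<otimes> (inv y \<otimes> y) \<otimes> inv z"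
    using c by (simp only: m_assoc m_closed inv_closed)
  then have "(x \<otimes> inv y) \<otimes> (y \<otimes> inv z) = x \<otimes> inv z" using c by simp
  then show ?thesis using K_m_closed[of "x \<otimes> inv y" n "y \<otimes> inv z"] assms c by (simp add: eqv_def)
qed

lemma eqv_pow: "eqv n x y \<Longrightarrow> eqv n (x [^] (k::nat)) (y [^] k)"
  by (induction k) (auto intro: eqv_mult)

lemma eqv_int_pow: "eqv n x y \<Longrightarrow> eqv n (x [^] (k::int)) (y [^] k)"
  using eqv_pow[of n x y "nat k"] eqv_inv[OF eqv_pow[of n x y "nat (- k)"]]
  unfolding int_pow_def2 by (cases "k < 0") (simp_all only: if_True if_False)

lemma eqv_one_iff: "x \<in> carrier G \<Longrightarrow> eqv n x \<one> \<longleftrightarrow> x \<in> K n"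
  by (simp add: eqv_def)

lemma eqv_K: "eqv n x y \<Longrightarrow> x \<in> K n \<longleftrightarrow> y \<in> K n"
  using eqv_one_iff[of x n] eqv_one_iff[of y n] eqv_trans[of n y x \<one>] eqv_trans[of n x y \<one>]
    eqv_sym[of n x y] eqv_carrier[of n x y] by blast

lemma eqv_mem: assumes "eqv n x y" "m \<le> n" shows "x \<in> K m \<longleftrightarrow> y \<in> K m"
  using eqv_K[OF eqv_mono[OF assms]] .

lemma eqv_quotient: "x \<in> carrier G \<Longrightarrow> y \<in> carrier G \<Longrightarrow> z \<in> carrier G \<Longrightarrow> eqv n (x \<otimes> inv y) z \<longleftrightarrow> eqv n x (y \<otimes> z)"
  by (simp add: eqv_def inv_mult m_ac)

lemma eqv_eq: assumes "\<And>n. eqv n x y" shows "x = y"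
proof -
  have "x \<in> carrier G" "y \<in> carrier G" "x \<otimes> inv y \<in> (\<Inter>n. K n)" using assms by (auto simp: eqv_def)
  then have "x \<otimes> inv y = \<one>" using K_sep by blast
  then show ?thesis using \<open>x \<in> carrier G\<close> \<open>y \<in> carrier G\<close> by (metis inv_closed inv_equality inv_inv)
qed

lemma eqv_limit:
  assumes "\<And>n. eqv n (y (Suc n)) (y n)"
  shows "\<exists>x\<in>carrier G. \<forall>n. eqv n x (y n)"
proof -
  have "y n \<in> carrier G" for n using assms eqv_carrier by blast
  then show ?thesis using K_complete[of y] assms by (simp add: eqv_def)
qed

lemma r_coset_iff: "x \<in> carrier G \<Longrightarrow> y \<in> K n #> x \<longleftrightarrow> eqv n y x"
  by (auto simp: r_coset_def eqv_def m_assoc K_carrier intro!: bexI[of _ "y \<otimes> inv x"])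

lemma r_coset_eq_iff: assumes "x \<in> carrier G" "y \<in> carrier G" shows "K n #> x = K n #> y \<longleftrightarrow> eqv n x y"
proof
  assume "K n #> x = K n #> y"
  then show "eqv n x y" using r_coset_iff assms eqv_refl by blast
next
  assume "eqv n x y"
  then have *: "eqv n z x \<longleftrightarrow> eqv n z y" for z using eqv_trans[of n z x y] eqv_trans[of n z y x] eqv_sym[of n x y] by blast
  show "K n #> x = K n #> y" by (auto simp: r_coset_iff assms *)
qed

lemma rcosets_eq: "rcosets (K n) = (\<lambda>x. K n #> x) ` carrier G"
  by (auto simp: RCOSETS_def)

lemma openin_iff: "openin (topo G) U \<longleftrightarrow> U \<subseteq> carrier G \<and> (\<forall>x\<in>U. \<exists>n. \<forall>y. eqv n y x \<longrightarrow> y \<in> U)"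
  unfolding K_open eqv_def by (intro conj_cong ball_cong refl) blast

lemma topspace_topo: "topspace (topo G) = carrier G"
  by (meson equalityI eqv_carrier(1) openin_iff openin_subset openin_topspace order_refl)

lemma openin_K: "openin (topo G) (K n)"
  unfolding openin_iff using eqv_K K_carrier by blast

end

text \<open>\<open>K_root\<close> asks for a root only up to one further level: this is what
  approximation in a number field can deliver.\<close>

locale p_filtered_group = filtered_group + padic p for p +
  assumes K_pow: "x \<in> K n \<Longrightarrow> x [^] p \<in> K (Suc n)"
    and K_root: "y \<in> K (Suc n) \<Longrightarrow> \<exists>x\<in>K n. y \<otimes> inv (x [^] p) \<in> K (Suc (Suc n))"
begin

lemma eqv_pow_p: assumes "eqv n x y" shows "eqv (Suc n) (x [^] p) (y [^] p)"
proof -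
  have c: "x \<in> carrier G" "y \<in> carrier G" using assms by (auto simp: eqv_def)
  have "(x \<otimes> inv y) [^] p = x [^] p \<otimes> inv (y [^] p)" using c by (simp add: nat_pow_distrib nat_pow_inv)
  then show ?thesis using K_pow[of "x \<otimes> inv y" n] assms c by (simp add: eqv_def)
qed

lemma K_root_approx: assumes "y \<in> K (Suc n)" shows "\<exists>x\<in>K n. eqv (Suc (Suc n)) y (x [^] p)"
proof -
  obtain x where "x \<in> K n" "y \<otimes> inv (x [^] p) \<in> K (Suc (Suc n))" using K_root[OF assms] by blast
  then show ?thesis using K_carrier[OF assms] K_carrier by (auto simp: eqv_def)
qed

text \<open>Successive approximation: if \<open>z [^] p\<close> is right modulo
  \<open>K (n + 2 + k)\<close>, the quotient has an approximate root \<open>w\<close> in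
  \<open>K (n + 1 + k)\<close>. Replacing \<open>z\<close> by \<open>z \<otimes> w\<close> gains one
  level and changes \<open>z\<close> only inside \<open>K (n + 1 + k)\<close>, so the corrections
  converge.\<close>

lemma K_root_exact:
  assumes y: "y \<in> K (Suc n)"
  shows "\<exists>x\<in>K n. x [^] p = y"
proof -
  have yc: "y \<in> carrier G" using y K_carrier by blast
  have "\<exists>z. \<forall>k. (z k \<in> K n \<and> eqv (Suc (Suc n) + k) y (z k [^] p)) \<and> eqv (Suc n + k) (z (Suc k)) (z k)"
  proof (rule dependent_nat_choice)
    show "\<exists>x. x \<in> K n \<and> eqv (Suc (Suc n) + 0) y (x [^] p)" using K_root_approx[OF y] by auto
  next
    fix z k assume z: "z \<in> K n \<and> eqv (Suc (Suc n) + k) y (z [^] p)"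
    then have zc: "z \<in> carrier G" using K_carrier by blast
    have "y \<otimes> inv (z [^] p) \<in> K (Suc (Suc n + k))" using z by (simp add: eqv_def)
    then obtain w where w: "w \<in> K (Suc n + k)" "eqv (Suc (Suc (Suc n + k))) (y \<otimes> inv (z [^] p)) (w [^] p)"
      using K_root_approx by blast
    have wc: "w \<in> carrier G" using w K_carrier by blast
    have "eqv (Suc (Suc n) + Suc k) y ((z \<otimes> w) [^] p)"
      using w(2) zc wc yc by (simp add: nat_pow_distrib eqv_quotient)
    moreover have "w \<in> K n" using w(1) K_mono[of n "Suc n + k"] by auto
    moreover have "eqv (Suc n + k) (z \<otimes> w) z"
    proof -
      have "z \<otimes> w \<otimes> inv z = w" using zc wc by (metis inv_closed m_comm m_assoc r_inv r_one)
      then show ?thesis using w(1) zc wc by (simp add: eqv_def)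
    qed
    ultimately show "\<exists>y'. (y' \<in> K n \<and> eqv (Suc (Suc n) + Suc k) y (y' [^] p)) \<and> eqv (Suc n + k) y' z"
      using z K_m_closed by blast
  qed
  then obtain z where z: "\<And>k. z k \<in> K n" "\<And>k. eqv (Suc (Suc n) + k) y (z k [^] p)"
    "\<And>k. eqv (Suc n + k) (z (Suc k)) (z k)" by blast
  have "eqv k (z (Suc k)) (z k)" for k by (rule eqv_mono[OF z(3)]) simp
  then obtain x where x: "x \<in> carrier G" "\<And>k. eqv k x (z k)" using eqv_limit by blast
  have "x \<in> K n" using eqv_K[OF x(2)[of n]] z(1) by blast
  moreover have "eqv k (x [^] p) y" for k
    using eqv_trans[OF eqv_pow[OF x(2)] eqv_sym[OF eqv_mono[OF z(2)]]] by simp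
  then have "x [^] p = y" by (rule eqv_eq)
  ultimately show ?thesis by blast
qed

lemma K_pow_power: "x \<in> K n \<Longrightarrow> x [^] (p ^ m) \<in> K (n + m)"
proof (induction m)
  case (Suc m)
  have "x [^] (p ^ Suc m) = (x [^] (p ^ m)) [^] p" using Suc.prems K_carrier by (simp add: nat_pow_pow mult.commute)
  then show ?case using K_pow[OF Suc.IH[OF Suc.prems]] by simp
qed (simp add: K_carrier)

lemma p_multiples_K: "p_multiples p m G (K n) = K (n + m)"
proof
  show "p_multiples p m G (K n) \<subseteq> K (n + m)" using K_pow_power by (auto simp: p_multiples_def)
  show "K (n + m) \<subseteq> p_multiples p m G (K n)"
  proof (induction m)
    case 0 then show ?case using K_carrier by (auto simp: p_multiples_def)
  next
    case (Suc m)
    show ?case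
    proof
      fix y assume "y \<in> K (n + Suc m)"
      then obtain x where x: "x \<in> K (n + m)" "x [^] p = y" using K_root_exact by auto
      then obtain h where h: "h \<in> K n" "x = h [^] (p ^ m)" using Suc by (auto simp: p_multiples_def)
      have "y = h [^] (p ^ Suc m)" using x h K_carrier by (simp add: nat_pow_pow mult.commute)
      then show "y \<in> p_multiples p (Suc m) G (K n)" using h by (auto simp: p_multiples_def)
    qed
  qed
qed

text \<open>The \<open>p\<close>-th power maps \<open>K n / K (n + 1)\<close> onto \<open>K (n + 1) / K (n + 2)\<close>, so these finite
  quotients have decreasing, hence eventually constant, cardinality.\<close>

lemma power_map_eventually_injective:
  "\<exists>t. \<forall>n\<ge>t. \<forall>x\<in>K n. x [^] p \<in> K (Suc (Suc n)) \<longrightarrow> x \<in> K (Suc n)"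
proof -
  define Q where "Q n = (\<lambda>x. K (Suc n) #> x) ` K n" for n
  have fin: "finite (Q n)" for n
    by (rule finite_subset[OF _ K_finite[of "Suc n"]]) (auto simp: Q_def rcosets_eq K_carrier)
  define rep where "rep n C = (SOME x. x \<in> K n \<and> C = K (Suc n) #> x)" for n C
  have rep: "rep n C \<in> K n" "C = K (Suc n) #> rep n C" if "C \<in> Q n" for n C
  proof -
    have "\<exists>x. x \<in> K n \<and> C = K (Suc n) #> x" using that by (auto simp: Q_def)
    then have "rep n C \<in> K n \<and> C = K (Suc n) #> rep n C" unfolding rep_def by (rule someI_ex)
    then show "rep n C \<in> K n" "C = K (Suc n) #> rep n C" by auto
  qed
  \<comment> \<open>The map induced by the power map on the quotients \<open>Q n\<close>;
    \<open>eqv_pow_p\<close> makes it independent of the chosen representative.\<close>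
  define g where "g n C = K (Suc (Suc n)) #> (rep n C [^] p)" for n C
  have g: "g n (K (Suc n) #> x) = K (Suc (Suc n)) #> (x [^] p)" if x: "x \<in> K n" for n x
  proof -
    let ?C = "K (Suc n) #> x"
    have "?C \<in> Q n" using x by (auto simp: Q_def)
    from rep[OF this] have "eqv (Suc n) (rep n ?C) x" using r_coset_eq_iff x K_carrier eqv_sym by metis
    then have "eqv (Suc (Suc n)) (rep n ?C [^] p) (x [^] p)" by (rule eqv_pow_p)
    then show ?thesis unfolding g_def using r_coset_eq_iff eqv_carrier by blast
  qed
  have surj: "Q (Suc n) = g n ` Q n" for n
  proof
    show "g n ` Q n \<subseteq> Q (Suc n)" using g K_pow by (auto simp: Q_def)
    show "Q (Suc n) \<subseteq> g n ` Q n"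
    proof
      fix C assume "C \<in> Q (Suc n)"
      then obtain y where y: "y \<in> K (Suc n)" "C = K (Suc (Suc n)) #> y" by (auto simp: Q_def)
      obtain x where x: "x \<in> K n" "x [^] p = y" using K_root_exact y by blast
      then have "C = g n (K (Suc n) #> x)" using g y by simp
      then show "C \<in> g n ` Q n" using x by (auto simp: Q_def)
    qed
  qed
  have dec: "card (Q (Suc n)) \<le> card (Q n)" for n unfolding surj by (rule card_image_le[OF fin])
  \<comment> \<open>\<open>t\<close> attains the least cardinality. As the cardinalities decrease
    they are equal from \<open>t\<close> on, and a surjection between finite sets of equal size is
    injective.\<close>
  obtain t where t: "\<And>n. card (Q t) \<le> card (Q n)"
    using ex_has_least_nat[of "\<lambda>_. True" 0 "\<lambda>n. card (Q n)"] by auto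
  have "x \<in> K (Suc n)" if n: "n \<ge> t" and x: "x \<in> K n" "x [^] p \<in> K (Suc (Suc n))" for n x
  proof -
    have "card (Q (Suc n)) = card (Q n)"
      using t[of "Suc n"] dec[of n] lift_Suc_antimono_le[of "\<lambda>n. card (Q n)", OF dec n] by linarith
    then have inj: "inj_on (g n) (Q n)" unfolding surj by (rule eq_card_imp_inj_on[OF fin])
    have "g n (K (Suc n) #> x) = g n (K (Suc n) #> \<one>)"
      using g[OF x(1)] g[OF K_one] r_coset_eq_iff[of "x [^] p" "\<one>"] x K_carrier eqv_one_iff by simp
    then have "K (Suc n) #> x = K (Suc n) #> \<one>" by (rule inj_onD[OF inj]) (use x in \<open>auto simp: Q_def\<close>)
    then show ?thesis using r_coset_eq_iff x K_carrier eqv_one_iff by blast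
  qed
  then show ?thesis by blast
qed

text \<open>The homomorphism from integer exponent vectors indexed by \<open>S\<close> to the group.
  Exponents are functions on the whole type; by \<open>E_cong\<close> their values off
  \<open>S\<close> are ignored.\<close>

definition E :: "'a set \<Rightarrow> ('a \<Rightarrow> int) \<Rightarrow> 'a" where
  "E S a = finprod G (\<lambda>x. x [^] a x) S"

lemma E_insert: "finite S \<Longrightarrow> insert x S \<subseteq> carrier G \<Longrightarrow> x \<notin> S \<Longrightarrow> E (insert x S) a = x [^] a x \<otimes> E S a"
  unfolding E_def by (rule finprod_insert) auto

lemma E_closed [simp]: "S \<subseteq> carrier G \<Longrightarrow> E S a \<in> carrier G"
  unfolding E_def by (rule finprod_closed) auto

lemma E_empty [simp]: "E {} a = \<one>"
  by (simp add: E_def)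

lemma E_cong: "S \<subseteq> carrier G \<Longrightarrow> (\<And>x. x \<in> S \<Longrightarrow> a x = b x) \<Longrightarrow> E S a = E S b"
  unfolding E_def by (rule finprod_cong') auto

lemma E_add: "finite S \<Longrightarrow> S \<subseteq> carrier G \<Longrightarrow> E S (\<lambda>x. a x + b x) = E S a \<otimes> E S b"
  by (induction S rule: finite_induct) (simp_all add: E_insert int_pow_mult m_ac)

lemma E_scale: "finite S \<Longrightarrow> S \<subseteq> carrier G \<Longrightarrow> E S (\<lambda>x. k * a x) = E S a [^] (k::int)"
proof (induction S rule: finite_induct)
  case (insert x S)
  then show ?case by (simp add: E_insert int_pow_distrib int_pow_pow mult.commute)
qed simp

lemma E_diff: assumes "finite S" "S \<subseteq> carrier G" shows "E S (\<lambda>x. a x - b x) = E S a \<otimes> inv (E S b)"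
  using E_add[OF assms, of a "\<lambda>x. -1 * b x"] E_scale[OF assms, of "-1" b] assms(2)
  by (simp add: int_pow_neg)

lemma E_mem: "finite S \<Longrightarrow> S \<subseteq> K n \<Longrightarrow> E S a \<in> K n"
proof (induction S rule: finite_induct)
  case (insert x S)
  then have "x [^] a x \<in> K n" using subgroup_int_pow_closed[OF K_subgroup] by auto
  moreover have "insert x S \<subseteq> carrier G" using insert K_carrier by blast
  ultimately show ?case using insert K_m_closed by (simp add: E_insert)
qed simp

lemma E_single: assumes "finite S" "S \<subseteq> carrier G" "x \<in> S" shows "E S (\<lambda>y. if y = x then k else 0) = x [^] k"
proof -
  have "E (S - {x}) (\<lambda>y. if y = x then k else 0) = E (S - {x}) (\<lambda>y. 0 * k)" by (rule E_cong) (use assms in auto)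
  also have "\<dots> = \<one>" using E_scale[of "S - {x}" 0 "\<lambda>_. k"] assms by (simp add: subset_eq)
  finally have "E (insert x (S - {x})) (\<lambda>y. if y = x then k else 0) = x [^] k"
    using assms by (subst E_insert) (auto simp: subset_eq)
  then show ?thesis using assms(3) by (simp add: insert_absorb)
qed

definition generates :: "nat \<Rightarrow> 'a set \<Rightarrow> bool" where
  "generates t S \<longleftrightarrow> finite S \<and> S \<subseteq> K t \<and> (\<forall>y\<in>K t. \<exists>a. eqv (Suc t) y (E S a))"

text \<open>By \<open>K_pow\<close> the quotient of \<open>K t\<close> by \<open>K (Suc t)\<close>
  is a vector space over the field with \<open>p\<close> elements. \<open>S\<close> represents a
  basis of it, expressed by integer exponents without forming the quotient.\<close>

definition p_basis :: "nat \<Rightarrow> 'a set \<Rightarrow> bool" where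
  "p_basis t S \<longleftrightarrow> generates t S \<and> (\<forall>a. E S a \<in> K (Suc t) \<longrightarrow> (\<forall>x\<in>S. int p dvd a x))"

lemma generates_exists: "\<exists>S. generates t S"
proof -
  define Q where "Q = (\<lambda>x. K (Suc t) #> x) ` K t"
  have fin: "finite Q"
    by (rule finite_subset[OF _ K_finite[of "Suc t"]]) (auto simp: Q_def rcosets_eq K_carrier)
  have "\<forall>C\<in>Q. \<exists>x\<in>K t. C = K (Suc t) #> x" by (auto simp: Q_def)
  then obtain r where r: "\<And>C. C \<in> Q \<Longrightarrow> r C \<in> K t \<and> C = K (Suc t) #> r C" by metis
  have S: "r ` Q \<subseteq> K t" using r by auto
  have "\<exists>a. eqv (Suc t) y (E (r ` Q) a)" if y: "y \<in> K t" for y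
  proof -
    let ?x = "r (K (Suc t) #> y)"
    have m: "K (Suc t) #> y \<in> Q" using y by (auto simp: Q_def)
    then have "eqv (Suc t) y ?x" using r[OF m] r_coset_eq_iff y K_carrier by metis
    moreover have "E (r ` Q) (\<lambda>y. if y = ?x then 1 else 0) = ?x"
      using E_single[of "r ` Q" ?x 1] fin m subset_trans[OF S subgroup.subset[OF K_subgroup]] r[OF m] K_carrier[OF conjunct1[OF r[OF m]]] by simp
    ultimately show ?thesis by metis
  qed
  then show ?thesis using fin S by (auto simp: generates_def)
qed

text \<open>Take a generating set of least size. If a relation involved \<open>x\<close> with
  exponent prime to \<open>p\<close>, Bezout would express \<open>x\<close> through the other
  elements modulo \<open>K (Suc t)\<close>, where \<open>x [^] p\<close> is trivial, and
  \<open>x\<close> could be dropped.\<close>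

lemma p_basis_exists: "\<exists>S. p_basis t S"
proof -
  obtain S where S: "generates t S" and min: "\<And>Y. generates t Y \<Longrightarrow> card S \<le> card Y"
    using ex_has_least_nat[of "generates t" _ card] generates_exists by metis
  have fX: "finite S" "S \<subseteq> K t" "S \<subseteq> carrier G" using S K_carrier by (auto simp: generates_def)
  have "int p dvd a x" if a: "E S a \<in> K (Suc t)" and x: "x \<in> S" for a x
  proof (rule ccontr)
    assume nd: "\<not> int p dvd a x"
    have "Factorial_Ring.prime (int p)" using prime_p by simp
    then have "coprime (int p) (a x)" using nd by (simp add: prime_imp_coprime)
    then obtain c b where bc: "c * int p + b * a x = 1" using bezout_int[of "int p" "a x"] by auto
    define Y where "Y = S - {x}"
    have Y: "finite Y" "Y \<subseteq> carrier G" "Y \<subseteq> K t" "S = insert x Y" "x \<notin> Y" using fX x by (auto simp: Y_def)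
    have xc: "x \<in> carrier G" "x \<in> K t" using x fX by auto
    have EX: "E S f = x [^] f x \<otimes> E Y f" for f using E_insert[of Y x f] Y xc by simp
    have "eqv (Suc t) (x [^] a x \<otimes> E Y a) \<one>" using a EX eqv_one_iff Y xc by simp
    then have "eqv (Suc t) (x [^] a x) (inv (E Y a))"
      using Y xc eqv_sym by (simp add: eqv_def m_ac)
    then have "eqv (Suc t) ((x [^] a x) [^] b) ((inv (E Y a)) [^] b)" by (rule eqv_int_pow)
    moreover have "(inv (E Y a)) [^] b = E Y (\<lambda>y. - b * a y)"
      using E_scale[OF Y(1,2), of "- b" a] Y by (simp add: int_pow_neg int_pow_inv)
    ultimately have 1: "eqv (Suc t) (x [^] (b * a x)) (E Y (\<lambda>y. - b * a y))"
      using xc by (simp add: int_pow_pow mult.commute)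
    have "x [^] p \<in> K (Suc t)" using K_pow xc by blast
    then have "(x [^] p) [^] c \<in> K (Suc t)" by (rule subgroup_int_pow_closed[OF K_subgroup])
    then have "x [^] (c * int p) \<in> K (Suc t)" using xc by (simp add: int_pow_pow mult.commute flip: int_pow_int)
    then have 2: "eqv (Suc t) (x [^] (c * int p)) \<one>" using eqv_one_iff xc by simp
    have "x [^] (c * int p + b * a x) = x [^] (c * int p) \<otimes> x [^] (b * a x)" using xc by (intro int_pow_mult)
    then have "x = x [^] (c * int p) \<otimes> x [^] (b * a x)" unfolding bc using xc by simp
    then have x_eq: "eqv (Suc t) x (E Y (\<lambda>y. - b * a y))" using eqv_mult[OF 2 1] Y by simp
    have "\<exists>f. eqv (Suc t) y (E Y f)" if "y \<in> K t" for y
    proof -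
      obtain f where f: "eqv (Suc t) y (E S f)" using S \<open>y \<in> K t\<close> by (auto simp: generates_def)
      have "eqv (Suc t) (E S f) (E Y (\<lambda>y. f x * (- b * a y)) \<otimes> E Y f)"
        unfolding EX E_scale[OF Y(1,2)] by (rule eqv_mult[OF eqv_int_pow[OF x_eq[unfolded E_scale[OF Y(1,2)]]]]) (use Y in simp)
      then have "eqv (Suc t) y (E Y (\<lambda>y. f x * (- b * a y) + f y))"
        unfolding E_add[OF Y(1,2)] by (rule eqv_trans[OF f])
      then show ?thesis by blast
    qed
    then have "generates t Y" using Y by (simp add: generates_def)
    then have "card S \<le> card Y" by (rule min)
    then show False using Y by simp
  qed
  then show ?thesis using S by (auto simp: p_basis_def)
qed


lemma eqv_one_K_iff: "eqv n y \<one> \<longleftrightarrow> y \<in> K n"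
  using eqv_one_iff K_carrier eqv_carrier by blast

section \<open>p-adic coordinates on a subgroup with injective power maps\<close>

context
  fixes t S
  assumes t: "\<forall>n\<ge>t. \<forall>x\<in>K n. x [^] p \<in> K (Suc (Suc n)) \<longrightarrow> x \<in> K (Suc n)"
    and S: "p_basis t S"
begin

lemma S_props: "finite S" "S \<subseteq> K t" "S \<subseteq> carrier G"
  using S K_carrier by (auto simp: p_basis_def generates_def)

text \<open>The \<open>p\<close>-th power map carries \<open>K (t + m)\<close> onto the next level,
  so the \<open>p ^ m\<close>-th powers of the elements of \<open>S\<close> generate each successive
  quotient.\<close>

lemma level_generates: "y \<in> K (t + m) \<Longrightarrow> \<exists>a. eqv (Suc (t + m)) y (E S (\<lambda>x. int p ^ m * a x))"
proof (induction m arbitrary: y)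
  case 0
  then show ?case using S by (auto simp: p_basis_def generates_def)
next
  case (Suc m)
  obtain z where z: "z \<in> K (t + m)" "z [^] p = y" using K_root_exact[of y "t + m"] Suc.prems by auto
  obtain a where a: "eqv (Suc (t + m)) z (E S (\<lambda>x. int p ^ m * a x))" using Suc.IH[OF z(1)] by blast
  have "E S (\<lambda>x. int p ^ m * a x) [^] p = E S (\<lambda>x. int p * (int p ^ m * a x))"
    using E_scale[OF S_props(1,3), of "int p" "\<lambda>x. int p ^ m * a x"] by (simp add: int_pow_int)
  then show ?case using eqv_pow_p[OF a] z(2) by (auto simp: mult.assoc)
qed

text \<open>The choice of \<open>t\<close> enters here: as the power map is injective on the
  successive quotients from \<open>t\<close> on, a relation at level \<open>m + 1\<close> comes from
  the same relation at level \<open>m\<close>.\<close>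

lemma level_independent: "E S (\<lambda>x. int p ^ m * a x) \<in> K (Suc (t + m)) \<Longrightarrow> x \<in> S \<Longrightarrow> int p dvd a x"
proof (induction m)
  case 0
  then show ?case using S by (auto simp: p_basis_def)
next
  case (Suc m)
  let ?e = "E S (\<lambda>x. int p ^ m * a x)"
  have "?e [^] p = E S (\<lambda>x. int p * (int p ^ m * a x))"
    using E_scale[OF S_props(1,3), of "int p" "\<lambda>x. int p ^ m * a x"] by (simp add: int_pow_int)
  then have "?e [^] p \<in> K (Suc (Suc (t + m)))" using Suc.prems by (simp add: mult.assoc)
  moreover have "?e = E S a [^] (p ^ m)"
    using E_scale[OF S_props(1,3), of "int p ^ m" a] by (simp add: int_pow_int flip: of_nat_power)
  then have "?e \<in> K (t + m)" using K_pow_power E_mem[OF S_props(1,2)] by simp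
  ultimately have "?e \<in> K (Suc (t + m))" using t by simp
  then show ?case using Suc by blast
qed

text \<open>On products of powers of \<open>S\<close> the filtration is the p-adic filtration of the
  exponents: by \<open>level_independent\<close>, divisibility grows by one factor \<open>p\<close>
  per level.\<close>

lemma E_mem_iff: "E S a \<in> K (t + m) \<longleftrightarrow> (\<forall>x\<in>S. int p ^ m dvd a x)"
proof
  assume "\<forall>x\<in>S. int p ^ m dvd a x"
  then obtain b where b: "\<And>x. x \<in> S \<Longrightarrow> a x = int p ^ m * b x" unfolding dvd_def by metis
  have "E S a = E S (\<lambda>x. int p ^ m * b x)" by (rule E_cong[OF S_props(3) b])
  also have "\<dots> = E S b [^] (p ^ m)"
    using E_scale[OF S_props(1,3), of "int p ^ m" b] by (simp add: int_pow_int flip: of_nat_power)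
  finally show "E S a \<in> K (t + m)" using K_pow_power E_mem[OF S_props(1,2)] by simp
next
  show "E S a \<in> K (t + m) \<Longrightarrow> \<forall>x\<in>S. int p ^ m dvd a x"
  proof (induction m)
    case (Suc m)
    then have "E S a \<in> K (t + m)" using K_Suc by auto
    then have "\<forall>x\<in>S. int p ^ m dvd a x" using Suc by blast
    then obtain b where b: "\<And>x. x \<in> S \<Longrightarrow> a x = int p ^ m * b x" unfolding dvd_def by metis
    have "E S a = E S (\<lambda>x. int p ^ m * b x)" by (rule E_cong[OF S_props(3) b])
    then have "\<forall>x\<in>S. int p dvd b x" using level_independent[of m b] Suc.prems by simp
    then show ?case using b by (simp add: mult.commute)
  qed simp
qed

lemma E_eqv_iff: "eqv (t + m) (E S a) (E S b) \<longleftrightarrow> (\<forall>x\<in>S. int p ^ m dvd a x - b x)"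
  using E_mem_iff[of "\<lambda>x. a x - b x"] S_props by (simp add: eqv_def E_diff)

text \<open>Together with \<open>E_eqv_iff\<close> this identifies \<open>K t\<close> modulo
  \<open>K (t + m)\<close> with exponent vectors modulo \<open>p ^ m\<close>. The error at level
  \<open>t + m\<close> is absorbed by exponents divisible by \<open>p ^ m\<close>.\<close>

lemma E_approx: "y \<in> K t \<Longrightarrow> \<exists>a. eqv (t + m) y (E S a)"
proof (induction m)
  case 0
  have "eqv t y \<one>" using eqv_one_K_iff[of t y] 0 by simp
  moreover have "eqv t (E S (\<lambda>_. 0)) \<one>" using eqv_one_K_iff[of t "E S (\<lambda>_. 0)"] E_mem[OF S_props(1,2)] by simp
  ultimately have "eqv t y (E S (\<lambda>_. 0))" by (rule eqv_trans[OF _ eqv_sym])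
  then show ?case by auto
next
  case (Suc m)
  then obtain a where a: "eqv (t + m) y (E S a)" by blast
  then have "y \<otimes> inv (E S a) \<in> K (t + m)" by (simp add: eqv_def)
  then obtain b where "eqv (Suc (t + m)) (y \<otimes> inv (E S a)) (E S (\<lambda>x. int p ^ m * b x))"
    using level_generates by blast
  then have "eqv (Suc (t + m)) y (E S a \<otimes> E S (\<lambda>x. int p ^ m * b x))"
    using eqv_quotient S_props Suc.prems K_carrier by simp
  then show ?case using E_add[OF S_props(1,3)] by (metis add_Suc_right)
qed

lemma coordinates_exist:
  assumes y: "y \<in> K t" and x: "x \<in> S"
  shows "\<exists>z\<in>Zp_set p. \<forall>m a. eqv (t + m) y (E S a) \<longrightarrow> zp_mod z m (a x)"
proof -
  obtain A where A: "\<And>m. eqv (t + m) y (E S (A m))" using E_approx[OF y] by metis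
  have "eqv (t + m) (E S (A (Suc m))) (E S (A m))" for m
    using eqv_trans[OF eqv_sym A] eqv_mono[OF A[of "Suc m"], of "t + m"] by simp
  then have "int p ^ m dvd A (Suc m) x - A m x" for m using E_eqv_iff x by blast
  then obtain z where z: "z \<in> Zp_set p" "\<And>m. zp_mod z m (A m x)" using zp_mod_sequence[of "\<lambda>m. A m x"] by blast
  have "zp_mod z m (a x)" if "eqv (t + m) y (E S a)" for m a
  proof -
    have "int p ^ m dvd A m x - a x" using E_eqv_iff eqv_trans[OF eqv_sym[OF A] that] x by blast
    then show ?thesis using zp_mod_cong_iff[OF Zp_carrier z(2)] z(1) by blast
  qed
  then show ?thesis using z by blast
qed

text \<open>The \<open>p\<close>-adic coordinates with respect to a basis \<open>S\<close>: \<open>y\<close> is approximated by products of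
  integer powers \<open>E S a\<close>, and \<open>Z y x\<close> is the limit of the exponents \<open>a x\<close>.\<close>

definition Z where "Z y x = (SOME z. z \<in> Zp_set p \<and> (\<forall>m a. eqv (t + m) y (E S a) \<longrightarrow> zp_mod z m (a x)))"

lemma Z: assumes "y \<in> K t" "x \<in> S"
  shows "Z y x \<in> Zp_set p" "eqv (t + m) y (E S a) \<Longrightarrow> zp_mod (Z y x) m (a x)"
proof -
  have "Z y x \<in> Zp_set p \<and> (\<forall>m a. eqv (t + m) y (E S a) \<longrightarrow> zp_mod (Z y x) m (a x))"
    unfolding Z_def by (rule someI_ex) (use coordinates_exist[OF assms] in blast)
  then show "Z y x \<in> Zp_set p" "eqv (t + m) y (E S a) \<Longrightarrow> zp_mod (Z y x) m (a x)" by blast+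
qed

lemma Z_mult: assumes "y \<in> K t" "y' \<in> K t" "x \<in> S" shows "Z (y \<otimes> y') x = Z y x \<oplus>\<^bsub>Qp p\<^esub> Z y' x"
proof (rule Qp_eqI)
  have yy: "y \<otimes> y' \<in> K t" using assms K_m_closed by blast
  show c: "Z (y \<otimes> y') x \<in> carrier (Qp p)" "Z y x \<oplus>\<^bsub>Qp p\<^esub> Z y' x \<in> carrier (Qp p)"
    using Z(1) assms yy Zp_carrier Zp_add by blast+
  fix m
  obtain a b where ab: "eqv (t + m) y (E S a)" "eqv (t + m) y' (E S b)" using E_approx assms by meson
  then have "eqv (t + m) (y \<otimes> y') (E S (\<lambda>x. a x + b x))" using eqv_mult E_add[OF S_props(1,3)] by simp
  then have "zp_mod (Z (y \<otimes> y') x) m (a x + b x)" using Z(2)[OF yy assms(3)] by fastforce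
  moreover have "zp_mod (Z y x \<oplus>\<^bsub>Qp p\<^esub> Z y' x) m (a x + b x)"
    by (rule zp_mod_add[OF Zp_carrier[OF Z(1)] Zp_carrier[OF Z(1)] Z(2)[OF _ _ ab(1)] Z(2)[OF _ _ ab(2)]]) (use assms in auto)
  ultimately show "ereal (real m) \<le> Qp_val p (Z (y \<otimes> y') x \<ominus>\<^bsub>Qp p\<^esub> (Z y x \<oplus>\<^bsub>Qp p\<^esub> Z y' x))"
    using zp_mod_val_diff_iff[OF c] by fastforce
qed

text \<open>The coordinates turn the filtration into the p-adic distance; injectivity and continuity
  in both directions all rest on this equivalence.\<close>

lemma Z_val_iff: assumes "y \<in> K t" "y' \<in> K t"
  shows "eqv (t + m) y y' \<longleftrightarrow> (\<forall>x\<in>S. ereal (real m) \<le> Qp_val p (Z y x \<ominus>\<^bsub>Qp p\<^esub> Z y' x))"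
proof -
  obtain a b where ab: "eqv (t + m) y (E S a)" "eqv (t + m) y' (E S b)" using E_approx assms by meson
  have "eqv (t + m) y y' \<longleftrightarrow> eqv (t + m) (E S a) (E S b)"
    using ab eqv_trans eqv_sym by blast
  also have "\<dots> \<longleftrightarrow> (\<forall>x\<in>S. int p ^ m dvd a x - b x)" by (rule E_eqv_iff)
  also have "\<dots> \<longleftrightarrow> (\<forall>x\<in>S. ereal (real m) \<le> Qp_val p (Z y x \<ominus>\<^bsub>Qp p\<^esub> Z y' x))"
    by (intro ball_cong refl zp_mod_val_diff_iff[symmetric] Zp_carrier Z assms ab)
  finally show ?thesis .
qed

text \<open>Truncate the given coordinates to integers at each level; the products
  \<open>E S (a m)\<close> are then compatible and converge by completeness.\<close>

lemma Z_surj: assumes "\<And>x. x \<in> S \<Longrightarrow> z x \<in> Zp_set p" shows "\<exists>y\<in>K t. \<forall>x\<in>S. Z y x = z x"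
proof -
  have "\<forall>m x. \<exists>a. x \<in> S \<longrightarrow> zp_mod (z x) m a" using assms zp_mod_exists by blast
  then obtain a where a: "\<And>m x. x \<in> S \<Longrightarrow> zp_mod (z x) m (a m x)" by metis
  let ?u = "\<lambda>m. E S (a m)"
  have u: "eqv (t + m) (?u k) (?u m)" if "m \<le> k" for m k
    unfolding E_eqv_iff using zp_mod_cong_iff[OF Zp_carrier[OF assms] zp_mod_mono[OF a that]] a by blast
  have "eqv m (?u (Suc m)) (?u m)" for m by (rule eqv_mono[OF u]) auto
  then obtain y where y: "\<And>m. eqv m y (?u m)" using eqv_limit[of ?u] by blast
  have yu: "eqv (t + m) y (?u m)" for m using eqv_trans[OF y[of "t + m"] u[of m "t + m"]] by simp
  have yt: "y \<in> K t" using eqv_K[OF y[of t]] E_mem[OF S_props(1,2)] by blast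
  have "Z y x = z x" if x: "x \<in> S" for x
  proof (rule Qp_eqI)
    show c: "Z y x \<in> carrier (Qp p)" "z x \<in> carrier (Qp p)" using Z(1)[OF yt x] assms[OF x] Zp_carrier by auto
    show "ereal (real m) \<le> Qp_val p (Z y x \<ominus>\<^bsub>Qp p\<^esub> z x)" for m
      using zp_mod_val_diff_iff[OF c Z(2)[OF yt x yu] a[OF x]] by simp
  qed
  then show ?thesis using yt by blast
qed

end

end

section \<open>The product topology on powers of the p-adic integers\<close>

context padic begin

lemma Qp_val_diff_trans:
  assumes "x \<in> Zp_set p" "y \<in> Zp_set p" "z \<in> Zp_set p"
    and "ereal (real n) \<le> Qp_val p (x \<ominus>\<^bsub>Qp p\<^esub> y)" "ereal (real n) \<le> Qp_val p (y \<ominus>\<^bsub>Qp p\<^esub> z)"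
  shows "ereal (real n) \<le> Qp_val p (x \<ominus>\<^bsub>Qp p\<^esub> z)"
proof -
  obtain a b c where abc: "zp_mod x n a" "zp_mod y n b" "zp_mod z n c" using assms zp_mod_exists by meson
  have "int p ^ n dvd (a - b) + (b - c)"
    using assms zp_mod_val_diff_iff[OF _ _ abc(1,2)] zp_mod_val_diff_iff[OF _ _ abc(2,3)] Zp_carrier by (intro dvd_add) blast+
  then show ?thesis using zp_mod_val_diff_iff[OF _ _ abc(1,3)] assms Zp_carrier by simp
qed

lemma Qp_val_diff_self: "x \<in> Zp_set p \<Longrightarrow> ereal (real n) \<le> Qp_val p (x \<ominus>\<^bsub>Qp p\<^esub> x)"
  using zp_mod_exists[of x n] zp_mod_val_diff_iff Zp_carrier by (metis diff_self dvd_0_right)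

text \<open>The radii of \<open>val_topology\<close> are reals; replacing them by natural exponents
  makes them match the levels of a filtration.\<close>

lemma openin_Zp: "openin (val_topology (Zp_set p) (\<lambda>x y. Qp_val p (x \<ominus>\<^bsub>Qp p\<^esub> y))) U \<longleftrightarrow>
  U \<subseteq> Zp_set p \<and> (\<forall>x\<in>U. \<exists>n. \<forall>y\<in>Zp_set p. ereal (real n) \<le> Qp_val p (x \<ominus>\<^bsub>Qp p\<^esub> y) \<longrightarrow> y \<in> U)"
  unfolding openin_val_topology
proof (intro conj_cong ball_cong refl iffI)
  fix x assume "\<exists>N::real. \<forall>y\<in>Zp_set p. ereal N \<le> Qp_val p (x \<ominus>\<^bsub>Qp p\<^esub> y) \<longrightarrow> y \<in> U"
  then obtain N :: real where N: "\<And>y. y \<in> Zp_set p \<Longrightarrow> ereal N \<le> Qp_val p (x \<ominus>\<^bsub>Qp p\<^esub> y) \<Longrightarrow> y \<in> U" by blast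
  obtain n :: nat where "ereal N \<le> ereal (real n)" using real_arch_simple by auto
  then show "\<exists>n. \<forall>y\<in>Zp_set p. ereal (real n) \<le> Qp_val p (x \<ominus>\<^bsub>Qp p\<^esub> y) \<longrightarrow> y \<in> U" using N order_trans by blast
qed blast

lemma Zp_power_simps:
  "carrier (Zp_power p d) = ({..<d} \<rightarrow>\<^sub>E Zp_set p)"
  "x \<otimes>\<^bsub>Zp_power p d\<^esub> y = (\<lambda>i\<in>{..<d}. x i \<oplus>\<^bsub>Qp p\<^esub> y i)"
  "topo (Zp_power p d) = product_topology (\<lambda>_. val_topology (Zp_set p) (\<lambda>x y. Qp_val p (x \<ominus>\<^bsub>Qp p\<^esub> y))) {..<d}"
  by (simp_all add: Zp_power_def)

lemma topspace_Zp: "topspace (val_topology (Zp_set p) (\<lambda>x y. Qp_val p (x \<ominus>\<^bsub>Qp p\<^esub> y))) = Zp_set p"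
  by (rule antisym) (use openin_Zp in \<open>blast intro: openin_subset\<close>, rule openin_subset, use openin_Zp in blast)

text \<open>In a finite product the basic neighbourhoods can be taken as balls with one common
  exponent, the maximum over the \<open>d\<close> coordinates.\<close>

lemma openin_Zp_power:
  "openin (topo (Zp_power p d)) U \<longleftrightarrow> U \<subseteq> carrier (Zp_power p d) \<and>
    (\<forall>x\<in>U. \<exists>n. \<forall>y\<in>carrier (Zp_power p d). (\<forall>i<d. ereal (real n) \<le> Qp_val p (x i \<ominus>\<^bsub>Qp p\<^esub> y i)) \<longrightarrow> y \<in> U)"
  (is "_ \<longleftrightarrow> _ \<and> ?B")
proof
  let ?T = "val_topology (Zp_set p) (\<lambda>x y. Qp_val p (x \<ominus>\<^bsub>Qp p\<^esub> y))"
  assume o: "openin (topo (Zp_power p d)) U"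
  have sub: "U \<subseteq> carrier (Zp_power p d)"
    using openin_subset[OF o] by (simp add: Zp_power_simps topspace_Zp)
  have "\<exists>n. \<forall>y\<in>carrier (Zp_power p d). (\<forall>i<d. ereal (real n) \<le> Qp_val p (x i \<ominus>\<^bsub>Qp p\<^esub> y i)) \<longrightarrow> y \<in> U"
    if x: "x \<in> U" for x
  proof -
    have "\<exists>V. finite {i \<in> {..<d}. V i \<noteq> topspace ?T} \<and> (\<forall>i\<in>{..<d}. openin ?T (V i)) \<and> x \<in> Pi\<^sub>E {..<d} V \<and> Pi\<^sub>E {..<d} V \<subseteq> U"
      using o x unfolding Zp_power_simps openin_product_topology_alt by (rule bspec)
    then obtain V where V: "\<forall>i\<in>{..<d}. openin ?T (V i)" "x \<in> Pi\<^sub>E {..<d} V" "Pi\<^sub>E {..<d} V \<subseteq> U"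
      by blast
    have "\<exists>n. i < d \<longrightarrow> (\<forall>y\<in>Zp_set p. ereal (real n) \<le> Qp_val p (x i \<ominus>\<^bsub>Qp p\<^esub> y) \<longrightarrow> y \<in> V i)" for i
    proof (cases "i < d")
      case True
      then have "openin ?T (V i)" "x i \<in> V i" using V by auto
      then show ?thesis unfolding openin_Zp by blast
    qed simp
    then obtain n where n: "\<And>i y. i < d \<Longrightarrow> y \<in> Zp_set p \<Longrightarrow> ereal (real (n i)) \<le> Qp_val p (x i \<ominus>\<^bsub>Qp p\<^esub> y) \<Longrightarrow> y \<in> V i"
      by metis
    define m where "m = Max (insert 0 (n ` {..<d}))"
    have m: "n i \<le> m" if "i < d" for i unfolding m_def using that by (intro Max_ge) auto
    have "y \<in> U" if y: "y \<in> carrier (Zp_power p d)" "\<forall>i<d. ereal (real m) \<le> Qp_val p (x i \<ominus>\<^bsub>Qp p\<^esub> y i)" for y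
    proof -
      have "y i \<in> V i" if i: "i < d" for i
      proof (rule n[OF i])
        show "y i \<in> Zp_set p" using y i by (auto simp: Zp_power_simps)
        have "ereal (real (n i)) \<le> ereal (real m)" using m[OF i] by simp
        then show "ereal (real (n i)) \<le> Qp_val p (x i \<ominus>\<^bsub>Qp p\<^esub> y i)" using y(2) i order_trans by blast
      qed
      then have "y \<in> Pi\<^sub>E {..<d} V" using y by (auto simp: Zp_power_simps PiE_iff)
      then show ?thesis using V by blast
    qed
    then show ?thesis by blast
  qed
  then show "U \<subseteq> carrier (Zp_power p d) \<and> ?B" using sub by blast
next
  let ?T = "val_topology (Zp_set p) (\<lambda>x y. Qp_val p (x \<ominus>\<^bsub>Qp p\<^esub> y))"
  assume U: "U \<subseteq> carrier (Zp_power p d) \<and> ?B"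
  show "openin (topo (Zp_power p d)) U" unfolding Zp_power_simps openin_product_topology_alt
  proof (intro ballI)
    fix x assume x: "x \<in> U"
    then obtain n where n: "\<And>y. y \<in> carrier (Zp_power p d) \<Longrightarrow> (\<forall>i<d. ereal (real n) \<le> Qp_val p (x i \<ominus>\<^bsub>Qp p\<^esub> y i)) \<Longrightarrow> y \<in> U"
      using U by blast
    define V where "V i = {y \<in> Zp_set p. ereal (real n) \<le> Qp_val p (x i \<ominus>\<^bsub>Qp p\<^esub> y)}" for i
    have xZ: "x i \<in> Zp_set p" if "i < d" for i using x U that by (auto simp: Zp_power_simps)
    have "openin ?T (V i)" if "i < d" for i
      unfolding openin_Zp V_def using Qp_val_diff_trans[OF xZ[OF that]] by blast
    moreover have "x \<in> {..<d} \<rightarrow>\<^sub>E Zp_set p" using x U by (auto simp add: Zp_power_simps)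
    then have "x \<in> Pi\<^sub>E {..<d} V" using Qp_val_diff_self by (simp add: PiE_iff V_def)
    moreover have "Pi\<^sub>E {..<d} V \<subseteq> U"
    proof
      fix y assume y: "y \<in> Pi\<^sub>E {..<d} V"
      then show "y \<in> U" by (intro n) (auto simp: Zp_power_simps V_def PiE_iff)
    qed
    ultimately show "\<exists>V. finite {i \<in> {..<d}. V i \<noteq> topspace ?T} \<and> (\<forall>i\<in>{..<d}. openin ?T (V i)) \<and> x \<in> Pi\<^sub>E {..<d} V \<and> Pi\<^sub>E {..<d} V \<subseteq> U"
      by (intro exI[of _ V]) auto
  qed
qed

end

lemma sub_topgroup_pow: "x [^]\<^bsub>sub_topgroup G H\<^esub> (n::nat) = x [^]\<^bsub>G\<^esub> n"
  by (simp add: sub_topgroup_def nat_pow_def)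

context p_filtered_group begin

text \<open>\<open>\<phi>\<close> lists the coordinates \<open>Z\<close> along an enumeration of the
  basis. By \<open>\<phi>_val\<close> it matches congruence modulo \<open>K (t + m)\<close> with
  congruence of coordinates modulo \<open>p ^ m\<close>, from which injectivity and both halves of
  the homeomorphism are read off.\<close>

lemma open_Zp_subgroup_K: "\<exists>t. open_Zp_subgroup p G (K t)"
proof -
  obtain t where t: "\<forall>n\<ge>t. \<forall>x\<in>K n. x [^] p \<in> K (Suc (Suc n)) \<longrightarrow> x \<in> K (Suc n)"
    using power_map_eventually_injective by blast
  obtain S where S: "p_basis t S" using p_basis_exists by blast
  note Z = Z[OF t S] and Z_mult = Z_mult[OF t S] and Z_val_iff = Z_val_iff[OF t S] and Z_surj = Z_surj[OF t S]
  have finX: "finite S" using S_props[OF t S] by blast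
  define d where "d = card S"
  obtain h where h: "bij_betw h {..<d} S" using finX ex_bij_betw_nat_finite[OF finX] by (auto simp: d_def atLeast0LessThan)
  have hS: "h i \<in> S" if "i < d" for i using h that by (auto simp: bij_betw_def)
  define \<phi> where "\<phi> y = (\<lambda>i\<in>{..<d}. Z t S y (h i))" for y
  have \<phi>_carrier: "\<phi> y \<in> carrier (Zp_power p d)" if "y \<in> K t" for y
    using Z(1)[OF that hS] by (auto simp: \<phi>_def Zp_power_simps)
  have \<phi>_val: "eqv (t + m) y y' \<longleftrightarrow> (\<forall>i<d. ereal (real m) \<le> Qp_val p (\<phi> y i \<ominus>\<^bsub>Qp p\<^esub> \<phi> y' i))" if "y \<in> K t" "y' \<in> K t" for m y y'
  proof -
    have "S = h ` {..<d}" using h by (auto simp: bij_betw_def)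
    then show ?thesis unfolding Z_val_iff[OF that] by (auto simp: \<phi>_def)
  qed
  have \<phi>_inj: "inj_on \<phi> (K t)"
  proof
    fix y y' assume y: "y \<in> K t" "y' \<in> K t" "\<phi> y = \<phi> y'"
    have "\<phi> y' i \<in> Zp_set p" if "i < d" for i using \<phi>_carrier[OF y(2)] that by (auto simp: Zp_power_simps)
    then have "eqv (t + m) y y'" for m unfolding \<phi>_val[OF y(1,2)] y(3) using Qp_val_diff_self by blast
    then have "eqv m y y'" for m using eqv_mono[of "t + m" y y' m] by simp
    then show "y = y'" by (rule eqv_eq)
  qed
  have \<phi>_surj: "\<phi> ` K t = carrier (Zp_power p d)"
  proof
    show "\<phi> ` K t \<subseteq> carrier (Zp_power p d)" using \<phi>_carrier by blast
    show "carrier (Zp_power p d) \<subseteq> \<phi> ` K t"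
    proof
      fix z assume z: "z \<in> carrier (Zp_power p d)"
      let ?z = "\<lambda>x. z (inv_into {..<d} h x)"
      have inv: "inv_into {..<d} h (h i) = i" if "i < d" for i using h that by (auto simp: bij_betw_def)
      have "?z x \<in> Zp_set p" if "x \<in> S" for x
        using z bij_betw_apply[OF bij_betw_inv_into[OF h] that] by (auto simp: Zp_power_simps)
      then obtain y where y: "y \<in> K t" "\<forall>x\<in>S. Z t S y x = ?z x" using Z_surj[of ?z] by blast
      have "\<phi> y = z"
      proof
        fix i show "\<phi> y i = z i"
          using y(2) hS inv z by (cases "i < d") (auto simp: \<phi>_def Zp_power_simps PiE_def extensional_def)
      qed
      then show "z \<in> \<phi> ` K t" using y by blast
    qed
  qed
  have hom: "\<phi> (y \<otimes> y') = \<phi> y \<otimes>\<^bsub>Zp_power p d\<^esub> \<phi> y'" if "y \<in> K t" "y' \<in> K t" for y y'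
    unfolding \<phi>_def Zp_power_simps by (rule restrict_ext) (use Z_mult[OF that hS] in simp)
  have "\<phi> \<in> iso (sub_topgroup G (K t)) (Zp_power p d)"
    using hom \<phi>_surj \<phi>_inj \<phi>_carrier by (auto simp: iso_def hom_def bij_betw_def sub_topgroup_def)
  moreover have "homeomorphic_map (topo (sub_topgroup G (K t))) (topo (Zp_power p d)) \<phi>"
    unfolding homeomorphic_map_def quotient_map_def
  proof (intro conjI allI impI)
    have op: "openin (topo (sub_topgroup G (K t))) U \<longleftrightarrow> U \<subseteq> K t \<and> openin (topo G) U" for U
      using openin_open_subtopology[OF openin_K] by (auto simp: sub_topgroup_def)
    have ts: "topspace (topo (sub_topgroup G (K t))) = K t"
      using K_carrier by (auto simp: sub_topgroup_def topspace_topo)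
    have tz: "topspace (topo (Zp_power p d)) = carrier (Zp_power p d)"
      by (simp add: Zp_power_simps topspace_Zp)
    show "\<phi> ` topspace (topo (sub_topgroup G (K t))) = topspace (topo (Zp_power p d))" unfolding ts tz by (rule \<phi>_surj)
    show "inj_on \<phi> (topspace (topo (sub_topgroup G (K t))))" unfolding ts by (rule \<phi>_inj)
    fix U assume "U \<subseteq> topspace (topo (Zp_power p d))"
    then have U: "U \<subseteq> carrier (Zp_power p d)" by (simp add: tz)
    let ?V = "{x \<in> topspace (topo (sub_topgroup G (K t))). \<phi> x \<in> U}"
    have V: "?V = {x \<in> K t. \<phi> x \<in> U}" by (simp add: ts)
    show "openin (topo (sub_topgroup G (K t))) ?V \<longleftrightarrow> openin (topo (Zp_power p d)) U"
    proof
      assume "openin (topo (sub_topgroup G (K t))) ?V"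
      then have *: "\<And>x. x \<in> K t \<Longrightarrow> \<phi> x \<in> U \<Longrightarrow> \<exists>n. \<forall>y. eqv n y x \<longrightarrow> y \<in> K t \<and> \<phi> y \<in> U"
        unfolding op V openin_iff by blast
      show "openin (topo (Zp_power p d)) U" unfolding openin_Zp_power
      proof (intro conjI ballI U)
        fix z assume z: "z \<in> U"
        then obtain x where x: "x \<in> K t" "z = \<phi> x" using U \<phi>_surj by blast
        obtain n where n: "\<forall>y. eqv n y x \<longrightarrow> y \<in> K t \<and> \<phi> y \<in> U" using *[OF x(1)] x z by blast
        have "w \<in> U" if w: "w \<in> carrier (Zp_power p d)" "\<forall>i<d. ereal (real n) \<le> Qp_val p (z i \<ominus>\<^bsub>Qp p\<^esub> w i)" for w
        proof -
          obtain y where y: "y \<in> K t" "w = \<phi> y" using w \<phi>_surj by blast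
          have "eqv (t + n) x y" using \<phi>_val[OF x(1) y(1)] w(2) x y by simp
          then show ?thesis using n y eqv_sym eqv_mono[of "t + n" y x n] by simp
        qed
        then show "\<exists>n. \<forall>y\<in>carrier (Zp_power p d). (\<forall>i<d. ereal (real n) \<le> Qp_val p (z i \<ominus>\<^bsub>Qp p\<^esub> y i)) \<longrightarrow> y \<in> U" by blast
      qed
    next
      assume "openin (topo (Zp_power p d)) U"
      then have *: "\<And>x. x \<in> U \<Longrightarrow> \<exists>n. \<forall>y\<in>carrier (Zp_power p d). (\<forall>i<d. ereal (real n) \<le> Qp_val p (x i \<ominus>\<^bsub>Qp p\<^esub> y i)) \<longrightarrow> y \<in> U"
        unfolding openin_Zp_power by blast
      have "\<exists>n. \<forall>y. eqv n y x \<longrightarrow> y \<in> {x \<in> K t. \<phi> x \<in> U}" if x: "x \<in> K t" "\<phi> x \<in> U" for x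
      proof -
        obtain n where n: "\<forall>y\<in>carrier (Zp_power p d). (\<forall>i<d. ereal (real n) \<le> Qp_val p (\<phi> x i \<ominus>\<^bsub>Qp p\<^esub> y i)) \<longrightarrow> y \<in> U"
          using *[OF x(2)] by blast
        have "y \<in> {x \<in> K t. \<phi> x \<in> U}" if y: "eqv (t + n) y x" for y
        proof -
          have yt: "y \<in> K t" using eqv_mem[OF y, of t] x by simp
          then show ?thesis using n \<phi>_carrier[OF yt] \<phi>_val[OF x(1) yt] eqv_sym[OF y] by blast
        qed
        then show ?thesis by blast
      qed
      then show "openin (topo (sub_topgroup G (K t))) ?V" unfolding op V openin_iff using K_carrier by blast
    qed
  qed
  ultimately have "iso_topgroup (sub_topgroup G (K t)) (Zp_power p d)" by (auto simp: iso_topgroup_def)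
  then show ?thesis using K_subgroup openin_K by (auto simp: open_Zp_subgroup_def)
qed

text \<open>Under the isomorphism a \<open>p ^ m\<close>-th power has coordinates divisible by
  \<open>p ^ m\<close>, and the image of the open set \<open>H \<inter> K n\<close> contains a ball
  about the image of the identity.\<close>

lemma open_Zp_subgroup_multiples_small:
  assumes H: "open_Zp_subgroup p G H"
  shows "\<exists>m. p_multiples p m G H \<subseteq> K n"
proof -
  obtain d \<phi> where \<phi>: "\<phi> \<in> iso (sub_topgroup G H) (Zp_power p d)"
      "homeomorphic_map (topo (sub_topgroup G H)) (topo (Zp_power p d)) \<phi>"
    using H by (auto simp: open_Zp_subgroup_def iso_topgroup_def)
  have Hs: "subgroup H G" and Ho: "openin (topo G) H" using H by (auto simp: open_Zp_subgroup_def)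
  have bij: "bij_betw \<phi> H (carrier (Zp_power p d))" and
    hom: "\<And>x y. x \<in> H \<Longrightarrow> y \<in> H \<Longrightarrow> \<phi> (x \<otimes> y) = \<phi> x \<otimes>\<^bsub>Zp_power p d\<^esub> \<phi> y"
    using \<phi>(1) by (auto simp: iso_def hom_def sub_topgroup_def)
  have \<phi>Z: "\<phi> x i \<in> Zp_set p" if "x \<in> H" "i < d" for x i
    using bij_betw_apply[OF bij that(1)] that by (auto simp: Zp_power_simps)
  have one: "\<one> \<in> H" using subgroup.one_closed[OF Hs] .
  have add: "\<phi> (x \<otimes> y) i = \<phi> x i \<oplus>\<^bsub>Qp p\<^esub> \<phi> y i" if "x \<in> H" "y \<in> H" "i < d" for x y i
    using hom[OF that(1,2)] that(3) by (simp add: Zp_power_simps)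
  \<comment> \<open>Only multiplicativity of \<open>\<phi>\<close> is at hand: from
    \<open>\<one> = \<one> \<otimes> \<one>\<close> a residue \<open>a\<close> of a coordinate
    satisfies \<open>a = a + a\<close> modulo \<open>p ^ k\<close>.\<close>
  have \<phi>1: "zp_mod (\<phi> \<one> i) k 0" if i: "i < d" for i k
  proof -
    obtain a where a: "zp_mod (\<phi> \<one> i) k a" using zp_mod_exists \<phi>Z one i by blast
    have "zp_mod (\<phi> \<one> i) k (a + a)" using zp_mod_add[OF _ _ a a] add[OF one one i] Zp_carrier[OF \<phi>Z[OF one i]] by simp
    then have "int p ^ k dvd a" using zp_mod_cong_iff[OF Zp_carrier[OF \<phi>Z[OF one i]] a, of "a + a"] by simp
    then show ?thesis using zp_mod_cong_iff[OF Zp_carrier[OF \<phi>Z[OF one i]] a, of 0] by simp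
  qed
  have pow: "x [^] (l::nat) \<in> H \<and> zp_mod (\<phi> (x [^] l) i) k (int l * a)"
    if x: "x \<in> H" and i: "i < d" and a: "zp_mod (\<phi> x i) k a" for x l i k a
  proof (induction l)
    case 0 then show ?case using one \<phi>1[OF i] by simp
  next
    case (Suc l)
    then have "zp_mod (\<phi> (x [^] l \<otimes> x) i) k (int l * a + a)"
      using add[of "x [^] l" x i] zp_mod_add[OF _ _ _ a] Zp_carrier[OF \<phi>Z] x i by simp
    moreover have "x [^] l \<otimes> x \<in> H" using Suc x subgroup.m_closed[OF Hs] by blast
    ultimately show ?case by (simp add: algebra_simps)
  qed
  have Hc: "H \<subseteq> carrier G" using subgroup.subset[OF Hs] .
  have powH: "x [^] (l::nat) \<in> H" if "x \<in> H" for x l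
    using that one subgroup.m_closed[OF Hs] by (induction l) auto
  let ?U = "H \<inter> K n"
  have "openin (topo (sub_topgroup G H)) ?U"
    using openin_open_subtopology[OF Ho] openin_Int[OF Ho openin_K] by (simp add: sub_topgroup_def)
  then have "openin (topo (Zp_power p d)) (\<phi> ` ?U)"
    using homeomorphic_map_openness_eq[OF \<phi>(2)] by blast
  moreover have "\<phi> \<one> \<in> \<phi> ` ?U" using one by simp
  ultimately have "\<exists>m. \<forall>y\<in>carrier (Zp_power p d).
      (\<forall>i<d. ereal (real m) \<le> Qp_val p (\<phi> \<one> i \<ominus>\<^bsub>Qp p\<^esub> y i)) \<longrightarrow> y \<in> \<phi> ` ?U"
    unfolding openin_Zp_power by (metis (no_types, lifting))
  then obtain m where m: "\<And>y. y \<in> carrier (Zp_power p d) \<Longrightarrow>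
      (\<forall>i<d. ereal (real m) \<le> Qp_val p (\<phi> \<one> i \<ominus>\<^bsub>Qp p\<^esub> y i)) \<Longrightarrow> y \<in> \<phi> ` ?U"
    by metis
  have "x [^] (p ^ m) \<in> K n" if x: "x \<in> H" for x
  proof -
    let ?y = "x [^] (p ^ m)"
    have y: "?y \<in> H" by (rule powH[OF x])
    have "ereal (real m) \<le> Qp_val p (\<phi> \<one> i \<ominus>\<^bsub>Qp p\<^esub> \<phi> ?y i)" if i: "i < d" for i
    proof -
      obtain a where a: "zp_mod (\<phi> x i) m a" using zp_mod_exists \<phi>Z x i by blast
      then have "zp_mod (\<phi> ?y i) m (int (p ^ m) * a)" using pow[OF x i a] by blast
      then show ?thesis
        using zp_mod_val_diff_iff[OF Zp_carrier[OF \<phi>Z[OF one i]] Zp_carrier[OF \<phi>Z[OF y i]] \<phi>1[OF i]] by simp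
    qed
    then have "\<phi> ?y \<in> \<phi> ` ?U" using m bij_betw_apply[OF bij y] by blast
    then obtain u where "u \<in> ?U" "\<phi> u = \<phi> ?y" by auto
    then show ?thesis using bij y by (auto simp: bij_betw_def inj_on_def)
  qed
  then show ?thesis by (auto simp: p_multiples_def)
qed

text \<open>An open \<open>H\<close> contains some \<open>K c\<close>, and the
  \<open>p ^ m\<close>-th powers of \<open>K c\<close> are exactly \<open>K (c + m)\<close>. One
  \<open>c\<close> serves all \<open>m\<close>, which keeps the loss in later estimates
  bounded.\<close>

lemma open_Zp_subgroup_contains_K:
  assumes H: "open_Zp_subgroup p G H"
  shows "\<exists>c. \<forall>m. K (c + m) \<subseteq> p_multiples p m G H"
proof -
  have Hs: "subgroup H G" and Ho: "openin (topo G) H" using H by (auto simp: open_Zp_subgroup_def)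
  have "\<one> \<in> H" using subgroup.one_closed[OF Hs] .
  then obtain c where c: "\<And>y. eqv c y \<one> \<Longrightarrow> y \<in> H" using Ho unfolding openin_iff by blast
  then have "K c \<subseteq> H" using eqv_one_K_iff by blast
  then have "p_multiples p m G (K c) \<subseteq> p_multiples p m G H" for m by (auto simp: p_multiples_def)
  then show ?thesis using p_multiples_K by blast
qed

end

section \<open>Locally constant distributions\<close>

context filtered_group begin

lemma rcosets_memE: assumes "C \<in> rcosets (K n)" obtains x where "x \<in> carrier G" "C = K n #> x"
  using assms by (auto simp: rcosets_eq)

lemma rcosets_sub: "C \<in> rcosets (K n) \<Longrightarrow> C \<subseteq> carrier G"
  using rcosets_memE r_coset_iff eqv_carrier(1) by (metis subsetI)

text \<open>A sample point of each coset, at which functions are evaluated.\<close>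

definition rep :: "'g set \<Rightarrow> 'g" where
  "rep C = (SOME x. x \<in> C)"

lemma rep: assumes "C \<in> rcosets (K n)" shows "rep C \<in> C" "rep C \<in> carrier G"
proof -
  obtain x where "x \<in> carrier G" "C = K n #> x" using assms by (rule rcosets_memE)
  then have "x \<in> C" using r_coset_iff[of x x n] by simp
  then show "rep C \<in> C" unfolding rep_def by (rule someI)
  then show "rep C \<in> carrier G" using rcosets_sub[OF assms] by blast
qed

lemma mem_rcoset_iff: assumes "C \<in> rcosets (K n)" "x \<in> C" shows "y \<in> C \<longleftrightarrow> eqv n y x"
proof -
  obtain z where z: "z \<in> carrier G" "C = K n #> z" using assms(1) by (rule rcosets_memE)
  have "eqv n x z" using assms z r_coset_iff by simp
  then show ?thesis using z r_coset_iff eqv_trans[of n y x z] eqv_trans[of n y z x] eqv_sym[of n x z] by auto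
qed

lemma rcoset_in: "x \<in> carrier G \<Longrightarrow> K n #> x \<in> rcosets (K n)"
  by (auto simp: rcosets_eq)

lemma rcoset_eqI: assumes "C \<in> rcosets (K n)" "x \<in> C" shows "C = K n #> x"
proof -
  obtain z where z: "z \<in> carrier G" "C = K n #> z" using assms(1) by (rule rcosets_memE)
  have e: "eqv n x z" using assms z r_coset_iff by simp
  show ?thesis using z(2) r_coset_eq_iff[OF eqv_carrier(1)[OF e] z(1), of n] e by simp
qed

lemma finite_representatives:
  obtains T where "finite T" "T \<subseteq> carrier G" "\<forall>x\<in>carrier G. \<exists>y\<in>T. eqv n x y"
proof (rule that[of "rep ` (rcosets (K n))"])
  show "finite (rep ` (rcosets (K n)))" using K_finite by blast
  show "rep ` (rcosets (K n)) \<subseteq> carrier G" using rep by blast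
  show "\<forall>x\<in>carrier G. \<exists>y\<in>rep ` (rcosets (K n)). eqv n x y"
  proof
    fix x assume x: "x \<in> carrier G"
    have "eqv n x (rep (K n #> x))"
      using rep(1)[OF rcoset_in[OF x]] r_coset_iff[OF x] eqv_sym by blast
    then show "\<exists>y\<in>rep ` (rcosets (K n)). eqv n x y" using rcoset_in[OF x] by blast
  qed
qed

text \<open>\<open>h\<close> factors through the finite quotient by \<open>K n\<close>.\<close>

definition invariant :: "nat \<Rightarrow> ('g \<Rightarrow> 'c) \<Rightarrow> bool" where
  "invariant n h \<longleftrightarrow> (\<forall>x y. eqv n x y \<longrightarrow> h x = h y)"

lemma invariantD: "invariant n h \<Longrightarrow> eqv n x y \<Longrightarrow> h x = h y"
  by (auto simp: invariant_def)

lemma invariant_mono: "invariant m h \<Longrightarrow> m \<le> n \<Longrightarrow> invariant n h"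
  using eqv_mono unfolding invariant_def by blast

text \<open>Compactness as an argument of Koenig type: if no level works globally, some coset is
  bad, and a bad coset contains a bad coset of the next level because there are only finitely many.
  The nested bad cosets shrink to a point where \<open>h\<close> is not locally constant.\<close>

lemma locally_constant_invariant:
  assumes loc: "\<And>x. x \<in> carrier G \<Longrightarrow> \<exists>n. \<forall>y. eqv n y x \<longrightarrow> h y = h x"
  shows "\<exists>n. invariant n h"
proof (rule ccontr)
  assume not: "\<not> ?thesis"
  \<comment> \<open>On the coset of \<open>x\<close> modulo \<open>K n\<close>, the function
    \<open>h\<close> is invariant under \<open>K m\<close>.\<close>
  define good where "good n x m \<longleftrightarrow> (\<forall>y z. eqv n y x \<longrightarrow> eqv m y z \<longrightarrow> h y = h z)" for n x m
  have good_mono: "good n x m'" if "good n x m" "m \<le> m'" for n x m m'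
    unfolding good_def
  proof (intro allI impI)
    fix y z assume "eqv n y x" "eqv m' y z"
    then show "h y = h z" using that(1) eqv_mono[OF _ that(2), of y z] unfolding good_def by blast
  qed
  have step: "\<exists>x'. eqv n x' x \<and> (\<forall>m. \<not> good (Suc n) x' m)" if bad: "\<forall>m. \<not> good n x m" and x: "x \<in> carrier G" for n x
  proof (rule ccontr)
    assume no: "\<not> ?thesis"
    obtain T where T: "finite T" "T \<subseteq> carrier G" "\<forall>x\<in>carrier G. \<exists>y\<in>T. eqv (Suc n) x y" by (rule finite_representatives)
    define m where "m t = (SOME m. good (Suc n) t m)" for t
    have m: "good (Suc n) t (m t)" if "eqv n t x" for t
      unfolding m_def by (rule someI_ex) (use no that in blast)
    define M where "M = Max (insert 0 (m ` T))"
    have M: "m t \<le> M" if "t \<in> T" for t unfolding M_def using T(1) that by (intro Max_ge) auto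
    have "good n x M" unfolding good_def
    proof (intro allI impI)
      fix y z assume y: "eqv n y x" and yz: "eqv M y z"
      obtain t where t: "t \<in> T" "eqv (Suc n) y t" using T(3) eqv_carrier(1)[OF y] by blast
      have "eqv n t x" using eqv_trans[OF eqv_sym[OF eqv_mono[OF t(2)]] y] by simp
      from good_mono[OF m[OF this] M[OF t(1)]] show "h y = h z" using t(2) yz unfolding good_def by blast
    qed
    then show False using bad by blast
  qed
  have "\<exists>x. x \<in> carrier G \<and> (\<forall>m. \<not> good 0 x m)"
  proof (rule ccontr)
    assume no: "\<not> ?thesis"
    obtain T where T: "finite T" "T \<subseteq> carrier G" "\<forall>x\<in>carrier G. \<exists>y\<in>T. eqv 0 x y" by (rule finite_representatives)
    define m where "m t = (SOME m. good 0 t m)" for t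
    have m: "good 0 t (m t)" if "t \<in> carrier G" for t
      unfolding m_def by (rule someI_ex) (use no that in blast)
    define M where "M = Max (insert 0 (m ` T))"
    have M: "m t \<le> M" if "t \<in> T" for t unfolding M_def using T(1) that by (intro Max_ge) auto
    have "invariant M h" unfolding invariant_def
    proof (intro allI impI)
      fix y z assume yz: "eqv M y z"
      obtain t where t: "t \<in> T" "eqv 0 y t" using T(3) eqv_carrier(1)[OF yz] by blast
      have "t \<in> carrier G" using t T by blast
      from good_mono[OF m[OF this] M[OF t(1)]] show "h y = h z" using t(2) yz unfolding good_def by blast
    qed
    then show False using not by blast
  qed
  then have "\<exists>x. \<forall>n. (x n \<in> carrier G \<and> (\<forall>m. \<not> good n (x n) m)) \<and> eqv n (x (Suc n)) (x n)"
    using step eqv_carrier(1) by (intro dependent_nat_choice) blast+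
  then obtain x where x: "\<And>n m. \<not> good n (x n) m" "\<And>n. eqv n (x (Suc n)) (x n)" by blast
  obtain l where l: "l \<in> carrier G" "\<And>n. eqv n l (x n)" using eqv_limit[of x] x(2) by blast
  obtain n where n: "\<And>y. eqv n y l \<Longrightarrow> h y = h l" using loc[OF l(1)] by blast
  have "good n (x n) n" unfolding good_def
  proof (intro allI impI)
    fix y z assume y: "eqv n y (x n)" and yz: "eqv n y z"
    have 1: "eqv n y l" by (rule eqv_trans[OF y eqv_sym[OF l(2)]])
    have 2: "eqv n z l" by (rule eqv_trans[OF eqv_sym[OF yz] 1])
    show "h y = h z" using n[OF 1] n[OF 2] by simp
  qed
  then show False using x(1) by blast
qed

lemma LC_iff: "h \<in> LC G \<longleftrightarrow> h \<in> extensional (carrier G) \<and> (\<exists>n. invariant n h)"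
proof
  assume h: "h \<in> LC G"
  have "\<exists>n. invariant n h"
  proof (rule locally_constant_invariant)
    fix x assume "x \<in> carrier G"
    then obtain U where U: "openin (topo G) U" "x \<in> U" "\<forall>y\<in>U. h y = h x" using h by (auto simp: LC_def)
    then show "\<exists>n. \<forall>y. eqv n y x \<longrightarrow> h y = h x" unfolding openin_iff by blast
  qed
  then show "h \<in> extensional (carrier G) \<and> (\<exists>n. invariant n h)" using h by (auto simp: LC_def)
next
  assume h: "h \<in> extensional (carrier G) \<and> (\<exists>n. invariant n h)"
  then obtain n where n: "invariant n h" by blast
  have "\<exists>U. openin (topo G) U \<and> x \<in> U \<and> (\<forall>y\<in>U. h y = h x)" if x: "x \<in> carrier G" for x
  proof (intro exI[of _ "K n #> x"] conjI ballI)
    show "openin (topo G) (K n #> x)" unfolding openin_iff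
      using r_coset_iff[OF x] eqv_trans eqv_carrier(1) by blast
    show "x \<in> K n #> x" using r_coset_iff[OF x] x by simp
    show "h y = h x" if "y \<in> K n #> x" for y using invariantD[OF n] r_coset_iff[OF x] that by blast
  qed
  then show "h \<in> LC G" using h by (auto simp: LC_def)
qed

lemma LC_E: assumes "h \<in> LC G" obtains n where "h \<in> extensional (carrier G)" "invariant n h"
  using assms LC_iff[of h] by auto

lemma LC_I: "h \<in> extensional (carrier G) \<Longrightarrow> invariant n h \<Longrightarrow> h \<in> LC G"
  using LC_iff[of h] by auto

lemma LC_common_level:
  assumes "f \<in> LC G" "g \<in> LC G"
  obtains n where "invariant n f" "invariant n g"
proof -
  obtain m where m: "invariant m f" using assms(1) by (rule LC_E)
  obtain n where n: "invariant n g" using assms(2) by (rule LC_E)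
  show ?thesis using that[OF invariant_mono[OF m max.cobounded1] invariant_mono[OF n max.cobounded2]] .
qed

lemma invariant_restrict:
  assumes "\<And>x y. eqv n x y \<Longrightarrow> f x = f y"
  shows "invariant n (\<lambda>x\<in>carrier G. f x)"
  unfolding invariant_def using assms by (auto dest: eqv_carrier)

lemma invariant_char_fun: assumes "C \<in> rcosets (K n)" shows "invariant n (char_fun G C)"
  unfolding invariant_def
proof (intro allI impI)
  fix x y assume xy: "eqv n x y"
  have "x \<in> C \<longleftrightarrow> y \<in> C"
    using mem_rcoset_iff[OF assms, of x y] mem_rcoset_iff[OF assms, of y x] xy eqv_sym[OF xy] by blast
  then show "char_fun G C x = char_fun G C y" using xy by (simp add: char_fun_def eqv_def)
qed

lemma char_fun_extensional: "char_fun G C \<in> extensional (carrier G)"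
  by (simp add: char_fun_def)

lemma char_fun_LC: "C \<in> rcosets (K n) \<Longrightarrow> char_fun G C \<in> LC G"
  by (rule LC_I[OF char_fun_extensional invariant_char_fun])

lemma LC_add: assumes "f \<in> LC G" "g \<in> LC G" shows "(\<lambda>x\<in>carrier G. f x + g x) \<in> LC G"
proof -
  obtain n where "invariant n f" "invariant n g" using assms by (rule LC_common_level)
  then have "invariant n (\<lambda>x\<in>carrier G. f x + g x)"
    by (intro invariant_restrict) (simp add: invariantD[of n f] invariantD[of n g])
  then show ?thesis by (intro LC_I) auto
qed

lemma LC_scale: assumes "f \<in> LC G" shows "(\<lambda>x\<in>carrier G. c * f x) \<in> LC G"
proof -
  obtain n where "invariant n f" using assms by (rule LC_E)
  then have "invariant n (\<lambda>x\<in>carrier G. c * f x)"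
    by (intro invariant_restrict) (simp add: invariantD[of n f])
  then show ?thesis by (intro LC_I) auto
qed

text \<open>Membership in \<open>LC\<close> is proved along with the value, since additivity of
  \<open>L\<close> is given only for members. All functions are restricted to the carrier, as
  \<open>LC\<close> consists of extensional functions.\<close>

lemma linear_functional_sum:
  fixes L :: "(_ \<Rightarrow> 'e::field) \<Rightarrow> 'e"
  assumes L: "linear_functional_on G (LC G) L" and g: "finite A" "\<And>i. i \<in> A \<Longrightarrow> g i \<in> LC G"
  shows "(\<lambda>x\<in>carrier G. \<Sum>i\<in>A. c i * g i x) \<in> LC G \<and>
    L (\<lambda>x\<in>carrier G. \<Sum>i\<in>A. c i * g i x) = (\<Sum>i\<in>A. c i * L (g i))"
  using g
proof (induction A rule: finite_induct)
  case empty
  have 0: "(\<lambda>x\<in>carrier G. 0 :: 'e) \<in> LC G" by (rule LC_I[OF _ invariant_restrict]) auto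
  \<comment> \<open>Homogeneity with the scalar 0 gives the value at the zero function, which is the
    empty sum.\<close>
  then have "L (\<lambda>x\<in>carrier G. 0 * (\<lambda>x\<in>carrier G. 0) x) = 0 * L (\<lambda>x\<in>carrier G. 0)"
    using L unfolding linear_functional_on_def by blast
  then have "L (\<lambda>x\<in>carrier G. 0) = 0" by (simp cong: restrict_cong del: restrict_apply)
  then show ?case using 0 by (simp del: restrict_apply)
next
  case (insert i A)
  let ?s = "\<lambda>x\<in>carrier G. \<Sum>i\<in>A. c i * g i x" and ?t = "\<lambda>x\<in>carrier G. c i * g i x"
  have s: "?s \<in> LC G" "L ?s = (\<Sum>i\<in>A. c i * L (g i))" using insert.IH insert.prems by blast+
  have gi: "g i \<in> LC G" using insert by simp
  have t: "?t \<in> LC G" "L ?t = c i * L (g i)"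
    using LC_scale[OF gi] L gi unfolding linear_functional_on_def by blast+
  have eq: "(\<lambda>x\<in>carrier G. ?t x + ?s x) = (\<lambda>x\<in>carrier G. \<Sum>i\<in>insert i A. c i * g i x)"
    using insert by (intro restrict_ext) simp
  have "L (\<lambda>x\<in>carrier G. ?t x + ?s x) = L ?t + L ?s" using L s t unfolding linear_functional_on_def by blast
  then show ?case using LC_add[OF t(1) s(1)] s t insert.hyps unfolding eq by (simp del: restrict_apply)
qed

lemma invariant_expansion:
  assumes h: "h \<in> extensional (carrier G)" "invariant n h"
  shows "h = (\<lambda>x\<in>carrier G. \<Sum>C\<in>rcosets (K n). h (rep C) * char_fun G C x)"
proof
  fix x show "h x = restrict (\<lambda>x. \<Sum>C\<in>rcosets (K n). h (rep C) * char_fun G C x) (carrier G) x"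
  proof (cases "x \<in> carrier G")
    case x: True
    let ?C = "K n #> x"
    have C: "?C \<in> rcosets (K n)" "x \<in> ?C" using rcoset_in[OF x] r_coset_iff[OF x, of x n] x by auto
    have "(\<Sum>C\<in>rcosets (K n). h (rep C) * char_fun G C x) = (\<Sum>C\<in>rcosets (K n). if C = ?C then h (rep ?C) else 0)"
    proof (rule sum.cong[OF refl])
      fix D assume D: "D \<in> rcosets (K n)"
      have "x \<in> D \<longleftrightarrow> D = ?C" using rcoset_eqI[OF D, of x] C(2) by auto
      then show "h (rep D) * char_fun G D x = (if D = ?C then h (rep ?C) else 0)"
        using x by (simp add: char_fun_def)
    qed
    also have "\<dots> = h (rep ?C)" using C K_finite by simp
    also have "\<dots> = h x" using invariantD[OF h(2)] rep(1)[OF C(1)] r_coset_iff[OF x] by blast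
    finally show ?thesis using x by simp
  qed (use h in \<open>simp add: extensional_def\<close>)
qed

text \<open>The characteristic functions of cosets span \<open>LC\<close> by
  \<open>invariant_expansion\<close>. Outside \<open>LC\<close> both functionals are
  \<open>undefined\<close> by extensionality, so they are equal as functions, as a definite
  description demands.\<close>

lemma lc_distribution_unique:
  assumes L: "lc_distribution G L" "lc_distribution G L'"
    and eq: "\<And>n C. C \<in> rcosets (K n) \<Longrightarrow> L (char_fun G C) = L' (char_fun G C)"
  shows "L = L'"
proof
  fix h show "L h = L' h"
  proof (cases "h \<in> LC G")
    case True
    then obtain n where n: "h \<in> extensional (carrier G)" "invariant n h" by (rule LC_E)
    have *: "M h = (\<Sum>C\<in>rcosets (K n). h (rep C) * M (char_fun G C))" if M: "lc_distribution G M" for M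
    proof -
      have "M (\<lambda>x\<in>carrier G. \<Sum>C\<in>rcosets (K n). h (rep C) * char_fun G C x) = (\<Sum>C\<in>rcosets (K n). h (rep C) * M (char_fun G C))"
        by (rule conjunct2[OF linear_functional_sum[OF _ K_finite char_fun_LC]]) (use M in \<open>simp_all add: lc_distribution_def\<close>)
      then show ?thesis by (subst (1) invariant_expansion[OF n])
    qed
    show ?thesis unfolding *[OF L(1)] *[OF L(2)] using eq by (intro sum.cong) simp_all
  qed (use L in \<open>simp add: lc_distribution_def linear_functional_on_def extensional_def\<close>)
qed

end

text \<open>\<open>\<psi> n C\<close> is the measure of the coset \<open>C\<close>. The level is an
  argument of its own because one set can be a coset at several levels when the filtration
  stalls.\<close>

locale filtered_distribution = filtered_group G K + valued_field v
  for G :: "'g topgroup" (structure) and K and v :: "'e::field \<Rightarrow> ereal" +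
  fixes \<psi> :: "nat \<Rightarrow> 'g set \<Rightarrow> 'e"
  assumes additive: "C \<in> rcosets (K n) \<Longrightarrow> \<psi> n C = (\<Sum>D | D \<in> rcosets (K (Suc n)) \<and> D \<subseteq> C. \<psi> (Suc n) D)"
begin

definition riemann_sum :: "nat \<Rightarrow> ('g \<Rightarrow> 'e) \<Rightarrow> 'e" where
  "riemann_sum n h = (\<Sum>C\<in>rcosets (K n). \<psi> n C * h (rep C))"

text \<open>Collect the finer cosets by the coarse coset that contains them; on each of these
  \<open>h\<close> is constant, and additivity sums the measures.\<close>

lemma riemann_sum_Suc:
  assumes h: "invariant n h"
  shows "riemann_sum (Suc n) h = riemann_sum n h"
proof -
  have sub: "K n #> rep D = C \<longleftrightarrow> D \<subseteq> C" if D: "D \<in> rcosets (K (Suc n))" and C: "C \<in> rcosets (K n)" for C D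
  proof
    assume eq: "K n #> rep D = C"
    show "D \<subseteq> C"
    proof
      fix x assume "x \<in> D"
      then have "eqv (Suc n) x (rep D)" using mem_rcoset_iff[OF D rep(1)[OF D]] by blast
      then have "eqv n x (rep D)" by (rule eqv_mono) simp
      then show "x \<in> C" using r_coset_iff[OF rep(2)[OF D]] eq by blast
    qed
  next
    assume "D \<subseteq> C" then show "K n #> rep D = C" using rcoset_eqI[OF C, of "rep D"] rep(1)[OF D] by auto
  qed
  have "riemann_sum (Suc n) h = (\<Sum>C\<in>rcosets (K n). \<Sum>D | D \<in> rcosets (K (Suc n)) \<and> K n #> rep D = C. \<psi> (Suc n) D * h (rep D))"
    unfolding riemann_sum_def
    by (rule sum.group[OF K_finite K_finite, symmetric]) (use rep rcoset_in in blast)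
  also have "\<dots> = (\<Sum>C\<in>rcosets (K n). \<psi> n C * h (rep C))"
  proof (rule sum.cong[OF refl])
    fix C assume C: "C \<in> rcosets (K n)"
    have "(\<Sum>D | D \<in> rcosets (K (Suc n)) \<and> K n #> rep D = C. \<psi> (Suc n) D * h (rep D)) =
        (\<Sum>D | D \<in> rcosets (K (Suc n)) \<and> D \<subseteq> C. \<psi> (Suc n) D * h (rep C))"
    proof (rule sum.cong)
      fix D assume D: "D \<in> {D. D \<in> rcosets (K (Suc n)) \<and> D \<subseteq> C}"
      then have "rep D \<in> C" using rep(1) by blast
      then have "eqv n (rep D) (rep C)" using mem_rcoset_iff[OF C rep(1)[OF C]] by blast
      then show "\<psi> (Suc n) D * h (rep D) = \<psi> (Suc n) D * h (rep C)" using invariantD[OF h] by simp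
    qed (use sub[OF _ C] in blast)
    then show "(\<Sum>D | D \<in> rcosets (K (Suc n)) \<and> K n #> rep D = C. \<psi> (Suc n) D * h (rep D)) = \<psi> n C * h (rep C)"
      using additive[OF C] by (simp add: sum_distrib_right)
  qed
  finally show ?thesis by (simp add: riemann_sum_def)
qed

lemma riemann_sum_stable:
  assumes "invariant n h" "n \<le> m"
  shows "riemann_sum m h = riemann_sum n h"
  using assms(2)
proof (induction m rule: dec_induct)
  case (step m)
  then show ?case using riemann_sum_Suc[OF invariant_mono[OF assms(1)]] by simp
qed simp

text \<open>The choice of the level is harmless by \<open>riemann_sum_stable\<close>; the value off
  \<open>LC\<close> makes \<open>\<mu>\<close> extensional.\<close>

definition \<mu> :: "('g \<Rightarrow> 'e) \<Rightarrow> 'e" where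
  "\<mu> h = (if h \<in> LC G then riemann_sum (SOME n. invariant n h) h else undefined)"

lemma \<mu>_eq: assumes "h \<in> extensional (carrier G)" "invariant n h" shows "\<mu> h = riemann_sum n h"
proof -
  have h: "h \<in> LC G" using assms by (rule LC_I)
  let ?m = "SOME n. invariant n h"
  have "invariant ?m h" using assms(2) by (rule someI)
  then have "riemann_sum ?m h = riemann_sum (max ?m n) h" using riemann_sum_stable by (metis max.cobounded1)
  also have "\<dots> = riemann_sum n h" using riemann_sum_stable assms(2) by (metis max.cobounded2)
  finally show ?thesis using h by (simp add: \<mu>_def)
qed

lemma \<mu>_char_fun: assumes C: "C \<in> rcosets (K n)" shows "\<mu> (char_fun G C) = \<psi> n C"
proof -
  have "\<mu> (char_fun G C) = riemann_sum n (char_fun G C)"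
    by (rule \<mu>_eq[OF char_fun_extensional invariant_char_fun[OF C]])
  also have "\<dots> = (\<Sum>D\<in>rcosets (K n). if D = C then \<psi> n C else 0)"
    unfolding riemann_sum_def
  proof (rule sum.cong[OF refl])
    fix D assume D: "D \<in> rcosets (K n)"
    have "D = C" if "rep D \<in> C" using rcoset_eqI[OF D rep(1)[OF D]] rcoset_eqI[OF C that] by simp
    then show "\<psi> n D * char_fun G C (rep D) = (if D = C then \<psi> n C else 0)"
      using rep[OF D] by (auto simp: char_fun_def)
  qed
  also have "\<dots> = \<psi> n C" using C K_finite by simp
  finally show ?thesis .
qed

lemma lc_distribution_\<mu>: "lc_distribution G \<mu>"
  unfolding lc_distribution_def linear_functional_on_def
proof (intro conjI ballI allI)
  show "\<mu> \<in> extensional (LC G)" by (auto simp: \<mu>_def extensional_def)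
  fix f g :: "'g \<Rightarrow> 'e" assume fg: "f \<in> LC G" "g \<in> LC G"
  obtain n where n: "invariant n f" "invariant n g" using fg by (rule LC_common_level)
  have "invariant n (\<lambda>x\<in>carrier G. f x + g x)"
    using n by (intro invariant_restrict) (simp add: invariantD[of n f] invariantD[of n g])
  then have "\<mu> (\<lambda>x\<in>carrier G. f x + g x) = riemann_sum n (\<lambda>x\<in>carrier G. f x + g x)" by (intro \<mu>_eq) auto
  also have "\<dots> = (\<Sum>C\<in>rcosets (K n). \<psi> n C * f (rep C) + \<psi> n C * g (rep C))"
    unfolding riemann_sum_def by (rule sum.cong[OF refl]) (simp add: rep distrib_left)
  also have "\<dots> = \<mu> f + \<mu> g"
    using \<mu>_eq[OF _ n(1)] \<mu>_eq[OF _ n(2)] fg by (simp add: LC_def riemann_sum_def sum.distrib)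
  finally show "\<mu> (\<lambda>x\<in>carrier G. f x + g x) = \<mu> f + \<mu> g" .
next
  fix c and f :: "'g \<Rightarrow> 'e" assume f: "f \<in> LC G"
  then obtain n where n: "invariant n f" by (rule LC_E)
  have "invariant n (\<lambda>x\<in>carrier G. c * f x)"
    using n by (intro invariant_restrict) (simp add: invariantD[of n f])
  then have "\<mu> (\<lambda>x\<in>carrier G. c * f x) = riemann_sum n (\<lambda>x\<in>carrier G. c * f x)" by (intro \<mu>_eq) auto
  also have "\<dots> = (\<Sum>C\<in>rcosets (K n). c * (\<psi> n C * f (rep C)))"
    unfolding riemann_sum_def by (rule sum.cong[OF refl]) (simp add: rep)
  also have "\<dots> = c * \<mu> f"
    using \<mu>_eq[OF _ n] f by (simp add: LC_def riemann_sum_def sum_distrib_left)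
  finally show "\<mu> (\<lambda>x\<in>carrier G. c * f x) = c * \<mu> f" .
qed

end

section \<open>Extension of distributions of bounded growth\<close>

lemma ereal_ge_minus_iff: "ereal N \<le> e - ereal c \<longleftrightarrow> ereal (N + c) \<le> e"
  by (cases e) auto

lemma ereal_tendsto_PInfty_iff:
  "(f \<longlonglongrightarrow> (\<infinity>::ereal)) \<longleftrightarrow> (\<forall>N::real. \<exists>M. \<forall>n\<ge>M. ereal N \<le> f n)"
proof
  assume "f \<longlonglongrightarrow> \<infinity>"
  then have "\<forall>\<^sub>F n in sequentially. ereal N < f n" for N :: real by (simp add: tendsto_PInfty)
  then show "\<forall>N::real. \<exists>M. \<forall>n\<ge>M. ereal N \<le> f n"
    unfolding eventually_sequentially by (meson less_imp_le)
next
  assume *: "\<forall>N::real. \<exists>M. \<forall>n\<ge>M. ereal N \<le> f n"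
  show "f \<longlonglongrightarrow> \<infinity>" unfolding tendsto_PInfty eventually_sequentially
  proof
    fix N :: real
    obtain M where M: "\<forall>n\<ge>M. ereal (N + 1) \<le> f n" using * by blast
    have "ereal N < f n" if "n \<ge> M" for n
    proof -
      have "ereal N < ereal (N + 1)" by simp
      also have "\<dots> \<le> f n" using M that by blast
      finally show ?thesis .
    qed
    then show "\<exists>M. \<forall>n\<ge>M. ereal N < f n" by blast
  qed
qed

lemma (in valued_field) v_lower_bound: "\<exists>b::real. ereal b \<le> v a"
proof (cases "a = 0")
  case False
  then obtain b where "v a = ereal b" using v_real by blast
  then show ?thesis by (intro exI[of _ b]) simp
qed simp

text \<open>Every point of an ultrametric ball is a centre of it.\<close>

lemma (in valued_field) openin_field_ball: "openin (field_topology v) {w. ereal N \<le> v (a - w)}"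
  unfolding openin_val_topology
proof (intro conjI ballI)
  fix x assume "x \<in> {w. ereal N \<le> v (a - w)}"
  then have x: "ereal N \<le> v (a - x)" by simp
  have "ereal N \<le> v (a - y)" if "ereal N \<le> v (x - y)" for y
    using v_add_ge[OF x that] by simp
  then show "\<exists>M::real. \<forall>y\<in>UNIV. ereal M \<le> v (x - y) \<longrightarrow> y \<in> {w. ereal N \<le> v (a - w)}" by blast
qed simp

lemma topspace_val_topology: "topspace (val_topology S d) = S"
proof
  show "topspace (val_topology S d) \<subseteq> S"
    using openin_topspace[of "val_topology S d"] unfolding openin_val_topology by blast
  have "openin (val_topology S d) S" unfolding openin_val_topology by blast
  then show "S \<subseteq> topspace (val_topology S d)" by (rule openin_subset)
qed

text \<open>Two filtrations meet here: the measure is bounded along \<open>K n\<close>, while the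
  space of functions is defined by the \<open>p ^ m\<close>-th powers of \<open>H\<close>.
  \<open>K_le_H\<close>, with its constant shift \<open>c\<close>, and \<open>H_small\<close>
  compare them.\<close>

locale growth_distribution = filtered_distribution G K v \<psi>
  for G :: "'g topgroup" (structure) and K and v :: "'e::field \<Rightarrow> ereal" and \<psi> +
  fixes r c0 :: real and p :: nat and H :: "'g set" and c :: nat
  assumes complete: "\<And>x :: nat \<Rightarrow> 'e. (\<And>N::real. \<exists>M. \<forall>m\<ge>M. \<forall>n\<ge>M. ereal N \<le> v (x m - x n)) \<Longrightarrow>
        \<exists>l. \<forall>N::real. \<exists>M. \<forall>n\<ge>M. ereal N \<le> v (x n - l)"
    and r: "0 \<le> r"
    and growth: "C \<in> rcosets (K n) \<Longrightarrow> ereal (c0 - r * real n) \<le> v (\<psi> n C)"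
    and H: "subgroup H G"
    and K_le_H: "K (c + m) \<subseteq> p_multiples p m G H"
    and H_small: "\<exists>m. p_multiples p m G H \<subseteq> K n"
begin

abbreviation "Hm m \<equiv> p_multiples p m G H"
abbreviation "A \<equiv> sub_topgroup G H"
abbreviation "Cr \<equiv> Cr_space p v r G H"

lemma H_carrier: "h \<in> H \<Longrightarrow> h \<in> carrier G"
  using subgroup.mem_carrier[OF H] .

lemma H_pow: "h \<in> H \<Longrightarrow> h [^] (n::nat) \<in> H"
  by (induction n) (auto simp: subgroup.one_closed[OF H] subgroup.m_closed[OF H])

lemma Hm_subgroup: "subgroup (Hm m) G"
proof (rule subgroupI)
  show "Hm m \<subseteq> carrier G" using H_carrier by (auto simp: p_multiples_def)
  show "Hm m \<noteq> {}" using subgroup.one_closed[OF H] by (auto simp: p_multiples_def)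
  fix a b assume a: "a \<in> Hm m" and b: "b \<in> Hm m"
  obtain x where x: "x \<in> H" "a = x [^] (p ^ m)" using a by (auto simp: p_multiples_def)
  obtain y where y: "y \<in> H" "b = y [^] (p ^ m)" using b by (auto simp: p_multiples_def)
  have "inv a = (inv x) [^] (p ^ m)" using x H_carrier nat_pow_inv by simp
  then show "inv a \<in> Hm m" using x subgroup.m_inv_closed[OF H] by (auto simp: p_multiples_def)
  have "a \<otimes> b = (x \<otimes> y) [^] (p ^ m)" using x y H_carrier nat_pow_distrib by simp
  then show "a \<otimes> b \<in> Hm m" using x y subgroup.m_closed[OF H] by (auto simp: p_multiples_def)
qed

lemma Hm_carrier: "y \<in> Hm m \<Longrightarrow> y \<in> carrier G"
  using subgroup.mem_carrier[OF Hm_subgroup] .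

lemma Hm_Suc: "Hm (Suc m) \<subseteq> Hm m"
proof
  fix y assume "y \<in> Hm (Suc m)"
  then obtain x where x: "x \<in> H" "y = x [^] (p ^ Suc m)" by (auto simp: p_multiples_def)
  then have "y = (x [^] p) [^] (p ^ m)" using H_carrier by (simp add: nat_pow_pow)
  then show "y \<in> Hm m" using H_pow[OF x(1)] by (auto simp: p_multiples_def)
qed

lemma Hm_mono: "m \<le> n \<Longrightarrow> Hm n \<subseteq> Hm m"
  using lift_Suc_antimono_le[of Hm, OF Hm_Suc] .

lemma Hm_subset_H: "Hm m \<subseteq> H"
  using H_pow by (auto simp: p_multiples_def)

lemma p_multiples_A: "p_multiples p m A (carrier A) = Hm m"
  by (simp add: p_multiples_def sub_topgroup_pow) (simp add: sub_topgroup_def)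

lemma A_simps: "carrier A = H" "x \<otimes>\<^bsub>A\<^esub> y = x \<otimes> y" "topo A = subtopology (topo G) H"
  by (simp_all add: sub_topgroup_def)

section \<open>The function space in terms of oscillations\<close>

lemma le_epsilon_iff:
  "e \<le> epsilon p v A m f \<longleftrightarrow> (\<forall>x\<in>H. \<forall>y\<in>Hm m. e \<le> v (f (x \<otimes> y) - f x))"
  unfolding epsilon_def p_multiples_A unfolding A_simps by (simp add: le_INF_iff)

text \<open>One bound over all of the group in place of a bound for each translate \<open>a\<close>;
  this removes the cosets of \<open>H\<close> from the estimates.\<close>

definition oscillation_ge :: "real \<Rightarrow> nat \<Rightarrow> ('g \<Rightarrow> 'e) \<Rightarrow> bool" where
  "oscillation_ge N m f \<longleftrightarrow> (\<forall>z\<in>carrier G. \<forall>y\<in>Hm m. ereal N \<le> v (f (z \<otimes> y) - f z))"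

lemma oscillation_geD: "oscillation_ge N m f \<Longrightarrow> z \<in> carrier G \<Longrightarrow> y \<in> Hm m \<Longrightarrow> ereal N \<le> v (f (z \<otimes> y) - f z)"
  by (auto simp: oscillation_ge_def)

lemma oscillation_ge_iff:
  "oscillation_ge N m f \<longleftrightarrow> (\<forall>a\<in>carrier G. ereal N \<le> epsilon p v A m (\<lambda>h. f (a \<otimes> h)))"
  unfolding le_epsilon_iff oscillation_ge_def
proof (intro iffI ballI)
  fix a x y assume *: "\<forall>z\<in>carrier G. \<forall>y\<in>Hm m. ereal N \<le> v (f (z \<otimes> y) - f z)"
    and "a \<in> carrier G" "x \<in> H" "y \<in> Hm m"
  then show "ereal N \<le> v (f (a \<otimes> (x \<otimes> y)) - f (a \<otimes> x))"
    using bspec[OF *, of "a \<otimes> x"] H_carrier Hm_carrier by (simp add: m_assoc)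
next
  fix z y assume *: "\<forall>a\<in>carrier G. \<forall>x\<in>H. \<forall>y\<in>Hm m. ereal N \<le> v (f (a \<otimes> (x \<otimes> y)) - f (a \<otimes> x))"
    and "z \<in> carrier G" "y \<in> Hm m"
  then show "ereal N \<le> v (f (z \<otimes> y) - f z)"
    using bspec[OF bspec[OF *, of z] subgroup.one_closed[OF H]] Hm_carrier by simp
qed

text \<open>The bounds for the individual translates become uniform because finitely many
  representatives modulo \<open>K c\<close>, a subgroup of \<open>H\<close>, cover the group.
  Conversely, as \<open>r\<close> is nonnegative, the oscillation bounds for all \<open>N\<close>
  yield continuity.\<close>

lemma Cr_iff: "f \<in> Cr \<longleftrightarrow> f \<in> extensional (carrier G) \<and>
    (\<forall>N::real. \<exists>M. \<forall>m\<ge>M. oscillation_ge (N + r * real m) m f)"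
proof
  assume f: "f \<in> Cr"
  then have lim: "\<And>a. a \<in> carrier G \<Longrightarrow> (\<lambda>m. epsilon p v A m (\<lambda>h. f (a \<otimes> h)) - ereal (r * real m)) \<longlonglongrightarrow> \<infinity>"
    by (simp add: Cr_space_def is_Cr_def)
  have "\<exists>M. \<forall>m\<ge>M. oscillation_ge (N + r * real m) m f" for N :: real
  proof -
    obtain T where T: "finite T" "T \<subseteq> carrier G" "\<forall>x\<in>carrier G. \<exists>y\<in>T. eqv c x y" by (rule finite_representatives)
    have "\<forall>a. \<exists>M. a \<in> carrier G \<longrightarrow> (\<forall>m\<ge>M. ereal (N + r * real m) \<le> epsilon p v A m (\<lambda>h. f (a \<otimes> h)))"
      using lim unfolding ereal_tendsto_PInfty_iff ereal_ge_minus_iff by blast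
    then obtain M where M: "\<And>a m. a \<in> carrier G \<Longrightarrow> m \<ge> M a \<Longrightarrow> ereal (N + r * real m) \<le> epsilon p v A m (\<lambda>h. f (a \<otimes> h))"
      by metis
    define M0 where "M0 = Max (insert 0 (M ` T))"
    have M0: "M t \<le> M0" if "t \<in> T" for t unfolding M0_def using T(1) that by (intro Max_ge) auto
    have "oscillation_ge (N + r * real m) m f" if m: "m \<ge> M0" for m
      unfolding oscillation_ge_def
    proof (intro ballI)
      fix z y assume z: "z \<in> carrier G" and y: "y \<in> Hm m"
      obtain t where t: "t \<in> T" "eqv c z t" using T(3) z by blast
      have tc: "t \<in> carrier G" using t T by blast
      \<comment> \<open>Written with \<open>+ 0\<close> to match \<open>K_le_H\<close> at
        \<open>m = 0\<close>, whose right-hand side lies in \<open>H\<close>.\<close>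
      have "z \<otimes> inv t \<in> K (c + 0)" using t by (simp add: eqv_def)
      then have x: "z \<otimes> inv t \<in> H" using K_le_H Hm_subset_H by blast
      have zt: "t \<otimes> (z \<otimes> inv t) = z" using z tc by (metis inv_closed m_comm m_assoc r_inv r_one)
      have "ereal (N + r * real m) \<le> epsilon p v A m (\<lambda>h. f (t \<otimes> h))" using M[OF tc] M0[OF t(1)] m by simp
      then have "ereal (N + r * real m) \<le> v (f (t \<otimes> (z \<otimes> inv t \<otimes> y)) - f (t \<otimes> (z \<otimes> inv t)))"
        unfolding le_epsilon_iff using x y by blast
      moreover have "t \<otimes> (z \<otimes> inv t \<otimes> y) = z \<otimes> y" using zt z tc Hm_carrier[OF y] by (metis inv_closed m_assoc m_closed)
      ultimately show "ereal (N + r * real m) \<le> v (f (z \<otimes> y) - f z)" using zt by simp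
    qed
    then show ?thesis by blast
  qed
  then show "f \<in> extensional (carrier G) \<and> (\<forall>N::real. \<exists>M. \<forall>m\<ge>M. oscillation_ge (N + r * real m) m f)"
    using f by (simp add: Cr_space_def)
next
  assume f: "f \<in> extensional (carrier G) \<and> (\<forall>N::real. \<exists>M. \<forall>m\<ge>M. oscillation_ge (N + r * real m) m f)"
  have "is_Cr p v r A (\<lambda>h. f (a \<otimes> h))" if a: "a \<in> carrier G" for a
    unfolding is_Cr_def
  proof
    show "(\<lambda>m. epsilon p v A m (\<lambda>h. f (a \<otimes> h)) - ereal (r * real m)) \<longlonglongrightarrow> \<infinity>"
      unfolding ereal_tendsto_PInfty_iff ereal_ge_minus_iff
      using f a oscillation_ge_iff by meson
    show "continuous_map (topo A) (field_topology v) (\<lambda>h. f (a \<otimes> h))"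
      unfolding continuous_map_def
    proof (intro conjI allI impI)
      show "(\<lambda>h. f (a \<otimes> h)) \<in> topspace (topo A) \<rightarrow> topspace (field_topology v)"
        by (simp add: topspace_val_topology)
      fix U assume U: "openin (field_topology v) U"
      define W where "W = {x \<in> H. f (a \<otimes> x) \<in> U}"
      have "openin (topo G) W" unfolding openin_iff
      proof (intro conjI ballI)
        show "W \<subseteq> carrier G" using H_carrier by (auto simp: W_def)
        fix x assume x: "x \<in> W"
        then have xc: "x \<in> carrier G" "x \<in> H" "f (a \<otimes> x) \<in> U" using H_carrier by (auto simp: W_def)
        obtain N :: real where N: "\<And>y. ereal N \<le> v (f (a \<otimes> x) - y) \<Longrightarrow> y \<in> U"
          using U xc(3) unfolding openin_val_topology by blast
        obtain m where "oscillation_ge (N + r * real m) m f" using f by blast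
        moreover have "0 \<le> r * real m" using r by simp
        ultimately have m: "ereal N \<le> v (f (z \<otimes> y) - f z)" if "z \<in> carrier G" "y \<in> Hm m" for z y
          using oscillation_geD[OF _ that, of "N + r * real m" f] by (meson ereal_less_eq(3) le_add_same_cancel1 order_trans)
        have "y \<in> W" if y: "eqv (c + m) y x" for y
        proof -
          have yc: "y \<in> carrier G" "y \<otimes> inv x \<in> Hm m" using y K_le_H by (auto simp: eqv_def)
          have yx: "x \<otimes> (y \<otimes> inv x) = y" using yc(1) xc(1) by (metis inv_closed m_comm m_assoc r_inv r_one)
          have "y \<otimes> inv x \<in> H" using yc Hm_subset_H by blast
          then have yH: "y \<in> H" using yx subgroup.m_closed[OF H xc(2)] by metis
          have "ereal N \<le> v (f (a \<otimes> x \<otimes> (y \<otimes> inv x)) - f (a \<otimes> x))" using m yc a xc by simp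
          moreover have "a \<otimes> x \<otimes> (y \<otimes> inv x) = a \<otimes> y" using yx a xc yc by (metis inv_closed m_assoc m_closed)
          ultimately have "f (a \<otimes> y) \<in> U" using N v_diff_commute by simp
          then show ?thesis using yH by (simp add: W_def)
        qed
        then show "\<exists>n. \<forall>y. eqv n y x \<longrightarrow> y \<in> W" by blast
      qed
      then have "openin (topo A) W" unfolding A_simps openin_subtopology W_def by blast
      moreover have "topspace (topo A) = H" using H_carrier by (auto simp: A_simps topspace_topo)
      ultimately show "openin (topo A) {x \<in> topspace (topo A). f (a \<otimes> x) \<in> U}" by (simp add: W_def)
    qed
  qed
  then show "f \<in> Cr" using f by (simp add: Cr_space_def)
qed

definition Cr_dist :: "('g \<Rightarrow> 'e) \<Rightarrow> ('g \<Rightarrow> 'e) \<Rightarrow> ereal" where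
  "Cr_dist f g = (INF a\<in>carrier G. Cr_val p v r A (\<lambda>h. f (a \<otimes> h) - g (a \<otimes> h)))"

lemma Cr_dist_ge_iff: "ereal N \<le> Cr_dist f g \<longleftrightarrow>
    (\<forall>z\<in>carrier G. ereal N \<le> v (f z - g z)) \<and> (\<forall>m. oscillation_ge (N + r * real m) m (\<lambda>z. f z - g z))"
proof -
  have "(\<forall>a\<in>carrier G. \<forall>x\<in>H. ereal N \<le> v (f (a \<otimes> x) - g (a \<otimes> x))) \<longleftrightarrow> (\<forall>z\<in>carrier G. ereal N \<le> v (f z - g z))"
  proof (intro iffI ballI)
    fix z assume *: "\<forall>a\<in>carrier G. \<forall>x\<in>H. ereal N \<le> v (f (a \<otimes> x) - g (a \<otimes> x))" and z: "z \<in> carrier G"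
    show "ereal N \<le> v (f z - g z)"
      using bspec[OF bspec[OF * z] subgroup.one_closed[OF H]] z by simp
  qed (use H_carrier in auto)
  moreover have "(\<forall>m. oscillation_ge (N + r * real m) m (\<lambda>z. f z - g z)) \<longleftrightarrow>
      (\<forall>a\<in>carrier G. \<forall>m. ereal N \<le> epsilon p v A m (\<lambda>h. f (a \<otimes> h) - g (a \<otimes> h)) - ereal (r * real m))"
    unfolding ereal_ge_minus_iff oscillation_ge_iff by blast
  ultimately show ?thesis
    unfolding Cr_dist_def Cr_val_def A_simps by (auto simp: le_INF_iff)
qed

lemma Cr_topology_eq: "Cr_topology p v r G H = val_topology Cr Cr_dist"
  by (simp add: Cr_topology_def Cr_dist_def[abs_def])

lemma oscillation_ge_add: "oscillation_ge N m f \<Longrightarrow> oscillation_ge N m g \<Longrightarrow> oscillation_ge N m (\<lambda>z. f z + g z)"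
proof -
  assume fg: "oscillation_ge N m f" "oscillation_ge N m g"
  show ?thesis unfolding oscillation_ge_def
  proof (intro ballI)
    fix z y assume "z \<in> carrier G" "y \<in> Hm m"
    then show "ereal N \<le> v (f (z \<otimes> y) + g (z \<otimes> y) - (f z + g z))"
      using v_add_ge[OF oscillation_geD[OF fg(1)] oscillation_geD[OF fg(2)]] by (simp add: algebra_simps)
  qed
qed

lemma oscillation_ge_restrict: "oscillation_ge N m (\<lambda>z\<in>carrier G. f z) \<longleftrightarrow> oscillation_ge N m f"
  unfolding oscillation_ge_def using Hm_carrier by (intro ball_cong refl) simp

lemma oscillation_ge_scale: assumes "oscillation_ge N m f" "ereal b \<le> v a" shows "oscillation_ge (N + b) m (\<lambda>z. a * f z)"
  unfolding oscillation_ge_def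
proof (intro ballI)
  fix z y assume *: "z \<in> carrier G" "y \<in> Hm m"
  have "a * f (z \<otimes> y) - a * f z = (f (z \<otimes> y) - f z) * a" by (simp add: algebra_simps)
  then have "v (a * f (z \<otimes> y) - a * f z) = v (f (z \<otimes> y) - f z) + v a" using v_mult by simp
  then show "ereal (N + b) \<le> v (a * f (z \<otimes> y) - a * f z)"
    using add_mono[OF oscillation_geD[OF assms(1) *] assms(2)] by simp
qed

lemma Cr_add: assumes "f \<in> Cr" "g \<in> Cr" shows "(\<lambda>x\<in>carrier G. f x + g x) \<in> Cr"
  unfolding Cr_iff
proof (intro conjI allI)
  fix N :: real
  obtain M1 where "\<forall>m\<ge>M1. oscillation_ge (N + r * real m) m f" using assms(1) Cr_iff by blast
  moreover obtain M2 where "\<forall>m\<ge>M2. oscillation_ge (N + r * real m) m g" using assms(2) Cr_iff by blast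
  ultimately have "\<forall>m\<ge>max M1 M2. oscillation_ge (N + r * real m) m (\<lambda>x. f x + g x)"
    using oscillation_ge_add by simp
  then show "\<exists>M. \<forall>m\<ge>M. oscillation_ge (N + r * real m) m (\<lambda>x\<in>carrier G. f x + g x)"
    unfolding oscillation_ge_restrict by blast
qed simp

lemma Cr_scale: assumes "f \<in> Cr" shows "(\<lambda>x\<in>carrier G. a * f x) \<in> Cr"
  unfolding Cr_iff
proof (intro conjI allI)
  fix N :: real
  obtain b :: real where b: "ereal b \<le> v a" using v_lower_bound by blast
  obtain M where M: "\<forall>m\<ge>M. oscillation_ge (N - b + r * real m) m f" using assms Cr_iff by blast
  have "oscillation_ge (N + r * real m) m (\<lambda>x. a * f x)" if "m \<ge> M" for m
    using oscillation_ge_scale[OF _ b, of "N - b + r * real m" m f] M that by simp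
  then show "\<exists>M. \<forall>m\<ge>M. oscillation_ge (N + r * real m) m (\<lambda>x\<in>carrier G. a * f x)"
    unfolding oscillation_ge_restrict by blast
qed simp

lemma oscillation_ge_invariant: "invariant n f \<Longrightarrow> Hm m \<subseteq> K n \<Longrightarrow> oscillation_ge N m f"
  unfolding oscillation_ge_def
proof (intro ballI)
  fix z y assume n: "invariant n f" "Hm m \<subseteq> K n" and *: "z \<in> carrier G" "y \<in> Hm m"
  have y: "y \<in> carrier G" "y \<in> K n" using n * Hm_carrier by auto
  have "z \<otimes> y \<otimes> inv z = y" using *(1) y(1) by (metis inv_closed m_comm m_assoc r_inv r_one)
  then have "eqv n (z \<otimes> y) z" using * y by (simp add: eqv_def)
  then show "ereal N \<le> v (f (z \<otimes> y) - f z)" using invariantD[OF n(1)] by simp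
qed

lemma LC_subset_Cr: "LC G \<subseteq> Cr"
proof
  fix f :: "'g \<Rightarrow> 'e" assume "f \<in> LC G"
  then obtain n where n: "f \<in> extensional (carrier G)" "invariant n f" by (rule LC_E)
  obtain M where M: "Hm M \<subseteq> K n" using H_small by blast
  have "oscillation_ge N m f" if "m \<ge> M" for N m
    by (rule oscillation_ge_invariant[OF n(2)]) (use M Hm_mono[OF that] in blast)
  then show "f \<in> Cr" unfolding Cr_iff using n(1) by blast
qed

text \<open>A sample point of the coset of \<open>x\<close> modulo the \<open>p ^ m\<close>-th
  powers of \<open>H\<close>, whereas \<open>rep\<close> serves the cosets of
  \<open>K n\<close>.\<close>

definition rp :: "nat \<Rightarrow> 'g \<Rightarrow> 'g" where
  "rp m x = (SOME y. y \<in> Hm m #> x)"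

lemma rp: assumes x: "x \<in> carrier G"
  shows "rp m x \<in> carrier G" "\<exists>y\<in>Hm m. rp m x = x \<otimes> y" "\<exists>y\<in>Hm m. x = rp m x \<otimes> y"
proof -
  have "x \<in> Hm m #> x" by (rule rcos_self[OF x Hm_subgroup])
  then have "rp m x \<in> Hm m #> x" unfolding rp_def by (rule someI)
  then obtain y where y: "y \<in> Hm m" "rp m x = y \<otimes> x" by (auto simp: r_coset_def)
  have yc: "y \<in> carrier G" using y Hm_carrier by blast
  show "rp m x \<in> carrier G" using y x yc by simp
  have comm: "rp m x = x \<otimes> y" using y(2) m_comm[OF yc x] by simp
  then show "\<exists>y\<in>Hm m. rp m x = x \<otimes> y" using y(1) by blast
  have "rp m x \<otimes> inv y = x" using x yc by (simp add: comm m_assoc)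
  then show "\<exists>y\<in>Hm m. x = rp m x \<otimes> y" using subgroup.m_inv_closed[OF Hm_subgroup y(1)] by metis
qed

lemma rp_eq: assumes "x \<in> carrier G" "y \<in> Hm m" shows "rp m (x \<otimes> y) = rp m x"
proof -
  have "x \<otimes> y = y \<otimes> x" using m_comm[OF assms(1) Hm_carrier[OF assms(2)]] .
  then have "x \<otimes> y \<in> Hm m #> x" using assms(2) by (auto simp: r_coset_def)
  then have "Hm m #> (x \<otimes> y) = Hm m #> x"
    using repr_independence[OF _ assms(1) Hm_subgroup] by simp
  then show ?thesis by (simp add: rp_def)
qed

text \<open>The locally constant functions \<open>st m f\<close> converge to \<open>f\<close> in \<open>C\<^sup>r\<close>, and the growth bound makes their
  integrals converge.\<close>

definition st :: "nat \<Rightarrow> ('g \<Rightarrow> 'e) \<Rightarrow> 'g \<Rightarrow> 'e" where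
  "st m f = (\<lambda>x\<in>carrier G. f (rp m x))"

lemma eqv_Hm: assumes "eqv (c + m) x y" shows "\<exists>h\<in>Hm m. x = y \<otimes> h"
proof (intro bexI)
  show "x \<otimes> inv y \<in> Hm m" using assms K_le_H by (auto simp: eqv_def)
  have "x \<in> carrier G" "y \<in> carrier G" using assms by (auto simp: eqv_def)
  then show "x = y \<otimes> (x \<otimes> inv y)" by (metis inv_closed m_comm m_assoc r_inv r_one)
qed

text \<open>The shift by \<open>c\<close> is the price for measuring along \<open>K\<close> a
  function that is constant on the cosets of \<open>Hm m\<close>.\<close>

lemma st_invariant: "invariant (c + m) (st m f)"
  unfolding st_def
proof (rule invariant_restrict)
  fix x y assume xy: "eqv (c + m) x y"
  then obtain h where "h \<in> Hm m" "x = y \<otimes> h" using eqv_Hm by blast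
  then show "f (rp m x) = f (rp m y)" using rp_eq eqv_carrier(2)[OF xy] by simp
qed

lemma st_extensional: "st m f \<in> extensional (carrier G)"
  by (simp add: st_def)

lemma st_LC: "st m f \<in> LC G"
  by (rule LC_I[OF st_extensional st_invariant])

lemma st_close: assumes "oscillation_ge N m f" "x \<in> carrier G" shows "ereal N \<le> v (f x - st m f x)"
proof -
  obtain y where y: "y \<in> Hm m" "x = rp m x \<otimes> y" using rp(3)[OF assms(2)] by blast
  have "ereal N \<le> v (f (rp m x \<otimes> y) - f (rp m x))" using oscillation_geD[OF assms(1) rp(1)[OF assms(2)] y(1)] .
  then show ?thesis using y(2)[symmetric] assms(2) by (simp add: st_def)
qed

text \<open>In an ultrametric sum only the worst term counts, so the number of cosets of
  \<open>K n\<close> does not enter.\<close>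

lemma \<mu>_bound:
  assumes h: "h \<in> extensional (carrier G)" "invariant n h" "\<And>x. x \<in> carrier G \<Longrightarrow> ereal a \<le> v (h x)"
  shows "ereal (a + c0 - r * real n) \<le> v (\<mu> h)"
  unfolding \<mu>_eq[OF h(1,2)] riemann_sum_def
proof (rule v_sum_ge)
  fix C assume C: "C \<in> rcosets (K n)"
  have "ereal (c0 - r * real n) + ereal a \<le> v (\<psi> n C) + v (h (rep C))"
    by (rule add_mono[OF growth[OF C] h(3)[OF rep(2)[OF C]]])
  then show "ereal (a + c0 - r * real n) \<le> v (\<psi> n C * h (rep C))" by (simp add: v_mult algebra_simps)
qed

lemma \<mu>_add: "f \<in> LC G \<Longrightarrow> g \<in> LC G \<Longrightarrow> \<mu> (\<lambda>x\<in>carrier G. f x + g x) = \<mu> f + \<mu> g"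
  and \<mu>_scale: "f \<in> LC G \<Longrightarrow> \<mu> (\<lambda>x\<in>carrier G. a * f x) = a * \<mu> f"
  using lc_distribution_\<mu> unfolding lc_distribution_def linear_functional_on_def by blast+

lemma \<mu>_diff: assumes "f \<in> LC G" "g \<in> LC G" shows "\<mu> (\<lambda>x\<in>carrier G. f x - g x) = \<mu> f - \<mu> g"
proof -
  have "(\<lambda>x\<in>carrier G. f x + (\<lambda>x\<in>carrier G. - 1 * g x) x) = (\<lambda>x\<in>carrier G. f x - g x)" by (rule restrict_ext) simp
  then show ?thesis using \<mu>_add[OF assms(1) LC_scale[OF assms(2), of "- 1"]] \<mu>_scale[OF assms(2), of "- 1"] by simp
qed

text \<open>The two step functions differ by valuation at least \<open>N + r * m\<close>, and the
  difference lives at level \<open>c + m + 1\<close>, where integration costs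
  \<open>r * (c + m + 1)\<close>. The terms \<open>r * m\<close> cancel, so the bound is uniform in
  \<open>m\<close>.\<close>

lemma \<mu>_step: assumes "oscillation_ge (N + r * real m) m f"
  shows "ereal (N + c0 - r * (real c + 1)) \<le> v (\<mu> (st (Suc m) f) - \<mu> (st m f))"
proof -
  let ?h = "\<lambda>x\<in>carrier G. st (Suc m) f x - st m f x"
  have "invariant (c + Suc m) (st m f)" by (rule invariant_mono[OF st_invariant]) simp
  then have inv: "invariant (c + Suc m) ?h"
    by (intro invariant_restrict) (simp add: invariantD[OF st_invariant] invariantD[of _ "st m f"])
  have "ereal (N + r * real m) \<le> v (?h x)" if x: "x \<in> carrier G" for x
  proof -
    obtain y where y: "y \<in> Hm (Suc m)" "rp (Suc m) x = x \<otimes> y" using rp(2)[OF x] by blast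
    have 1: "ereal (N + r * real m) \<le> v (f (x \<otimes> y) - f x)"
      using oscillation_geD[OF assms x] y(1) Hm_Suc by blast
    have 2: "ereal (N + r * real m) \<le> v (f x - st m f x)" by (rule st_close[OF assms x])
    show ?thesis using v_add_ge[OF 1 2] x y(2) by (simp add: st_def)
  qed
  then have "ereal (N + r * real m + c0 - r * real (c + Suc m)) \<le> v (\<mu> ?h)" by (intro \<mu>_bound[OF _ inv]) auto
  then show ?thesis unfolding \<mu>_diff[OF st_LC st_LC] by (simp add: algebra_simps)
qed

lemma \<mu>_st_telescope:
  assumes "\<And>m. m \<ge> M \<Longrightarrow> oscillation_ge (N + r * real m) m f" "m \<ge> M"
  shows "ereal (N + c0 - r * (real c + 1)) \<le> v (\<mu> (st m f) - \<mu> (st M f))"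
  using assms(2)
proof (induction m rule: dec_induct)
  case (step m)
  have "ereal (N + c0 - r * (real c + 1)) \<le> v (\<mu> (st (Suc m) f) - \<mu> (st m f))"
    by (rule \<mu>_step[OF assms(1)]) (use step in simp)
  from v_add_ge[OF this step.IH] show ?case by simp
qed simp

definition is_limit :: "('g \<Rightarrow> 'e) \<Rightarrow> 'e \<Rightarrow> bool" where
  "is_limit f l \<longleftrightarrow> (\<forall>N::real. \<exists>M. \<forall>m\<ge>M. ereal N \<le> v (\<mu> (st m f) - l))"

lemma is_limit_exists: assumes "f \<in> Cr" shows "\<exists>l. is_limit f l"
  unfolding is_limit_def
proof (rule complete)
  fix N :: real
  \<comment> \<open>The constants of \<open>\<mu>_st_telescope\<close> are put into the oscillation
    bound in advance, so that exactly \<open>N\<close> is left.\<close>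
  obtain M where "\<And>m. m \<ge> M \<Longrightarrow> oscillation_ge (N - c0 + r * (real c + 1) + r * real m) m f"
    using assms unfolding Cr_iff by meson
  from \<mu>_st_telescope[OF this] have M: "ereal N \<le> v (\<mu> (st m f) - \<mu> (st M f))" if "m \<ge> M" for m
    using that by simp
  have "ereal N \<le> v (\<mu> (st m f) - \<mu> (st n f))" if "m \<ge> M" "n \<ge> M" for m n
    using v_diff_ge[OF M[OF that(1)] M[OF that(2)]] by simp
  then show "\<exists>M. \<forall>m\<ge>M. \<forall>n\<ge>M. ereal N \<le> v (\<mu> (st m f) - \<mu> (st n f))" by blast
qed

lemma eq_of_close: assumes "\<And>N::real. ereal N \<le> v (a - b)" shows "a = b"
  using ereal_top[of "v (a - b)"] assms by simp

lemma is_limit_unique: assumes "is_limit f l" "is_limit f l'" shows "l = l'"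
proof (rule eq_of_close)
  fix N :: real
  obtain M1 where M1: "\<forall>m\<ge>M1. ereal N \<le> v (\<mu> (st m f) - l)" using assms(1) is_limit_def by blast
  obtain M2 where M2: "\<forall>m\<ge>M2. ereal N \<le> v (\<mu> (st m f) - l')" using assms(2) is_limit_def by blast
  let ?m = "max M1 M2"
  have "ereal N \<le> v (\<mu> (st ?m f) - l')" "ereal N \<le> v (\<mu> (st ?m f) - l)" using M1 M2 by auto
  from v_diff_ge[OF this] show "ereal N \<le> v (l - l')" by simp
qed

definition L :: "('g \<Rightarrow> 'e) \<Rightarrow> 'e" where
  "L f = (if f \<in> Cr then THE l. is_limit f l else undefined)"

lemma is_limit_L: assumes "f \<in> Cr" shows "is_limit f (L f)"
proof -
  have "\<exists>!l. is_limit f l" using is_limit_exists[OF assms] is_limit_unique by blast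
  then have "is_limit f (THE l. is_limit f l)" by (rule theI')
  then show ?thesis using assms by (simp add: L_def)
qed

lemma L_eqI: "f \<in> Cr \<Longrightarrow> is_limit f l \<Longrightarrow> L f = l"
  using is_limit_L is_limit_unique by blast

lemma st_add: "st m (\<lambda>x\<in>carrier G. f x + g x) = (\<lambda>x\<in>carrier G. st m f x + st m g x)"
  unfolding st_def by (rule restrict_ext) (simp add: rp)

lemma st_scale: "st m (\<lambda>x\<in>carrier G. a * f x) = (\<lambda>x\<in>carrier G. a * st m f x)"
  unfolding st_def by (rule restrict_ext) (simp add: rp)

lemma L_add: assumes "f \<in> Cr" "g \<in> Cr" shows "L (\<lambda>x\<in>carrier G. f x + g x) = L f + L g"
proof (rule L_eqI[OF Cr_add[OF assms]], unfold is_limit_def st_add \<mu>_add[OF st_LC st_LC], rule allI)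
  fix N :: real
  obtain M1 where M1: "\<forall>m\<ge>M1. ereal N \<le> v (\<mu> (st m f) - L f)" using is_limit_L[OF assms(1)] is_limit_def by blast
  obtain M2 where M2: "\<forall>m\<ge>M2. ereal N \<le> v (\<mu> (st m g) - L g)" using is_limit_L[OF assms(2)] is_limit_def by blast
  have "ereal N \<le> v (\<mu> (st m f) + \<mu> (st m g) - (L f + L g))" if "m \<ge> max M1 M2" for m
    using v_add_ge[of "ereal N" "\<mu> (st m f) - L f" "\<mu> (st m g) - L g"] M1 M2 that by (simp add: algebra_simps)
  then show "\<exists>M. \<forall>m\<ge>M. ereal N \<le> v (\<mu> (st m f) + \<mu> (st m g) - (L f + L g))" by blast
qed

lemma L_scale: assumes "f \<in> Cr" shows "L (\<lambda>x\<in>carrier G. a * f x) = a * L f"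
proof (rule L_eqI[OF Cr_scale[OF assms]], unfold is_limit_def st_scale \<mu>_scale[OF st_LC], rule allI)
  fix N :: real
  obtain b :: real where b: "ereal b \<le> v a" using v_lower_bound by blast
  obtain M where M: "\<forall>m\<ge>M. ereal (N - b) \<le> v (\<mu> (st m f) - L f)" using is_limit_L[OF assms] is_limit_def by blast
  have "ereal N \<le> v (a * \<mu> (st m f) - a * L f)" if "m \<ge> M" for m
  proof -
    have "v (a * \<mu> (st m f) - a * L f) = v (\<mu> (st m f) - L f) + v a"
      using v_mult[of "\<mu> (st m f) - L f" a] by (simp add: algebra_simps)
    moreover have "ereal (N - b) \<le> v (\<mu> (st m f) - L f)" using M that by blast
    ultimately show ?thesis using add_mono[OF _ b, of "ereal (N - b)" "v (\<mu> (st m f) - L f)"] by simp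
  qed
  then show "\<exists>M. \<forall>m\<ge>M. ereal N \<le> v (a * \<mu> (st m f) - a * L f)" by blast
qed

text \<open>Once \<open>Hm m\<close> lies in the level of \<open>f\<close>, the oscillation bound
  holds for every \<open>N\<close>, so the step function equals \<open>f\<close> and the integrals
  are eventually constant.\<close>

lemma L_LC: assumes f: "f \<in> LC G" shows "L f = \<mu> f"
proof (rule L_eqI)
  show "f \<in> Cr" using f LC_subset_Cr by blast
  obtain n where n: "f \<in> extensional (carrier G)" "invariant n f" using f by (rule LC_E)
  obtain M where M: "Hm M \<subseteq> K n" using H_small by blast
  have "st m f = f" if m: "m \<ge> M" for m
  proof
    fix x show "st m f x = f x"
    proof (cases "x \<in> carrier G")
      case x: True
      have "oscillation_ge N m f" for N by (rule oscillation_ge_invariant[OF n(2)]) (use M Hm_mono[OF m] in blast)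
      then have "f x = st m f x" by (intro eq_of_close st_close[OF _ x])
      then show ?thesis by simp
    qed (use n(1) in \<open>simp add: st_def extensional_def\<close>)
  qed
  then have "\<forall>m\<ge>M. ereal N \<le> v (\<mu> (st m f) - \<mu> f)" for N by simp
  then show "is_limit f (\<mu> f)" unfolding is_limit_def by blast
qed

text \<open>The continuity estimate: the integral of \<open>st 0 f\<close> is bounded by the values
  of \<open>f\<close>, and the passage from level 0 to the limit by its oscillations at all
  levels.\<close>

lemma L_bound:
  assumes f: "f \<in> Cr" and N: "\<And>z. z \<in> carrier G \<Longrightarrow> ereal N \<le> v (f z)" "\<And>m. oscillation_ge (N + r * real m) m f"
  shows "ereal (N + c0 - r * (real c + 1)) \<le> v (L f)"
proof -
  let ?B = "N + c0 - r * (real c + 1)"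
  have "ereal (N + c0 - r * real (c + 0)) \<le> v (\<mu> (st 0 f))"
    by (rule \<mu>_bound[OF st_extensional st_invariant]) (simp add: st_def rp N)
  moreover have "?B \<le> N + c0 - r * real (c + 0)" using r by (simp add: algebra_simps)
  ultimately have 0: "ereal ?B \<le> v (\<mu> (st 0 f))" by (meson ereal_less_eq(3) order_trans)
  obtain M where M: "\<forall>m\<ge>M. ereal ?B \<le> v (\<mu> (st m f) - L f)" using is_limit_L[OF f] is_limit_def by blast
  have "ereal ?B \<le> v (\<mu> (st M f) - \<mu> (st 0 f))" by (rule \<mu>_st_telescope) (use N in auto)
  from v_add_ge[OF this 0] have "ereal ?B \<le> v (\<mu> (st M f))" by simp
  from v_diff_ge[OF this, of "\<mu> (st M f) - L f"] show ?thesis using M by simp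
qed

lemma L_in_Dr: "L \<in> Dr_space p v r G H"
  unfolding Dr_space_def linear_functional_on_def Cr_topology_eq
proof (intro CollectI conjI ballI allI)
  show "L \<in> extensional Cr" by (simp add: L_def extensional_def)
  show "continuous_map (val_topology Cr Cr_dist) (field_topology v) L"
    unfolding continuous_map_def topspace_val_topology
  proof (intro conjI allI impI)
    fix U assume U: "openin (field_topology v) U"
    show "openin (val_topology Cr Cr_dist) {f \<in> Cr. L f \<in> U}" unfolding openin_val_topology
    proof (intro conjI ballI)
      fix f assume "f \<in> {f \<in> Cr. L f \<in> U}"
      then have f: "f \<in> Cr" "L f \<in> U" by auto
      obtain N :: real where N: "\<And>y. ereal N \<le> v (L f - y) \<Longrightarrow> y \<in> U"
        using U f(2) unfolding openin_val_topology by blast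
      let ?N = "N - c0 + r * (real c + 1)"
      have "g \<in> {f \<in> Cr. L f \<in> U}" if g: "g \<in> Cr" and d: "ereal ?N \<le> Cr_dist f g" for g
      proof -
        \<comment> \<open>The difference is built from a sum and a scaling, the two operations that
          a linear functional is required to respect.\<close>
        let ?h = "\<lambda>x\<in>carrier G. f x + (\<lambda>x\<in>carrier G. - 1 * g x) x"
        have h: "?h \<in> Cr" by (rule Cr_add[OF f(1) Cr_scale[OF g]])
        have "L ?h = L f - L g" using L_add[OF f(1) Cr_scale[OF g, of "-1"]] L_scale[OF g, of "-1"] by simp
        moreover have h_eq: "?h = (\<lambda>x\<in>carrier G. f x - g x)" by (rule restrict_ext) simp
        have "ereal (?N + c0 - r * (real c + 1)) \<le> v (L ?h)"
        proof (rule L_bound[OF h])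
          show "ereal ?N \<le> v (?h z)" if "z \<in> carrier G" for z
            using d that unfolding Cr_dist_ge_iff h_eq by simp
          show "oscillation_ge (?N + r * real m) m ?h" for m
            using d unfolding Cr_dist_ge_iff h_eq oscillation_ge_restrict by blast
        qed
        ultimately have "ereal N \<le> v (L f - L g)" by simp
        then show ?thesis using N g by blast
      qed
      then show "\<exists>N::real. \<forall>y\<in>Cr. ereal N \<le> Cr_dist f y \<longrightarrow> y \<in> {f \<in> Cr. L f \<in> U}" by blast
    qed blast
  qed simp
qed (rule L_add L_scale, assumption+)+

text \<open>The step functions \<open>st m f\<close> converge to \<open>f\<close> in
  \<open>Cr\<close>; \<open>L'\<close> is continuous and agrees with \<open>\<mu>\<close> on them.
  So \<open>L' f\<close> is forced, which is the uniqueness of the extension.\<close>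

lemma Dr_determined:
  assumes L': "L' \<in> Dr_space p v r G H" "restrict L' (LC G) = \<mu>" and f: "f \<in> Cr"
  shows "is_limit f (L' f)"
  unfolding is_limit_def
proof
  fix N :: real
  let ?U = "{w. ereal N \<le> v (L' f - w)}"
  have "openin (val_topology Cr Cr_dist) {g \<in> Cr. L' g \<in> ?U}"
    using L'(1) openin_field_ball[of N "L' f"]
    unfolding Dr_space_def Cr_topology_eq continuous_map_def topspace_val_topology by blast
  moreover have "f \<in> {g \<in> Cr. L' g \<in> ?U}" using f by simp
  ultimately obtain N' :: real where N': "\<And>g. g \<in> Cr \<Longrightarrow> ereal N' \<le> Cr_dist f g \<Longrightarrow> L' g \<in> ?U"
    unfolding openin_val_topology by blast
  obtain M where M: "\<And>m. m \<ge> M \<Longrightarrow> oscillation_ge (N' + r * real m) m f" using f unfolding Cr_iff by meson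
  have "ereal N \<le> v (\<mu> (st m f) - L' f)" if m: "m \<ge> M" for m
  proof -
    have close: "ereal (N' + r * real m) \<le> v (f z - st m f z)" if "z \<in> carrier G" for z
      by (rule st_close[OF M[OF m] that])
    have "ereal N' \<le> Cr_dist f (st m f)" unfolding Cr_dist_ge_iff
    proof (intro conjI ballI allI)
      fix z assume "z \<in> carrier G"
      from close[OF this] show "ereal N' \<le> v (f z - st m f z)"
        using r by (meson ereal_less_eq(3) le_add_same_cancel1 mult_nonneg_nonneg of_nat_0_le_iff order_trans)
    next
      fix k show "oscillation_ge (N' + r * real k) k (\<lambda>z. f z - st m f z)"
        unfolding oscillation_ge_def
      proof (intro ballI)
        fix z y assume z: "z \<in> carrier G" and y: "y \<in> Hm k"
        show "ereal (N' + r * real k) \<le> v (f (z \<otimes> y) - st m f (z \<otimes> y) - (f z - st m f z))"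
        \<comment> \<open>For \<open>k\<close> at least \<open>m\<close> the step function does not
          change under \<open>Hm k\<close>, leaving the oscillation of \<open>f\<close>. For smaller
          \<open>k\<close> the oscillation is controlled by the pointwise distance, whose bound
          contains \<open>r * m\<close> and hence has room for \<open>r * k\<close>.\<close>
        proof (cases "m \<le> k")
          case True
          then have "rp m (z \<otimes> y) = rp m z" using rp_eq[OF z] y Hm_mono by blast
          then have "st m f (z \<otimes> y) = st m f z" using z Hm_carrier[OF y] by (simp add: st_def)
          moreover have "ereal (N' + r * real k) \<le> v (f (z \<otimes> y) - f z)"
            using M[of k] True m oscillation_geD[OF _ z y] by simp
          ultimately show ?thesis by simp
        next
          case False
          then have "r * real k \<le> r * real m" using r by (simp add: mult_left_mono)
          then have "ereal (N' + r * real k) \<le> ereal (N' + r * real m)" by simp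
          then show ?thesis using v_diff_ge[of "ereal (N' + r * real k)"] close z Hm_carrier[OF y]
            by (meson m_closed order_trans)
        qed
      qed
    qed
    then have "L' (st m f) \<in> ?U" using N' st_LC LC_subset_Cr by blast
    moreover have "L' (st m f) = \<mu> (st m f)" using L'(2) st_LC by (metis restrict_apply')
    ultimately show ?thesis using v_diff_commute by simp
  qed
  then show "\<exists>M. \<forall>m\<ge>M. ereal N \<le> v (\<mu> (st m f) - L' f)" by blast
qed

theorem unique_extension:
  "\<exists>!L. L \<in> Dr_space p v r G H \<and> restrict L (LC G) = \<mu>"
proof (rule ex1I)
  have "restrict L (LC G) = \<mu>"
    using L_LC by (auto simp: restrict_def \<mu>_def)
  then show "L \<in> Dr_space p v r G H \<and> restrict L (LC G) = \<mu>" using L_in_Dr by blast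
  fix L' assume L': "L' \<in> Dr_space p v r G H \<and> restrict L' (LC G) = \<mu>"
  show "L' = L"
  proof
    fix f show "L' f = L f"
    proof (cases "f \<in> Cr")
      case True
      then show ?thesis using L_eqI[OF True Dr_determined[OF conjunct1[OF L'] conjunct2[OF L'] True]] by simp
    next
      case False
      have "L' \<in> extensional Cr" using L' by (simp add: Dr_space_def linear_functional_on_def)
      then show ?thesis using False by (simp add: L_def extensional_def)
    qed
  qed
qed

end

section \<open>Algebraic integers\<close>

text \<open>The additive group generated by a finite \<open>W\<close>, with no independence
  assumed.\<close>

definition zspan :: "'k::field_char_0 set \<Rightarrow> 'k set" where
  "zspan W = {y. \<exists>c :: 'k \<Rightarrow> int. y = (\<Sum>u\<in>W. of_int (c u) * u)}"

lemma zspan_base: assumes "finite W" "w \<in> W" shows "w \<in> zspan W"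
proof -
  have "w = (\<Sum>u\<in>W. of_int (if u = w then 1 else 0) * u)"
    using assms by (simp add: if_distrib[of of_int] if_distrib[of "\<lambda>x. x * _"] cong: if_cong)
  then show ?thesis unfolding zspan_def by (intro CollectI exI)
qed

lemma zspan_0: "0 \<in> zspan W"
  unfolding zspan_def by (auto intro!: exI[of _ "\<lambda>_. 0"])

lemma zspan_add: assumes "x \<in> zspan W" "y \<in> zspan W" shows "x + y \<in> zspan W"
proof -
  obtain c d where "x = (\<Sum>u\<in>W. of_int (c u) * u)" "y = (\<Sum>u\<in>W. of_int (d u) * u)" using assms by (auto simp: zspan_def)
  then have "x + y = (\<Sum>u\<in>W. of_int (c u + d u) * u)" by (simp add: algebra_simps sum.distrib)
  then show ?thesis unfolding zspan_def by (intro CollectI exI)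
qed

lemma zspan_int_mult: assumes "x \<in> zspan W" shows "of_int k * x \<in> zspan W"
proof -
  obtain c where "x = (\<Sum>u\<in>W. of_int (c u) * u)" using assms by (auto simp: zspan_def)
  then have "of_int k * x = (\<Sum>u\<in>W. of_int (k * c u) * u)" by (simp add: sum_distrib_left mult.assoc)
  then show ?thesis unfolding zspan_def by (intro CollectI exI)
qed

lemma zspan_sum: "(\<And>i. i \<in> A \<Longrightarrow> f i \<in> zspan W) \<Longrightarrow> sum f A \<in> zspan W"
  by (induction A rule: infinite_finite_induct) (auto intro: zspan_add zspan_0)

lemma zspan_mult_stable:
  assumes "\<And>w. w \<in> W \<Longrightarrow> x * w \<in> zspan V" "y \<in> zspan W"
  shows "x * y \<in> zspan V"
proof -
  obtain c where "y = (\<Sum>u\<in>W. of_int (c u) * u)" using assms by (auto simp: zspan_def)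
  then have "x * y = (\<Sum>u\<in>W. of_int (c u) * (x * u))" by (simp add: sum_distrib_left mult.left_commute)
  then show ?thesis using assms(1) by (auto intro!: zspan_sum zspan_int_mult)
qed

text \<open>An element acting on a nonzero finitely generated group is an eigenvalue of an integer matrix.\<close>

lemma algebraic_int_if_stable:
  fixes x :: "'k::field_char_0"
  assumes W: "finite W" "w0 \<in> W" "w0 \<noteq> 0" and stable: "\<And>w. w \<in> W \<Longrightarrow> x * w \<in> zspan W"
  shows "algebraic_int x"
proof -
  have "\<forall>w\<in>W. \<exists>c. x * w = (\<Sum>u\<in>W. of_int (c u) * u)" using stable by (auto simp: zspan_def)
  then obtain c :: "'k \<Rightarrow> 'k \<Rightarrow> int" where c: "\<And>w. w \<in> W \<Longrightarrow> x * w = (\<Sum>u\<in>W. of_int (c w u) * u)" by metis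
  obtain ws where ws: "set ws = W" "distinct ws" using finite_distinct_list[OF W(1)] by blast
  define n where "n = length ws"
  define A where "A = mat n n (\<lambda>(i, j). c (ws ! i) (ws ! j))"
  define B where "B = (map_mat of_int A :: 'k mat)"
  define w where "w = vec n (\<lambda>i. ws ! i)"
  have A: "A \<in> carrier_mat n n" and B: "B \<in> carrier_mat n n" and w: "w \<in> carrier_vec n"
    by (auto simp: A_def B_def w_def)
  have "eigenvector B w x" unfolding eigenvector_def
  proof (intro conjI)
    show "w \<in> carrier_vec (dim_row B)" using B w by simp
    obtain i where i: "i < n" "ws ! i = w0" using W(2) ws by (metis in_set_conv_nth n_def)
    have wi: "vec_index w i = w0" using i by (simp add: w_def)
    show "w \<noteq> 0\<^sub>v (dim_row B)"
    proof
      assume "w = 0\<^sub>v (dim_row B)"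
      then show False using i B W(3) wi by simp
    qed
    show "B *\<^sub>v w = x \<cdot>\<^sub>v w"
    proof
      fix i assume "i < dim_vec (x \<cdot>\<^sub>v w)"
      then have i: "i < n" using w by simp
      have "vec_index (B *\<^sub>v w) i = (\<Sum>j = 0..<n. of_int (c (ws ! i) (ws ! j)) * (ws ! j))"
        using i by (simp add: B_def A_def w_def scalar_prod_def)
      also have "\<dots> = (\<Sum>u\<in>W. of_int (c (ws ! i) u) * u)"
        using sum.reindex_bij_betw[OF bij_betw_nth[OF ws(2), of "{..<n}" W], of "\<lambda>u. of_int (c (ws ! i) u) * u"] ws
        by (simp add: n_def atLeast0LessThan)
      also have "\<dots> = x * ws ! i" using c[of "ws ! i"] i ws nth_mem[of i ws] by (simp add: n_def)
      finally show "vec_index (B *\<^sub>v w) i = vec_index (x \<cdot>\<^sub>v w) i" using i by (simp add: w_def)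
    qed (use B w in auto)
  qed
  then have "eigenvalue B x" unfolding eigenvalue_def by blast
  then have root: "poly (char_poly B) x = 0" using eigenvalue_root_char_poly[OF B] by blast
  have hom: "char_poly B = map_poly of_int (char_poly A)"
    unfolding B_def by (rule of_int_hom.char_poly_hom[OF A])
  show ?thesis unfolding algebraic_int.simps
  proof (intro exI conjI allI)
    show "Polynomial.lead_coeff (char_poly B) = 1" using degree_monic_char_poly[OF B] by simp
    show "poly.coeff (char_poly B) i \<in> \<int>" for i unfolding hom by (simp add: coeff_map_poly)
  qed (use root in simp_all)
qed

text \<open>A monic integral equation, read as a reduction rule for the top power.\<close>

lemma algebraic_int_power_zspan:
  fixes x :: "'k::field_char_0"
  assumes "algebraic_int x"
  shows "\<exists>n>0. x ^ n \<in> zspan ((\<lambda>i. x ^ i) ` {..<n})"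
proof -
  obtain q where q: "\<And>i. poly.coeff q i \<in> \<int>" "Polynomial.lead_coeff q = 1" "poly q x = 0"
    using assms unfolding algebraic_int.simps by blast
  define n where "n = Polynomial.degree q"
  have "n \<noteq> 0"
  proof
    assume "n = 0"
    then have "Polynomial.degree q = 0" by (simp add: n_def)
    then obtain a where "q = [:a:]" by (rule degree_eq_zeroE)
    then show False using q by simp
  qed
  have "0 = (\<Sum>i\<le>n. poly.coeff q i * x ^ i)" using q(3) by (simp add: poly_altdef n_def)
  also have "\<dots> = (\<Sum>i<n. poly.coeff q i * x ^ i) + x ^ n" using q(2) by (simp add: n_def lessThan_Suc_atMost[symmetric])
  finally have eq: "x ^ n = (\<Sum>i<n. - poly.coeff q i * x ^ i)" by (simp add: sum_negf add_eq_0_iff2)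
  have "- poly.coeff q i * x ^ i \<in> zspan ((\<lambda>i. x ^ i) ` {..<n})" if i: "i < n" for i
  proof -
    obtain k where "poly.coeff q i = of_int k" using q(1) Ints_cases by blast
    then have eq: "- poly.coeff q i * x ^ i = of_int (- k) * x ^ i" by simp
    show ?thesis unfolding eq by (rule zspan_int_mult[OF zspan_base]) (use i in auto)
  qed
  then have "x ^ n \<in> zspan ((\<lambda>i. x ^ i) ` {..<n})" unfolding eq by (intro zspan_sum) auto
  then show ?thesis using \<open>n \<noteq> 0\<close> by (intro exI[of _ n]) simp
qed

text \<open>The monomials \<open>x ^ i * y ^ j\<close> generate a group stable under
  \<open>x\<close> and \<open>y\<close>. The equation for \<open>x\<close> may have powers of
  \<open>y\<close> in its coefficients, so this also covers elements known only to be integral over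
  the ring generated by \<open>y\<close>.\<close>

lemma algebraic_int_two_generators:
  fixes x y :: "'k::field_char_0"
  defines "W \<equiv> \<lambda>m n. (\<lambda>(i, j). x ^ i * y ^ j) ` ({..<m} \<times> {..<n})"
  assumes mn: "m > 0" "n > 0" and y: "y ^ n \<in> zspan ((\<lambda>j. y ^ j) ` {..<n})" and x: "x ^ m \<in> zspan (W m n)"
  shows "algebraic_int x" "algebraic_int (x + y)" "algebraic_int (x * y)"
proof -
  let ?W = "W m n"
  have W: "finite ?W" "1 \<in> ?W" unfolding W_def using mn by (auto intro!: image_eqI[of _ _ "(0, 0)"])
  have base: "x ^ i * y ^ j \<in> zspan ?W" if "i < m" "j < n" for i j
    by (rule zspan_base[OF W(1)]) (use that in \<open>auto simp: W_def\<close>)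
  have sy: "y * w \<in> zspan ?W" if w: "w \<in> ?W" for w
  proof -
    obtain i j where ij: "i < m" "j < n" "w = x ^ i * y ^ j" using w by (auto simp: W_def)
    show ?thesis
    proof (cases "Suc j < n")
      case True
      then show ?thesis using base[OF ij(1) True] ij(3) by (simp add: mult.left_commute)
    next
      case False
      then have "y * w = x ^ i * y ^ n" using ij by (metis Suc_lessI mult.left_commute power_Suc)
      also have "\<dots> \<in> zspan ?W"
        by (rule zspan_mult_stable[OF _ y]) (use base[OF ij(1)] in auto)
      finally show ?thesis .
    qed
  qed
  have sy': "y ^ j * w \<in> zspan ?W" if "w \<in> zspan ?W" for w j
    using that
  proof (induction j)
    case (Suc j)
    then show ?case using zspan_mult_stable[OF sy Suc.IH[OF Suc.prems]] by (simp add: mult.assoc)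
  qed simp
  have sx: "x * w \<in> zspan ?W" if w: "w \<in> ?W" for w
  proof -
    obtain i j where ij: "i < m" "j < n" "w = x ^ i * y ^ j" using w by (auto simp: W_def)
    show ?thesis
    proof (cases "Suc i < m")
      case True
      then show ?thesis using base[OF True ij(2)] ij(3) by (simp add: mult.assoc)
    next
      case False
      then have "x * w = y ^ j * x ^ m" using ij by (metis Suc_lessI mult.assoc mult.commute power_Suc)
      then show ?thesis using sy'[OF x] by simp
    qed
  qed
  show "algebraic_int x" by (rule algebraic_int_if_stable[OF W]) (use sx in auto)
  show "algebraic_int (x + y)"
    by (rule algebraic_int_if_stable[OF W]) (use zspan_add[OF sx sy] in \<open>auto simp: distrib_right\<close>)
  show "algebraic_int (x * y)"
    by (rule algebraic_int_if_stable[OF W]) (use zspan_mult_stable[OF sx sy] in \<open>auto simp: mult.assoc\<close>)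
qed

lemma algebraic_int_add_mult:
  fixes x y :: "'k::field_char_0"
  assumes x: "algebraic_int x" and y: "algebraic_int y"
  shows algebraic_int_add: "algebraic_int (x + y)" and algebraic_int_mult: "algebraic_int (x * y)"
proof -
  obtain m where m: "m > 0" "x ^ m \<in> zspan ((\<lambda>i. x ^ i) ` {..<m})" using algebraic_int_power_zspan[OF x] by blast
  obtain n where n: "n > 0" "y ^ n \<in> zspan ((\<lambda>i. y ^ i) ` {..<n})" using algebraic_int_power_zspan[OF y] by blast
  let ?W = "(\<lambda>(i, j). x ^ i * y ^ j) ` ({..<m} \<times> {..<n})"
  have "1 * w \<in> zspan ?W" if "w \<in> (\<lambda>i. x ^ i) ` {..<m}" for w
    by (rule zspan_base) (use that n in \<open>force+\<close>)
  from zspan_mult_stable[OF this m(2)] have "x ^ m \<in> zspan ?W" by simp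
  then show "algebraic_int (x + y)" "algebraic_int (x * y)" using algebraic_int_two_generators[OF m(1) n] by auto
qed

text \<open>With \<open>y = x ^ k - x ^ l\<close>, the element \<open>x\<close> is a root of a monic
  polynomial over the ring generated by \<open>y\<close>. This turns a coincidence of powers of
  \<open>x\<close> modulo an integer into integrality.\<close>

lemma algebraic_int_of_power_diff:
  fixes x :: "'k::field_char_0"
  assumes y: "algebraic_int (x ^ k - x ^ l)" and "l < k"
  shows "algebraic_int x"
proof -
  define y where "y = x ^ k - x ^ l"
  obtain n where n: "n > 0" "y ^ n \<in> zspan ((\<lambda>i. y ^ i) ` {..<n})" using algebraic_int_power_zspan assms y_def by blast
  let ?W = "\<lambda>n. (\<lambda>(i, j). x ^ i * y ^ j) ` ({..<k} \<times> {..<n})"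
  have l: "x ^ l \<in> zspan (?W n)" by (rule zspan_base) (use n assms in \<open>auto intro!: image_eqI[of _ _ "(l, 0)"]\<close>)
  have mem: "y ^ j \<in> zspan (?W n)" if "j < n" for j
    by (rule zspan_base) (use that assms in \<open>auto intro!: image_eqI[of _ _ "(0, j)"]\<close>)
  \<comment> \<open>For \<open>n = 1\<close> the element \<open>y\<close> itself is not among the
    monomials, but its equation makes it an integer multiple of 1.\<close>
  have "y \<in> zspan (?W n)"
  proof (cases "n = 1")
    case True
    have "1 * w \<in> zspan (?W n)" if "w \<in> (\<lambda>i. y ^ i) ` {..<n}" for w using that mem by auto
    from zspan_mult_stable[OF this n(2)] show ?thesis using True by simp
  next
    case False
    then show ?thesis using mem[of 1] n by simp
  qed
  from zspan_add[OF l this] have "x ^ k \<in> zspan (?W n)" by (simp add: y_def)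
  then show ?thesis using algebraic_int_two_generators(1)[of k n y x] assms n by auto
qed

lemma algebraic_int_of_int: "algebraic_int (of_int k :: 'k::field_char_0)"
  by (rule int_imp_algebraic_int) simp

lemma algebraic_int_diff: "algebraic_int (x :: 'k::field_char_0) \<Longrightarrow> algebraic_int y \<Longrightarrow> algebraic_int (x - y)"
  using algebraic_int_add[of x "- y"] by simp

lemma algebraic_int_sum: "(\<And>i. i \<in> A \<Longrightarrow> algebraic_int (f i :: 'k::field_char_0)) \<Longrightarrow> algebraic_int (sum f A)"
  by (induction A rule: infinite_finite_induct) (auto intro: algebraic_int_add)

lemma algebraic_int_power: "algebraic_int (x :: 'k::field_char_0) \<Longrightarrow> algebraic_int (x ^ n)"
  using algebraic_int_of_int[of 1] by (induction n) (auto intro: algebraic_int_mult)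

text \<open>Divide an integral equation for \<open>a\<close> by a power of the variable until the
  constant term is nonzero; up to sign, that constant is then \<open>a\<close> times a polynomial in
  \<open>a\<close>.\<close>

lemma algebraic_int_divides_integer:
  fixes a :: "'k::field_char_0"
  assumes a: "algebraic_int a" "a \<noteq> 0"
  shows "\<exists>m b. m > 0 \<and> algebraic_int b \<and> (of_nat m :: 'k) = a * b"
proof -
  obtain q where q: "\<And>i. poly.coeff q i \<in> \<int>" "Polynomial.lead_coeff q = 1" "poly q a = 0"
    using a(1) unfolding algebraic_int.simps by blast
  have "\<exists>q. (\<forall>i. poly.coeff q i \<in> \<int>) \<and> poly q a = 0 \<and> poly.coeff q 0 \<noteq> 0"
    using q
  proof (induction "Polynomial.degree q" arbitrary: q rule: less_induct)
    case less
    show ?case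
    proof (cases "poly.coeff q 0 = 0")
      case True
      obtain c q' where q': "q = pCons c q'" by (cases q) 
      have c: "c = 0" using True q' by simp
      have nz: "q' \<noteq> 0" using less.prems(2) q' c by auto
      have "Polynomial.degree q' < Polynomial.degree q" using q' nz by simp
      moreover have "poly.coeff q' i \<in> \<int>" for i using less.prems(1)[of "Suc i"] q' by simp
      moreover have "Polynomial.lead_coeff q' = 1" using less.prems(2) q' nz by simp
      moreover have "poly q' a = 0" using less.prems(3) q' c a(2) by simp
      ultimately show ?thesis using less.hyps by blast
    qed (use less.prems in blast)
  qed
  then obtain q where q: "\<And>i. poly.coeff q i \<in> \<int>" "poly q a = 0" "poly.coeff q 0 \<noteq> 0" by blast
  obtain c q' where q': "q = pCons c q'" by (cases q)
  obtain k where k: "c = of_int k" using q(1)[of 0] q' Ints_cases by auto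
  have k0: "k \<noteq> 0" using q(3) q' k by auto
  define b where "b = poly q' a"
  have "algebraic_int b" unfolding b_def poly_altdef
  proof (intro algebraic_int_sum algebraic_int_mult algebraic_int_power a)
    fix i show "algebraic_int (poly.coeff q' i)" using q(1)[of "Suc i"] q' int_imp_algebraic_int by simp
  qed
  moreover have k_eq: "(of_int k :: 'k) = - (a * b)" using q(2) q' k by (simp add: b_def eq_neg_iff_add_eq_0)
  \<comment> \<open>The sign of the constant term is absorbed into the cofactor, so that the integer
    becomes a positive natural number.\<close>
  have "\<bar>k\<bar> = sgn k * k" by (simp add: abs_sgn mult.commute)
  then have "int (nat \<bar>k\<bar>) = sgn k * k" by simp
  then have "of_int (int (nat \<bar>k\<bar>)) = (of_int (sgn k * k) :: 'k)" by simp
  then have "of_nat (nat \<bar>k\<bar>) = a * (of_int (- sgn k) * b)" by (simp add: k_eq)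
  moreover have "algebraic_int (of_int (- sgn k) * b)" by (intro algebraic_int_mult algebraic_int_of_int) fact
  moreover have "nat \<bar>k\<bar> > 0" using k0 by simp
  ultimately show ?thesis by blast
qed

section \<open>Number fields and Hurwitz's lemma\<close>

lemma vector_space_of_rat: "vector_space (\<lambda>(q::rat) (x::'k::field_char_0). of_rat q * x)"
  by unfold_locales (simp_all add: algebra_simps of_rat_add of_rat_mult)

text \<open>Bridges \<open>finite_dimension\<close> of HOL-Algebra to spans in
  \<open>vector_space\<close>, where coordinates and independence are available.\<close>

lemma number_field_finite_span:
  assumes "number_field TYPE('k::field_char_0)"
  shows "\<exists>B. finite B \<and> module.span (\<lambda>(q::rat) (x::'k). of_rat q * x) B = UNIV"
proof -
  interpret Q: vector_space "\<lambda>(q::rat) (x::'k). of_rat q * x" by (rule vector_space_of_rat)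
  interpret R: ring "ring_of_type_algebra :: 'k ring" by (rule ring_from_type_algebra)
  have "\<exists>B. finite B \<and> Q.span B = E" if "R.dimension n F E" "F = range of_rat" for n F E
    using that
  proof (induction rule: R.dimension.induct)
    case (zero_dim F)
    show ?case by (rule exI[of _ "{}"]) (simp add: ring_of_type_algebra_def)
  next
    case (Suc_dim b E n F)
    then obtain B where B: "finite B" "Q.span B = E" by blast
    have "R.line_extension F b E = {k * b + e |k e. k \<in> F \<and> e \<in> E}"
      unfolding R.line_extension_def by (force simp: r_coset_def set_add_def set_mult_def ring_of_type_algebra_def)
    also have "\<dots> = Q.span (insert b B)"
    proof (intro equalityI subsetI)
      fix x assume "x \<in> {k * b + e |k e. k \<in> F \<and> e \<in> E}"
      then obtain q e where "x = of_rat q * b + e" "e \<in> E" using Suc_dim.prems by auto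
      then show "x \<in> Q.span (insert b B)" using B(2) by (auto simp: Q.span_insert intro!: exI[of _ q])
    next
      fix x assume "x \<in> Q.span (insert b B)"
      then obtain q where q: "x - of_rat q * b \<in> E" using B(2) by (auto simp: Q.span_insert)
      have "x = of_rat q * b + (x - of_rat q * b)" by simp
      then show "x \<in> {k * b + e |k e. k \<in> F \<and> e \<in> E}" using q Suc_dim.prems by blast
    qed
    finally show ?case using B(1) by (intro exI[of _ "insert b B"]) auto
  qed
  then show ?thesis using assms by (auto simp: number_field_def R.finite_dimension_def)
qed

locale numfield =
  fixes kt :: "'k::field_char_0 itself"
  assumes nf: "number_field TYPE('k)"
begin

sublocale Q: vector_space "\<lambda>(q::rat) (x::'k). of_rat q * x" by (rule vector_space_of_rat)

definition basis :: "'k set" where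
  "basis = (SOME B. finite B \<and> Q.independent B \<and> Q.span B = UNIV)"

lemma basis: "finite basis" "Q.independent basis" "Q.span basis = UNIV"
proof -
  obtain B where B: "finite B" "Q.span B = UNIV" using number_field_finite_span nf by blast
  obtain B' where B': "B' \<subseteq> B" "Q.independent B'" "B \<subseteq> Q.span B'"
    using Q.maximal_independent_subset by blast
  have "UNIV \<subseteq> Q.span B'" using Q.span_mono[OF B'(3)] B(2) by (simp only: Q.span_span)
  then have "Q.span B' = UNIV" by blast
  then have "finite B' \<and> Q.independent B' \<and> Q.span B' = UNIV" using B B' finite_subset by blast
  then have "finite basis \<and> Q.independent basis \<and> Q.span basis = UNIV" unfolding basis_def by (rule someI)
  then show "finite basis" "Q.independent basis" "Q.span basis = UNIV" by auto
qed

definition kdim :: nat where "kdim = card basis"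

definition bvec :: "nat \<Rightarrow> 'k" where
  "bvec = (SOME f. bij_betw f {..<kdim} basis)"

lemma bij_bvec: "bij_betw bvec {..<kdim} basis"
proof -
  have "\<exists>f. bij_betw f {..<kdim} basis"
    using ex_bij_betw_nat_finite[OF basis(1)] by (simp add: kdim_def atLeast0LessThan)
  then show ?thesis unfolding bvec_def by (rule someI_ex)
qed

lemma bvec_basis: "i < kdim \<Longrightarrow> bvec i \<in> basis"
  using bij_bvec by (auto simp: bij_betw_def)

definition cf :: "'k \<Rightarrow> nat \<Rightarrow> rat" where
  "cf x i = Q.representation basis x (bvec i)"

lemma expand: "x = (\<Sum>i<kdim. of_rat (cf x i) * bvec i)"
proof -
  have "x = (\<Sum>b\<in>basis. of_rat (Q.representation basis x b) * b)"
    using Q.sum_representation_eq[OF basis(2) _ basis(1) order_refl, of x] basis(3) by simp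
  also have "\<dots> = (\<Sum>i<kdim. of_rat (cf x i) * bvec i)"
    unfolding cf_def by (rule sum.reindex_bij_betw[OF bij_bvec, symmetric])
  finally show ?thesis .
qed

lemma cf_add: "cf (x + y) i = cf x i + cf y i"
  unfolding cf_def using Q.representation_add[OF basis(2)] basis(3) by simp

lemma cf_scale: "cf (of_rat q * x) i = q * cf x i"
  unfolding cf_def using Q.representation_scale[OF basis(2)] basis(3) by simp

lemma cf_0 [simp]: "cf 0 i = 0"
  unfolding cf_def by (simp add: Q.representation_zero)

lemma cf_sum: "cf (sum f A) i = (\<Sum>a\<in>A. cf (f a) i)"
  by (induction A rule: infinite_finite_induct) (simp_all add: cf_add)

lemma cf_bvec: "i < kdim \<Longrightarrow> j < kdim \<Longrightarrow> cf (bvec j) i = (if i = j then 1 else 0)"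
  unfolding cf_def using bij_bvec Q.representation_basis[OF basis(2) bvec_basis, of j]
  by (auto simp: bij_betw_def inj_on_def)

lemma cf_combination:
  assumes "i < kdim" shows "cf (\<Sum>j<kdim. of_rat (c j) * bvec j) i = c i"
proof -
  have "cf (\<Sum>j<kdim. of_rat (c j) * bvec j) i = (\<Sum>j<kdim. if j = i then c j else 0)"
    unfolding cf_sum cf_scale using assms by (intro sum.cong) (auto simp: cf_bvec)
  then show ?thesis using assms by simp
qed

lemma kdim_pos: "kdim > 0"
proof (rule ccontr)
  assume "\<not> kdim > 0"
  then have "(1 :: 'k) = 0" using expand[of 1] by simp
  then show False by simp
qed

section \<open>Norms and their integrality\<close>

definition mult_mat :: "'k \<Rightarrow> rat mat" where
  "mult_mat x = mat kdim kdim (\<lambda>(i, j). cf (x * bvec j) i)"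

definition field_norm :: "'k \<Rightarrow> rat" where
  "field_norm x = Determinant.det (mult_mat x)"

lemma mult_mat_carrier [simp]: "mult_mat x \<in> carrier_mat kdim kdim"
  by (simp add: mult_mat_def)

lemma cf_mult: "cf (x * y) i = (\<Sum>k<kdim. cf y k * cf (x * bvec k) i)"
proof -
  have "x * y = (\<Sum>k<kdim. of_rat (cf y k) * (x * bvec k))"
    by (subst expand[of y]) (simp add: sum_distrib_left mult.left_commute)
  then show ?thesis by (simp add: cf_sum cf_scale)
qed

lemma mult_mat_mult: "mult_mat (x * y) = mult_mat x * mult_mat y"
proof
  fix i j assume "i < dim_row (mult_mat x * mult_mat y)" "j < dim_col (mult_mat x * mult_mat y)"
  then have ij: "i < kdim" "j < kdim" by (simp_all add: mult_mat_def)
  have "cf (x * y * bvec j) i = (\<Sum>k<kdim. cf (y * bvec j) k * cf (x * bvec k) i)"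
    using cf_mult[of x "y * bvec j"] by (simp add: mult.assoc)
  then show "mult_mat (x * y) $$ (i, j) = (mult_mat x * mult_mat y) $$ (i, j)"
    using ij by (simp add: mult_mat_def scalar_prod_def atLeast0LessThan mult.commute)
qed (simp_all add: mult_mat_def)

lemma field_norm_mult: "field_norm (x * y) = field_norm x * field_norm y"
  unfolding field_norm_def mult_mat_mult by (rule det_mult[of _ kdim]) simp_all

lemma field_norm_1: "field_norm 1 = 1"
proof -
  have "mult_mat 1 = 1\<^sub>m kdim" by (rule eq_matI) (auto simp: mult_mat_def cf_bvec)
  then show ?thesis by (simp add: field_norm_def)
qed

lemma field_norm_nonzero: "x \<noteq> 0 \<Longrightarrow> field_norm x \<noteq> 0"
  using field_norm_mult[of x "inverse x"] field_norm_1 by auto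

lemma field_norm_power: "field_norm (x ^ k) = field_norm x ^ k"
  by (induction k) (simp_all add: field_norm_1 field_norm_mult)

text \<open>A crude constant: the sum of all absolute structure constants bounds each entry of
  \<open>mult_mat x\<close> relative to the coordinates of \<open>x\<close>.\<close>

definition structure_bound :: rat where
  "structure_bound = (\<Sum>i<kdim. \<Sum>j<kdim. \<Sum>k<kdim. \<bar>cf (bvec k * bvec j) i\<bar>)"

lemma field_norm_bound:
  assumes "\<And>i. i < kdim \<Longrightarrow> \<bar>cf x i\<bar> \<le> \<epsilon>"
  shows "\<bar>field_norm x\<bar> \<le> fact kdim * (structure_bound * \<epsilon>) ^ kdim"
proof -
  have \<epsilon>: "0 \<le> \<epsilon>" using assms[OF kdim_pos] by (meson abs_ge_zero order_trans)
  have entry: "\<bar>mult_mat x $$ (i, j)\<bar> \<le> structure_bound * \<epsilon>" if "i < kdim" "j < kdim" for i j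
  proof -
    have "\<bar>mult_mat x $$ (i, j)\<bar> = \<bar>\<Sum>k<kdim. cf x k * cf (bvec k * bvec j) i\<bar>"
      using that cf_mult[of "bvec j" x i] by (simp add: mult_mat_def mult.commute)
    also have "\<dots> \<le> (\<Sum>k<kdim. \<bar>cf x k * cf (bvec k * bvec j) i\<bar>)" by (rule sum_abs)
    also have "\<dots> \<le> (\<Sum>k<kdim. \<epsilon> * \<bar>cf (bvec k * bvec j) i\<bar>)"
      by (intro sum_mono) (simp add: abs_mult assms mult_right_mono)
    also have "\<dots> = \<epsilon> * (\<Sum>k<kdim. \<bar>cf (bvec k * bvec j) i\<bar>)" by (simp add: sum_distrib_left)
    also have "\<dots> \<le> \<epsilon> * structure_bound"
    proof (rule mult_left_mono[OF _ \<epsilon>])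
      have "(\<Sum>k<kdim. \<bar>cf (bvec k * bvec j) i\<bar>) \<le> (\<Sum>j<kdim. \<Sum>k<kdim. \<bar>cf (bvec k * bvec j) i\<bar>)"
        by (rule member_le_sum) (use that in \<open>auto intro: sum_nonneg\<close>)
      also have "\<dots> \<le> structure_bound" unfolding structure_bound_def
        by (rule member_le_sum) (use that in \<open>auto intro!: sum_nonneg\<close>)
      finally show "(\<Sum>k<kdim. \<bar>cf (bvec k * bvec j) i\<bar>) \<le> structure_bound" .
    qed
    finally show ?thesis by (simp add: mult.commute)
  qed
  have "field_norm x = (\<Sum>p | p permutes {0..<kdim}. of_int (sign p) * (\<Prod>i = 0..<kdim. mult_mat x $$ (i, p i)))"
    unfolding field_norm_def Determinant.det_def by (simp add: mult_mat_def)
  then have "\<bar>field_norm x\<bar> \<le> (\<Sum>p | p permutes {0..<kdim}. \<bar>of_int (sign p) * (\<Prod>i = 0..<kdim. mult_mat x $$ (i, p i))\<bar>)"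
    by (simp add: sum_abs)
  also have "\<dots> \<le> (\<Sum>p | p permutes {0..<kdim}. (structure_bound * \<epsilon>) ^ kdim)"
  proof (rule sum_mono)
    fix p assume "p \<in> {p. p permutes {0..<kdim}}"
    then have p: "p i < kdim" if "i < kdim" for i using permutes_in_image[of p "{0..<kdim}" i] that by auto
    have "\<bar>of_int (sign p) * (\<Prod>i = 0..<kdim. mult_mat x $$ (i, p i))\<bar> = (\<Prod>i = 0..<kdim. \<bar>mult_mat x $$ (i, p i)\<bar>)"
      by (simp add: abs_mult abs_prod sign_def)
    also have "\<dots> \<le> (\<Prod>i = 0..<kdim. structure_bound * \<epsilon>)"
      by (rule prod_mono) (use entry p in auto)
    finally show "\<bar>of_int (sign p) * (\<Prod>i = 0..<kdim. mult_mat x $$ (i, p i))\<bar> \<le> (structure_bound * \<epsilon>) ^ kdim" by simp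
  qed
  also have "\<dots> = fact kdim * (structure_bound * \<epsilon>) ^ kdim" by (simp add: card_permutations)
  finally show ?thesis .
qed

lemma common_denominator:
  assumes "finite A"
  shows "\<exists>D::int. D > 0 \<and> (\<forall>a\<in>A. (of_int D * f a :: rat) \<in> \<int>)"
  using assms
proof (induction A rule: finite_induct)
  case empty show ?case by (intro exI[of _ 1]) simp
next
  case (insert a A)
  then obtain D :: int where D: "D > 0" "\<forall>a\<in>A. of_int D * f a \<in> \<int>" by blast
  obtain u w where uw: "quotient_of (f a) = (u, w)" by (cases "quotient_of (f a)")
  have w: "w > 0" "f a = of_int u / of_int w" using quotient_of_denom_pos[OF uw] quotient_of_div[OF uw] by auto
  have "of_int (D * w) * f a = of_int (D * u)" using w by simp
  then have "of_int (D * w) * f a \<in> \<int>" by (metis Ints_of_int)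
  moreover have "of_int (D * w) * f b \<in> \<int>" if "b \<in> A" for b
  proof -
    have "of_int (D * w) * f b = of_int w * (of_int D * f b)" by simp
    then show ?thesis using D(2) that by (metis Ints_mult Ints_of_int)
  qed
  ultimately show ?case using D(1) w(1) by (intro exI[of _ "D * w"]) auto
qed

lemma all_powers_dvd_imp_0:
  fixes w D :: int
  assumes "w \<ge> 2" "\<And>k. w ^ k dvd D"
  shows "D = 0"
proof (rule ccontr)
  assume "D \<noteq> 0"
  then have "w ^ nat \<bar>D\<bar> \<le> \<bar>D\<bar>" using zdvd_imp_le[of "w ^ nat \<bar>D\<bar>" "\<bar>D\<bar>"] assms(2) by simp
  moreover have "2 ^ nat \<bar>D\<bar> \<le> w ^ nat \<bar>D\<bar>" using assms(1) by (rule power_mono) simp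
  moreover have "int (nat \<bar>D\<bar>) < 2 ^ nat \<bar>D\<bar>" using less_exp[of "nat \<bar>D\<bar>"] by (metis of_nat_less_iff of_nat_numeral of_nat_power)
  ultimately show False by simp
qed

text \<open>The powers of the reduced denominator all divide \<open>D\<close>, so that denominator
  is 1.\<close>

lemma rational_bounded_denominators:
  fixes q :: rat
  assumes D: "D > 0" and q: "\<And>k. of_int D * q ^ k \<in> \<int>"
  shows "q \<in> \<int>"
proof -
  obtain u w where uw: "quotient_of q = (u, w)" by (cases "quotient_of q")
  have w: "w > 0" "q = of_int u / of_int w" "coprime u w"
    using quotient_of_denom_pos[OF uw] quotient_of_div[OF uw] quotient_of_coprime[OF uw] by auto
  have dvd: "w ^ k dvd D" for k
  proof -
    obtain z where z: "of_int D * q ^ k = of_int z" using q[of k] Ints_cases by blast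
    have "(of_int (D * u ^ k) :: rat) = of_int (z * w ^ k)"
      using z w by (simp add: power_divide field_simps)
    then have "D * u ^ k = z * w ^ k" by (simp only: of_int_eq_iff)
    then have "w ^ k dvd D * u ^ k" by simp
    moreover have "coprime (w ^ k) (u ^ k)" using w(3) by (simp add: coprime_commute)
    ultimately show ?thesis by (simp add: coprime_dvd_mult_left_iff)
  qed
  have "w = 1"
  proof (rule ccontr)
    assume "w \<noteq> 1"
    then have "w \<ge> 2" using w by simp
    then show False using all_powers_dvd_imp_0[OF _ dvd] D by simp
  qed
  then show ?thesis using w by simp
qed

text \<open>The powers of \<open>x\<close> lie in one finitely generated group, so their
  multiplication matrices have a common denominator \<open>D\<close>. Hence \<open>D ^ kdim\<close>
  clears all powers of the norm, and a rational with this property is an integer.\<close>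

lemma field_norm_algebraic_int:
  assumes x: "algebraic_int x"
  shows "field_norm x \<in> \<int>"
proof -
  obtain m where m: "m > 0" "x ^ m \<in> zspan ((\<lambda>i. x ^ i) ` {..<m})" using algebraic_int_power_zspan[OF x] by blast
  let ?W = "(\<lambda>i. x ^ i) ` {..<m}"
  have stable: "x * w \<in> zspan ?W" if w: "w \<in> ?W" for w
  proof -
    obtain i where i: "i < m" "w = x ^ i" using w by auto
    show ?thesis
    proof (cases "Suc i < m")
      case True
      then have "x ^ Suc i \<in> zspan ?W" by (intro zspan_base image_eqI[of _ _ "Suc i"]) auto
      then show ?thesis using i by simp
    next
      case False
      then have "m = Suc i" using i by simp
      then show ?thesis using i m(2) by simp
    qed
  qed
  have power: "x ^ k \<in> zspan ?W" for k
  proof (induction k)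
    case 0 show ?case by (rule zspan_base) (use m in \<open>auto intro!: image_eqI[of _ _ 0]\<close>)
  next
    case (Suc k) then show ?case using zspan_mult_stable[OF stable Suc] by simp
  qed
  obtain D :: int where D: "D > 0" "\<forall>a\<in>?W \<times> {..<kdim} \<times> {..<kdim}. of_int D * (case a of (w, i, j) \<Rightarrow> cf (w * bvec j) i) \<in> \<int>"
    using common_denominator[of "?W \<times> {..<kdim} \<times> {..<kdim}" "\<lambda>(w, i, j). cf (w * bvec j) i"] by auto
  have entries: "of_int D * cf (x ^ k * bvec j) i \<in> \<int>" if ij: "i < kdim" "j < kdim" for i j k
  proof -
    obtain c where c: "x ^ k = (\<Sum>u\<in>?W. of_int (c u) * u)" using power[of k] by (auto simp: zspan_def)
    have xe: "x ^ k * bvec j = (\<Sum>u\<in>?W. of_rat (of_int (c u)) * (u * bvec j))" by (simp add: c sum_distrib_right mult.assoc)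
    have "of_int D * cf (x ^ k * bvec j) i = (\<Sum>u\<in>?W. of_int (c u) * (of_int D * cf (u * bvec j) i))"
      unfolding xe cf_sum cf_scale sum_distrib_left by (rule sum.cong[OF refl]) (rule mult.left_commute)
    also have "\<dots> \<in> \<int>" by (rule Ints_sum, rule Ints_mult[OF Ints_of_int]) (use D(2) ij in auto)
    finally show ?thesis .
  qed
  have "of_int (D ^ kdim) * field_norm x ^ k \<in> \<int>" for k
  proof -
    define A where "A = mat kdim kdim (\<lambda>(i, j). \<lfloor>of_int D * cf (x ^ k * bvec j) i\<rfloor>)"
    have "of_int D \<cdot>\<^sub>m mult_mat (x ^ k) = map_mat of_int A"
      by (rule eq_matI) (use entries in \<open>auto simp: mult_mat_def A_def elim!: Ints_cases\<close>)
    then have "Determinant.det (of_int D \<cdot>\<^sub>m mult_mat (x ^ k)) = of_int (Determinant.det A)"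
      by (simp only: of_int_hom.hom_det)
    moreover have "dim_col (mult_mat (x ^ k)) = kdim" by (simp add: mult_mat_def)
    ultimately have "of_int D ^ kdim * field_norm (x ^ k) = of_int (Determinant.det A)" by (simp add: field_norm_def)
    then show ?thesis by (simp only: of_int_power field_norm_power Ints_of_int)
  qed
  then show ?thesis by (rule rational_bounded_denominators[rotated]) (use D(1) in simp)
qed

text \<open>Clear the denominators of the multiplication matrix: then \<open>D * x\<close> maps the
  group generated by \<open>basis\<close> into itself, and \<open>algebraic_int_if_stable\<close>
  applies.\<close>

lemma integral_multiple:
  fixes x :: 'k
  shows "\<exists>D::int. D > 0 \<and> algebraic_int (of_int D * x)"
proof -
  obtain D :: int where D: "D > 0" "\<forall>a\<in>{..<kdim} \<times> {..<kdim}. of_int D * (case a of (i, j) \<Rightarrow> cf (x * bvec j) i) \<in> \<int>"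
    using common_denominator[of "{..<kdim} \<times> {..<kdim}" "\<lambda>(i, j). cf (x * bvec j) i"] by auto
  have "algebraic_int (of_int D * x)"
  proof (rule algebraic_int_if_stable[OF basis(1) bvec_basis[OF kdim_pos]])
    show "bvec 0 \<noteq> 0" using cf_bvec[OF kdim_pos kdim_pos] by auto
    fix w assume "w \<in> basis"
    then obtain j where j: "j < kdim" "w = bvec j" using bij_bvec by (auto simp: bij_betw_def)
    have "of_int D * x * w = (\<Sum>i<kdim. of_int D * (of_rat (cf (x * bvec j) i) * bvec i))"
      by (subst sum_distrib_left[symmetric], subst expand[of "x * bvec j", symmetric]) (simp add: j mult.assoc)
    also have "\<dots> \<in> zspan basis"
    proof (rule zspan_sum)
      fix i assume i: "i \<in> {..<kdim}"
      then have "of_int D * cf (x * bvec j) i \<in> \<int>" using D(2) j by auto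
      then obtain z where "of_int D * cf (x * bvec j) i = of_int z" by (rule Ints_cases)
      then have "(of_rat (of_int D * cf (x * bvec j) i) :: 'k) = of_int z" by simp
      then have eq: "of_int D * (of_rat (cf (x * bvec j) i) * bvec i) = of_int z * bvec i"
        by (simp add: of_rat_mult flip: mult.assoc)
      show "of_int D * (of_rat (cf (x * bvec j) i) * bvec i) \<in> zspan basis"
        unfolding eq by (rule zspan_int_mult[OF zspan_base[OF basis(1) bvec_basis]]) (use i in simp)
    qed
    finally show "of_int D * x * w \<in> zspan basis" .
  qed
  then show ?thesis using D(1) by blast
qed

lemma fraction:
  fixes x :: 'k
  obtains a b where "algebraic_int a" "algebraic_int b" "b \<noteq> 0" "x = a / b"
proof -
  obtain D :: int where "D > 0" "algebraic_int (of_int D * x)" using integral_multiple by blast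
  then show ?thesis using that[of "of_int D * x" "of_int D"] algebraic_int_of_int by simp
qed

text \<open>Hurwitz's substitute for the Euclidean algorithm, by pigeonhole on fractional parts.\<close>

lemma hurwitz: "\<exists>T>0. \<forall>\<gamma>. \<exists>t \<omega>. 1 \<le> t \<and> t \<le> T \<and> algebraic_int \<omega> \<and> \<bar>field_norm (of_nat t * \<gamma> - \<omega>)\<bar> < 1"
proof -
  have "\<forall>i. \<exists>D::int. D > 0 \<and> algebraic_int (of_int D * bvec i)" using integral_multiple by blast
  then obtain De :: "nat \<Rightarrow> int" where De: "\<And>i. De i > 0" "\<And>i. algebraic_int (of_int (De i) * bvec i)"
    by metis
  define D where "D = (\<Prod>i<kdim. De i)"
  have D: "D > 0" unfolding D_def by (rule prod_pos) (use De in auto)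
  have De_int: "algebraic_int (of_int D * bvec i)" if i: "i < kdim" for i
  proof -
    have "D = De i * (\<Prod>j\<in>{..<kdim} - {i}. De j)" unfolding D_def using i by (simp add: prod.remove)
    then have "of_int D * bvec i = of_int (\<Prod>j\<in>{..<kdim} - {i}. De j) * (of_int (De i) * bvec i)" by simp
    then show ?thesis using algebraic_int_mult[OF algebraic_int_of_int De(2)] by metis
  qed
  have sb: "structure_bound \<ge> 0" unfolding structure_bound_def by (intro sum_nonneg) auto
  \<comment> \<open>The mesh \<open>1 / m\<close> is so fine that, by
    \<open>field_norm_bound\<close>, an element with coordinates at most \<open>D / m\<close> has
    norm below 1.\<close>
  obtain m :: nat where m: "fact kdim * (structure_bound * of_int D) < of_nat m" using reals_Archimedean2 by blast
  have m0: "m > 0"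
  proof (rule ccontr)
    assume "\<not> m > 0"
    moreover have "0 \<le> fact kdim * (structure_bound * of_int D)" using sb D by simp
    ultimately show False using m by simp
  qed
  define T where "T = m ^ kdim"
  have T: "T > 0" using m0 by (simp add: T_def)
  have "\<exists>t \<omega>. 1 \<le> t \<and> t \<le> T \<and> algebraic_int \<omega> \<and> \<bar>field_norm (of_nat t * \<gamma> - \<omega>)\<bar> < 1" for \<gamma>
  proof -
    \<comment> \<open>Coordinates of \<open>t * \<gamma>\<close> in units of \<open>D\<close>:
      subtracting integers in these units subtracts multiples of the integral elements
      \<open>D * bvec i\<close>. The function \<open>g\<close> records the box of side
      \<open>1 / m\<close> containing the fractional parts.\<close>
    define a where "a t i = of_nat t * cf \<gamma> i / of_int D" for t i
    define g where "g t = (\<lambda>i\<in>{..<kdim}. nat \<lfloor>of_nat m * frac (a t i)\<rfloor>)" for t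
    have g: "g t \<in> {..<kdim} \<rightarrow>\<^sub>E {..<m}" for t
    proof -
      have "\<lfloor>of_nat m * frac (a t i)\<rfloor> < int m" for i
      proof -
        have "of_nat m * frac (a t i) < of_nat m * 1" using m0 frac_lt_1[of "a t i"] by (intro mult_strict_left_mono) auto
        then show ?thesis by (simp add: floor_less_iff)
      qed
      moreover have "0 \<le> \<lfloor>of_nat m * frac (a t i)\<rfloor>" for i by simp
      ultimately show ?thesis by (auto simp: g_def nat_less_iff)
    qed
    have "card ({..<kdim} \<rightarrow>\<^sub>E {..<m}) = T" by (simp add: card_PiE T_def)
    moreover have "g ` {..T} \<subseteq> {..<kdim} \<rightarrow>\<^sub>E {..<m}" using g by blast
    ultimately have "card (g ` {..T}) \<le> T" by (metis card_mono finite_PiE finite_lessThan)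
    then have "\<not> inj_on g {..T}" by (intro pigeonhole) simp
    then obtain t1 t2 where t: "t1 < t2" "t2 \<le> T" "g t1 = g t2"
      unfolding inj_on_def by (metis atMost_iff linorder_neqE_nat)
    define z where "z i = \<lfloor>a t2 i\<rfloor> - \<lfloor>a t1 i\<rfloor>" for i
    define \<omega> where "\<omega> = (\<Sum>i<kdim. of_rat (of_int D * of_int (z i)) * bvec i)"
    have "\<omega> = (\<Sum>i<kdim. of_int (z i) * (of_int D * bvec i))"
      unfolding \<omega>_def by (rule sum.cong) (simp_all add: of_rat_mult)
    then have \<omega>: "algebraic_int \<omega>"
      by (simp only:) (rule algebraic_int_sum, rule algebraic_int_mult[OF algebraic_int_of_int De_int], simp)
    have coord: "\<bar>cf (of_nat (t2 - t1) * \<gamma> - \<omega>) i\<bar> \<le> of_int D / of_nat m" if i: "i < kdim" for i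
    proof -
      have eq: "of_nat (t2 - t1) * \<gamma> - \<omega> = of_rat (of_nat (t2 - t1)) * \<gamma> + of_rat (-1) * \<omega>" by simp
      have "cf (of_nat (t2 - t1) * \<gamma> - \<omega>) i = of_nat (t2 - t1) * cf \<gamma> i - of_int D * of_int (z i)"
        unfolding eq cf_add cf_scale using cf_combination[OF i, of "\<lambda>i. of_int D * of_int (z i)"] by (simp add: \<omega>_def)
      also have "\<dots> = of_int D * (frac (a t2 i) - frac (a t1 i))"
        using D t(1) by (simp add: a_def z_def frac_def field_simps of_nat_diff)
      finally have c: "cf (of_nat (t2 - t1) * \<gamma> - \<omega>) i = of_int D * (frac (a t2 i) - frac (a t1 i))" .
      have "nat \<lfloor>of_nat m * frac (a t1 i)\<rfloor> = nat \<lfloor>of_nat m * frac (a t2 i)\<rfloor>"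
        using fun_cong[OF t(3), of i] i by (simp add: g_def)
      then have "\<lfloor>of_nat m * frac (a t1 i)\<rfloor> = \<lfloor>of_nat m * frac (a t2 i)\<rfloor>" by (simp add: nat_eq_iff)
      then have "\<bar>of_nat m * frac (a t2 i) - of_nat m * frac (a t1 i)\<bar> < 1" by linarith
      then have "of_nat m * \<bar>frac (a t2 i) - frac (a t1 i)\<bar> < 1"
        by (simp add: abs_mult right_diff_distrib[symmetric])
      then have "\<bar>frac (a t2 i) - frac (a t1 i)\<bar> \<le> 1 / of_nat m" using m0 by (simp add: field_simps)
      then have "of_int D * \<bar>frac (a t2 i) - frac (a t1 i)\<bar> \<le> of_int D * (1 / of_nat m)"
        using D by (intro mult_left_mono) auto
      then show ?thesis unfolding c using D by (simp add: abs_mult)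
    qed
    let ?q = "structure_bound * (of_int D / of_nat m)"
    have q0: "0 \<le> ?q" using sb D by simp
    have fq: "fact kdim * ?q < 1" using m m0 by (simp add: field_simps)
    \<comment> \<open>The norm bound contains the \<open>kdim\<close>-th power of \<open>?q\<close>;
      as \<open>?q\<close> is at most 1, the power is at most \<open>?q\<close>, for which
      \<open>m\<close> was chosen.\<close>
    have "?q \<le> fact kdim * ?q" using q0 fact_ge_1[of kdim] by (metis mult_right_mono mult_1)
    then have "?q \<le> 1" using fq by linarith
    then have "?q ^ kdim \<le> ?q ^ 1" using q0 kdim_pos by (intro power_decreasing) auto
    then have "?q ^ kdim \<le> ?q" by (simp only: power_one_right)
    then have "fact kdim * ?q ^ kdim \<le> fact kdim * ?q" by (rule mult_left_mono) simp
    then have "\<bar>field_norm (of_nat (t2 - t1) * \<gamma> - \<omega>)\<bar> < 1" using field_norm_bound[OF coord] fq by linarith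
    then show ?thesis using t \<omega> by (intro exI[of _ "t2 - t1"] exI[of _ \<omega>]) auto
  qed
  then show ?thesis using T by blast
qed

end

section \<open>Ideals of the ring of integers\<close>

abbreviation ideal_mult :: "'k::field_char_0 set \<Rightarrow> 'k set \<Rightarrow> 'k set" (infixl "\<diamondop>" 70) where
  "I \<diamondop> J \<equiv> ideal_prod ring_of_type_algebra I J"

abbreviation Int_ring :: "'k::field_char_0 set" ("\<O>") where
  "\<O> \<equiv> {x. algebraic_int x}"

text \<open>Modules over the ring of integers inside the field; ideals, fractional ideals and
  principal modules are all instances. As products are formed in the field, one product serves them
  all.\<close>

definition Omod :: "'k::field_char_0 set \<Rightarrow> bool" where
  "Omod I \<longleftrightarrow> 0 \<in> I \<and> (\<forall>x\<in>I. \<forall>y\<in>I. x + y \<in> I) \<and> (\<forall>a\<in>\<O>. \<forall>x\<in>I. a * x \<in> I)"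

definition nzideal :: "'k::field_char_0 set \<Rightarrow> bool" where
  "nzideal I \<longleftrightarrow> Omod I \<and> I \<subseteq> \<O> \<and> I \<noteq> {0}"

lemma OmodD:
  assumes "Omod I"
  shows "0 \<in> I" "x \<in> I \<Longrightarrow> y \<in> I \<Longrightarrow> x + y \<in> I" "algebraic_int a \<Longrightarrow> x \<in> I \<Longrightarrow> a * x \<in> I"
  using assms by (auto simp: Omod_def)

lemma Omod_diff: assumes "Omod I" "x \<in> I" "y \<in> I" shows "x - y \<in> I"
proof -
  have "(- 1) * y \<in> I" using OmodD(3)[OF assms(1) _ assms(3), of "- 1"] algebraic_int_of_int[of "- 1"] by simp
  then have "x + (- 1) * y \<in> I" by (rule OmodD(2)[OF assms(1,2)])
  then show ?thesis by simp
qed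

lemma Omod_sum: "Omod I \<Longrightarrow> (\<And>i. i \<in> A \<Longrightarrow> f i \<in> I) \<Longrightarrow> sum f A \<in> I"
  by (induction A rule: infinite_finite_induct) (auto simp: OmodD)

lemma nzidealD: assumes "nzideal I" shows "Omod I" "I \<subseteq> \<O>" "x \<in> I \<Longrightarrow> algebraic_int x" "\<exists>x\<in>I. x \<noteq> 0"
  using assms OmodD(1)[of I] by (auto simp: nzideal_def)

lemma algebraic_int_1 [simp]: "algebraic_int (1 :: 'k::field_char_0)"
  using algebraic_int_of_int[of 1] by simp

lemma algebraic_int_of_nat [simp]: "algebraic_int (of_nat m :: 'k::field_char_0)"
  using algebraic_int_of_int[of "int m"] by simp

lemma Omod_ring: "Omod \<O>"
  by (auto simp: Omod_def intro: algebraic_int_add algebraic_int_mult)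

lemma nzideal_ring: "nzideal (\<O> :: 'k::field_char_0 set)"
proof -
  have "(1 :: 'k) \<in> \<O>" by simp
  then have "\<O> \<noteq> {0 :: 'k}" by (metis singletonD one_neq_zero)
  then show ?thesis using Omod_ring by (simp add: nzideal_def)
qed

lemma ideal_mult_prod: "i \<in> I \<Longrightarrow> j \<in> J \<Longrightarrow> i * j \<in> I \<diamondop> J"
  using ideal_prod.prod[of i I j J ring_of_type_algebra] by simp

lemma ideal_mult_add: "x \<in> I \<diamondop> J \<Longrightarrow> y \<in> I \<diamondop> J \<Longrightarrow> x + y \<in> I \<diamondop> J"
  using ideal_prod.sum[of x ring_of_type_algebra I J y] by simp

lemma ideal_mult_subset:
  assumes "\<And>i j. i \<in> I \<Longrightarrow> j \<in> J \<Longrightarrow> i * j \<in> S" "\<And>x y. x \<in> S \<Longrightarrow> y \<in> S \<Longrightarrow> x + y \<in> S"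
  shows "I \<diamondop> J \<subseteq> S"
proof
  fix x assume "x \<in> I \<diamondop> J" then show "x \<in> S" by (induction rule: ideal_prod.induct) (auto simp: assms)
qed

lemma ideal_mult_subset_Omod: "(\<And>i j. i \<in> I \<Longrightarrow> j \<in> J \<Longrightarrow> i * j \<in> S) \<Longrightarrow> Omod S \<Longrightarrow> I \<diamondop> J \<subseteq> S"
  using ideal_mult_subset OmodD(2) by metis

lemma ideal_mult_mono: "I \<subseteq> I' \<Longrightarrow> J \<subseteq> J' \<Longrightarrow> I \<diamondop> J \<subseteq> I' \<diamondop> J'"
  by (rule ideal_mult_subset) (auto intro: ideal_mult_prod ideal_mult_add)

lemma ideal_mult_commute: "I \<diamondop> J = J \<diamondop> I"
proof -
  have "I \<diamondop> J \<subseteq> J \<diamondop> I" for I J :: "'a set"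
    by (rule ideal_mult_subset) (metis ideal_mult_prod mult.commute, rule ideal_mult_add)
  then show ?thesis by blast
qed

lemma ideal_mult_closed_left: assumes "\<And>i. i \<in> I \<Longrightarrow> c * i \<in> I'" "x \<in> I \<diamondop> J" shows "c * x \<in> I' \<diamondop> J"
  using assms(2)
proof (induction rule: ideal_prod.induct)
  case (prod i j)
  then show ?case using ideal_mult_prod[OF assms(1)[OF prod(1)] prod(2)] by (simp add: mult.assoc)
next
  case (sum s1 s2)
  then show ?case using ideal_mult_add by (simp add: distrib_left)
qed

lemma ideal_mult_assoc: "(I \<diamondop> J) \<diamondop> K = I \<diamondop> (J \<diamondop> K)"
proof -
  have *: "(I \<diamondop> J) \<diamondop> K \<subseteq> I \<diamondop> (J \<diamondop> K)" for I J K :: "'a set"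
  proof (rule ideal_mult_subset)
    fix x k assume "x \<in> I \<diamondop> J" "k \<in> K"
    then show "x * k \<in> I \<diamondop> (J \<diamondop> K)"
    proof (induction rule: ideal_prod.induct)
      case (prod i j)
      then show ?case using ideal_mult_prod[of i I "j * k" "J \<diamondop> K"] ideal_mult_prod[of j J k K] by (simp add: mult.assoc)
    next
      case (sum s1 s2)
      then show ?case using ideal_mult_add by (simp add: distrib_right)
    qed
  qed (rule ideal_mult_add)
  have "I \<diamondop> (J \<diamondop> K) = (K \<diamondop> J) \<diamondop> I" by (simp only: ideal_mult_commute)
  also have "\<dots> \<subseteq> K \<diamondop> (J \<diamondop> I)" by (rule *)
  also have "\<dots> = (I \<diamondop> J) \<diamondop> K" by (simp only: ideal_mult_commute)
  finally show ?thesis using *[of I J K] by blast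
qed

lemma Omod_ideal_mult:
  fixes I J :: "'k::field_char_0 set"
  assumes "Omod I" "Omod J" shows "Omod (I \<diamondop> J)"
  unfolding Omod_def
proof (intro conjI ballI)
  show "0 \<in> I \<diamondop> J" using ideal_mult_prod[OF OmodD(1)[OF assms(1)] OmodD(1)[OF assms(2)]] by simp
  fix a x :: 'k assume "a \<in> \<O>" "x \<in> I \<diamondop> J" then show "a * x \<in> I \<diamondop> J"
    by (intro ideal_mult_closed_left) (auto intro: OmodD(3)[OF assms(1)])
qed (rule ideal_mult_add)

lemma ideal_mult_ring: assumes "Omod I" shows "\<O> \<diamondop> I = I" "I \<diamondop> \<O> = I"
proof -
  show "\<O> \<diamondop> I = I"
  proof
    show "\<O> \<diamondop> I \<subseteq> I" by (rule ideal_mult_subset_Omod[OF _ assms]) (auto intro: OmodD(3)[OF assms])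
    show "I \<subseteq> \<O> \<diamondop> I" using ideal_mult_prod[of 1 \<O>] by auto
  qed
  then show "I \<diamondop> \<O> = I" by (simp only: ideal_mult_commute)
qed

lemma ideal_mult_nonzero: assumes "i \<in> I" "i \<noteq> 0" "j \<in> J" "j \<noteq> 0" shows "I \<diamondop> J \<noteq> {0}"
proof -
  have "i * j \<in> I \<diamondop> J" using assms by (intro ideal_mult_prod)
  moreover have "i * j \<noteq> 0" using assms by simp
  ultimately show ?thesis by blast
qed

lemma nzideal_mult: assumes "nzideal I" "nzideal J" shows "nzideal (I \<diamondop> J)"
proof -
  obtain i j where "i \<in> I" "i \<noteq> 0" "j \<in> J" "j \<noteq> 0" using nzidealD(4) assms by meson
  then have "I \<diamondop> J \<noteq> {0}" by (rule ideal_mult_nonzero)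
  moreover have "I \<diamondop> J \<subseteq> \<O>"
    by (rule ideal_mult_subset_Omod[OF _ Omod_ring]) (use nzidealD(3)[OF assms(1)] nzidealD(3)[OF assms(2)] algebraic_int_mult in blast)
  ultimately show ?thesis using assms Omod_ideal_mult by (auto simp: nzideal_def)
qed

lemma scale_ideal_mult: "((*) c ` I) \<diamondop> J = (*) c ` (I \<diamondop> J)"
proof
  show "((*) c ` I) \<diamondop> J \<subseteq> (*) c ` (I \<diamondop> J)"
  proof (rule ideal_mult_subset)
    fix i j assume "i \<in> (*) c ` I" "j \<in> J"
    then obtain k where "k \<in> I" "i = c * k" by blast
    then show "i * j \<in> (*) c ` (I \<diamondop> J)" using ideal_mult_prod[OF \<open>k \<in> I\<close> \<open>j \<in> J\<close>] by (auto simp: mult.assoc)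
  next
    fix x y assume "x \<in> (*) c ` (I \<diamondop> J)" "y \<in> (*) c ` (I \<diamondop> J)"
    then obtain x' y' where "x' \<in> I \<diamondop> J" "x = c * x'" "y' \<in> I \<diamondop> J" "y = c * y'" by blast
    then show "x + y \<in> (*) c ` (I \<diamondop> J)" using ideal_mult_add by (metis distrib_left imageI)
  qed
  show "(*) c ` (I \<diamondop> J) \<subseteq> ((*) c ` I) \<diamondop> J" using ideal_mult_closed_left[of I c "(*) c ` I"] by blast
qed

lemma Omod_scale:
  fixes I :: "'k::field_char_0 set"
  assumes "Omod I" shows "Omod ((*) c ` I)"
  unfolding Omod_def
proof (intro conjI ballI)
  show "0 \<in> (*) c ` I" using OmodD(1)[OF assms] by (auto intro!: image_eqI[of _ _ 0])
  fix x y assume "x \<in> (*) c ` I" "y \<in> (*) c ` I"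
  then show "x + y \<in> (*) c ` I" using OmodD(2)[OF assms] by (auto simp flip: distrib_left)
next
  fix a x :: 'k assume "a \<in> \<O>" "x \<in> (*) c ` I"
  then show "a * x \<in> (*) c ` I" using OmodD(3)[OF assms] by (auto simp: mult.left_commute)
qed

lemma scale_inverse: "c \<noteq> 0 \<Longrightarrow> (*) (inverse c) ` ((*) c ` I) = (I :: 'k::field_char_0 set)"
  by (auto simp: image_image mult.assoc[symmetric])

lemma nzideal_contains_nat: assumes "nzideal I" shows "\<exists>m>0. of_nat m \<in> I"
proof -
  obtain x where x: "x \<in> I" "x \<noteq> 0" using nzidealD(4)[OF assms] by blast
  obtain m b where m: "m > 0" "algebraic_int b" "of_nat m = x * b"
    using algebraic_int_divides_integer[OF nzidealD(3)[OF assms x(1)] x(2)] by blast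
  have "of_nat m \<in> I" using OmodD(3)[OF nzidealD(1)[OF assms] m(2) x(1)] m(3) by (simp add: mult.commute)
  then show ?thesis using m(1) by blast
qed

lemma Omod_generated_mult_subset:
  assumes "Omod C" "Omod J" "finite F" "\<And>x. x \<in> J \<Longrightarrow> \<exists>c. (\<forall>f. algebraic_int (c f)) \<and> x = (\<Sum>f\<in>F. c f * f)"
  shows "C \<diamondop> J \<subseteq> {\<Sum>f\<in>F. c f * f | c. \<forall>f. c f \<in> C}"
proof (rule ideal_mult_subset)
  fix i j assume i: "i \<in> C" and j: "j \<in> J"
  obtain c where c: "\<And>f. algebraic_int (c f)" "j = (\<Sum>f\<in>F. c f * f)" using assms(4)[OF j] by blast
  have "i * j = (\<Sum>f\<in>F. (c f * i) * f)" by (simp add: c sum_distrib_left ac_simps)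
  moreover have "c f * i \<in> C" for f using OmodD(3)[OF assms(1) c(1) i] .
  ultimately show "i * j \<in> {\<Sum>f\<in>F. c f * f | c. \<forall>f. c f \<in> C}"
    by (intro CollectI exI[of _ "\<lambda>f. c f * i"]) simp
next
  fix x y assume "x \<in> {\<Sum>f\<in>F. c f * f | c. \<forall>f. c f \<in> C}" "y \<in> {\<Sum>f\<in>F. c f * f | c. \<forall>f. c f \<in> C}"
  then obtain c d where "x = (\<Sum>f\<in>F. c f * f)" "y = (\<Sum>f\<in>F. d f * f)" "\<And>f. c f \<in> C" "\<And>f. d f \<in> C" by blast
  then have "x + y = (\<Sum>f\<in>F. (c f + d f) * f)" "\<And>f. c f + d f \<in> C"
    using OmodD(2)[OF assms(1)] by (auto simp: distrib_right sum.distrib)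
  then show "x + y \<in> {\<Sum>f\<in>F. c f * f | c. \<forall>f. c f \<in> C}"
    by (intro CollectI exI[of _ "\<lambda>f. c f + d f"]) simp
qed

text \<open>Elimination in place of determinants. A factor \<open>u\<close> congruent to 1 modulo
  \<open>C\<close> multiplies all relations; to remove the generator \<open>h\<close> one multiplies
  by \<open>u - c h\<close>, again congruent to 1, and substitutes. The factor found for the
  remaining generators, times \<open>u - c h\<close>, kills \<open>h\<close> as well.\<close>

lemma nakayama_elimination:
  fixes C :: "'k::field_char_0 set"
  assumes C: "Omod C" "C \<subseteq> \<O>" and F: "finite F"
    and u: "u - 1 \<in> C" "\<And>f. f \<in> F \<Longrightarrow> \<exists>c. (\<forall>g. c g \<in> C) \<and> u * f = (\<Sum>g\<in>F. c g * g)"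
  shows "\<exists>u. u - 1 \<in> C \<and> (\<forall>f\<in>F. u * f = 0)"
  using F u
proof (induction F arbitrary: u rule: finite_induct)
  case empty then show ?case by blast
next
  case (insert h F)
  have mult: "a * b - 1 \<in> C" if "a - 1 \<in> C" "b - 1 \<in> C" for a b
  proof -
    have "algebraic_int (b - 1)" using C(2) that by blast
    then have "(b - 1) * (a - 1) \<in> C" using OmodD(3)[OF C(1)] that by blast
    then have "(b - 1) * (a - 1) + (a - 1) + (b - 1) \<in> C" using that OmodD(2)[OF C(1)] by blast
    then show ?thesis by (simp add: algebra_simps)
  qed
  have int: "algebraic_int a" if "a - 1 \<in> C" for a
    using algebraic_int_add[of "a - 1" 1] C(2) that by auto
  obtain c where c: "\<And>g. c g \<in> C" "u * h = (\<Sum>g\<in>insert h F. c g * g)" using insert.prems(2)[of h] by auto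
  have ch: "(u - c h) * h = (\<Sum>g\<in>F. c g * g)" using c(2) insert.hyps by (simp add: algebra_simps)
  have w1: "(u - c h) - 1 \<in> C" using Omod_diff[OF C(1) insert.prems(1) c(1)[of h]] by (simp add: algebra_simps)
  let ?w = "(u - c h) * u"
  have "\<exists>d. (\<forall>g. d g \<in> C) \<and> ?w * f = (\<Sum>g\<in>F. d g * g)" if f: "f \<in> F" for f
  proof -
    obtain d where d: "\<And>g. d g \<in> C" "u * f = (\<Sum>g\<in>insert h F. d g * g)" using insert.prems(2)[of f] f by auto
    have "?w * f = (u - c h) * (d h * h + (\<Sum>g\<in>F. d g * g))" using d(2) insert.hyps by (simp add: mult.assoc)
    also have "\<dots> = d h * ((u - c h) * h) + (\<Sum>g\<in>F. (u - c h) * d g * g)"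
      by (simp add: distrib_left sum_distrib_left mult.assoc mult.left_commute)
    also have "\<dots> = (\<Sum>g\<in>F. (d h * c g + (u - c h) * d g) * g)"
      unfolding ch by (simp add: distrib_right sum.distrib sum_distrib_left mult.assoc)
    finally have "?w * f = (\<Sum>g\<in>F. (d h * c g + (u - c h) * d g) * g)" .
    moreover have "d h * c g + (u - c h) * d g \<in> C" for g
      by (rule OmodD(2)[OF C(1)]; rule OmodD(3)[OF C(1)]) (use C(2) c d int[OF w1] in auto)
    ultimately show ?thesis by (intro exI[of _ "\<lambda>g. d h * c g + (u - c h) * d g"]) auto
  qed
  then obtain z where z: "z - 1 \<in> C" "\<forall>f\<in>F. z * f = 0" using insert.IH[OF mult[OF w1 insert.prems(1)]] by blast
  have "z * (u - c h) * h = (\<Sum>g\<in>F. c g * (z * g))"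
    using ch by (simp add: mult.assoc sum_distrib_left mult.left_commute)
  then have "z * (u - c h) * h = 0" using z(2) by simp
  moreover have "z * (u - c h) * f = 0" if "f \<in> F" for f
  proof -
    have "z * (u - c h) * f = (u - c h) * (z * f)" by (simp add: ac_simps)
    then show ?thesis using z(2) that by (metis mult_zero_right)
  qed
  ultimately have "\<forall>f\<in>insert h F. z * (u - c h) * f = 0" by blast
  then show ?case using mult[OF z(1) w1] by blast
qed

section \<open>Finite residue rings, Nakayama's lemma and inverses of ideals\<close>

context numfield begin

text \<open>Independence of the images modulo \<open>p\<close> over the field with \<open>p\<close>
  elements, stated with integer coefficients.\<close>

definition p_independent :: "nat \<Rightarrow> 'k set \<Rightarrow> bool" where
  "p_independent p Z \<longleftrightarrow> finite Z \<and> Z \<subseteq> \<O> \<and>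
     (\<forall>c :: 'k \<Rightarrow> int. (\<exists>y. algebraic_int y \<and> (\<Sum>x\<in>Z. of_int (c x) * x) = of_nat p * y) \<longrightarrow> (\<forall>x\<in>Z. int p dvd c x))"

text \<open>A rational relation, cleared of denominators, has coefficients divisible by every power
  of \<open>p\<close>, so it is trivial. Hence such sets are also independent over the rationals and
  bounded by the degree.\<close>

lemma p_independent_card:
  assumes p: "p \<ge> 2" and Z: "p_independent p Z"
  shows "card Z \<le> kdim"
proof -
  have fin: "finite Z" using Z by (simp add: p_independent_def)
  have dvd: "(\<Sum>x\<in>Z. of_int (c x) * x) = 0 \<Longrightarrow> \<forall>x\<in>Z. int p ^ k dvd c x" for c :: "'k \<Rightarrow> int" and k
  proof (induction k arbitrary: c)
    case (Suc k)
    have "(\<Sum>x\<in>Z. of_int (c x) * x) = of_nat p * 0" using Suc.prems by simp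
    then have "\<forall>x\<in>Z. int p dvd c x" using Z unfolding p_independent_def by (metis algebraic_int_0)
    then have "\<forall>x. \<exists>d. x \<in> Z \<longrightarrow> c x = int p * d" by (auto simp: dvd_def)
    then obtain d where d: "\<And>x. x \<in> Z \<Longrightarrow> c x = int p * d x" by metis
    have "(\<Sum>x\<in>Z. of_int (c x) * x) = of_nat p * (\<Sum>x\<in>Z. of_int (d x) * x)"
      by (simp add: d sum_distrib_left mult.assoc)
    then have "(\<Sum>x\<in>Z. of_int (d x) * x) = 0" using Suc.prems p by simp
    then show ?case using Suc.IH d by simp
  qed simp
  have "\<not> Q.dependent Z"
  proof
    assume "Q.dependent Z"
    then obtain u v where u: "v \<in> Z" "u v \<noteq> 0" "(\<Sum>x\<in>Z. of_rat (u x) * x) = 0"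
      using Q.dependent_finite[OF fin] by auto
    obtain D :: int where D: "D > 0" "\<forall>x\<in>Z. of_int D * u x \<in> \<int>" using common_denominator[OF fin] by blast
    define c where "c x = \<lfloor>of_int D * u x\<rfloor>" for x
    have c: "of_int (c x) = of_int D * u x" if "x \<in> Z" for x
      using D(2) that by (auto simp: c_def elim!: Ints_cases)
    have c': "(of_int (c x) :: 'k) = of_int D * of_rat (u x)" if "x \<in> Z" for x
      using arg_cong[OF c[OF that], of "of_rat :: rat \<Rightarrow> 'k"] by (simp add: of_rat_mult)
    have "(\<Sum>x\<in>Z. of_int (c x) * x) = of_int D * (\<Sum>x\<in>Z. of_rat (u x) * x)"
      by (simp add: c' sum_distrib_left mult.assoc)
    then have "\<And>k. int p ^ k dvd c v" using dvd u by auto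
    then have "c v = 0" using all_powers_dvd_imp_0[of "int p" "c v"] p by simp
    then show False using c[OF u(1)] u(2) D(1) by simp
  qed
  then show ?thesis using Q.independent_span_bound[OF basis(1), of Z] basis(3) by (simp add: kdim_def)
qed

text \<open>Finiteness modulo \<open>p\<close> without an integral basis: a maximal
  \<open>p\<close>-independent set spans modulo \<open>p\<close>, and the coefficients can be
  reduced to the range below \<open>p\<close>.\<close>

lemma residues_prime:
  assumes p: "Factorial_Ring.prime p"
  shows "\<exists>S. finite S \<and> S \<subseteq> \<O> \<and> (\<forall>x\<in>\<O>. \<exists>s\<in>S. \<exists>y\<in>\<O>. x = s + of_nat p * (y :: 'k))"
proof -
  have p2: "p \<ge> 2" using p prime_ge_2_nat by blast
  have "p_independent p {}" by (simp add: p_independent_def)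
  then obtain Z where Z: "p_independent p Z" and max: "\<And>Y. p_independent p Y \<Longrightarrow> card Y \<le> card Z"
    using ex_has_greatest_nat[of "p_independent p" "{}" card "Suc kdim"] p_independent_card[OF p2] by (auto simp: less_Suc_eq_le)
  have fin: "finite Z" and XO: "Z \<subseteq> \<O>" using Z by (auto simp: p_independent_def)
  define S where "S = (\<lambda>c. \<Sum>x\<in>Z. of_int (c x) * x) ` (Z \<rightarrow>\<^sub>E {0..<int p})"
  have SI: "\<exists>s\<in>S. \<exists>y\<in>\<O>. (\<Sum>x\<in>Z. of_int (c x) * x) = s + of_nat p * y" for c :: "'k \<Rightarrow> int"
  proof (intro bexI)
    show "(\<Sum>x\<in>Z. of_int ((\<lambda>x\<in>Z. c x mod int p) x) * x) \<in> S"
      unfolding S_def using p2 by (intro imageI) auto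
    show "(\<Sum>x\<in>Z. of_int (c x div int p) * x) \<in> \<O>"
      using XO by (auto intro!: algebraic_int_sum algebraic_int_mult algebraic_int_of_int)
    have "(of_int (c x) :: 'k) = of_int (c x mod int p) + of_nat p * of_int (c x div int p)" for x
      by (metis mod_mult_div_eq of_int_add of_int_mult of_int_of_nat_eq)
    then show "(\<Sum>x\<in>Z. of_int (c x) * x) = (\<Sum>x\<in>Z. of_int ((\<lambda>x\<in>Z. c x mod int p) x) * x) + of_nat p * (\<Sum>x\<in>Z. of_int (c x div int p) * x)"
      by (simp add: distrib_right sum.distrib sum_distrib_left mult.assoc)
  qed
  have main: "\<exists>s\<in>S. \<exists>y\<in>\<O>. z = s + of_nat p * y" if z: "z \<in> \<O>" for z
  proof (cases "z \<in> Z")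
    case True
    have "(\<Sum>x\<in>Z. of_int (if x = z then 1 else 0) * x) = z"
      using True fin by (simp add: if_distrib[of of_int] if_distrib[of "\<lambda>x. x * _"] cong: if_cong)
    then show ?thesis using SI[of "\<lambda>x. if x = z then 1 else 0"] by simp
  next
    case False
    have "\<not> p_independent p (insert z Z)" using max[of "insert z Z"] fin False by auto
    then obtain c y x where c: "algebraic_int y" "(\<Sum>x\<in>insert z Z. of_int (c x) * x) = of_nat p * y"
        "x \<in> insert z Z" "\<not> int p dvd c x"
      using fin XO z unfolding p_independent_def by auto
    have s: "of_int (c z) * z + (\<Sum>x\<in>Z. of_int (c x) * x) = of_nat p * y" using c(2) fin False by simp
    \<comment> \<open>If \<open>p\<close> divided \<open>c z\<close>, moving that term to the right
      would give a relation on \<open>Z\<close> alone. So \<open>c z\<close> is invertible modulo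
      \<open>p\<close>, and the relation can be solved for \<open>z\<close>.\<close>
    have "\<not> int p dvd c z"
    proof
      assume "int p dvd c z"
      then obtain d where d: "c z = int p * d" by (auto simp: dvd_def)
      have "(\<Sum>x\<in>Z. of_int (c x) * x) = of_nat p * (y - of_int d * z)" using s d by (simp add: algebra_simps)
      moreover have "algebraic_int (y - of_int d * z)"
        using c(1) z by (auto intro!: algebraic_int_diff algebraic_int_mult algebraic_int_of_int)
      ultimately have "\<forall>x\<in>Z. int p dvd c x" using Z unfolding p_independent_def by blast
      then show False using c(3,4) \<open>int p dvd c z\<close> by auto
    qed
    moreover have "Factorial_Ring.prime (int p)" using p by simp
    ultimately have "coprime (int p) (c z)" by (simp add: prime_imp_coprime)
    then obtain a b where ab: "a * int p + b * c z = 1" using bezout_int[of "int p" "c z"] by auto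
    obtain s' y' where s': "s' \<in> S" "y' \<in> \<O>" "(\<Sum>x\<in>Z. of_int (- b * c x) * x) = s' + of_nat p * y'" using SI[of "\<lambda>x. - b * c x"] by blast
    have b_sum: "(\<Sum>x\<in>Z. of_int (- b * c x) * x) = - of_int b * (\<Sum>x\<in>Z. of_int (c x) * x)"
      by (simp add: sum_distrib_left mult.assoc sum_negf)
    have "z = of_int (a * int p + b * c z) * z" using ab by simp
    also have "\<dots> = of_nat p * (of_int a * z) + of_int b * (of_int (c z) * z)" by (simp add: algebra_simps)
    also have "of_int (c z) * z = of_nat p * y - (\<Sum>x\<in>Z. of_int (c x) * x)" using s by (simp add: algebra_simps)
    finally have "z = of_nat p * (of_int a * z + of_int b * y) + (\<Sum>x\<in>Z. of_int (- b * c x) * x)"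
      unfolding b_sum by (simp add: algebra_simps)
    then have "z = s' + of_nat p * (of_int a * z + of_int b * y + y')" unfolding s'(3) by (simp add: algebra_simps)
    moreover have "algebraic_int (of_int a * z + of_int b * y + y')"
      using z c(1) s'(2) by (auto intro!: algebraic_int_add algebraic_int_mult algebraic_int_of_int)
    ultimately show ?thesis using s'(1) by blast
  qed
  have finS: "finite S" unfolding S_def using fin by (intro finite_imageI finite_PiE) auto
  have SO: "S \<subseteq> \<O>" unfolding S_def using XO
    by (auto intro!: algebraic_int_sum algebraic_int_mult algebraic_int_of_int)
  show ?thesis by (intro exI[of _ S] conjI ballI finS SO main)
qed

text \<open>Residue systems for the prime factors are combined like digits.\<close>

lemma residues:
  assumes "m > 0"
  shows "\<exists>S. finite S \<and> S \<subseteq> \<O> \<and> (\<forall>x\<in>\<O>. \<exists>s\<in>S. \<exists>y\<in>\<O>. x = s + of_nat m * (y :: 'k))"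
  using assms
proof (induction m rule: less_induct)
  case (less m)
  show ?case
  proof (cases "m = 1")
    case True
    then show ?thesis by (intro exI[of _ "{0}"]) auto
  next
    case False
    then obtain p where p: "Factorial_Ring.prime p" "p dvd m" using prime_factor_nat by blast
    then obtain m' where m': "m = p * m'" by blast
    have "m' < m" "m' > 0" using m' less.prems prime_gt_1_nat[OF p(1)] by auto
    from less.IH[OF this] obtain S' where S': "finite S'" "S' \<subseteq> \<O>" "\<forall>x\<in>\<O>. \<exists>s\<in>S'. \<exists>y\<in>\<O>. x = s + of_nat m' * (y :: 'k)"
      by (elim exE conjE) (rule that)
    obtain S :: "'k set" where S: "finite S" "S \<subseteq> \<O>" "\<forall>x\<in>\<O>. \<exists>s\<in>S. \<exists>y\<in>\<O>. x = s + of_nat p * y"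
      using residues_prime[OF p(1)] by (elim exE conjE) (rule that)
    let ?T = "(\<lambda>(s, s'). s + of_nat p * s') ` (S \<times> S')"
    have "\<exists>t\<in>?T. \<exists>y\<in>\<O>. x = t + of_nat m * y" if x: "x \<in> \<O>" for x
    proof -
      obtain s y where sy: "s \<in> S" "y \<in> \<O>" "x = s + of_nat p * y" using S(3) x by blast
      obtain s' y' where sy': "s' \<in> S'" "y' \<in> \<O>" "y = s' + of_nat m' * y'" using S'(3) sy(2) by blast
      have "x = (s + of_nat p * s') + of_nat m * y'" using sy(3) sy'(3) m' by (simp add: algebra_simps)
      moreover have "s + of_nat p * s' \<in> ?T" using sy(1) sy'(1) by (intro image_eqI[of _ _ "(s, s')"]) auto
      ultimately show ?thesis using sy'(2) by blast
    qed
    moreover have "?T \<subseteq> \<O>" using S(2) S'(2) by (auto intro!: algebraic_int_add algebraic_int_mult)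
    ultimately show ?thesis using S(1) S'(1) by (intro exI[of _ ?T]) auto
  qed
qed

text \<open>Such an ideal is determined by the residues modulo \<open>m\<close> that it contains,
  and a finite set of residues suffices.\<close>

lemma finite_ideals_containing:
  assumes m: "m > 0"
  shows "finite {J :: 'k set. Omod J \<and> J \<subseteq> \<O> \<and> of_nat m \<in> J}"
proof -
  obtain S :: "'k set" where S: "finite S" "S \<subseteq> \<O>" "\<forall>x\<in>\<O>. \<exists>s\<in>S. \<exists>y\<in>\<O>. x = s + of_nat m * y"
    using residues[OF m] by (elim exE conjE) (rule that)
  let ?A = "{J :: 'k set. Omod J \<and> J \<subseteq> \<O> \<and> of_nat m \<in> J}"
  have sub: "J \<subseteq> J'" if J: "J \<in> ?A" and J': "J' \<in> ?A" and eq: "J \<inter> S = J' \<inter> S" for J J'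
  proof
    fix x assume x: "x \<in> J"
    then have "x \<in> \<O>" using J by blast
    then obtain s y where sy: "s \<in> S" "y \<in> \<O>" "x = s + of_nat m * y" using S(3) by blast
    have my: "y * of_nat m \<in> J" "y * of_nat m \<in> J'" using OmodD(3) J J' sy(2) by auto
    have "s = x - y * of_nat m" using sy by (simp add: mult.commute)
    then have "s \<in> J" using Omod_diff[OF _ x my(1)] J by simp
    then have "s \<in> J'" using eq sy by blast
    then have "s + y * of_nat m \<in> J'" using OmodD(2) my J' by blast
    then show "x \<in> J'" using sy by (simp add: mult.commute)
  qed
  have "inj_on (\<lambda>J. J \<inter> S) ?A"
  proof (rule inj_onI)
    fix J J' assume a: "J \<in> ?A" "J' \<in> ?A" "J \<inter> S = J' \<inter> S"
    show "J = J'" using sub[OF a] sub[OF a(2,1) a(3)[symmetric]] by (rule equalityI)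
  qed
  then show ?thesis using inj_on_finite[of "\<lambda>J. J \<inter> S" ?A "Pow S"] S(1) by blast
qed

lemma nzideal_finitely_generated:
  assumes J: "nzideal (J :: 'k set)"
  shows "\<exists>F. finite F \<and> F \<subseteq> J \<and> (\<exists>f\<in>F. f \<noteq> 0) \<and>
    (\<forall>x\<in>J. \<exists>c. (\<forall>f. algebraic_int (c f)) \<and> x = (\<Sum>f\<in>F. c f * f))"
proof -
  obtain m where m: "m > 0" "of_nat m \<in> J" using nzideal_contains_nat[OF J] by blast
  obtain S :: "'k set" where S: "finite S" "S \<subseteq> \<O>" "\<forall>x\<in>\<O>. \<exists>s\<in>S. \<exists>y\<in>\<O>. x = s + of_nat m * y"
    using residues[OF m(1)] by (elim exE conjE) (rule that)
  let ?F = "insert (of_nat m) (J \<inter> S)"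
  have "\<exists>c. (\<forall>f. algebraic_int (c f)) \<and> x = (\<Sum>f\<in>?F. c f * f)" if x: "x \<in> J" for x
  proof -
    have "x \<in> \<O>" using nzidealD(2)[OF J] x by blast
    then obtain s y where sy: "s \<in> S" "y \<in> \<O>" "x = s + of_nat m * y" using S(3) by blast
    have "y * of_nat m \<in> J" using OmodD(3)[OF nzidealD(1)[OF J] _ m(2)] sy(2) by simp
    then have "x - y * of_nat m \<in> J" using Omod_diff[OF nzidealD(1)[OF J] x] by blast
    then have s: "s \<in> ?F" using sy by (simp add: mult.commute)
    define c where "c f = (if f = s then 1 else 0) + (if f = of_nat m then y else 0)" for f
    have "(\<Sum>f\<in>?F. c f * f) = (\<Sum>f\<in>?F. (if f = s then f else 0)) + (\<Sum>f\<in>?F. (if f = of_nat m then y * f else 0))"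
      unfolding sum.distrib[symmetric] by (rule sum.cong) (auto simp: c_def distrib_right)
    also have "\<dots> = x"
    proof -
      have "(\<Sum>f\<in>?F. (if f = s then f else 0)) = s" using s S(1) by (subst sum.delta) auto
      moreover have "(\<Sum>f\<in>?F. (if f = of_nat m then y * f else 0)) = y * of_nat m" using S(1) by (subst sum.delta) auto
      ultimately show ?thesis using sy(3) by (simp add: mult.commute)
    qed
    finally have "x = (\<Sum>f\<in>?F. c f * f)" by simp
    moreover have "algebraic_int (c f)" for f using sy(2) by (auto simp: c_def intro!: algebraic_int_add)
    ultimately show ?thesis by blast
  qed
  then show ?thesis using m S(1) by (intro exI[of _ ?F]) auto
qed

text \<open>The factor \<open>u\<close> kills a nonzero element of the field, so it is 0, and
  \<open>u - 1 = - 1\<close> lies in \<open>C\<close>.\<close>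

lemma nakayama:
  assumes C: "Omod C" "C \<subseteq> \<O>" and J: "nzideal (J :: 'k set)" and sub: "J \<subseteq> C \<diamondop> J"
  shows "1 \<in> C"
proof -
  obtain F where F: "finite F" "F \<subseteq> J" "\<exists>f\<in>F. f \<noteq> 0"
      "\<And>x. x \<in> J \<Longrightarrow> \<exists>c. (\<forall>f. algebraic_int (c f)) \<and> x = (\<Sum>f\<in>F. c f * f)"
    using nzideal_finitely_generated[OF J] by blast
  have C_sub: "C \<diamondop> J \<subseteq> {\<Sum>f\<in>F. c f * f | c. \<forall>f. c f \<in> C}"
    by (rule Omod_generated_mult_subset[OF C(1) nzidealD(1)[OF J] F(1) F(4)])
  have "\<exists>c. (\<forall>g. c g \<in> C) \<and> 1 * f = (\<Sum>g\<in>F. c g * g)" if "f \<in> F" for f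
    using C_sub sub F(2) that by (auto dest!: subsetD)
  then obtain u where u: "u - 1 \<in> C" "\<forall>f\<in>F. u * f = 0"
    using nakayama_elimination[OF C F(1), of 1] OmodD(1)[OF C(1)] by auto
  then have "u = 0" using F(3) by auto
  then have "(0 - 1) * (0 - 1) \<in> C" using u(1) OmodD(3)[OF C(1), of "0 - 1"] C(2) by blast
  then show ?thesis by simp
qed

text \<open>Powers of \<open>x\<close> have a common denominator \<open>m\<close>, so two of them agree modulo \<open>m\<close>.\<close>

lemma algebraic_int_if_stabilizes_ideal:
  assumes I: "nzideal (I :: 'k set)" and x: "\<And>a. a \<in> I \<Longrightarrow> x * a \<in> I"
  shows "algebraic_int x"
proof -
  obtain m where m: "m > 0" "of_nat m \<in> I" using nzideal_contains_nat[OF I] by blast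
  have pow: "x ^ k * of_nat m \<in> I" for k
  proof (induction k)
    case (Suc k) then show ?case using x[OF Suc] by (simp add: mult.assoc)
  qed (use m in simp)
  \<comment> \<open>Residues are taken modulo \<open>m * m\<close> because the powers of
    \<open>x\<close> are known to be integral only after multiplication by \<open>m\<close>; one
    factor \<open>m\<close> is cancelled at the end.\<close>
  obtain S :: "'k set" where S: "finite S" "S \<subseteq> \<O>" "\<forall>x\<in>\<O>. \<exists>s\<in>S. \<exists>y\<in>\<O>. x = s + of_nat (m * m) * y"
    using residues[of "m * m"] m(1) by (metis nat_0_less_mult_iff)
  have "\<forall>k. \<exists>s y. s \<in> S \<and> y \<in> \<O> \<and> x ^ k * of_nat m = s + of_nat (m * m) * y"
    using S(3) pow nzidealD(2)[OF I] by blast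
  then obtain s y where sy: "\<And>k. s k \<in> S" "\<And>k. y k \<in> \<O>" "\<And>k. x ^ k * of_nat m = s k + of_nat (m * m) * y k" by metis
  have "\<not> inj s"
  proof
    assume "inj s"
    moreover have "finite (range s)" using finite_subset[OF _ S(1)] sy(1) by blast
    ultimately show False using finite_imageD infinite_UNIV_nat by blast
  qed
  then obtain k l where kl: "l < k" "s k = s l" unfolding inj_def by (metis linorder_neqE_nat)
  have "(x ^ k - x ^ l) * of_nat m = (of_nat m * (y k - y l)) * of_nat m"
    using sy(3)[of k] sy(3)[of l] kl(2) by (simp add: algebra_simps)
  then have "x ^ k - x ^ l = of_nat m * (y k - y l)" using m(1) by simp
  moreover have "algebraic_int (of_nat m * (y k - y l))" using sy(2) by (auto intro!: algebraic_int_mult algebraic_int_diff)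
  ultimately show ?thesis using algebraic_int_of_power_diff[of x k l] kl(1) by simp
qed

text \<open>Let \<open>b\<close> have least norm in \<open>I\<close>. By \<open>hurwitz\<close> some
  \<open>t * a - \<omega> * b\<close> with \<open>t\<close> at most \<open>T\<close> has smaller
  norm, so it is 0; \<open>c = fact T\<close> is a multiple of every such \<open>t\<close> and does
  not depend on \<open>I\<close>.\<close>

lemma almost_principal:
  "\<exists>c>0. \<forall>I :: 'k set. nzideal I \<longrightarrow> (\<exists>b\<in>I. b \<noteq> 0 \<and> (\<forall>a\<in>I. \<exists>\<omega>\<in>\<O>. of_nat c * a = \<omega> * b))"
proof -
  obtain T where T: "T > 0" "\<And>\<gamma>. \<exists>t \<omega>. 1 \<le> t \<and> t \<le> T \<and> algebraic_int \<omega> \<and> \<bar>field_norm (of_nat t * \<gamma> - \<omega>)\<bar> < 1"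
    using hurwitz by blast
  have "\<exists>b\<in>I. b \<noteq> 0 \<and> (\<forall>a\<in>I. \<exists>\<omega>\<in>\<O>. of_nat (fact T) * a = \<omega> * b)" if I: "nzideal I" for I :: "'k set"
  proof -
    define h where "h b = nat \<lfloor>\<bar>field_norm b\<bar>\<rfloor>" for b
    have h: "of_nat (h b) = \<bar>field_norm b\<bar>" if "b \<in> I" for b
    proof -
      have "field_norm b \<in> \<int>" using field_norm_algebraic_int nzidealD(3)[OF I that] by blast
      then obtain z where "field_norm b = of_int z" by (rule Ints_cases)
      then show ?thesis by (simp add: h_def)
    qed
    obtain b where b: "b \<in> I" "b \<noteq> 0" and min: "\<And>b'. b' \<in> I \<Longrightarrow> b' \<noteq> 0 \<Longrightarrow> h b \<le> h b'"
      using ex_has_least_nat[of "\<lambda>b. b \<in> I \<and> b \<noteq> 0" _ h] nzidealD(4)[OF I] by metis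
    have "\<exists>\<omega>\<in>\<O>. of_nat (fact T) * a = \<omega> * b" if a: "a \<in> I" for a
    proof -
      obtain t \<omega> where t: "1 \<le> t" "t \<le> T" "algebraic_int \<omega>" "\<bar>field_norm (of_nat t * (a / b) - \<omega>)\<bar> < 1" using T(2) by blast
      let ?d = "of_nat t * a - \<omega> * b"
      have d: "?d \<in> I" using Omod_diff[OF nzidealD(1)[OF I]] OmodD(3)[OF nzidealD(1)[OF I]] a b t by simp
      have eq: "?d = (of_nat t * (a / b) - \<omega>) * b" using b by (simp add: field_simps)
      have "\<bar>field_norm ?d\<bar> = \<bar>field_norm (of_nat t * (a / b) - \<omega>)\<bar> * \<bar>field_norm b\<bar>" unfolding eq field_norm_mult by (simp add: abs_mult)
      also have "\<dots> < 1 * \<bar>field_norm b\<bar>" using t(4) field_norm_nonzero[OF b(2)] by (intro mult_strict_right_mono) auto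
      finally have "(of_nat (h ?d) :: rat) < of_nat (h b)" using h[OF d] h[OF b(1)] by simp
      then have "h ?d < h b" by simp
      then have "?d = 0" using min[OF d] by (meson not_le)
      then have tb: "of_nat t * a = \<omega> * b" by simp
      have "t dvd fact T" using t by (simp add: dvd_fact)
      then obtain q where q: "fact T = t * q" by blast
      have "of_nat (fact T) * a = (of_nat q * \<omega>) * b"
        unfolding q using tb by (simp add: mult.assoc mult.left_commute)
      moreover have "algebraic_int (of_nat q * \<omega>)" using t(3) by (intro algebraic_int_mult) auto
      ultimately show ?thesis by blast
    qed
    then show ?thesis using b by blast
  qed
  then show ?thesis by (intro exI[of _ "fact T"]) auto
qed

text \<open>Powers as plain sets; \<open>pow_ideals_set\<close> identifies them with the powers that
  occur in \<open>prime_exponent\<close>.\<close>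

primrec ipow :: "'k set \<Rightarrow> nat \<Rightarrow> 'k set" where
  "ipow J 0 = \<O>"
| "ipow J (Suc k) = ipow J k \<diamondop> J"

lemma nzideal_ipow: "nzideal J \<Longrightarrow> nzideal (ipow J k)"
  by (induction k) (auto simp: nzideal_ring intro: nzideal_mult)

lemma ipow_add: "nzideal J \<Longrightarrow> ipow J (i + k) = ipow J i \<diamondop> ipow J k"
proof (induction k)
  case 0 then show ?case using ideal_mult_ring(2)[OF nzidealD(1)[OF nzideal_ipow]] by simp
next
  case (Suc k) then show ?case by (simp add: ideal_mult_assoc)
qed

text \<open>By finiteness of the class number two powers of \<open>J\<close> lie in the same class; Nakayama's lemma
  allows to cancel the smaller one.\<close>

lemma power_principal:
  assumes J: "nzideal (J :: 'k set)"
  shows "\<exists>k x. x \<noteq> 0 \<and> algebraic_int x \<and> ipow J (Suc k) = (*) x ` \<O>"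
proof -
  obtain c where c: "c > 0" "\<And>I :: 'k set. nzideal I \<Longrightarrow> \<exists>b\<in>I. b \<noteq> 0 \<and> (\<forall>a\<in>I. \<exists>\<omega>\<in>\<O>. of_nat c * a = \<omega> * b)"
    using almost_principal by blast
  have "\<forall>i. \<exists>b\<in>ipow J i. b \<noteq> 0 \<and> (\<forall>a\<in>ipow J i. \<exists>\<omega>\<in>\<O>. of_nat c * a = \<omega> * b)"
    using c(2)[OF nzideal_ipow[OF J]] by blast
  then obtain b where b: "\<And>i. b i \<in> ipow J i" "\<And>i. b i \<noteq> 0" "\<And>i a. a \<in> ipow J i \<Longrightarrow> \<exists>\<omega>\<in>\<O>. of_nat c * a = \<omega> * b i" by metis
  \<comment> \<open>An ideal in the class of \<open>ipow J i\<close> that is integral and contains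
    the fixed integer \<open>c\<close>; there are only finitely many of these.\<close>
  define red where "red i = (*) (of_nat c / b i) ` ipow J i" for i
  have red: "red i \<in> {J. Omod J \<and> J \<subseteq> \<O> \<and> of_nat c \<in> J}" for i
  proof (intro CollectI conjI)
    show "Omod (red i)" unfolding red_def by (rule Omod_scale[OF nzidealD(1)[OF nzideal_ipow[OF J]]])
    show "red i \<subseteq> \<O>"
    proof
      fix x assume "x \<in> red i"
      then obtain a where a: "a \<in> ipow J i" "x = of_nat c / b i * a" by (auto simp: red_def)
      obtain \<omega> where "\<omega> \<in> \<O>" "of_nat c * a = \<omega> * b i" using b(3)[OF a(1)] by blast
      then show "x \<in> \<O>" using a(2) b(2)[of i] by (simp add: field_simps)
    qed
    show "of_nat c \<in> red i" unfolding red_def using b(1,2) by (intro image_eqI[of _ _ "b i"]) auto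
  qed
  have "finite (range red)" by (rule finite_subset[OF _ finite_ideals_containing[OF c(1)]]) (use red in blast)
  then have "\<not> inj red" using finite_imageD infinite_UNIV_nat by blast
  then obtain i j where ij: "i < j" "red i = red j" unfolding inj_def by (metis linorder_neqE_nat)
  define A where "A = ipow J i"
  define B where "B = ipow J (j - i)"
  have AI: "nzideal A" and BI: "nzideal B" using nzideal_ipow[OF J] by (auto simp: A_def B_def)
  define x where "x = b j / b i"
  have x0: "x \<noteq> 0" using b(2) by (simp add: x_def)
  have AB: "A \<diamondop> B = (*) x ` A"
  proof -
    have "A \<diamondop> B = ipow J j" using ipow_add[OF J, of i "j - i"] ij by (simp add: A_def B_def)
    also have "\<dots> = (*) (b j / of_nat c) ` red j" unfolding red_def image_image using b(2) c(1) by simp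
    also have "\<dots> = (*) (b j / of_nat c) ` red i" using ij by simp
    also have "\<dots> = (*) x ` A" unfolding red_def image_image A_def x_def using c(1) by simp
    finally show ?thesis .
  qed
  \<comment> \<open>\<open>C\<close> satisfies \<open>C \<diamondop> A = A\<close>. So its elements
    stabilize \<open>A\<close> and are integral, while Nakayama's lemma puts 1 into
    \<open>C\<close>: it is the whole ring, and \<open>B\<close> is principal.\<close>
  define C where "C = (*) (inverse x) ` B"
  have Cmod: "Omod C" unfolding C_def by (rule Omod_scale[OF nzidealD(1)[OF BI]])
  have CA: "C \<diamondop> A = A"
  proof -
    have "C \<diamondop> A = (*) (inverse x) ` (B \<diamondop> A)" unfolding C_def by (rule scale_ideal_mult)
    also have "B \<diamondop> A = (*) x ` A" using AB by (simp only: ideal_mult_commute)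
    finally show ?thesis using scale_inverse[OF x0] by simp
  qed
  have CO: "C \<subseteq> \<O>"
  proof
    fix y assume y: "y \<in> C"
    have "y * a \<in> A" if "a \<in> A" for a using ideal_mult_prod[OF y that] CA by simp
    then show "y \<in> \<O>" using algebraic_int_if_stabilizes_ideal[OF AI] by blast
  qed
  have "1 \<in> C" by (rule nakayama[OF Cmod CO AI]) (simp add: CA)
  then have CO': "C = \<O>" using CO OmodD(3)[OF Cmod, of _ 1] by auto
  have "(*) x ` C = B" unfolding C_def using scale_inverse[of "inverse x" B] x0 by simp
  then have B: "B = (*) x ` \<O>" using CO' by simp
  then have "x \<in> B" by (auto intro!: image_eqI[of _ _ 1])
  then have "algebraic_int x" using nzidealD(3)[OF BI] by blast
  moreover have "Suc (j - i - 1) = j - i" using ij by simp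
  then have "ipow J (Suc (j - i - 1)) = (*) x ` \<O>" using B by (simp only: B_def)
  ultimately show ?thesis using x0 by blast
qed

lemma ideal_inverse:
  assumes J: "nzideal (J :: 'k set)"
  shows "\<exists>J' x. nzideal J' \<and> x \<noteq> 0 \<and> algebraic_int x \<and> J \<diamondop> J' = (*) x ` \<O>"
proof -
  obtain k x where "x \<noteq> 0" "algebraic_int x" "ipow J k \<diamondop> J = (*) x ` \<O>" using power_principal[OF J] by auto
  then show ?thesis using nzideal_ipow[OF J, of k] ideal_mult_commute by blast
qed

end

section \<open>Fractional ideals and valuations\<close>

lemma ring_of_integers_simps [simp]:
  "carrier ring_of_integers = \<O>"
  "x \<otimes>\<^bsub>ring_of_integers\<^esub> y = x * y" "x \<oplus>\<^bsub>ring_of_integers\<^esub> y = x + y"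
  "\<one>\<^bsub>ring_of_integers\<^esub> = 1" "\<zero>\<^bsub>ring_of_integers\<^esub> = 0"
  by (simp_all add: ring_of_integers_def ring_of_type_algebra_def)

lemma cring_ring_of_integers: "cring (ring_of_integers :: 'k::field_char_0 ring)"
proof (rule cringI)
  show "abelian_group (ring_of_integers :: 'k ring)"
  proof (rule abelian_groupI)
    fix x :: 'k assume "x \<in> carrier ring_of_integers"
    then show "\<exists>y\<in>carrier ring_of_integers. y \<oplus>\<^bsub>ring_of_integers\<^esub> x = \<zero>\<^bsub>ring_of_integers\<^esub>"
      by (intro bexI[of _ "- x"]) auto
  qed (auto intro: algebraic_int_add)
  show "comm_monoid (ring_of_integers :: 'k ring)"
    by (rule comm_monoidI) (auto intro: algebraic_int_mult simp: mult.assoc mult.commute)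
qed (simp add: distrib_right)

lemma ideal_prod_ring_of_integers: "ideal_prod ring_of_integers I J = I \<diamondop> J"
proof
  show "ideal_prod ring_of_integers I J \<subseteq> I \<diamondop> J"
  proof
    fix x assume "x \<in> ideal_prod ring_of_integers I J"
    then show "x \<in> I \<diamondop> J"
      by (induction rule: ideal_prod.induct) (auto intro: ideal_mult_prod ideal_mult_add)
  qed
  show "I \<diamondop> J \<subseteq> ideal_prod ring_of_integers I J"
  proof (rule ideal_mult_subset)
    show "i * j \<in> ideal_prod ring_of_integers I J" if "i \<in> I" "j \<in> J" for i j
      using ideal_prod.prod[OF that, of ring_of_integers] by simp
    show "x + y \<in> ideal_prod ring_of_integers I J" if "x \<in> ideal_prod ring_of_integers I J" "y \<in> ideal_prod ring_of_integers I J" for x y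
      using ideal_prod.sum[OF that] by simp
  qed
qed

lemma ideal_ring_of_integers_iff: "ideal I ring_of_integers \<longleftrightarrow> Omod I \<and> I \<subseteq> \<O>"
proof
  assume "ideal I ring_of_integers"
  then interpret ideal I ring_of_integers .
  show "Omod I \<and> I \<subseteq> \<O>"
    using additive_subgroup.zero_closed[OF is_additive_subgroup] additive_subgroup.a_closed[OF is_additive_subgroup]
      I_l_closed a_subset by (auto simp: Omod_def)
next
  assume I: "Omod I \<and> I \<subseteq> \<O>"
  interpret cring "ring_of_integers :: 'a ring" by (rule cring_ring_of_integers)
  show "ideal I ring_of_integers"
  proof (rule idealI)
    show "ring (ring_of_integers :: 'a ring)" by (rule ring_axioms)
    show "subgroup I (add_monoid ring_of_integers)"
    proof (rule add.subgroupI)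
      fix a assume a: "a \<in> I"
      have "\<ominus>\<^bsub>ring_of_integers\<^esub> a = - a" by (rule minus_equality) (use a I in auto)
      moreover have "0 - a \<in> I" using Omod_diff[of I 0 a] OmodD(1)[of I] I a by blast
      ultimately show "\<ominus>\<^bsub>ring_of_integers\<^esub> a \<in> I" by simp
    qed (use I OmodD in auto)
    fix a x :: 'a assume "a \<in> I" "x \<in> carrier ring_of_integers"
    then have "x * a \<in> I" using OmodD(3)[of I x a] I by simp
    then show "x \<otimes>\<^bsub>ring_of_integers\<^esub> a \<in> I" "a \<otimes>\<^bsub>ring_of_integers\<^esub> x \<in> I" by (simp_all add: mult.commute)
  qed
qed

lemma primeideal_iff:
  "P \<in> finite_primes \<longleftrightarrow> nzideal P \<and> 1 \<notin> P \<and> (\<forall>a\<in>\<O>. \<forall>b\<in>\<O>. a * b \<in> P \<longrightarrow> a \<in> P \<or> b \<in> P)"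
proof
  assume "P \<in> finite_primes"
  then have P: "primeideal P ring_of_integers" "P \<noteq> {0}" by (auto simp: finite_primes_def)
  interpret primeideal P ring_of_integers by (rule P(1))
  have id: "Omod P \<and> P \<subseteq> \<O>" using ideal_ring_of_integers_iff is_ideal by blast
  have "1 \<notin> P"
  proof
    assume "1 \<in> P"
    then have "P = \<O>" using id OmodD(3)[of P _ 1] by auto
    then show False using I_notcarr by simp
  qed
  then show "nzideal P \<and> 1 \<notin> P \<and> (\<forall>a\<in>\<O>. \<forall>b\<in>\<O>. a * b \<in> P \<longrightarrow> a \<in> P \<or> b \<in> P)"
    using id P(2) I_prime by (auto simp: nzideal_def)
next
  assume P: "nzideal P \<and> 1 \<notin> P \<and> (\<forall>a\<in>\<O>. \<forall>b\<in>\<O>. a * b \<in> P \<longrightarrow> a \<in> P \<or> b \<in> P)"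
  have "primeideal P ring_of_integers"
  proof (rule primeidealI)
    show "ideal P ring_of_integers" using P by (simp add: ideal_ring_of_integers_iff nzideal_def)
    show "cring (ring_of_integers :: 'a ring)" by (rule cring_ring_of_integers)
    show "carrier ring_of_integers \<noteq> P" using P by auto
  qed (use P in auto)
  then show "P \<in> finite_primes" using P by (simp add: finite_primes_def nzideal_def)
qed

lemma finite_primeD:
  assumes "P \<in> finite_primes"
  shows "nzideal P" "1 \<notin> P" "algebraic_int a \<Longrightarrow> algebraic_int b \<Longrightarrow> a * b \<in> P \<Longrightarrow> a \<in> P \<or> b \<in> P"
  using assms by (auto simp: primeideal_iff)

lemma fractional_ideal_iff:
  "fractional_ideal I \<longleftrightarrow> Omod I \<and> I \<noteq> {0} \<and> (\<exists>d. algebraic_int d \<and> d \<noteq> 0 \<and> (\<forall>x\<in>I. algebraic_int (d * x)))"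
proof
  assume I: "fractional_ideal I"
  then interpret additive_subgroup I "ring_of_type_algebra :: 'a ring" by (simp add: fractional_ideal_def)
  show "Omod I \<and> I \<noteq> {0} \<and> (\<exists>d. algebraic_int d \<and> d \<noteq> 0 \<and> (\<forall>x\<in>I. algebraic_int (d * x)))"
    using I zero_closed a_closed by (auto simp: fractional_ideal_def Omod_def)
next
  assume I: "Omod I \<and> I \<noteq> {0} \<and> (\<exists>d. algebraic_int d \<and> d \<noteq> 0 \<and> (\<forall>x\<in>I. algebraic_int (d * x)))"
  interpret ring "ring_of_type_algebra :: 'a ring" by (rule ring_from_type_algebra)
  have "subgroup I (add_monoid ring_of_type_algebra)"
  proof (rule add.subgroupI)
    fix a assume a: "a \<in> I"
    have "\<ominus>\<^bsub>ring_of_type_algebra\<^esub> a = - a" by (rule minus_equality) (use a in auto)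
    moreover have "0 - a \<in> I" using Omod_diff[of I 0 a] OmodD(1)[of I] I a by blast
    ultimately show "\<ominus>\<^bsub>ring_of_type_algebra\<^esub> a \<in> I" by simp
  qed (use I OmodD in auto)
  then show "fractional_ideal I" using I OmodD(3)[of I] by (auto simp: fractional_ideal_def additive_subgroup_def)
qed

lemma fractional_idealD: "fractional_ideal I \<Longrightarrow> Omod I"
  by (simp add: fractional_ideal_iff)

lemma fractional_ideal_nonzero: "fractional_ideal I \<Longrightarrow> \<exists>x\<in>I. x \<noteq> 0"
  using OmodD(1)[of I] by (auto simp: fractional_ideal_iff)

lemma nzideal_fractional: "nzideal I \<Longrightarrow> fractional_ideal I"
  by (auto simp: fractional_ideal_iff nzideal_def intro!: exI[of _ 1])

lemma nzideal_iff_fractional: "nzideal I \<longleftrightarrow> fractional_ideal I \<and> I \<subseteq> \<O>"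
  using nzideal_fractional by (auto simp: nzideal_def fractional_ideal_iff)

lemma fractional_ideal_scale:
  assumes I: "fractional_ideal I" and c: "c = a / b" "algebraic_int a" "algebraic_int b" "a \<noteq> 0" "b \<noteq> 0"
  shows "fractional_ideal ((*) c ` I)"
proof -
  obtain x where x: "x \<in> I" "x \<noteq> 0" using fractional_ideal_nonzero[OF I] by blast
  obtain d where d: "algebraic_int d" "d \<noteq> 0" "\<And>x. x \<in> I \<Longrightarrow> algebraic_int (d * x)" using I by (auto simp: fractional_ideal_iff)
  have "c * x \<in> (*) c ` I" "c * x \<noteq> 0" using x c by auto
  then have "(*) c ` I \<noteq> {0}" by (metis singletonD)
  moreover have "algebraic_int (b * d * y)" if y: "y \<in> (*) c ` I" for y
  proof -
    obtain z where z: "z \<in> I" "y = c * z" using y by blast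
    have eq: "b * d * y = a * (d * z)" using z c by simp
    show ?thesis unfolding eq by (rule algebraic_int_mult[OF c(2) d(3)[OF z(1)]])
  qed
  moreover have "algebraic_int (b * d)" "b * d \<noteq> 0" using c d algebraic_int_mult by auto
  ultimately show ?thesis using Omod_scale[OF fractional_idealD[OF I]] unfolding fractional_ideal_iff by blast
qed

lemma fractional_ideal_mult: assumes "fractional_ideal I" "fractional_ideal J" shows "fractional_ideal (I \<diamondop> J)"
proof -
  obtain i j where "i \<in> I" "i \<noteq> 0" "j \<in> J" "j \<noteq> 0" using fractional_ideal_nonzero assms by meson
  then have nz: "I \<diamondop> J \<noteq> {0}" by (rule ideal_mult_nonzero)
  obtain d where d: "algebraic_int d" "d \<noteq> 0" "\<And>x. x \<in> I \<Longrightarrow> algebraic_int (d * x)" using assms(1) by (auto simp: fractional_ideal_iff)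
  obtain e where e: "algebraic_int e" "e \<noteq> 0" "\<And>x. x \<in> J \<Longrightarrow> algebraic_int (e * x)" using assms(2) by (auto simp: fractional_ideal_iff)
  have "I \<diamondop> J \<subseteq> {x. algebraic_int (d * e * x)}"
  proof (rule ideal_mult_subset)
    fix i j assume "i \<in> I" "j \<in> J"
    then have "algebraic_int ((d * i) * (e * j))" using d e algebraic_int_mult by blast
    then show "i * j \<in> {x. algebraic_int (d * e * x)}" by (simp add: ac_simps)
  qed (auto simp: distrib_left intro: algebraic_int_add)
  moreover have "algebraic_int (d * e)" "d * e \<noteq> 0" using d e algebraic_int_mult by auto
  ultimately show ?thesis using nz Omod_ideal_mult[OF fractional_idealD fractional_idealD] assms
    unfolding fractional_ideal_iff by blast
qed

abbreviation principal :: "'k::field_char_0 \<Rightarrow> 'k set" where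
  "principal x \<equiv> (*) x ` \<O>"

lemma principal_mult: "principal x \<diamondop> principal y = principal (x * y)"
proof -
  have "principal x \<diamondop> principal y = (*) x ` (\<O> \<diamondop> principal y)" by (rule scale_ideal_mult)
  also have "\<O> \<diamondop> principal y = principal y" by (rule ideal_mult_ring(1)[OF Omod_scale[OF Omod_ring]])
  finally show ?thesis by (simp add: image_image mult.assoc)
qed

lemma principal_self: "x \<in> principal x"
  by (auto intro!: image_eqI[of _ _ 1])

lemma principal_subset_iff: "Omod I \<Longrightarrow> principal x \<subseteq> I \<longleftrightarrow> x \<in> I"
  using principal_self[of x] OmodD(3)[of I _ x] by (auto simp: mult.commute)

lemma Omod_principal: "Omod (principal x)"
  by (rule Omod_scale[OF Omod_ring])

lemma nzideal_principal: assumes "algebraic_int x" "x \<noteq> 0" shows "nzideal (principal x)"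
  using assms Omod_principal principal_self[of x] principal_subset_iff[OF Omod_ring, of x] by (auto simp: nzideal_def)

lemma ideal_mult_left_commute: "I \<diamondop> (J \<diamondop> L) = J \<diamondop> (I \<diamondop> L)"
  by (simp only: ideal_mult_assoc[symmetric] ideal_mult_commute[of I J])

lemmas ideal_mult_ac = ideal_mult_assoc ideal_mult_commute ideal_mult_left_commute

context numfield begin

lemma fractional_scale: "fractional_ideal I \<Longrightarrow> c \<noteq> 0 \<Longrightarrow> fractional_ideal ((*) c ` (I :: 'k set))"
  using fraction[of c] fractional_ideal_scale by (metis div_0)

lemma fractional_principal: "x \<noteq> 0 \<Longrightarrow> fractional_ideal (principal (x :: 'k))"
  by (rule fractional_scale[OF nzideal_fractional[OF nzideal_ring]])

text \<open>Scale to an integral ideal, invert that by \<open>ideal_inverse\<close>, and scale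
  back.\<close>

lemma fractional_inverse_exists:
  assumes I: "fractional_ideal (I :: 'k set)"
  shows "\<exists>I'. fractional_ideal I' \<and> I' \<diamondop> I = \<O>"
proof -
  obtain d where d: "algebraic_int d" "d \<noteq> 0" "\<And>x. x \<in> I \<Longrightarrow> algebraic_int (d * x)" using I by (auto simp: fractional_ideal_iff)
  let ?J = "(*) d ` I"
  have "nzideal ?J" unfolding nzideal_iff_fractional using fractional_scale[OF I d(2)] d(3) by auto
  then obtain J' x where J': "nzideal J'" "x \<noteq> 0" "?J \<diamondop> J' = principal x" using ideal_inverse by blast
  let ?I' = "(*) (d / x) ` J'"
  have "?I' \<diamondop> I = (*) (inverse x) ` ((*) d ` (J' \<diamondop> I))"
    unfolding scale_ideal_mult by (simp add: image_image field_simps)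
  also have "(*) d ` (J' \<diamondop> I) = principal x"
    using J'(3) unfolding scale_ideal_mult by (simp only: ideal_mult_commute)
  finally have "?I' \<diamondop> I = \<O>" using scale_inverse[OF J'(2)] by simp
  moreover have "fractional_ideal ?I'" by (intro fractional_scale nzideal_fractional J'(1)) (use d J' in simp)
  ultimately show ?thesis by blast
qed

abbreviation IG :: "'k set monoid" where "IG \<equiv> ideal_group"

lemma IG_simps:
  "carrier IG = {I. fractional_ideal I}" "I \<otimes>\<^bsub>IG\<^esub> J = I \<diamondop> J" "\<one>\<^bsub>IG\<^esub> = \<O>"
  by (simp_all add: ideal_group_def)

sublocale IG: comm_group IG
proof (rule comm_groupI, unfold IG_simps)
  show "\<O> \<in> {I :: 'k set. fractional_ideal I}" using nzideal_fractional[OF nzideal_ring] by simp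
  fix I J L :: "'k set"
  show "\<O> \<diamondop> I = I" if "I \<in> {I. fractional_ideal I}" using that ideal_mult_ring(1)[OF fractional_idealD] by simp
  show "I \<diamondop> J \<diamondop> L = I \<diamondop> (J \<diamondop> L)" by (rule ideal_mult_assoc)
  show "I \<diamondop> J = J \<diamondop> I" by (rule ideal_mult_commute)
  show "I \<diamondop> J \<in> {I. fractional_ideal I}" if "I \<in> {I. fractional_ideal I}" "J \<in> {I. fractional_ideal I}"
    using that fractional_ideal_mult by simp
  show "\<exists>J\<in>{I. fractional_ideal I}. J \<diamondop> I = \<O>" if "I \<in> {I. fractional_ideal I}"
    using fractional_inverse_exists that by blast
qed

section \<open>Inverses of fractional ideals and prime factorisation\<close>

abbreviation idinv :: "'k set \<Rightarrow> 'k set" where "idinv I \<equiv> inv\<^bsub>IG\<^esub> I"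

lemma idinv:
  assumes "fractional_ideal I"
  shows "fractional_ideal (idinv I)" "I \<diamondop> idinv I = \<O>" "idinv I \<diamondop> I = \<O>"
  using IG.inv_closed[of I] IG.r_inv[of I] IG.l_inv[of I] assms by (simp_all add: IG_simps)

lemma idinv_cancel:
  assumes "fractional_ideal I" "Omod A"
  shows "I \<diamondop> (idinv I \<diamondop> A) = A" "idinv I \<diamondop> (I \<diamondop> A) = A" "(A \<diamondop> I) \<diamondop> idinv I = A" "(A \<diamondop> idinv I) \<diamondop> I = A"
proof -
  show "I \<diamondop> (idinv I \<diamondop> A) = A" using idinv[OF assms(1)] ideal_mult_ring[OF assms(2)] by (simp flip: ideal_mult_assoc)
  show "idinv I \<diamondop> (I \<diamondop> A) = A" using idinv[OF assms(1)] ideal_mult_ring[OF assms(2)] by (simp flip: ideal_mult_assoc)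
  show "(A \<diamondop> I) \<diamondop> idinv I = A" using idinv[OF assms(1)] ideal_mult_ring[OF assms(2)] by (simp add: ideal_mult_assoc)
  show "(A \<diamondop> idinv I) \<diamondop> I = A" using idinv[OF assms(1)] ideal_mult_ring[OF assms(2)] by (simp add: ideal_mult_assoc)
qed

text \<open>To contain is to divide: \<open>P = J \<diamondop> Q\<close> with \<open>Q\<close>
  integral. An element of \<open>J\<close> outside \<open>P\<close> forces
  \<open>Q \<subseteq> P\<close>, so that \<open>P \<subseteq> J \<diamondop> P\<close>, and
  Nakayama's lemma gives 1 in \<open>J\<close>.\<close>

lemma prime_maximal:
  assumes P: "P \<in> finite_primes" and J: "nzideal (J :: 'k set)" "P \<subseteq> J" "J \<noteq> P"
  shows "1 \<in> J"
proof -
  have PI: "nzideal P" by (rule finite_primeD(1)[OF P])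
  have Jf: "fractional_ideal J" by (rule nzideal_fractional[OF J(1)])
  define Q where "Q = idinv J \<diamondop> P"
  have JQ: "J \<diamondop> Q = P" unfolding Q_def by (rule idinv_cancel(1)[OF Jf nzidealD(1)[OF PI]])
  have QO: "Q \<subseteq> \<O>" unfolding Q_def using ideal_mult_mono[OF order_refl J(2), of "idinv J"] idinv(3)[OF Jf] by simp
  obtain j where j: "j \<in> J" "j \<notin> P" using J by blast
  have "Q \<subseteq> P"
  proof
    fix q assume q: "q \<in> Q"
    then have "j * q \<in> P" using ideal_mult_prod[OF j(1) q] JQ by simp
    then show "q \<in> P" using finite_primeD(3)[OF P] j nzidealD(3)[OF J(1)] q QO by blast
  qed
  then have "P \<subseteq> J \<diamondop> P" using JQ ideal_mult_mono[of J J Q P] by blast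
  then show ?thesis using nakayama[OF nzidealD(1,2)[OF J(1)] PI] by blast
qed

text \<open>Only finitely many ideals contain a given positive integer, so among the ideals above
  \<open>J\<close> without 1 there is a maximal one. It is prime by the usual argument with the
  ideal generated by \<open>P\<close> and \<open>a\<close>.\<close>

lemma exists_prime_above:
  assumes J: "nzideal (J :: 'k set)" "1 \<notin> J"
  shows "\<exists>P\<in>finite_primes. J \<subseteq> P"
proof -
  obtain m where m: "m > 0" "of_nat m \<in> J" using nzideal_contains_nat[OF J(1)] by blast
  let ?A = "{I. Omod I \<and> I \<subseteq> \<O> \<and> J \<subseteq> I \<and> 1 \<notin> I}"
  have "finite ?A" by (rule finite_subset[OF _ finite_ideals_containing[OF m(1)]]) (use m(2) in blast)
  moreover have "J \<in> ?A" using J nzidealD[OF J(1)] by simp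
  ultimately have "\<exists>P\<in>?A. J \<subseteq> P \<and> (\<forall>I\<in>?A. P \<subseteq> I \<longrightarrow> P = I)" by (rule finite_has_maximal2)
  then obtain P where P: "P \<in> ?A" "J \<subseteq> P" and max': "\<forall>I\<in>?A. P \<subseteq> I \<longrightarrow> P = I"
    by (elim bexE conjE) (rule that)
  have max: "P = I" if "I \<in> ?A" "P \<subseteq> I" for I using bspec[OF max' that(1)] that(2) by blast
  have Pm: "Omod P" "P \<subseteq> \<O>" "1 \<notin> P" using P by auto
  have nz: "nzideal P" using P J nzidealD(4)[OF J(1)] by (auto simp: nzideal_def)
  have "a \<in> P \<or> b \<in> P" if ab: "algebraic_int a" "algebraic_int b" "a * b \<in> P" for a b
  proof (rule ccontr)
    assume n: "\<not> (a \<in> P \<or> b \<in> P)"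
    let ?I = "{x + a * c | x c. x \<in> P \<and> algebraic_int c}"
    have mem: "x + a * c \<in> ?I" if "x \<in> P" "algebraic_int c" for x c using that by blast
    have "Omod ?I" unfolding Omod_def
    proof (intro conjI ballI)
      show "0 \<in> ?I" using mem[OF OmodD(1)[OF Pm(1)], of 0] by simp
    next
      fix x y assume "x \<in> ?I" "y \<in> ?I"
      then obtain x1 c1 x2 c2 where *: "x = x1 + a * c1" "y = x2 + a * c2" "x1 \<in> P" "x2 \<in> P" "algebraic_int c1" "algebraic_int c2" by blast
      have "x + y = (x1 + x2) + a * (c1 + c2)" using * by (simp add: algebra_simps)
      then show "x + y \<in> ?I" using mem[OF OmodD(2)[OF Pm(1) *(3,4)] algebraic_int_add[OF *(5,6)]] by simp
    next
      fix d x :: 'k assume d: "d \<in> \<O>" and "x \<in> ?I"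
      then obtain x1 c1 where *: "x = x1 + a * c1" "x1 \<in> P" "algebraic_int c1" by blast
      have "d * x = d * x1 + a * (d * c1)" using * by (simp add: algebra_simps)
      moreover have "algebraic_int d" using d by simp
      ultimately show "d * x \<in> ?I" using mem[OF OmodD(3)[OF Pm(1) _ *(2)] algebraic_int_mult[OF _ *(3)]] by simp
    qed
    moreover have "?I \<subseteq> \<O>" using Pm(2) ab(1) by (auto intro!: algebraic_int_add algebraic_int_mult)
    moreover have PI: "P \<subseteq> ?I" using mem[of _ 0] by auto
    moreover have aI: "a \<in> ?I" using mem[OF OmodD(1)[OF Pm(1)], of 1] by simp
    ultimately have "1 \<in> ?I" using max[of ?I] P(2) n by blast
    then obtain x c where xc: "1 = x + a * c" "x \<in> P" "algebraic_int c" by blast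
    have "b = b * (x + a * c)" using xc(1) by simp
    then have "b = b * x + c * (a * b)" by (simp add: algebra_simps)
    moreover have "b * x + c * (a * b) \<in> P"
      by (intro OmodD(2)[OF Pm(1)] OmodD(3)[OF Pm(1)] ab xc)
    ultimately show False using n by simp
  qed
  then have "P \<in> finite_primes" using nz Pm by (simp add: primeideal_iff)
  then show ?thesis using P(2) by blast
qed

text \<open>Factorisation by induction on the number of ideals above \<open>J\<close>: dividing by a
  prime above \<open>J\<close> gives a strictly larger ideal, by Nakayama's lemma. The set
  \<open>S\<close> keeps track of the primes that may occur.\<close>

lemma mem_generate_primes:
  assumes J: "nzideal (J :: 'k set)" and S: "S \<subseteq> finite_primes" "\<And>P. P \<in> finite_primes \<Longrightarrow> J \<subseteq> P \<Longrightarrow> P \<in> S"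
  shows "J \<in> generate IG S"
  using J S(2)
proof (induction "card {I. Omod I \<and> I \<subseteq> \<O> \<and> J \<subseteq> I}" arbitrary: J rule: less_induct)
  case less
  have Jm: "Omod J" "J \<subseteq> \<O>" using nzidealD less.prems(1) by auto
  show ?case
  proof (cases "1 \<in> J")
    case True
    then have "J = \<O>" using Jm OmodD(3)[OF Jm(1), of _ 1] by auto
    then show ?thesis using generate.one[of IG S] by (simp add: IG_simps)
  next
    case False
    then obtain P where P: "P \<in> finite_primes" "J \<subseteq> P" using exists_prime_above[OF less.prems(1)] by blast
    have PI: "nzideal P" and Pf: "fractional_ideal P" using finite_primeD(1)[OF P(1)] nzideal_fractional by auto
    let ?J = "idinv P \<diamondop> J"
    have JP: "P \<diamondop> ?J = J" by (rule idinv_cancel(1)[OF Pf Jm(1)])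
    have "?J \<subseteq> \<O>" using ideal_mult_mono[OF order_refl P(2), of "idinv P"] idinv(3)[OF Pf] by simp
    moreover have "fractional_ideal ?J" using fractional_ideal_mult[OF idinv(1)[OF Pf] nzideal_fractional[OF less.prems(1)]] .
    ultimately have nJ: "nzideal ?J" by (simp add: nzideal_iff_fractional)
    have sub: "J \<subseteq> ?J" using JP ideal_mult_mono[OF nzidealD(2)[OF PI] order_refl, of ?J] ideal_mult_ring(1)[OF nzidealD(1)[OF nJ]] by simp
    have ne: "J \<noteq> ?J"
    proof
      assume "J = ?J"
      then have "J \<subseteq> P \<diamondop> J" using JP by simp
      then have "1 \<in> P" using nakayama[OF nzidealD(1,2)[OF PI] less.prems(1)] by blast
      then show False using finite_primeD(2)[OF P(1)] by blast
    qed
    obtain m where m: "m > 0" "of_nat m \<in> J" using nzideal_contains_nat[OF less.prems(1)] by blast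
    have fin: "finite {I. Omod I \<and> I \<subseteq> \<O> \<and> J \<subseteq> I}"
      by (rule finite_subset[OF _ finite_ideals_containing[OF m(1)]]) (use m(2) in blast)
    have "{I. Omod I \<and> I \<subseteq> \<O> \<and> ?J \<subseteq> I} \<subset> {I. Omod I \<and> I \<subseteq> \<O> \<and> J \<subseteq> I}"
      using sub ne Jm by blast
    from less.hyps[OF psubset_card_mono[OF fin this] nJ] have "?J \<in> generate IG S"
      using less.prems(2) subset_trans[OF sub] by simp
    moreover have "P \<in> generate IG S" using generate.incl[of P S IG] less.prems(2) P by blast
    ultimately have "P \<otimes>\<^bsub>IG\<^esub> ?J \<in> generate IG S" using generate.eng[of P IG S ?J] by simp
    then show ?thesis using JP by (simp add: IG_simps)
  qed
qed

lemma ipow_Suc_subset: "nzideal P \<Longrightarrow> ipow P (Suc k) \<subseteq> ipow P k"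
  using ideal_mult_mono[OF order_refl nzidealD(2), of P "ipow P k"] ideal_mult_ring(2)[OF nzidealD(1)[OF nzideal_ipow]] by simp

lemma ipow_mono: "nzideal P \<Longrightarrow> i \<le> j \<Longrightarrow> ipow P j \<subseteq> ipow P i"
  using lift_Suc_antimono_le[of "ipow P"] ipow_Suc_subset by blast

section \<open>The valuation at a prime ideal\<close>

lemma pow_ideals_set: "P [^]\<^bsub>ideals_set ring_of_integers\<^esub> k = ipow P k"
  by (induction k) (simp_all add: ideals_set_def nat_pow_def ideal_prod_ring_of_integers)

text \<open>All powers of \<open>P\<close> would contain one positive integer, so two of them would
  coincide; Nakayama's lemma cancels the common factor and gives 1 in \<open>P\<close>.\<close>

lemma not_in_high_power:
  assumes P: "P \<in> finite_primes" and a: "algebraic_int (a :: 'k)" "a \<noteq> 0"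
  shows "\<exists>k. a \<notin> ipow P k"
proof (rule ccontr)
  assume "\<nexists>k. a \<notin> ipow P k"
  then have all: "a \<in> ipow P k" for k by blast
  have PI: "nzideal P" by (rule finite_primeD(1)[OF P])
  obtain m b where m: "m > 0" "algebraic_int b" "of_nat m = a * b" using algebraic_int_divides_integer[OF a] by blast
  have mem: "ipow P k \<in> {J. Omod J \<and> J \<subseteq> \<O> \<and> of_nat m \<in> J}" for k
    using nzidealD(1,2)[OF nzideal_ipow[OF PI]] OmodD(3)[OF nzidealD(1)[OF nzideal_ipow[OF PI]] m(2) all] m(3) by (simp add: mult.commute)
  have "finite (range (ipow P))" by (rule finite_subset[OF _ finite_ideals_containing[OF m(1)]]) (use mem in blast)
  then have "\<not> inj (ipow P)" using finite_imageD infinite_UNIV_nat by blast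
  then obtain i j where ij: "i < j" "ipow P i = ipow P j" unfolding inj_def by (metis linorder_neqE_nat)
  have "ipow P j = ipow P i \<diamondop> ipow P (j - i)" using ipow_add[OF PI, of i "j - i"] ij by simp
  then have "ipow P i \<subseteq> ipow P (j - i) \<diamondop> ipow P i" using ij(2) ideal_mult_commute by blast
  then have "1 \<in> ipow P (j - i)"
    using nakayama[OF nzidealD(1,2)[OF nzideal_ipow[OF PI]] nzideal_ipow[OF PI]] by blast
  moreover have "ipow P (j - i) \<subseteq> ipow P 1" by (rule ipow_mono[OF PI]) (use ij in simp)
  moreover have "ipow P 1 = P" using ideal_mult_ring(1)[OF nzidealD(1)[OF PI]] by simp
  ultimately show False using finite_primeD(2)[OF P] by blast
qed

text \<open>The maximum in \<open>prime_exponent\<close> exists by \<open>not_in_high_power\<close>,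
  and the powers of \<open>P\<close> decrease.\<close>

lemma prime_exponent_iff:
  assumes P: "P \<in> finite_primes" and a: "algebraic_int (a :: 'k)" "a \<noteq> 0"
  shows "a \<in> ipow P k \<longleftrightarrow> k \<le> prime_exponent P a"
proof -
  have PI: "nzideal P" by (rule finite_primeD(1)[OF P])
  obtain b where b: "a \<notin> ipow P b" using not_in_high_power[OF P a] by blast
  have bound: "k \<le> b" if "a \<in> ipow P k" for k
    using ipow_mono[OF PI, of b k] that b by (meson nle_le subsetD)
  have 0: "a \<in> ipow P 0" using a by simp
  have pe: "prime_exponent P a = (GREATEST k. a \<in> ipow P k)" by (simp add: prime_exponent_def pow_ideals_set)
  have mem: "a \<in> ipow P (prime_exponent P a)" unfolding pe by (rule GreatestI_nat[of "\<lambda>k. a \<in> ipow P k", OF 0 bound])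
  show ?thesis
  proof
    assume "a \<in> ipow P k" then show "k \<le> prime_exponent P a"
      unfolding pe by (rule Greatest_le_nat[of "\<lambda>k. a \<in> ipow P k"]) (rule bound)
  next
    assume "k \<le> prime_exponent P a" then show "a \<in> ipow P k" using ipow_mono[OF PI] mem by blast
  qed
qed

text \<open>\<open>A\<close> is the part of the principal ideal of \<open>a\<close> that is prime to
  \<open>P\<close>. Were it contained in \<open>P\<close>, one more power of \<open>P\<close> would
  contain \<open>a\<close>.\<close>

lemma cofactor:
  assumes P: "P \<in> finite_primes" and a: "algebraic_int (a :: 'k)" "a \<noteq> 0"
  defines "A \<equiv> principal a \<diamondop> idinv (ipow P (prime_exponent P a))"
  shows "A \<subseteq> \<O>" "\<exists>\<alpha>\<in>A. \<alpha> \<notin> P"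
proof -
  let ?k = "prime_exponent P a"
  have PI: "nzideal P" by (rule finite_primeD(1)[OF P])
  have Qf: "fractional_ideal (ipow P ?k)" by (rule nzideal_fractional[OF nzideal_ipow[OF PI]])
  have "principal a \<subseteq> ipow P ?k"
    using principal_subset_iff[OF nzidealD(1)[OF nzideal_ipow[OF PI]]] prime_exponent_iff[OF P a] by blast
  then show "A \<subseteq> \<O>" unfolding A_def using ideal_mult_mono[OF _ order_refl, of "principal a" "ipow P ?k"] idinv(2)[OF Qf] by blast
  show "\<exists>\<alpha>\<in>A. \<alpha> \<notin> P"
  proof (rule ccontr)
    assume "\<not> (\<exists>\<alpha>\<in>A. \<alpha> \<notin> P)"
    then have "A \<subseteq> P" by blast
    then have "A \<diamondop> ipow P ?k \<subseteq> P \<diamondop> ipow P ?k" by (rule ideal_mult_mono[OF _ order_refl])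
    then have "A \<diamondop> ipow P ?k \<subseteq> ipow P (Suc ?k)" by (simp only: ipow.simps ideal_mult_commute)
    moreover have "A \<diamondop> ipow P ?k = principal a" unfolding A_def by (rule idinv_cancel(4)[OF Qf Omod_principal])
    ultimately have "a \<in> ipow P (Suc ?k)" using principal_self by blast
    then show False using prime_exponent_iff[OF P a, of "Suc ?k"] by (simp del: ipow.simps)
  qed
qed

text \<open>If the exponent exceeded the sum, the product of the two cofactors would lie in
  \<open>P\<close>, although each of them has an element outside \<open>P\<close>.\<close>

lemma prime_exponent_mult:
  assumes P: "P \<in> finite_primes" and a: "algebraic_int (a :: 'k)" "a \<noteq> 0" and b: "algebraic_int b" "b \<noteq> 0"
  shows "prime_exponent P (a * b) = prime_exponent P a + prime_exponent P b"
proof -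
  have PI: "nzideal P" by (rule finite_primeD(1)[OF P])
  have ab: "algebraic_int (a * b)" "a * b \<noteq> 0" using a b algebraic_int_mult by auto
  let ?i = "prime_exponent P a" and ?j = "prime_exponent P b"
  let ?A = "principal a \<diamondop> idinv (ipow P ?i)" and ?B = "principal b \<diamondop> idinv (ipow P ?j)"
  have fr: "fractional_ideal (ipow P k)" for k by (rule nzideal_fractional[OF nzideal_ipow[OF PI]])
  have "a * b \<in> ipow P (?i + ?j)"
    unfolding ipow_add[OF PI] by (rule ideal_mult_prod) (use prime_exponent_iff[OF P] a b in auto)
  then have ge: "?i + ?j \<le> prime_exponent P (a * b)" using prime_exponent_iff[OF P ab] by blast
  have "\<not> Suc (?i + ?j) \<le> prime_exponent P (a * b)"
  proof
    assume "Suc (?i + ?j) \<le> prime_exponent P (a * b)"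
    then have "a * b \<in> ipow P (Suc (?i + ?j))" using prime_exponent_iff[OF P ab] by blast
    then have "principal (a * b) \<subseteq> ipow P (Suc (?i + ?j))"
      using principal_subset_iff[OF nzidealD(1)[OF nzideal_ipow[OF PI]]] by blast
    moreover have "ipow P (Suc (?i + ?j)) = P \<diamondop> (ipow P ?i \<diamondop> ipow P ?j)"
      by (simp only: ipow.simps ipow_add[OF PI] ideal_mult_commute)
    ultimately have "principal (a * b) \<subseteq> P \<diamondop> (ipow P ?i \<diamondop> ipow P ?j)" by (simp only:)
    then have "principal (a * b) \<diamondop> (idinv (ipow P ?i) \<diamondop> idinv (ipow P ?j))
        \<subseteq> P \<diamondop> (ipow P ?i \<diamondop> ipow P ?j) \<diamondop> (idinv (ipow P ?i) \<diamondop> idinv (ipow P ?j))"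
      by (rule ideal_mult_mono[OF _ order_refl])
    also have "P \<diamondop> (ipow P ?i \<diamondop> ipow P ?j) \<diamondop> (idinv (ipow P ?i) \<diamondop> idinv (ipow P ?j))
        = P \<diamondop> (ipow P ?i \<diamondop> ((ipow P ?j \<diamondop> idinv (ipow P ?j)) \<diamondop> idinv (ipow P ?i)))"
      by (simp only: ideal_mult_ac)
    also have "\<dots> = P"
      using idinv(2)[OF fr] ideal_mult_ring[OF fractional_idealD[OF idinv(1)[OF fr]]] ideal_mult_ring[OF nzidealD(1)[OF PI]] by simp
    finally have sub: "principal (a * b) \<diamondop> (idinv (ipow P ?i) \<diamondop> idinv (ipow P ?j)) \<subseteq> P" .
    have eq: "?A \<diamondop> ?B = principal (a * b) \<diamondop> (idinv (ipow P ?i) \<diamondop> idinv (ipow P ?j))"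
      unfolding principal_mult[symmetric] by (simp only: ideal_mult_ac)
    obtain \<alpha> \<beta> where ab': "\<alpha> \<in> ?A" "\<alpha> \<notin> P" "\<beta> \<in> ?B" "\<beta> \<notin> P"
      using cofactor(2)[OF P a] cofactor(2)[OF P b] by blast
    have "\<alpha> * \<beta> \<in> P" using ideal_mult_prod[OF ab'(1,3)] eq sub by blast
    moreover have "algebraic_int \<alpha>" "algebraic_int \<beta>" using ab' cofactor(1)[OF P a] cofactor(1)[OF P b] by blast+
    ultimately show False using finite_primeD(3)[OF P] ab' by blast
  qed
  then show ?thesis using ge by simp
qed

lemma prime_val_fraction:
  assumes P: "P \<in> finite_primes" and a: "algebraic_int (a :: 'k)" "a \<noteq> 0" and b: "algebraic_int b" "b \<noteq> 0"
  shows "prime_val P (a / b) = int (prime_exponent P a) - int (prime_exponent P b)"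
  unfolding prime_val_def
proof (rule the_equality)
  show "\<exists>a' b'. algebraic_int a' \<and> a' \<noteq> 0 \<and> algebraic_int b' \<and> b' \<noteq> 0 \<and> a / b = a' / b' \<and>
      int (prime_exponent P a) - int (prime_exponent P b) = int (prime_exponent P a') - int (prime_exponent P b')"
    using a b by blast
  fix n assume "\<exists>a' b'. algebraic_int a' \<and> a' \<noteq> 0 \<and> algebraic_int b' \<and> b' \<noteq> 0 \<and> a / b = a' / b' \<and>
      n = int (prime_exponent P a') - int (prime_exponent P b')"
  then obtain a' b' where *: "algebraic_int a'" "a' \<noteq> 0" "algebraic_int b'" "b' \<noteq> 0" "a / b = a' / b'"
      "n = int (prime_exponent P a') - int (prime_exponent P b')" by blast
  have "a * b' = a' * b" using *(4,5) b(2) by (simp add: field_simps)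
  then have "prime_exponent P a + prime_exponent P b' = prime_exponent P a' + prime_exponent P b"
    using prime_exponent_mult[OF P a *(3,4)] prime_exponent_mult[OF P *(1,2) b] by simp
  then show "n = int (prime_exponent P a) - int (prime_exponent P b)" using *(6) by linarith
qed

lemma prime_exponent_1: "P \<in> finite_primes \<Longrightarrow> prime_exponent P (1 :: 'k) = 0"
  using prime_exponent_mult[of P 1 1] by simp

lemma prime_val_int: "P \<in> finite_primes \<Longrightarrow> algebraic_int (a :: 'k) \<Longrightarrow> a \<noteq> 0 \<Longrightarrow> prime_val P a = int (prime_exponent P a)"
  using prime_val_fraction[of P a 1] prime_exponent_1[of P] by simp

lemma prime_val_mult:
  assumes P: "P \<in> finite_primes" and xy: "(x :: 'k) \<noteq> 0" "y \<noteq> 0"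
  shows "prime_val P (x * y) = prime_val P x + prime_val P y"
proof -
  obtain a b where ab: "algebraic_int a" "algebraic_int b" "b \<noteq> 0" "x = a / b" by (rule fraction)
  obtain c d where cd: "algebraic_int c" "algebraic_int d" "d \<noteq> 0" "y = c / d" by (rule fraction)
  have nz: "a \<noteq> 0" "c \<noteq> 0" using xy ab cd by auto
  have "prime_val P (x * y) = prime_val P ((a * c) / (b * d))" using ab cd by simp
  also have "\<dots> = int (prime_exponent P (a * c)) - int (prime_exponent P (b * d))"
    by (rule prime_val_fraction[OF P]) (use ab cd nz algebraic_int_mult in auto)
  also have "\<dots> = prime_val P x + prime_val P y"
    using ab cd nz by (simp add: prime_exponent_mult[OF P] prime_val_fraction[OF P])
  finally show ?thesis .
qed

lemma prime_val_1: "P \<in> finite_primes \<Longrightarrow> prime_val P (1 :: 'k) = 0"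
  using prime_val_mult[of P 1 1] by simp

lemma prime_val_inverse: "P \<in> finite_primes \<Longrightarrow> (x :: 'k) \<noteq> 0 \<Longrightarrow> prime_val P (inverse x) = - prime_val P x"
  using prime_val_mult[of P x "inverse x"] prime_val_1[of P] by simp

lemma prime_val_power: "P \<in> finite_primes \<Longrightarrow> (x :: 'k) \<noteq> 0 \<Longrightarrow> prime_val P (x ^ k) = int k * prime_val P x"
  by (induction k) (simp_all add: prime_val_1 prime_val_mult algebra_simps)

text \<open>Valuation at least \<open>n\<close>, made to include 0, at which
  \<open>prime_val\<close> is unspecified.\<close>

definition vge :: "'k set \<Rightarrow> int \<Rightarrow> 'k \<Rightarrow> bool" where
  "vge P n x \<longleftrightarrow> x = 0 \<or> n \<le> prime_val P x"

lemma vge_0 [simp]: "vge P n 0"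
  by (simp add: vge_def)

lemma vge_mono: "vge P n x \<Longrightarrow> m \<le> n \<Longrightarrow> vge P m x"
  by (auto simp: vge_def)

lemma vge_mult: "P \<in> finite_primes \<Longrightarrow> vge P m x \<Longrightarrow> vge P n y \<Longrightarrow> vge P (m + n) (x * y)"
  using prime_val_mult[of P x y] by (cases "x = 0 \<or> y = 0") (auto simp: vge_def)

lemma vge_int: "P \<in> finite_primes \<Longrightarrow> algebraic_int x \<Longrightarrow> vge P 0 x"
  using prime_val_int[of P x] by (cases "x = 0") (auto simp: vge_def)

lemma vge_mult_int: "P \<in> finite_primes \<Longrightarrow> vge P n x \<Longrightarrow> vge P 0 y \<Longrightarrow> vge P n (x * y)"
  using vge_mult[of P n x 0 y] by simp

lemma vge_add:
  assumes P: "P \<in> finite_primes" and x: "vge P n x" and y: "vge P n y"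
  shows "vge P n (x + y)"
proof (cases "x = 0 \<or> y = 0 \<or> x + y = 0")
  case False
  obtain a b where ab: "algebraic_int a" "algebraic_int b" "b \<noteq> 0" "x = a / b" by (rule fraction)
  obtain c d where cd: "algebraic_int c" "algebraic_int d" "d \<noteq> 0" "y = c / d" by (rule fraction)
  have bd: "algebraic_int (b * d)" "b * d \<noteq> 0" "algebraic_int (a * d)" "algebraic_int (c * b)" using ab cd algebraic_int_mult by auto
  have x': "x = (a * d) / (b * d)" and y': "y = (c * b) / (b * d)" using ab cd by auto
  have "a \<noteq> 0" "c \<noteq> 0" using False ab(4) cd(4) by auto
  then have nz: "a * d \<noteq> 0" "c * b \<noteq> 0" using ab(3) cd(3) by auto
  have s: "x + y = (a * d + c * b) / (b * d)" unfolding x' y' by (simp add: add_divide_distrib)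
  then have nzs: "a * d + c * b \<noteq> 0" using False by auto
  \<comment> \<open>Over the common denominator the bound becomes membership in a power of
    \<open>P\<close>. If the number is negative, \<open>nat\<close> yields the power 0, which
    contains every algebraic integer.\<close>
  let ?k = "nat (n + int (prime_exponent P (b * d)))"
  have "a * d \<in> ipow P ?k" "c * b \<in> ipow P ?k"
    unfolding prime_exponent_iff[OF P bd(3) nz(1)] prime_exponent_iff[OF P bd(4) nz(2)]
    using x y False prime_val_fraction[OF P bd(3) nz(1) bd(1,2)] prime_val_fraction[OF P bd(4) nz(2) bd(1,2)]
    unfolding vge_def x'[symmetric] y'[symmetric] by auto
  then have "a * d + c * b \<in> ipow P ?k" using OmodD(2)[OF nzidealD(1)[OF nzideal_ipow[OF finite_primeD(1)[OF P]]]] by blast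
  then have "?k \<le> prime_exponent P (a * d + c * b)" using prime_exponent_iff[OF P algebraic_int_add[OF bd(3,4)] nzs] by blast
  then show ?thesis using prime_val_fraction[OF P algebraic_int_add[OF bd(3,4)] nzs bd(1,2)] unfolding vge_def s by linarith
qed (use x y in auto)

lemma vge_minus: assumes "P \<in> finite_primes" "vge P n x" shows "vge P n (- x)"
  using vge_mult_int[OF assms vge_int[OF assms(1), of "- 1"]] by simp

lemma vge_diff: "P \<in> finite_primes \<Longrightarrow> vge P n x \<Longrightarrow> vge P n y \<Longrightarrow> vge P n (x - y)"
  using vge_add[of P n x "- y"] vge_minus[of P n y] by simp

lemma vge_power: "P \<in> finite_primes \<Longrightarrow> vge P n x \<Longrightarrow> vge P (int k * n) (x ^ k)"
  by (induction k) (auto intro: vge_int vge_mult simp: distrib_right)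

lemma vge_mem: assumes P: "P \<in> finite_primes" and x: "x \<in> P" shows "vge P 1 x"
proof (cases "x = 0")
  case False
  have PI: "nzideal P" by (rule finite_primeD(1)[OF P])
  have "x \<in> ipow P 1" using x ideal_mult_ring(1)[OF nzidealD(1)[OF PI]] by simp
  then have "1 \<le> prime_exponent P x" using prime_exponent_iff[OF P nzidealD(3)[OF PI x] False] by blast
  then show ?thesis using prime_val_int[OF P nzidealD(3)[OF PI x] False] by (simp add: vge_def)
qed simp

lemma prime_val_not_mem:
  fixes x :: 'k
  assumes P: "P \<in> finite_primes" and x: "algebraic_int x" "x \<notin> P" shows "x \<noteq> 0" "prime_val P x = 0"
proof -
  have PI: "nzideal P" by (rule finite_primeD(1)[OF P])
  show nz: "x \<noteq> 0" using x OmodD(1)[OF nzidealD(1)[OF PI]] by blast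
  have "x \<notin> ipow P 1" using x ideal_mult_ring(1)[OF nzidealD(1)[OF PI]] by simp
  then have "\<not> 1 \<le> prime_exponent P x" using prime_exponent_iff[OF P x(1) nz] by blast
  then show "prime_val P x = 0" using prime_val_int[OF P x(1) nz] by simp
qed

section \<open>Approximation at finitely many primes\<close>

lemma prime_not_subset:
  fixes P Q :: "'k set"
  assumes "P \<in> finite_primes" "Q \<in> finite_primes" "P \<noteq> Q"
  shows "\<exists>q\<in>Q. q \<notin> P"
proof (rule ccontr)
  assume "\<not> (\<exists>q\<in>Q. q \<notin> P)"
  then have "Q \<subseteq> P" by blast
  then have "1 \<in> P" using prime_maximal[OF assms(2) finite_primeD(1)[OF assms(1)]] assms(3) by blast
  then show False using finite_primeD(2)[OF assms(1)] by blast
qed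

lemma prod_not_mem_prime:
  assumes P: "P \<in> finite_primes" and f: "finite S" "\<And>i. i \<in> S \<Longrightarrow> algebraic_int (f i)" "\<And>i. i \<in> S \<Longrightarrow> f i \<notin> P"
  shows "algebraic_int (prod f S) \<and> prod f S \<notin> P"
  using f
proof (induction S rule: finite_induct)
  case (insert i S)
  then show ?case using finite_primeD(3)[OF P, of "f i" "prod f S"] algebraic_int_mult by auto
qed (use finite_primeD(2)[OF P] in simp)

lemma prod_mem_Omod:
  assumes I: "Omod I" and f: "finite S" "\<And>i. i \<in> S \<Longrightarrow> algebraic_int (f i)" "i \<in> S" "f i \<in> I"
  shows "prod f S \<in> I"
proof -
  have "algebraic_int (prod f S')" if "finite S'" "S' \<subseteq> S" for S'
    using that f(2) by (induction S' rule: finite_induct) (auto intro: algebraic_int_mult)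
  then have "prod f (S - {i}) * f i \<in> I" using OmodD(3)[OF I _ f(4)] f(1) by simp
  then show ?thesis using f(1,3) by (simp add: prod.remove mult.commute)
qed

text \<open>Multiplying \<open>d P\<close> by elements of the other primes gives \<open>e P\<close>,
  which lies in every prime of \<open>S\<close> except \<open>P\<close>. In the sum of all
  \<open>e P\<close> exactly one term is outside a given prime.\<close>

lemma prime_avoidance:
  assumes S: "finite S" "S \<subseteq> finite_primes" and D: "Omod D" "D \<subseteq> \<O>" "\<And>P. P \<in> S \<Longrightarrow> \<exists>d\<in>D. d \<notin> (P :: 'k set)"
  shows "\<exists>d\<in>D. \<forall>P\<in>S. d \<notin> P"
proof -
  obtain d where d: "\<And>P. P \<in> S \<Longrightarrow> d P \<in> D" "\<And>P. P \<in> S \<Longrightarrow> d P \<notin> P" using D(3) by metis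
  have "\<exists>q. q \<in> Q \<and> q \<notin> P" if "P \<in> S" "Q \<in> S" "P \<noteq> Q" for P Q
    using prime_not_subset[of P Q] that S(2) by blast
  then obtain q where q: "\<And>P Q. P \<in> S \<Longrightarrow> Q \<in> S \<Longrightarrow> P \<noteq> Q \<Longrightarrow> q P Q \<in> Q \<and> q P Q \<notin> P" by metis
  have qO: "algebraic_int (q P Q)" if "P \<in> S" "Q \<in> S" "P \<noteq> Q" for P Q
    using q[OF that] nzidealD(3)[OF finite_primeD(1)] that S(2) by blast
  define e where "e P = (\<Prod>Q\<in>S - {P}. q P Q) * d P" for P
  have prodq: "algebraic_int (\<Prod>Q\<in>S - {P}. q P Q) \<and> (\<Prod>Q\<in>S - {P}. q P Q) \<notin> P" if P: "P \<in> S" for P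
  proof (rule prod_not_mem_prime)
    show "P \<in> finite_primes" "finite (S - {P})" using P S by auto
    fix Q assume "Q \<in> S - {P}"
    then have "Q \<in> S" "P \<noteq> Q" by auto
    then show "algebraic_int (q P Q)" "q P Q \<notin> P" using qO[OF P] q[OF P] by blast+
  qed
  have eD: "e P \<in> D" if "P \<in> S" for P
    unfolding e_def using OmodD(3)[OF D(1) _ d(1)[OF that]] prodq[OF that] by blast
  have eP: "e P \<notin> P" if P: "P \<in> S" for P
    unfolding e_def using finite_primeD(3)[of P] prodq[OF P] d[OF P] D(2) P S(2) by blast
  have eQ: "e P \<in> Q" if PQ: "P \<in> S" "Q \<in> S" "P \<noteq> Q" for P Q
  proof -
    have Q: "Omod Q" using nzidealD(1)[OF finite_primeD(1)] PQ S(2) by blast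
    have "(\<Prod>Q\<in>S - {P}. q P Q) \<in> Q"
    proof (rule prod_mem_Omod[OF Q, of _ _ Q])
      show "finite (S - {P})" "Q \<in> S - {P}" using S PQ by auto
      show "q P Q \<in> Q" using q[OF PQ] by blast
      fix R assume "R \<in> S - {P}"
      then have "R \<in> S" "P \<noteq> R" by auto
      then show "algebraic_int (q P R)" using qO[OF PQ(1)] by blast
    qed
    moreover have "algebraic_int (d P)" using d(1)[OF PQ(1)] D(2) by blast
    ultimately have "d P * (\<Prod>Q\<in>S - {P}. q P Q) \<in> Q" using OmodD(3)[OF Q] by blast
    then show ?thesis by (simp add: e_def mult.commute)
  qed
  have "sum e S \<notin> P" if P: "P \<in> S" for P
  proof
    assume s: "sum e S \<in> P"
    have PO: "Omod P" using nzidealD(1)[OF finite_primeD(1)] P S(2) by blast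
    have "sum e (S - {P}) \<in> P" by (rule Omod_sum[OF PO]) (use eQ P in auto)
    then have "sum e S - sum e (S - {P}) \<in> P" using Omod_diff[OF PO s] by blast
    then show False using eP[OF P] S(1) P by (simp add: sum.remove)
  qed
  then show ?thesis using Omod_sum[OF D(1), of S e] eD by blast
qed

text \<open>The denominators of \<open>x\<close> form an ideal \<open>?D\<close>. Where the
  valuation of \<open>x\<close> vanishes, \<open>a\<close> and \<open>b\<close> contain the same
  power of \<open>P\<close>, so an element of the cofactor of \<open>b\<close> outside
  \<open>P\<close> is a denominator; prime avoidance serves all primes of \<open>S\<close> at
  once.\<close>

lemma coprime_fraction:
  assumes S: "finite S" "S \<subseteq> finite_primes" and x: "(x :: 'k) \<noteq> 0" "\<And>P. P \<in> S \<Longrightarrow> prime_val P x = 0"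
  shows "\<exists>a b. algebraic_int a \<and> algebraic_int b \<and> a \<noteq> 0 \<and> b \<noteq> 0 \<and> x = a / b \<and> (\<forall>P\<in>S. a \<notin> P \<and> b \<notin> P)"
proof -
  obtain a b where ab: "algebraic_int a" "algebraic_int b" "b \<noteq> 0" "x = a / b" by (rule fraction)
  have a0: "a \<noteq> 0" using x ab by auto
  let ?D = "{d. algebraic_int d \<and> algebraic_int (d * x)}"
  have D: "Omod ?D" unfolding Omod_def
    by (auto simp: distrib_right mult.assoc intro: algebraic_int_add algebraic_int_mult)
  have "\<exists>d\<in>?D. d \<notin> P" if PS: "P \<in> S" for P
  proof -
    have P: "P \<in> finite_primes" using PS S by blast
    have eq: "prime_exponent P a = prime_exponent P b"
      using x(2)[OF PS] prime_val_fraction[OF P ab(1) a0 ab(2,3)] ab(4) by simp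
    obtain \<beta> where \<beta>: "\<beta> \<in> principal b \<diamondop> idinv (ipow P (prime_exponent P b))" "\<beta> \<notin> P"
      using cofactor(2)[OF P ab(2,3)] by blast
    have "x * b = a" using ab(3,4) by simp
    moreover have "(*) x ` principal b = principal (x * b)"
      unfolding image_image by (rule image_cong) (simp_all add: mult.assoc)
    ultimately have "(*) x ` principal b = principal a" by (simp only:)
    then have "(*) x ` (principal b \<diamondop> idinv (ipow P (prime_exponent P b))) = principal a \<diamondop> idinv (ipow P (prime_exponent P a))"
      by (simp only: eq scale_ideal_mult[symmetric])
    then have "x * \<beta> \<in> \<O>" using \<beta>(1) cofactor(1)[OF P ab(1) a0] by blast
    moreover have "\<beta> \<in> \<O>" using \<beta>(1) cofactor(1)[OF P ab(2,3)] by blast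
    ultimately show ?thesis using \<beta>(2) by (auto simp: mult.commute)
  qed
  then obtain d where d: "algebraic_int d" "algebraic_int (d * x)" "\<forall>P\<in>S. d \<notin> P"
    using prime_avoidance[OF S D] by blast
  have step: "d * x \<notin> P" if PS: "P \<in> S" "d \<noteq> 0" for P
  proof
    assume m: "d * x \<in> P"
    have P: "P \<in> finite_primes" using PS S by blast
    have "vge P 1 (d * x)" by (rule vge_mem[OF P m])
    then have "1 \<le> prime_val P d + prime_val P x" using PS(2) x(1) prime_val_mult[OF P PS(2) x(1)] by (simp add: vge_def)
    then show False using x(2)[OF PS(1)] prime_val_not_mem[OF P d(1)] d(3) PS(1) by simp
  qed
  show ?thesis
  proof (cases "d = 0")
    case True
    then have "S = {}" using d(3) S(2) OmodD(1)[OF nzidealD(1)[OF finite_primeD(1)]] by blast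
    then show ?thesis using ab a0 by blast
  next
    case False
    then show ?thesis using d x(1) step by (intro exI[of _ "d * x"] exI[of _ d]) auto
  qed
qed

text \<open>A positive rational integer is wanted, because it is positive at every real place and
  has finitely many residues.\<close>

lemma deep_integer:
  assumes S: "finite S" "S \<subseteq> finite_primes"
  shows "\<exists>m>0. \<forall>P\<in>S. vge P (int k) (of_nat m :: 'k)"
proof -
  have "\<exists>m>0. (of_nat m :: 'k) \<in> P" if "P \<in> S" for P
    using nzideal_contains_nat[OF finite_primeD(1)] that S by blast
  then obtain m where m: "\<And>P. P \<in> S \<Longrightarrow> m P > 0" "\<And>P. P \<in> S \<Longrightarrow> (of_nat (m P) :: 'k) \<in> P" by metis
  have "vge P (int k) (of_nat ((\<Prod>P\<in>S. m P) ^ k) :: 'k)" if PS: "P \<in> S" for P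
  proof -
    have P: "P \<in> finite_primes" using PS S by blast
    have "(of_nat (\<Prod>P\<in>S. m P) :: 'k) = of_nat (m P) * of_nat (\<Prod>Q\<in>S - {P}. m Q)"
      using S(1) PS by (simp add: prod.remove)
    then have "vge P 1 (of_nat (\<Prod>P\<in>S. m P) :: 'k)"
      using vge_mult_int[OF P vge_mem[OF P m(2)[OF PS]] vge_int[OF P algebraic_int_of_nat]] by (simp only:)
    from vge_power[OF P this, of k] show ?thesis by (simp only: of_nat_power mult_1_right)
  qed
  moreover have "(\<Prod>P\<in>S. m P) ^ k > 0" using m(1) by (simp add: prod_pos)
  ultimately show ?thesis by blast
qed

text \<open>Some power of an element \<open>e\<close> which lies in all primes of \<open>T\<close> and in no prime of \<open>S\<close>: two powers
  of \<open>e\<close> agree modulo a highly divisible integer, by pigeonhole.\<close>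

lemma approximate_idempotent:
  assumes S: "finite S" "S \<subseteq> finite_primes" and T: "finite T" "T \<subseteq> finite_primes" "S \<inter> T = {}"
  shows "\<exists>\<epsilon> :: 'k. algebraic_int \<epsilon> \<and> (\<forall>P\<in>S. vge P (int k) (\<epsilon> - 1)) \<and> (\<forall>Q\<in>T. vge Q (int k) \<epsilon>)"
proof -
  let ?D = "{d. algebraic_int d \<and> (\<forall>Q\<in>T. d \<in> Q)} :: 'k set"
  have TO: "Omod Q" if "Q \<in> T" for Q using nzidealD(1)[OF finite_primeD(1)] that T by blast
  have D: "Omod ?D" using OmodD[OF TO] unfolding Omod_def by (auto intro: algebraic_int_add algebraic_int_mult)
  have "\<exists>d\<in>?D. d \<notin> P" if PS: "P \<in> S" for P
  proof -
    have P: "P \<in> finite_primes" using PS S by blast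
    have "\<exists>q. q \<in> Q \<and> q \<notin> P" if "Q \<in> T" for Q using prime_not_subset[OF P, of Q] that PS T by blast
    then obtain q where q: "\<And>Q. Q \<in> T \<Longrightarrow> q Q \<in> Q" "\<And>Q. Q \<in> T \<Longrightarrow> q Q \<notin> P" by metis
    have qO: "algebraic_int (q Q)" if "Q \<in> T" for Q using q(1)[OF that] nzidealD(3)[OF finite_primeD(1)] that T by blast
    have 1: "algebraic_int (prod q T) \<and> prod q T \<notin> P" by (rule prod_not_mem_prime[OF P T(1) qO q(2)])
    have 2: "prod q T \<in> Q" if Q: "Q \<in> T" for Q by (rule prod_mem_Omod[of Q T q Q, OF TO[OF Q] T(1) qO Q q(1)[OF Q]])
    show ?thesis using 1 2 by blast
  qed
  then obtain e where e: "algebraic_int e" "\<forall>Q\<in>T. e \<in> Q" "\<forall>P\<in>S. e \<notin> P" using prime_avoidance[OF S D] by blast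
  obtain m where m: "m > 0" "\<And>P. P \<in> S \<Longrightarrow> vge P (int k) (of_nat m :: 'k)" using deep_integer[OF S] by blast
  obtain R :: "'k set" where R: "finite R" "R \<subseteq> \<O>" "\<forall>x\<in>\<O>. \<exists>s\<in>R. \<exists>y\<in>\<O>. x = s + of_nat m * y"
    using residues[OF m(1)] by (elim exE conjE) (rule that)
  have "\<forall>i. \<exists>s y. s \<in> R \<and> y \<in> \<O> \<and> e ^ i = s + of_nat m * y"
    using R(3) algebraic_int_power[OF e(1)] by blast
  then obtain s y where sy: "\<And>i. s i \<in> R" "\<And>i. y i \<in> \<O>" "\<And>i. e ^ i = s i + of_nat m * y i" by metis
  have "finite (range s)" using finite_subset[OF _ R(1)] sy(1) by blast
  then have "\<not> inj s" using finite_imageD infinite_UNIV_nat by blast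
  then obtain i j where ij: "i < j" "s i = s j" unfolding inj_def by (metis linorder_neqE_nat)
  define l where "l = j - i"
  have l: "l > 0" using ij by (simp add: l_def)
  have "e ^ i * e ^ l = e ^ j" using ij by (simp add: l_def flip: power_add)
  then have "e ^ i * (e ^ l - 1) = e ^ j - e ^ i" by (simp add: right_diff_distrib)
  then have "e ^ i * (e ^ l - 1) = of_nat m * (y j - y i)"
    unfolding sy(3)[of i] sy(3)[of j] ij(2) by (simp add: right_diff_distrib)
  moreover have yO: "algebraic_int (y j - y i)" using sy(2) algebraic_int_diff by blast
  ultimately have el: "vge P (int k) (e ^ l - 1)" if PS: "P \<in> S" for P
  proof -
    have P: "P \<in> finite_primes" using PS S by blast
    have e0: "e \<noteq> 0" "prime_val P e = 0" using prime_val_not_mem[OF P e(1)] e(3) PS by auto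
    have "vge P (int k) (of_nat m * (y j - y i))" by (rule vge_mult_int[OF P m(2)[OF PS] vge_int[OF P yO]])
    then have "vge P (int k) (e ^ i * (e ^ l - 1))" using \<open>e ^ i * (e ^ l - 1) = of_nat m * (y j - y i)\<close> by simp
    then show ?thesis using e0 prime_val_mult[OF P, of "e ^ i" "e ^ l - 1"] prime_val_power[OF P e0(1), of i]
      by (cases "e ^ l - 1 = 0") (auto simp: vge_def)
  qed
  \<comment> \<open>The exponent \<open>k\<close> produces vanishing of order \<open>k\<close> at
    \<open>T\<close> and keeps the congruence with 1, as \<open>e ^ l - 1\<close> divides
    \<open>e ^ (l * k) - 1\<close>.\<close>
  have "vge P (int k) (e ^ (l * k) - 1)" if PS: "P \<in> S" for P
  proof -
    have P: "P \<in> finite_primes" using PS S by blast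
    have "e ^ (l * k) - 1 = (e ^ l - 1) * (\<Sum>i<k. (e ^ l) ^ i)"
      using power_diff_1_eq[of "e ^ l" k] by (simp add: power_mult)
    moreover have "algebraic_int (\<Sum>i<k. (e ^ l) ^ i)" by (intro algebraic_int_sum algebraic_int_power e)
    ultimately show ?thesis using vge_mult_int[OF P el[OF PS] vge_int[OF P]] by simp
  qed
  moreover have "vge Q (int k) (e ^ (l * k))" if QT: "Q \<in> T" for Q
  proof -
    have Q: "Q \<in> finite_primes" using QT T by blast
    have "vge Q (int (l * k) * 1) (e ^ (l * k))" by (rule vge_power[OF Q vge_mem[OF Q]]) (use e(2) QT in blast)
    moreover have "1 * int k \<le> int l * int k" using l by (intro mult_right_mono) auto
    ultimately show ?thesis using vge_mono[of Q "int (l * k) * 1" "e ^ (l * k)" "int k"] by simp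
  qed
  ultimately show ?thesis using algebraic_int_power[OF e(1)] by blast
qed

end

section \<open>Ray class groups\<close>

lemma finite_image_factor:
  assumes "finite (g ` A)" "\<And>x y. x \<in> A \<Longrightarrow> y \<in> A \<Longrightarrow> g x = g y \<Longrightarrow> f x = f y"
  shows "finite (f ` A)"
proof -
  have "f ` A \<subseteq> (\<lambda>s. f (SOME x. x \<in> A \<and> g x = s)) ` (g ` A)"
  proof
    fix y assume "y \<in> f ` A"
    then obtain x where x: "x \<in> A" "y = f x" by blast
    let ?x = "SOME z. z \<in> A \<and> g z = g x"
    have "?x \<in> A \<and> g ?x = g x" by (rule someI[of _ x]) (use x in simp)
    then have "y = f ?x" using assms(2)[of x ?x] x by simp
    then show "y \<in> (\<lambda>s. f (SOME x. x \<in> A \<and> g x = s)) ` (g ` A)" using x by blast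
  qed
  then show ?thesis using assms(1) finite_surj by blast
qed

lemma real_place_simps:
  assumes "\<sigma> \<in> real_places"
  shows "\<sigma> (x * y) = \<sigma> x * \<sigma> y" "\<sigma> (x + y) = \<sigma> x + \<sigma> y" "\<sigma> 1 = 1"
  using assms ring_hom_mult[of \<sigma> ring_of_type_algebra ring_of_type_algebra x y]
    ring_hom_add[of \<sigma> ring_of_type_algebra ring_of_type_algebra x y]
    ring_hom_one[of \<sigma> ring_of_type_algebra ring_of_type_algebra]
  by (auto simp: real_places_def)

lemma real_place_0: "\<sigma> \<in> real_places \<Longrightarrow> \<sigma> 0 = 0"
  using real_place_simps(2)[of \<sigma> 0 0] by simp

lemma real_place_of_nat: "\<sigma> \<in> real_places \<Longrightarrow> \<sigma> (of_nat m) = real m"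
  by (induction m) (simp_all add: real_place_0 real_place_simps)

lemma real_place_inverse: "\<sigma> \<in> real_places \<Longrightarrow> x \<noteq> 0 \<Longrightarrow> \<sigma> (inverse x) = inverse (\<sigma> x)"
  using real_place_simps(1)[of \<sigma> x "inverse x"] real_place_simps(3)[of \<sigma>]
  by (simp add: inverse_unique[symmetric])

lemma real_place_nonzero: "\<sigma> \<in> real_places \<Longrightarrow> x \<noteq> 0 \<Longrightarrow> \<sigma> x \<noteq> 0"
  using real_place_simps(1)[of \<sigma> x "inverse x"] real_place_simps(3)[of \<sigma>] by auto

context numfield begin

definition supp :: "'k modulus \<Rightarrow> 'k set set" where
  "supp \<ff> = {P. exponent \<ff> P \<noteq> 0}"

lemma supp: assumes "pseudo_modulus \<ff>" shows "finite (supp \<ff>)" "supp \<ff> \<subseteq> finite_primes"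
  using assms by (auto simp: supp_def pseudo_modulus_def)

lemma modulusD: assumes "modulus \<ff>"
  shows "finite (supp \<ff>)" "supp \<ff> \<subseteq> finite_primes" "finite (reals \<ff>)" "reals \<ff> \<subseteq> real_places"
  using assms supp by (auto simp: modulus_def pseudo_modulus_def)

abbreviation ex :: "'k modulus \<Rightarrow> 'k set \<Rightarrow> nat" where "ex \<ff> P \<equiv> the_enat (exponent \<ff> P)"

lemma ray_iff:
  assumes "modulus (\<ff> :: 'k modulus)"
  shows "x \<in> ray \<ff> \<longleftrightarrow> x \<noteq> 0 \<and> (\<forall>P\<in>supp \<ff>. vge P (int (ex \<ff> P)) (x - 1)) \<and> (\<forall>\<sigma>\<in>reals \<ff>. 0 < \<sigma> x)"
  using modulusD(2)[OF assms] by (auto simp: ray_def vge_def supp_def)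

lemma exponent_enat: assumes "modulus \<ff>" shows "exponent \<ff> P = enat (ex \<ff> P)"
  using assms unfolding modulus_def by (metis enat.exhaust the_enat.simps)

lemma exponent_pos: assumes "modulus \<ff>" "P \<in> supp \<ff>" shows "ex \<ff> P > 0"
proof (rule ccontr)
  assume "\<not> ex \<ff> P > 0"
  then have "exponent \<ff> P = 0" using exponent_enat[OF assms(1), of P] by (simp add: zero_enat_def)
  then show False using assms(2) by (simp add: supp_def)
qed

lemma unit_of_vge:
  assumes P: "P \<in> finite_primes" and x: "x \<noteq> 0" "vge P n (x - 1)" "n > 0"
  shows "prime_val P x = 0"
proof -
  have "vge P 0 ((x - 1) + 1)" by (rule vge_add[OF P vge_mono[OF x(2)] vge_int[OF P]]) (use x in auto)
  then have "prime_val P x \<ge> 0" using x(1) by (simp add: vge_def)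
  moreover have "\<not> prime_val P x > 0"
  proof
    assume "prime_val P x > 0"
    then have "vge P 1 x" by (simp add: vge_def)
    moreover have "vge P 1 (x - 1)" by (rule vge_mono[OF x(2)]) (use x in simp)
    ultimately have "vge P 1 (x - (x - 1))" by (rule vge_diff[OF P])
    then show False using prime_val_1[OF P] by (simp add: vge_def)
  qed
  ultimately show ?thesis by simp
qed

lemma ray_unit: assumes "modulus (\<ff> :: 'k modulus)" "x \<in> ray \<ff>" "P \<in> supp \<ff>" shows "prime_val P x = 0"
  using unit_of_vge[of P x "int (ex \<ff> P)"] assms ray_iff[OF assms(1)] exponent_pos[OF assms(1,3)] modulusD(2)[OF assms(1)] by auto

lemma vge_mult_one:
  assumes P: "P \<in> finite_primes" and "vge P n (x - 1)" "vge P n (y - 1)" "vge P 0 x"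
  shows "vge P n (x * y - 1)"
proof -
  have "vge P n ((y - 1) * x + (x - 1))" by (rule vge_add[OF P vge_mult_int[OF P]]) (use assms in auto)
  then show ?thesis by (simp add: algebra_simps)
qed

lemma ray_mult: assumes f: "modulus (\<ff> :: 'k modulus)" and x: "x \<in> ray \<ff>" and y: "y \<in> ray \<ff>" shows "x * y \<in> ray \<ff>"
  unfolding ray_iff[OF f]
proof (intro conjI ballI)
  show "x * y \<noteq> 0" using x y ray_iff[OF f] by auto
  fix P assume P: "P \<in> supp \<ff>"
  then have Pf: "P \<in> finite_primes" using modulusD(2)[OF f] by blast
  have "vge P 0 x" using ray_unit[OF f x P] by (simp add: vge_def)
  then show "vge P (int (ex \<ff> P)) (x * y - 1)" using vge_mult_one[OF Pf] x y P ray_iff[OF f] by blast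
next
  fix \<sigma> assume s: "\<sigma> \<in> reals \<ff>"
  then show "0 < \<sigma> (x * y)" using real_place_simps(1)[of \<sigma> x y] modulusD(4)[OF f] x y ray_iff[OF f] by auto
qed

lemma ray_1: assumes "modulus (\<ff> :: 'k modulus)" shows "1 \<in> ray \<ff>"
  unfolding ray_iff[OF assms]
proof (intro conjI ballI)
  show "0 < \<sigma> 1" if "\<sigma> \<in> reals \<ff>" for \<sigma>
    using real_place_simps(3)[of \<sigma>] modulusD(4)[OF assms] that by (simp add: subset_iff)
qed (simp_all add: vge_def)

lemma ray_inverse: assumes f: "modulus (\<ff> :: 'k modulus)" and x: "x \<in> ray \<ff>" shows "inverse x \<in> ray \<ff>"
  unfolding ray_iff[OF f]
proof (intro conjI ballI)
  have x0: "x \<noteq> 0" using x ray_iff[OF f] by blast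
  show "inverse x \<noteq> 0" using x0 by simp
  fix P assume P: "P \<in> supp \<ff>"
  then have Pf: "P \<in> finite_primes" using modulusD(2)[OF f] by blast
  have "vge P 0 (- inverse x)"
    by (rule vge_minus[OF Pf]) (simp add: vge_def prime_val_inverse[OF Pf x0] ray_unit[OF f x P])
  then have "vge P (int (ex \<ff> P)) ((x - 1) * (- inverse x))" using vge_mult_int[OF Pf] x P ray_iff[OF f] by blast
  moreover have "(x - 1) * (- inverse x) = inverse x - 1" using x0 by (simp add: algebra_simps)
  ultimately show "vge P (int (ex \<ff> P)) (inverse x - 1)" by simp
next
  fix \<sigma> assume s: "\<sigma> \<in> reals \<ff>"
  have x0: "x \<noteq> 0" using x ray_iff[OF f] by blast
  show "0 < \<sigma> (inverse x)" using s real_place_inverse[of \<sigma> x] x0 modulusD(4)[OF f] x ray_iff[OF f] by auto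
qed

lemma ray_power: "modulus (\<ff> :: 'k modulus) \<Longrightarrow> x \<in> ray \<ff> \<Longrightarrow> x ^ k \<in> ray \<ff>"
  by (induction k) (auto intro: ray_1 ray_mult)

lemma ray_nonzero: "x \<in> ray \<ff> \<Longrightarrow> x \<noteq> 0"
  by (simp add: ray_def)

lemma ray_antimono:
  assumes f: "modulus (\<ff> :: 'k modulus)" "modulus \<ff>'" and d: "mod_dvd \<ff> \<ff>'" shows "ray \<ff>' \<subseteq> ray \<ff>"
proof
  fix x assume x: "x \<in> ray \<ff>'"
  have ex: "P \<in> supp \<ff>' \<and> ex \<ff> P \<le> ex \<ff>' P" if P: "P \<in> supp \<ff>" for P
  proof -
    have "exponent \<ff> P \<le> exponent \<ff>' P" using d by (simp add: mod_dvd_def)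
    then have "ex \<ff> P \<le> ex \<ff>' P"
      by (subst (asm) (1 2) exponent_enat) (simp_all add: f)
    moreover have "exponent \<ff>' P \<noteq> 0" 
    proof
      assume "exponent \<ff>' P = 0"
      moreover have "exponent \<ff> P \<le> exponent \<ff>' P" using d unfolding mod_dvd_def by blast
      ultimately show False using P by (simp add: supp_def)
    qed
    ultimately show ?thesis by (simp add: supp_def)
  qed
  show "x \<in> ray \<ff>" unfolding ray_iff[OF f(1)]
  proof (intro conjI ballI)
    show "x \<noteq> 0" by (rule ray_nonzero[OF x])
    show "vge P (int (ex \<ff> P)) (x - 1)" if "P \<in> supp \<ff>" for P
      using ex[OF that] x ray_iff[OF f(2)] vge_mono by (meson of_nat_mono)
    show "0 < \<sigma> x" if "\<sigma> \<in> reals \<ff>" for \<sigma> using that d x ray_iff[OF f(2)] by (auto simp: mod_dvd_def)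
  qed
qed

section \<open>Ideals prime to a modulus\<close>

abbreviation PG :: "'k modulus \<Rightarrow> 'k set monoid" where "PG \<ff> \<equiv> prime_to_group \<ff>"
abbreviation A :: "'k modulus \<Rightarrow> 'k set set" where "A \<ff> \<equiv> carrier (PG \<ff>)"
abbreviation RG :: "'k modulus \<Rightarrow> 'k set set monoid" where "RG \<ff> \<equiv> ray_class_group \<ff>"

definition away :: "'k modulus \<Rightarrow> 'k set set" where
  "away \<ff> = {P \<in> finite_primes. exponent \<ff> P = 0}"

lemma away_sub: "away \<ff> \<subseteq> finite_primes" "away \<ff> \<subseteq> carrier IG"
  using nzideal_fractional[OF finite_primeD(1)] by (auto simp: away_def IG_simps)

lemma A_eq: "A \<ff> = generate IG (away \<ff>)"
  using away_sub(2)[of \<ff>] by (simp add: prime_to_group_def carrier_subgroup_generated away_def[symmetric] Int_absorb1)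

lemma PG_simps: "I \<otimes>\<^bsub>PG \<ff>\<^esub> J = I \<diamondop> J" "\<one>\<^bsub>PG \<ff>\<^esub> = \<O>"
  by (simp_all add: prime_to_group_def subgroup_generated_def IG_simps)

lemma comm_group_PG: "comm_group (PG \<ff>)"
  unfolding prime_to_group_def by (rule IG.abelian_subgroup_generated[OF IG.comm_group_axioms]) 

lemma A_subgroup: "subgroup (A \<ff>) IG"
  unfolding A_eq by (rule IG.generate_is_subgroup[OF away_sub(2)])

lemma A_frac: "I \<in> A \<ff> \<Longrightarrow> fractional_ideal I"
  using subgroup.mem_carrier[OF A_subgroup] by (simp add: IG_simps)

lemma A_closed: "I \<in> A \<ff> \<Longrightarrow> J \<in> A \<ff> \<Longrightarrow> I \<diamondop> J \<in> A \<ff>" "I \<in> A \<ff> \<Longrightarrow> idinv I \<in> A \<ff>" "\<O> \<in> A \<ff>"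
  using subgroup.m_closed[OF A_subgroup, of I \<ff> J] subgroup.m_inv_closed[OF A_subgroup] subgroup.one_closed[OF A_subgroup]
  by (simp_all add: IG_simps)

lemma A_antimono: assumes "mod_dvd \<ff> \<ff>'" shows "A \<ff>' \<subseteq> A \<ff>"
proof -
  have "away \<ff>' \<subseteq> away \<ff>"
  proof
    fix P assume "P \<in> away \<ff>'"
    moreover have "exponent \<ff> P \<le> exponent \<ff>' P" using assms by (simp add: mod_dvd_def)
    ultimately show "P \<in> away \<ff>" by (simp add: away_def)
  qed
  then show ?thesis unfolding A_eq by (rule IG.mono_generate)
qed

lemma principal_in_A:
  assumes f: "modulus \<ff>" and x: "x \<noteq> 0" "\<And>P. P \<in> supp \<ff> \<Longrightarrow> prime_val P x = 0"
  shows "principal x \<in> A \<ff>"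
proof -
  obtain a b where ab: "algebraic_int a" "algebraic_int b" "a \<noteq> 0" "b \<noteq> 0" "x = a / b" "\<forall>P\<in>supp \<ff>. a \<notin> P \<and> b \<notin> P"
    using coprime_fraction[OF modulusD(1,2)[OF f] x] by blast
  have int: "principal c \<in> A \<ff>" if c: "algebraic_int c" "c \<noteq> 0" "\<forall>P\<in>supp \<ff>. c \<notin> P" for c
    unfolding A_eq
  proof (rule mem_generate_primes[OF nzideal_principal[OF c(1,2)] away_sub(1)])
    fix P assume P: "P \<in> finite_primes" "principal c \<subseteq> P"
    then have "c \<in> P" using principal_self by blast
    then show "P \<in> away \<ff>" using c(3) P(1) by (auto simp: away_def supp_def)
  qed
  have pb: "fractional_ideal (principal b)" by (rule fractional_principal[OF ab(4)])
  have "principal x \<diamondop> principal b = principal a" unfolding principal_mult using ab by simp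
  then have "principal x = principal a \<diamondop> idinv (principal b)"
    using idinv_cancel(3)[OF pb Omod_principal, of x] by simp
  then show ?thesis using A_closed int ab by simp
qed

text \<open>The localisation of \<open>I\<close> at \<open>P\<close> is trivial: both
  \<open>I\<close> and its inverse have a denominator outside \<open>P\<close>. The condition is
  symmetric under inversion and stable under products, so it passes from generators to the group
  they generate.\<close>

definition locally_unit :: "'k set \<Rightarrow> 'k set \<Rightarrow> bool" where
  "locally_unit P I \<longleftrightarrow> fractional_ideal I \<and> (\<exists>a. algebraic_int a \<and> a \<notin> P \<and> (\<forall>x\<in>I. algebraic_int (a * x))) \<and>
     (\<exists>b. algebraic_int b \<and> b \<notin> P \<and> (\<forall>x\<in>idinv I. algebraic_int (b * x)))"

lemma locally_unit_integral_mult: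
  assumes P: "P \<in> finite_primes"
    and a: "algebraic_int a" "a \<notin> P" "\<And>x. x \<in> I \<Longrightarrow> algebraic_int (a * x)"
    and b: "algebraic_int b" "b \<notin> P" "\<And>x. x \<in> J \<Longrightarrow> algebraic_int (b * x)"
  shows "\<exists>c. algebraic_int c \<and> c \<notin> P \<and> (\<forall>x\<in>I \<diamondop> J. algebraic_int (c * x))"
proof (intro exI[of _ "a * b"] conjI ballI)
  show "algebraic_int (a * b)" by (rule algebraic_int_mult[OF a(1) b(1)])
  show "a * b \<notin> P" using finite_primeD(3)[OF P a(1) b(1)] a b by blast
  have "I \<diamondop> J \<subseteq> {x. algebraic_int (a * b * x)}"
  proof (rule ideal_mult_subset)
    fix i j assume "i \<in> I" "j \<in> J"
    then have "algebraic_int ((a * i) * (b * j))" by (intro algebraic_int_mult a b)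
    then show "i * j \<in> {x. algebraic_int (a * b * x)}" by (simp add: ac_simps)
  qed (auto simp: distrib_left intro: algebraic_int_add)
  then show "algebraic_int (a * b * x)" if "x \<in> I \<diamondop> J" for x using that by blast
qed

lemma A_locally_unit:
  assumes f: "modulus \<ff>" and P: "P \<in> supp \<ff>" and I: "I \<in> A \<ff>"
  shows "locally_unit P I"
proof -
  have Pf: "P \<in> finite_primes" using P modulusD(2)[OF f] by blast
  have P1: "1 \<notin> P" by (rule finite_primeD(2)[OF Pf])
  have away: "locally_unit P Q" if Q: "Q \<in> away \<ff>" for Q
  proof -
    have Qf: "Q \<in> finite_primes" "Q \<noteq> P" using Q P by (auto simp: away_def supp_def)
    have QI: "nzideal Q" and fQ: "fractional_ideal Q" using finite_primeD(1)[OF Qf(1)] nzideal_fractional by auto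
    obtain q where q: "q \<in> Q" "q \<notin> P" using prime_not_subset[OF Pf Qf(1)] Qf(2) by blast
    have "algebraic_int (q * x)" if "x \<in> idinv Q" for x
      using ideal_mult_prod[OF q(1) that] idinv(2)[OF fQ] by blast
    moreover have "algebraic_int (1 * x)" if "x \<in> Q" for x using nzidealD(3)[OF QI that] by simp
    ultimately show ?thesis unfolding locally_unit_def using fQ q P1 nzidealD(3)[OF QI q(1)] algebraic_int_1 by blast
  qed
  have idinv_lu: "locally_unit P (idinv J)" if J: "locally_unit P J" for J
  proof -
    have fJ: "fractional_ideal J" using J by (simp add: locally_unit_def)
    have "idinv (idinv J) = J" using IG.inv_inv[of J] fJ by (simp add: IG_simps)
    then show ?thesis using J idinv(1)[OF fJ] unfolding locally_unit_def by simp
  qed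
  show ?thesis
    using I unfolding A_eq
  proof (induction rule: generate.induct)
    case one
    have "idinv \<O> = \<O>" using IG.inv_one by (simp add: IG_simps)
    then show ?case unfolding IG_simps locally_unit_def
      using nzideal_fractional[OF nzideal_ring] P1 by (simp, intro exI[of _ 1] conjI) simp_all
  next
    case (incl h) then show ?case by (rule away)
  next
    case (inv h) then show ?case by (intro idinv_lu away)
  next
    case (eng I J)
    have fr: "fractional_ideal I" "fractional_ideal J" using eng by (auto simp: locally_unit_def)
    have "idinv (I \<diamondop> J) = idinv I \<diamondop> idinv J" using IG.inv_mult[of I J] fr by (simp add: IG_simps)
    moreover obtain a where a: "algebraic_int a" "a \<notin> P" "\<And>x. x \<in> I \<Longrightarrow> algebraic_int (a * x)" using eng.IH(1) by (auto simp: locally_unit_def)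
    moreover obtain b where b: "algebraic_int b" "b \<notin> P" "\<And>x. x \<in> J \<Longrightarrow> algebraic_int (b * x)" using eng.IH(2) by (auto simp: locally_unit_def)
    moreover obtain a' where a': "algebraic_int a'" "a' \<notin> P" "\<And>x. x \<in> idinv I \<Longrightarrow> algebraic_int (a' * x)" using eng.IH(1) by (auto simp: locally_unit_def)
    moreover obtain b' where b': "algebraic_int b'" "b' \<notin> P" "\<And>x. x \<in> idinv J \<Longrightarrow> algebraic_int (b' * x)" using eng.IH(2) by (auto simp: locally_unit_def)
    ultimately show ?case unfolding IG_simps locally_unit_def
      using fractional_ideal_mult[OF fr] locally_unit_integral_mult[OF Pf a b] locally_unit_integral_mult[OF Pf a' b'] by simp
  qed
qed

text \<open>Converse to \<open>principal_in_A\<close>. It makes the multiplier between two ideals of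
  the group, when there is one, a unit at the primes of the modulus, as \<open>finite_RG\<close>
  requires.\<close>

lemma principal_A_unit:
  assumes f: "modulus \<ff>" and P: "P \<in> supp \<ff>" and x: "x \<noteq> 0" "principal x \<in> A \<ff>"
  shows "prime_val P x = 0"
proof -
  have Pf: "P \<in> finite_primes" using P modulusD(2)[OF f] by blast
  have ge: "0 \<le> prime_val P y" if "y \<noteq> 0" "algebraic_int a" "a \<notin> P" "algebraic_int (a * y)" for a y
  proof -
    have a: "a \<noteq> 0" "prime_val P a = 0" using prime_val_not_mem[OF Pf that(2,3)] by auto
    then have "a * y \<noteq> 0" using that(1) by simp
    then have "0 \<le> prime_val P (a * y)" using vge_int[OF Pf that(4)] by (simp add: vge_def)
    then show ?thesis using prime_val_mult[OF Pf a(1) that(1)] a(2) by simp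
  qed
  have u: "locally_unit P (principal x)" by (rule A_locally_unit[OF f P x(2)])
  have fx: "fractional_ideal (principal x)" by (rule fractional_principal[OF x(1)])
  have "principal (inverse x) \<diamondop> principal x = \<O>" unfolding principal_mult using x(1) by simp
  then have "idinv (principal x) = principal (inverse x)"
    using IG.inv_equality[of "principal (inverse x)" "principal x"] fx fractional_principal[of "inverse x"] x(1) by (simp add: IG_simps)
  then obtain a b where "algebraic_int a" "a \<notin> P" "algebraic_int (a * x)" "algebraic_int b" "b \<notin> P" "algebraic_int (b * inverse x)"
    using u principal_self[of x] principal_self[of "inverse x"] unfolding locally_unit_def by metis
  then have "0 \<le> prime_val P x" "0 \<le> prime_val P (inverse x)" using ge x(1) by simp_all
  then show ?thesis using prime_val_inverse[OF Pf x(1)] by simp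
qed

section \<open>Ray classes as cosets\<close>

abbreviation NR :: "'k modulus \<Rightarrow> 'k set set" where "NR \<ff> \<equiv> principal_ray \<ff>"

lemma NR_eq: "NR \<ff> = principal ` ray \<ff>"
  by (simp add: principal_ray_def)

lemma NR_sub: assumes "modulus (\<ff> :: 'k modulus)" shows "NR \<ff> \<subseteq> A \<ff>"
  unfolding NR_eq by (intro image_subsetI principal_in_A[OF assms] ray_nonzero ray_unit[OF assms])

definition cs :: "'k modulus \<Rightarrow> 'k set \<Rightarrow> 'k set set" where
  "cs \<ff> I = (\<lambda>n. n \<diamondop> I) ` NR \<ff>"

lemma r_coset_PG: "NR \<ff> #>\<^bsub>PG \<ff>\<^esub> I = cs \<ff> I"
  by (auto simp: r_coset_def cs_def PG_simps)

lemma subgroup_NR: assumes f: "modulus \<ff>" shows "subgroup (NR \<ff>) (PG \<ff>)"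
proof -
  interpret PG: comm_group "PG \<ff>" by (rule comm_group_PG)
  show ?thesis
  proof (rule PG.subgroupI)
    show "NR \<ff> \<subseteq> A \<ff>" by (rule NR_sub[OF f])
    show "NR \<ff> \<noteq> {}" using ray_1[OF f] by (auto simp: NR_eq)
    fix a b assume a: "a \<in> NR \<ff>" and b: "b \<in> NR \<ff>"
    obtain x where x: "x \<in> ray \<ff>" "a = principal x" using a by (auto simp: NR_eq)
    obtain y where y: "y \<in> ray \<ff>" "b = principal y" using b by (auto simp: NR_eq)
    have "principal (inverse x) \<diamondop> principal x = \<O>" unfolding principal_mult using ray_nonzero[OF x(1)] by simp
    moreover have xi: "principal (inverse x) \<in> NR \<ff>" using ray_inverse[OF f x(1)] by (auto simp: NR_eq)
    ultimately have "inv\<^bsub>PG \<ff>\<^esub> a = principal (inverse x)"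
      using PG.inv_equality[of "principal (inverse x)" a] NR_sub[OF f] a x(2) by (auto simp: PG_simps)
    then show "inv\<^bsub>PG \<ff>\<^esub> a \<in> NR \<ff>" using xi by simp
    show "a \<otimes>\<^bsub>PG \<ff>\<^esub> b \<in> NR \<ff>" using ray_mult[OF f x(1) y(1)] x y by (auto simp: PG_simps principal_mult NR_eq)
  qed
qed

lemma cs_eq_iff:
  assumes f: "modulus \<ff>" and I: "I \<in> A \<ff>" and J: "J \<in> A \<ff>"
  shows "cs \<ff> I = cs \<ff> J \<longleftrightarrow> (\<exists>x\<in>ray \<ff>. I = principal x \<diamondop> J)"
proof
  assume eq: "cs \<ff> I = cs \<ff> J"
  have "I = principal 1 \<diamondop> I" using ideal_mult_ring(1)[OF fractional_idealD[OF A_frac[OF I]]] by simp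
  then have "I \<in> cs \<ff> I" using ray_1[OF f] unfolding cs_def NR_eq by blast
  then show "\<exists>x\<in>ray \<ff>. I = principal x \<diamondop> J" unfolding eq by (auto simp: cs_def NR_eq)
next
  assume "\<exists>x\<in>ray \<ff>. I = principal x \<diamondop> J"
  then obtain x where x: "x \<in> ray \<ff>" "I = principal x \<diamondop> J" by blast
  show "cs \<ff> I = cs \<ff> J"
  proof
    show "cs \<ff> I \<subseteq> cs \<ff> J"
    proof
      fix L assume "L \<in> cs \<ff> I"
      then obtain y where y: "y \<in> ray \<ff>" "L = principal y \<diamondop> I" by (auto simp: cs_def NR_eq)
      then have "L = principal (y * x) \<diamondop> J" using x by (simp only: principal_mult[symmetric] ideal_mult_assoc)
      then show "L \<in> cs \<ff> J" using ray_mult[OF f y(1) x(1)] by (auto simp: cs_def NR_eq)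
    qed
    show "cs \<ff> J \<subseteq> cs \<ff> I"
    proof
      fix L assume "L \<in> cs \<ff> J"
      then obtain y where y: "y \<in> ray \<ff>" "L = principal y \<diamondop> J" by (auto simp: cs_def NR_eq)
      have "principal (y * inverse x) \<diamondop> I = principal (y * inverse x * x) \<diamondop> J"
        using x by (simp only: principal_mult[symmetric] ideal_mult_assoc)
      moreover have "y * inverse x * x = y" using ray_nonzero[OF x(1)] by simp
      ultimately have "L = principal (y * inverse x) \<diamondop> I" using y(2) by simp
      then show "L \<in> cs \<ff> I" using ray_mult[OF f y(1) ray_inverse[OF f x(1)]] by (auto simp: cs_def NR_eq)
    qed
  qed
qed

lemma cs_one: assumes "modulus \<ff>" shows "cs \<ff> \<O> = NR \<ff>"
proof -
  have "n \<diamondop> \<O> = n" if "n \<in> NR \<ff>" for n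
    using ideal_mult_ring(2)[OF fractional_idealD[OF A_frac]] NR_sub[OF assms] that by blast
  then show ?thesis by (auto simp: cs_def)
qed

lemma RG_carrier: "carrier (RG \<ff>) = cs \<ff> ` A \<ff>"
  by (auto simp: ray_class_group_def FactGroup_def RCOSETS_def r_coset_PG)

lemma RG_one: "\<one>\<^bsub>RG \<ff>\<^esub> = NR \<ff>"
  by (simp add: ray_class_group_def FactGroup_def)

lemma comm_group_RG: assumes f: "modulus \<ff>" shows "comm_group (RG \<ff>)"
proof -
  interpret PG: comm_group "PG \<ff>" by (rule comm_group_PG)
  show ?thesis unfolding ray_class_group_def by (rule PG.abelian_FactGroup[OF subgroup_NR[OF f]])
qed

lemma RG_mult: assumes f: "modulus \<ff>" and I: "I \<in> A \<ff>" and J: "J \<in> A \<ff>"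
  shows "cs \<ff> I \<otimes>\<^bsub>RG \<ff>\<^esub> cs \<ff> J = cs \<ff> (I \<diamondop> J)"
proof -
  interpret PG: comm_group "PG \<ff>" by (rule comm_group_PG)
  have "normal (NR \<ff>) (PG \<ff>)" using PG.normal_iff_subgroup subgroup_NR[OF f] by blast
  then have "(NR \<ff> #>\<^bsub>PG \<ff>\<^esub> I) <#>\<^bsub>PG \<ff>\<^esub> (NR \<ff> #>\<^bsub>PG \<ff>\<^esub> J) = NR \<ff> #>\<^bsub>PG \<ff>\<^esub> (I \<otimes>\<^bsub>PG \<ff>\<^esub> J)"
    by (rule normal.rcos_sum[OF _ I J])
  then show ?thesis by (simp add: ray_class_group_def FactGroup_def r_coset_PG PG_simps)
qed

text \<open>As the finer ray is contained in the coarser one, the enlarged coset is the coset of the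
  same ideal; so maps between levels can be computed on representing ideals.\<close>

lemma ray_class_map_cs:
  assumes f: "modulus \<ff>" "modulus \<ff>'" "mod_dvd \<ff> \<ff>'"
  shows "ray_class_map \<ff> (cs \<ff>' I) = cs \<ff> I"
proof
  show "ray_class_map \<ff> (cs \<ff>' I) \<subseteq> cs \<ff> I"
  proof
    fix L assume "L \<in> ray_class_map \<ff> (cs \<ff>' I)"
    then obtain x y where xy: "x \<in> ray \<ff>" "y \<in> ray \<ff>'" "L = principal x \<diamondop> (principal y \<diamondop> I)"
      by (auto simp: ray_class_map_def set_mult_def cs_def NR_eq PG_simps)
    then have "L = principal (x * y) \<diamondop> I" by (simp only: principal_mult[symmetric] ideal_mult_assoc)
    then show "L \<in> cs \<ff> I" using ray_mult[OF f(1) xy(1)] ray_antimono[OF f] xy(2) by (auto simp: cs_def NR_eq)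
  qed
  show "cs \<ff> I \<subseteq> ray_class_map \<ff> (cs \<ff>' I)"
  proof
    fix L assume "L \<in> cs \<ff> I"
    then obtain x where x: "x \<in> ray \<ff>" "L = principal x \<diamondop> I" by (auto simp: cs_def NR_eq)
    have "principal x \<diamondop> principal 1 = principal x" unfolding principal_mult by simp
    then have "L = principal x \<diamondop> (principal 1 \<diamondop> I)" using x(2) by (simp only: ideal_mult_assoc[symmetric])
    moreover have "principal 1 \<diamondop> I \<in> cs \<ff>' I" using ray_1[OF f(2)] unfolding cs_def NR_eq by blast
    ultimately show "L \<in> ray_class_map \<ff> (cs \<ff>' I)"
      using x(1) unfolding ray_class_map_def set_mult_def PG_simps NR_eq by blast
  qed
qed

lemma scale_eq_principal_mult: "Omod I \<Longrightarrow> (*) x ` I = principal x \<diamondop> I"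
  unfolding scale_ideal_mult by (simp add: ideal_mult_ring)

text \<open>A class is determined by an ideal of bounded index in its ordinary class together with the residues
  and signs of a generator.\<close>

lemma finite_RG: assumes f: "modulus \<ff>" shows "finite (carrier (RG \<ff>))"
proof -
  obtain c where c: "c > 0" "\<And>I :: 'k set. nzideal I \<Longrightarrow> \<exists>b\<in>I. b \<noteq> 0 \<and> (\<forall>a\<in>I. \<exists>\<omega>\<in>\<O>. of_nat c * a = \<omega> * b)"
    using almost_principal by blast
  define Fin where "Fin = {J :: 'k set. Omod J \<and> J \<subseteq> \<O> \<and> of_nat c \<in> J}"
  \<comment> \<open>By \<open>almost_principal\<close> every ideal has an integral multiple
    containing the fixed integer \<open>c\<close>.\<close>
  have "\<exists>y. y \<noteq> 0 \<and> (*) y ` I \<in> Fin" if I: "I \<in> A \<ff>" for I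
  proof -
    have fI: "fractional_ideal I" by (rule A_frac[OF I])
    obtain d where d: "algebraic_int d" "d \<noteq> 0" "\<And>x. x \<in> I \<Longrightarrow> algebraic_int (d * x)" using fI by (auto simp: fractional_ideal_iff)
    have nz: "nzideal ((*) d ` I)" unfolding nzideal_iff_fractional using fractional_scale[OF fI d(2)] d(3) by auto
    obtain b where b: "b \<in> (*) d ` I" "b \<noteq> 0" "\<forall>a\<in>(*) d ` I. \<exists>\<omega>\<in>\<O>. of_nat c * a = \<omega> * b" using c(2)[OF nz] by blast
    let ?y = "of_nat c / b * d"
    have "algebraic_int (?y * x)" if xI: "x \<in> I" for x
    proof -
      obtain \<omega> where "\<omega> \<in> \<O>" "of_nat c * (d * x) = \<omega> * b"
        using bspec[OF b(3) imageI[OF xI]] by (elim bexE)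
      then show ?thesis using b(2) by (simp add: field_simps)
    qed
    moreover obtain x where "x \<in> I" "b = d * x" using b(1) by blast
    then have "of_nat c \<in> (*) ?y ` I" using b(2) by (intro image_eqI[of _ _ x]) auto
    moreover have "Omod ((*) ?y ` I)" by (rule Omod_scale[OF fractional_idealD[OF fI]])
    ultimately have "(*) ?y ` I \<in> Fin" unfolding Fin_def by (intro CollectI conjI image_subsetI) simp_all
    moreover have "?y \<noteq> 0" using b c d by simp
    ultimately show ?thesis by blast
  qed
  then obtain y where y: "\<And>I. I \<in> A \<ff> \<Longrightarrow> y I \<noteq> 0" "\<And>I. I \<in> A \<ff> \<Longrightarrow> (*) (y I) ` I \<in> Fin" by metis
  define J where "J I = (*) (y I) ` I" for I
  \<comment> \<open>One fixed ideal of the group for each value of \<open>J\<close>; every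
    \<open>I\<close> with this value is a multiple of it.\<close>
  define B where "B L = (SOME I. I \<in> A \<ff> \<and> J I = L)" for L
  have B: "B (J I) \<in> A \<ff>" "J (B (J I)) = J I" if I: "I \<in> A \<ff>" for I
  proof -
    have "B (J I) \<in> A \<ff> \<and> J (B (J I)) = J I" unfolding B_def by (rule someI[of _ I]) (use I in simp)
    then show "B (J I) \<in> A \<ff>" "J (B (J I)) = J I" by auto
  qed
  \<comment> \<open>The sum of the exponents serves as a common upper bound for all of them.\<close>
  obtain m where m: "m > 0" "\<forall>P\<in>supp \<ff>. vge P (int (\<Sum>P\<in>supp \<ff>. ex \<ff> P)) (of_nat m)"
    using deep_integer[OF modulusD(1,2)[OF f]] by blast
  obtain R :: "'k set" where R: "finite R" "R \<subseteq> \<O>" "\<forall>x\<in>\<O>. \<exists>s\<in>R. \<exists>y\<in>\<O>. x = s + of_nat m * y"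
    using residues[OF m(1)] by (elim exE conjE) (rule that)
  have "\<exists>z a b s t. z \<noteq> 0 \<and> I = (*) z ` B (J I) \<and> algebraic_int a \<and> algebraic_int b \<and> a \<noteq> 0 \<and> b \<noteq> 0 \<and> z = a / b \<and>
      (\<forall>P\<in>supp \<ff>. a \<notin> P \<and> b \<notin> P) \<and> s \<in> R \<and> t \<in> R \<and> (\<exists>w\<in>\<O>. a = s + of_nat m * w) \<and> (\<exists>w\<in>\<O>. b = t + of_nat m * w)"
    if I: "I \<in> A \<ff>" for I
  proof -
    let ?B = "B (J I)"
    define z where "z = inverse (y I) * y ?B"
    have z0: "z \<noteq> 0" using y(1)[OF I] y(1)[OF B(1)[OF I]] by (simp add: z_def)
    have "(*) (y I) ` I = (*) (y ?B) ` ?B" using B(2)[OF I] by (simp add: J_def)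
    then have "I = (*) (inverse (y I)) ` ((*) (y ?B) ` ?B)" using scale_inverse[OF y(1)[OF I], of I] by simp
    then have Iz: "I = (*) z ` ?B" by (simp add: image_image z_def mult.assoc)
    have fB: "fractional_ideal ?B" by (rule A_frac[OF B(1)[OF I]])
    have "I = principal z \<diamondop> ?B" using Iz scale_eq_principal_mult[OF fractional_idealD[OF fB]] by simp
    then have "I \<diamondop> idinv ?B = principal z \<diamondop> ?B \<diamondop> idinv ?B" by (rule arg_cong[of _ _ "\<lambda>L. L \<diamondop> idinv ?B"])
    also have "\<dots> = principal z" by (rule idinv_cancel(3)[OF fB Omod_principal])
    finally have "principal z = I \<diamondop> idinv ?B" ..
    then have "principal z \<in> A \<ff>" using A_closed I B(1)[OF I] by simp
    then have "\<And>P. P \<in> supp \<ff> \<Longrightarrow> prime_val P z = 0" using principal_A_unit[OF f _ z0] by blast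
    then obtain a b where ab: "algebraic_int a" "algebraic_int b" "a \<noteq> 0" "b \<noteq> 0" "z = a / b" "\<forall>P\<in>supp \<ff>. a \<notin> P \<and> b \<notin> P"
      using coprime_fraction[OF modulusD(1,2)[OF f] z0] by blast
    obtain s where s: "s \<in> R" "\<exists>w\<in>\<O>. a = s + of_nat m * w" using R(3) ab(1) by blast
    obtain t where t: "t \<in> R" "\<exists>w\<in>\<O>. b = t + of_nat m * w" using R(3) ab(2) by blast
    show ?thesis
      by (rule exI[of _ z], rule exI[of _ a], rule exI[of _ b], rule exI[of _ s], rule exI[of _ t]) (intro conjI z0 Iz ab s t)
  qed
  then obtain z a b s t where z: "\<And>I. I \<in> A \<ff> \<Longrightarrow> z I \<noteq> 0 \<and> I = (*) (z I) ` B (J I) \<and> algebraic_int (a I) \<and> algebraic_int (b I) \<and>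
      a I \<noteq> 0 \<and> b I \<noteq> 0 \<and> z I = a I / b I \<and>
      (\<forall>P\<in>supp \<ff>. a I \<notin> P \<and> b I \<notin> P) \<and> s I \<in> R \<and> t I \<in> R \<and> (\<exists>w\<in>\<O>. a I = s I + of_nat m * w) \<and> (\<exists>w\<in>\<O>. b I = t I + of_nat m * w)"
    by metis
  have zn: "z I \<noteq> 0" if "I \<in> A \<ff>" for I using z[OF that] by (elim conjE)
  have zI: "I = (*) (z I) ` B (J I)" if "I \<in> A \<ff>" for I using z[OF that] by (elim conjE)
  have za: "algebraic_int (a I)" if "I \<in> A \<ff>" for I using z[OF that] by (elim conjE)
  have zb: "algebraic_int (b I)" if "I \<in> A \<ff>" for I using z[OF that] by (elim conjE)
  have za0: "a I \<noteq> 0" if "I \<in> A \<ff>" for I using z[OF that] by (elim conjE)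
  have zb0: "b I \<noteq> 0" if "I \<in> A \<ff>" for I using z[OF that] by (elim conjE)
  have zab: "z I = a I / b I" if "I \<in> A \<ff>" for I using z[OF that] by (elim conjE)
  have zP: "\<forall>P\<in>supp \<ff>. a I \<notin> P \<and> b I \<notin> P" if "I \<in> A \<ff>" for I using z[OF that] by (elim conjE)
  have zs: "s I \<in> R" if "I \<in> A \<ff>" for I using z[OF that] by (elim conjE)
  have zt: "t I \<in> R" if "I \<in> A \<ff>" for I using z[OF that] by (elim conjE)
  have zas: "\<exists>w\<in>\<O>. a I = s I + of_nat m * w" if "I \<in> A \<ff>" for I using z[OF that] by (elim conjE)
  have zbt: "\<exists>w\<in>\<O>. b I = t I + of_nat m * w" if "I \<in> A \<ff>" for I using z[OF that] by (elim conjE)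
  \<comment> \<open>The invariant with finitely many values: reduced ideal, residues of numerator
    and denominator of the multiplier, and its signs. If two invariants agree, the quotient of the
    multipliers lies in the ray.\<close>
  define \<Psi> where "\<Psi> I = (J I, s I, t I, {\<sigma>\<in>reals \<ff>. \<sigma> (z I) > 0})" for I
  have "\<Psi> ` A \<ff> \<subseteq> Fin \<times> R \<times> R \<times> Pow (reals \<ff>)" 
  proof
    fix q assume "q \<in> \<Psi> ` A \<ff>"
    then obtain I where I: "I \<in> A \<ff>" "q = \<Psi> I" by (rule imageE) simp
    have "J I \<in> Fin" "s I \<in> R" "t I \<in> R" using y(2)[OF I(1)] zs[OF I(1)] zt[OF I(1)] by (simp_all only: J_def)
    then show "q \<in> Fin \<times> R \<times> R \<times> Pow (reals \<ff>)" unfolding I(2) \<Psi>_def by (intro SigmaI) auto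
  qed
  moreover have "finite (Fin \<times> R \<times> R \<times> Pow (reals \<ff>))"
    using finite_ideals_containing[OF c(1)] R(1) modulusD(3)[OF f] by (simp add: Fin_def)
  ultimately have "finite (\<Psi> ` A \<ff>)" by (rule finite_subset)
  moreover have "cs \<ff> I = cs \<ff> I'" if I: "I \<in> A \<ff>" and I': "I' \<in> A \<ff>" and eq: "\<Psi> I = \<Psi> I'" for I I'
  proof -
    let ?x = "z I * inverse (z I')"
    have nz: "z I \<noteq> 0" "z I' \<noteq> 0" using zn I I' by simp_all
    have JJ: "J I = J I'" "s I = s I'" "t I = t I'" using eq by (auto simp: \<Psi>_def)
    have "I = (*) (z I) ` B (J I)" by (rule zI[OF I])
    also have "\<dots> = (*) ?x ` ((*) (z I') ` B (J I'))" unfolding image_image JJ(1) using nz by (intro image_cong refl) (simp add: field_simps)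
    also have "(*) (z I') ` B (J I') = I'" by (rule zI[OF I', symmetric])
    also have "(*) ?x ` I' = principal ?x \<diamondop> I'" by (rule scale_eq_principal_mult[OF fractional_idealD[OF A_frac[OF I']]])
    finally have "I = principal ?x \<diamondop> I'" .
    moreover have "?x \<in> ray \<ff>" unfolding ray_iff[OF f]
    proof (intro conjI ballI)
      show "?x \<noteq> 0" using nz by simp
      fix P assume P: "P \<in> supp \<ff>"
      then have Pf: "P \<in> finite_primes" using modulusD(2)[OF f] by blast
      obtain w where w: "w \<in> \<O>" "a I = s I' + of_nat m * w" using zas[OF I] unfolding JJ by (elim bexE)
      obtain w' where w': "w' \<in> \<O>" "a I' = s I' + of_nat m * w'" using zas[OF I'] by (elim bexE)
      obtain u where u: "u \<in> \<O>" "b I = t I' + of_nat m * u" using zbt[OF I] unfolding JJ by (elim bexE)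
      obtain u' where u': "u' \<in> \<O>" "b I' = t I' + of_nat m * u'" using zbt[OF I'] by (elim bexE)
      let ?g = "(w - w') * b I' - a I' * (u - u')"
      have ab: "algebraic_int (a I')" "algebraic_int (b I')" "algebraic_int (b I)" "a I' \<noteq> 0" "b I \<noteq> 0" "b I' \<noteq> 0" "a I' \<notin> P" "b I \<notin> P"
        using za[OF I'] zb[OF I'] zb[OF I] za0[OF I'] zb0[OF I] zb0[OF I'] zP[OF I'] zP[OF I] P by simp_all
      have g: "algebraic_int ?g" using w w' u u' ab by (auto intro!: algebraic_int_diff algebraic_int_mult)
      have aw: "a I - a I' = of_nat m * (w - w')" using w w' by (simp add: algebra_simps)
      have bu: "b I - b I' = of_nat m * (u - u')" using u u' by (simp add: algebra_simps)
      \<comment> \<open>Numerators and denominators agree modulo \<open>m\<close>, hence so do the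
        cross products; the remaining factors are units at \<open>P\<close>.\<close>
      have "a I * b I' - a I' * b I = (a I - a I') * b I' - a I' * (b I - b I')" by (simp add: algebra_simps)
      then have num: "a I * b I' - a I' * b I = of_nat m * ?g" unfolding aw bu by (simp add: algebra_simps)
      have "?x - 1 = (a I * b I' - a I' * b I) * (inverse (a I') * inverse (b I))"
        unfolding zab[OF I] zab[OF I'] using ab by (simp add: field_simps)
      then have x1: "?x - 1 = of_nat m * ?g * (inverse (a I') * inverse (b I))" unfolding num .
      have "vge P (int (\<Sum>P\<in>supp \<ff>. ex \<ff> P)) (of_nat m * ?g)"
        using vge_mult_int[OF Pf _ vge_int[OF Pf g]] m(2) P by blast
      moreover have "vge P 0 (inverse (a I') * inverse (b I))"
        using prime_val_not_mem[OF Pf ab(1,7)] prime_val_not_mem[OF Pf ab(3,8)] ab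
        by (simp add: vge_def prime_val_mult[OF Pf] prime_val_inverse[OF Pf])
      ultimately have "vge P (int (\<Sum>P\<in>supp \<ff>. ex \<ff> P)) (?x - 1)" unfolding x1 by (rule vge_mult_int[OF Pf])
      moreover have "ex \<ff> P \<le> (\<Sum>P\<in>supp \<ff>. ex \<ff> P)" by (rule member_le_sum) (use P modulusD(1)[OF f] in auto)
      ultimately show "vge P (int (ex \<ff> P)) (?x - 1)" using vge_mono by (meson of_nat_mono)
    next
      fix \<sigma> assume \<sigma>: "\<sigma> \<in> reals \<ff>"
      then have \<sigma>r: "\<sigma> \<in> real_places" using modulusD(4)[OF f] by blast
      have "\<sigma> (z I) > 0 \<longleftrightarrow> \<sigma> (z I') > 0" using eq \<sigma> by (auto simp: \<Psi>_def)
      moreover have "\<sigma> (z I) \<noteq> 0" "\<sigma> (z I') \<noteq> 0" using real_place_nonzero[OF \<sigma>r] nz by auto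
      moreover have "\<sigma> ?x = \<sigma> (z I) * inverse (\<sigma> (z I'))"
        by (simp add: real_place_simps[OF \<sigma>r] real_place_inverse[OF \<sigma>r nz(2)])
      ultimately show "0 < \<sigma> ?x" by (auto simp: zero_less_mult_iff not_less_iff_gr_or_eq)
    qed
    ultimately show ?thesis using cs_eq_iff[OF f I I'] by blast
  qed
  ultimately have "finite (cs \<ff> ` A \<ff>)" by (rule finite_image_factor)
  then show ?thesis by (simp add: RG_carrier)
qed

text \<open>The remainder is quadratic in \<open>w\<close> with a \<open>P\<close>-integral
  cofactor, so that the valuation of \<open>w\<close> counts twice in it.\<close>

lemma binomial_expansion:
  assumes P: "P \<in> finite_primes" and w: "vge P 0 w"
  shows "\<exists>R. vge P 0 R \<and> (1 + w) ^ n = 1 + of_nat n * w + w * w * R"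
proof (induction n)
  case 0 show ?case by (intro exI[of _ 0]) simp
next
  case (Suc n)
  then obtain R where R: "vge P 0 R" "(1 + w) ^ n = 1 + of_nat n * w + w * w * R" by blast
  have "(1 + w) ^ Suc n = 1 + of_nat (Suc n) * w + w * w * (of_nat n + R + R * w)"
    unfolding power_Suc R(2) by (simp add: algebra_simps)
  moreover have "vge P 0 (of_nat n + R + R * w)"
    by (intro vge_add[OF P] vge_mult_int[OF P] vge_int[OF P] R w) simp
  ultimately show ?case by blast
qed

end

section \<open>A cofinal tower of moduli\<close>

locale ray_class_setting = numfield kt for kt :: "'k::field_char_0 itself" +
  fixes p :: nat and F :: "'k modulus"
  assumes p: "Factorial_Ring.prime p"
    and F: "pseudo_modulus F"
    and above: "unbounded_primes F \<subseteq> primes_above p"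
begin

abbreviation Ub :: "'k set set" where "Ub \<equiv> unbounded_primes F"
abbreviation e :: "'k set \<Rightarrow> nat" where "e P \<equiv> ramification_index p P"

text \<open>The exponents start at \<open>2 e P\<close> so that \<open>(1 + w)\<^sup>p = 1 + p w\<close> modulo the level \<open>m + 2\<close> for \<open>1 + w\<close> in
  the ray of level \<open>m\<close>, because \<open>2 (m + 2) \<ge> m + 4\<close>.\<close>

definition lev :: "nat \<Rightarrow> 'k modulus" where
  "lev m = Modulus (\<lambda>P. if P \<in> Ub then enat (e P * (m + 2)) else exponent F P) (reals F)"

lemma Ub: assumes "P \<in> Ub" shows "P \<in> finite_primes" "P \<in> supp F" "of_nat p \<in> P"
  using assms above by (auto simp: unbounded_primes_def supp_def primes_above_def)

lemma finite_Ub: "finite Ub"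
  using finite_subset[OF _ supp(1)[OF F]] Ub(2) by blast

lemma p_nonzero: "(of_nat p :: 'k) \<noteq> 0"
  using prime_gt_0_nat[OF p] by simp

lemma e: assumes P: "P \<in> Ub" shows "vge P (int (e P)) (of_nat p)" "prime_val P (of_nat p) = int (e P)" "0 < e P"
proof -
  show v: "prime_val P (of_nat p) = int (e P)"
    unfolding ramification_index_def by (rule prime_val_int[OF Ub(1)[OF P] _ p_nonzero]) simp
  then show "vge P (int (e P)) (of_nat p)" by (simp add: vge_def)
  show "0 < e P" using vge_mem[OF Ub(1)[OF P] Ub(3)[OF P]] v p_nonzero by (simp add: vge_def)
qed

lemma exponent_lev: "exponent (lev m) P = (if P \<in> Ub then enat (e P * (m + 2)) else exponent F P)"
  by (simp add: lev_def)

lemma reals_lev [simp]: "reals (lev m) = reals F"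
  by (simp add: lev_def)

lemma exponent_lev_eq_0: "exponent (lev m) P = 0 \<longleftrightarrow> exponent F P = 0"
  using e(3)[of P] by (auto simp: exponent_lev zero_enat_def unbounded_primes_def)

lemma supp_lev [simp]: "supp (lev m) = supp F"
  by (simp add: supp_def exponent_lev_eq_0)

lemma modulus_lev: "modulus (lev m)"
proof -
  have "exponent (lev m) P \<noteq> \<infinity>" for P
  proof (cases "P \<in> Ub")
    case False
    have "exponent F P \<noteq> \<infinity>"
    proof
      assume inf: "exponent F P = \<infinity>"
      then have "P \<in> supp F" by (simp add: supp_def)
      then show False using inf False supp(2)[OF F] by (auto simp: unbounded_primes_def)
    qed
    then show ?thesis using False by (simp add: exponent_lev)
  qed (simp add: exponent_lev)
  then show ?thesis using F unfolding modulus_def pseudo_modulus_def exponent_lev_eq_0 by simp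
qed

lemma mod_dvd_lev_mono: "m \<le> n \<Longrightarrow> mod_dvd (lev m) (lev n)"
  by (simp add: mod_dvd_def exponent_lev)

lemma lev_moduli: "lev m \<in> moduli F"
  using modulus_lev by (auto simp: moduli_def mod_dvd_def exponent_lev unbounded_primes_def)

lemma moduliD: assumes "f \<in> moduli F" shows "modulus f" "mod_dvd f F"
  using assms by (auto simp: moduli_def)

lemma mod_dvd_trans: "mod_dvd f g \<Longrightarrow> mod_dvd g h \<Longrightarrow> mod_dvd f h"
  by (auto simp: mod_dvd_def intro: order_trans)

text \<open>Cofinality: at a prime with infinite exponent \<open>lev m\<close> has exponent at least
  \<open>m\<close>, since \<open>e P\<close> is positive; at the others it already has the exponent
  of \<open>F\<close>.\<close>

lemma divides_lev: assumes f: "f \<in> moduli F" shows "\<exists>m. mod_dvd f (lev m)"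
proof -
  define m where "m = (\<Sum>P\<in>Ub. ex f P)"
  have "exponent f P \<le> exponent (lev m) P" for P
  proof (cases "P \<in> Ub")
    case True
    then have "ex f P \<le> m" unfolding m_def using finite_Ub by (intro member_le_sum) auto
    also have "m \<le> m + 2" by simp
    also have "\<dots> \<le> e P * (m + 2)" using e(3)[OF True] by (cases "e P") auto
    finally show ?thesis using True by (subst exponent_enat[OF moduliD(1)[OF f]]) (simp add: exponent_lev)
  qed (use moduliD(2)[OF f] in \<open>simp add: exponent_lev mod_dvd_def\<close>)
  then have "mod_dvd f (lev m)" using moduliD(2)[OF f] by (simp add: mod_dvd_def)
  then show ?thesis ..
qed

text \<open>The ideals prime to \<open>F\<close>; all levels have the same support and hence share
  this group.\<close>

definition A0 :: "'k set set" where "A0 = A (lev 0)"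

lemma A_lev: "A (lev m) = A0"
  unfolding A0_def A_eq away_def by (simp only: exponent_lev_eq_0)

lemma A0_sub: assumes "f \<in> moduli F" shows "A0 \<subseteq> A f"
  using divides_lev[OF assms] A_antimono A_lev by metis

lemma ray_lev_iff:
  "x \<in> ray (lev m) \<longleftrightarrow> x \<noteq> 0 \<and> (\<forall>P\<in>Ub. vge P (int (e P) * (int m + 2)) (x - 1)) \<and>
     (\<forall>Q\<in>supp F - Ub. vge Q (int (ex F Q)) (x - 1)) \<and> (\<forall>\<sigma>\<in>reals F. 0 < \<sigma> x)"
proof -
  have "(\<forall>P\<in>supp F. vge P (int (ex (lev m) P)) (x - 1)) \<longleftrightarrow>
      (\<forall>P\<in>Ub. vge P (int (e P) * (int m + 2)) (x - 1)) \<and> (\<forall>Q\<in>supp F - Ub. vge Q (int (ex F Q)) (x - 1))"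
    using Ub(2) by (auto simp: exponent_lev algebra_simps)
  then show ?thesis by (simp add: ray_iff[OF modulus_lev])
qed

lemma e_times_le: "a \<le> b \<Longrightarrow> int (e P) * a \<le> int (e P) * b"
  by (rule mult_left_mono) auto

text \<open>In the expansion of \<open>(1 + w) ^ p\<close> the linear term gains \<open>e P\<close>
  from the factor \<open>p\<close>, and the quadratic one doubles the level. At primes with finite
  exponent the condition is the same at both levels, so closure of the ray under powers settles
  it.\<close>

lemma power_p_ray: assumes z: "z \<in> ray (lev m)" shows "z ^ p \<in> ray (lev (Suc m))"
proof -
  have zp: "z ^ p \<in> ray (lev m)" by (rule ray_power[OF modulus_lev z])
  have "vge P (int (e P) * (int (Suc m) + 2)) (z ^ p - 1)" if PU: "P \<in> Ub" for P
  proof -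
    note P = Ub(1)[OF PU]
    let ?E = "int (e P)"
    have w: "vge P (?E * (int m + 2)) (z - 1)" using z PU unfolding ray_lev_iff by blast
    have w0: "vge P 0 (z - 1)" by (rule vge_mono[OF w]) simp
    obtain R where R: "vge P 0 R" "(1 + (z - 1)) ^ p = 1 + of_nat p * (z - 1) + (z - 1) * (z - 1) * R"
      using binomial_expansion[OF P w0, of p] by blast
    have "vge P (?E + ?E * (int m + 2)) (of_nat p * (z - 1))" by (rule vge_mult[OF P e(1)[OF PU] w])
    then have 1: "vge P (?E * (int (Suc m) + 2)) (of_nat p * (z - 1))" by (rule vge_mono) (simp add: algebra_simps)
    have "vge P (?E * (int m + 2) + ?E * (int m + 2)) ((z - 1) * (z - 1) * R)"
      by (rule vge_mult_int[OF P vge_mult[OF P w w] R(1)])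
    moreover have "?E * (int (Suc m) + 2) \<le> ?E * (int m + 2) + ?E * (int m + 2)"
      unfolding distrib_left[symmetric] by (rule e_times_le) simp
    ultimately have 2: "vge P (?E * (int (Suc m) + 2)) ((z - 1) * (z - 1) * R)" by (rule vge_mono)
    have "z ^ p - 1 = of_nat p * (z - 1) + (z - 1) * (z - 1) * R" using R(2) by simp
    then show ?thesis using vge_add[OF P 1 2] by simp
  qed
  then show ?thesis using zp unfolding ray_lev_iff by blast
qed

lemma positive_shift:
  assumes R: "finite (R :: ('k \<Rightarrow> real) set)" "R \<subseteq> real_places"
  shows "\<exists>l. \<forall>n\<ge>l. \<forall>\<sigma>\<in>R. 0 < \<sigma> (1 + y + of_nat n)"
proof (intro exI allI impI ballI)
  \<comment> \<open>This assumption instantiates the open witness: the threshold is the sum of all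
    \<open>\<bar>\<sigma> y\<bar>\<close>, rounded up.\<close>
  fix n \<sigma> assume n: "nat \<lceil>\<Sum>\<sigma>\<in>R. \<bar>\<sigma> y\<bar>\<rceil> \<le> n" and \<sigma>: "\<sigma> \<in> R"
  have "\<bar>\<sigma> y\<bar> \<le> (\<Sum>\<sigma>\<in>R. \<bar>\<sigma> y\<bar>)" by (rule member_le_sum) (use \<sigma> R in auto)
  also have "\<dots> \<le> real n" using n by linarith
  finally have "\<bar>\<sigma> y\<bar> \<le> real n" .
  moreover have "\<sigma> (1 + y + of_nat n) = 1 + \<sigma> y + real n"
    using R(2) \<sigma> by (simp add: real_place_simps real_place_of_nat subset_iff)
  ultimately show "0 < \<sigma> (1 + y + of_nat n)" by linarith
qed

text \<open>Away from \<open>p\<close> there is no congruence between \<open>x\<close> and its \<open>p\<close>-th root, so the approximate root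
  \<open>1 + (x - 1) / p\<close> is multiplied by an approximate idempotent to kill it there, and shifted by a
  multiple of a highly divisible integer to make it totally positive.\<close>

lemma approximate_root:
  assumes x: "x \<in> ray (lev (Suc m))"
  shows "\<exists>z\<in>ray (lev m). x * inverse (z ^ p) \<in> ray (lev (m + 2))"
proof -
  define u where "u = (x - 1) / of_nat p"
  have pu: "x - 1 = of_nat p * u" using p_nonzero by (simp add: u_def)
  let ?T = "supp F - Ub"
  have UbS: "Ub \<subseteq> finite_primes" using Ub(1) by blast
  have T: "finite ?T" "?T \<subseteq> finite_primes" "Ub \<inter> ?T = {}" using supp[OF F] by auto
  \<comment> \<open>\<open>k\<close> dominates three requirements: the exponent at the target level
    \<open>m + 2\<close> for the primes of \<open>Ub\<close>, the exponents of \<open>F\<close> at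
    the other primes, and the denominators of \<open>u\<close> there.\<close>
  define k where "k = (\<Sum>P\<in>Ub. e P * (m + 4)) + (\<Sum>Q\<in>?T. ex F Q + nat (- prime_val Q u))"
  have kU: "int (e P) * (int m + 4) \<le> int k" if "P \<in> Ub" for P
  proof -
    have "e P * (m + 4) \<le> (\<Sum>P\<in>Ub. e P * (m + 4))" by (rule member_le_sum) (use that finite_Ub in auto)
    then have "int (e P * (m + 4)) \<le> int k" unfolding k_def by linarith
    then show ?thesis by (simp add: add.commute)
  qed
  have kT: "int (ex F Q) - prime_val Q u \<le> int k" "int (ex F Q) \<le> int k" if "Q \<in> ?T" for Q
  proof -
    have "ex F Q + nat (- prime_val Q u) \<le> (\<Sum>Q\<in>?T. ex F Q + nat (- prime_val Q u))"
      by (rule member_le_sum) (use that T in auto)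
    then show "int (ex F Q) - prime_val Q u \<le> int k" "int (ex F Q) \<le> int k" unfolding k_def by linarith+
  qed
  obtain \<epsilon> where \<epsilon>: "algebraic_int \<epsilon>" "\<forall>P\<in>Ub. vge P (int k) (\<epsilon> - 1)" "\<forall>Q\<in>?T. vge Q (int k) \<epsilon>"
    using approximate_idempotent[OF finite_Ub UbS T, of k] by blast
  obtain D where D: "D > 0" "\<forall>P\<in>supp F. vge P (int k) (of_nat D)"
    using deep_integer[OF supp[OF F], of k] by blast
  have R: "finite (reals F)" "reals F \<subseteq> real_places" using F by (auto simp: pseudo_modulus_def)
  obtain l where l: "\<forall>n\<ge>l. \<forall>\<sigma>\<in>reals F. 0 < \<sigma> (1 + \<epsilon> * u + of_nat n)"
    using positive_shift[OF R] by blast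
  \<comment> \<open>Positivity excludes \<open>z = 0\<close> only if there are real places. If the
    shift by \<open>l * D\<close> gives 0, one further \<open>D\<close> makes
    \<open>z = D\<close>.\<close>
  define l' where "l' = (if 1 + \<epsilon> * u + of_nat (l * D) = 0 then Suc l else l)"
  define z where "z = 1 + \<epsilon> * u + of_nat (l' * D)"
  have z0: "z \<noteq> 0"
  proof (cases "1 + \<epsilon> * u + of_nat (l * D) = 0")
    case True
    then have "z = of_nat D" by (simp add: z_def l'_def algebra_simps)
    then show ?thesis using D(1) by simp
  qed (simp add: z_def l'_def)
  have zw: "z - 1 = \<epsilon> * u + of_nat D * of_nat l'" by (simp add: z_def mult.commute)
  have Dk: "vge P (int k) (of_nat D * of_nat l')" if "P \<in> supp F" for P
    using that D(2) supp(2)[OF F] by (intro vge_mult_int vge_int) auto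
  \<comment> \<open>Division by \<open>p\<close> costs exactly one level, from \<open>m + 1\<close>
    to \<open>m\<close>.\<close>
  have uU: "vge P (int (e P) * (int m + 2)) u" if PU: "P \<in> Ub" for P
  proof (cases "u = 0")
    case False
    note P = Ub(1)[OF PU]
    have "vge P (int (e P) * (int (Suc m) + 2)) (of_nat p * u)" using x PU pu unfolding ray_lev_iff by auto
    then have "int (e P) * (int m + 2) + int (e P) \<le> int (e P) + prime_val P u"
      using False p_nonzero e(2)[OF PU] prime_val_mult[OF P p_nonzero False] by (simp add: vge_def algebra_simps)
    then show ?thesis by (simp add: vge_def)
  qed simp
  have \<epsilon>0: "vge P 0 \<epsilon>" if "P \<in> finite_primes" for P using vge_int[OF that \<epsilon>(1)] .
  have zU: "vge P (int (e P) * (int m + 2)) (z - 1)" if PU: "P \<in> Ub" for P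
  proof -
    note P = Ub(1)[OF PU]
    have "int (e P) * (int m + 2) \<le> int k" using kU[OF PU] e_times_le[of "int m + 2" "int m + 4" P] by linarith
    moreover have "vge P (int (e P) * (int m + 2)) (\<epsilon> * u)"
      using vge_mult_int[OF P uU[OF PU] \<epsilon>0[OF P]] by (simp add: mult.commute)
    ultimately show ?thesis unfolding zw by (intro vge_add[OF P] vge_mono[OF Dk[OF Ub(2)[OF PU]]])
  qed
  have zT: "vge Q (int (ex F Q)) (z - 1)" if QT: "Q \<in> ?T" for Q
  proof -
    have Q: "Q \<in> finite_primes" "Q \<in> supp F" using T(2) QT by auto
    have "vge Q (prime_val Q u) u" by (simp add: vge_def)
    then have "vge Q (int k + prime_val Q u) (\<epsilon> * u)" using \<epsilon>(3) QT by (intro vge_mult[OF Q(1)]) auto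
    then have "vge Q (int (ex F Q)) (\<epsilon> * u)" by (rule vge_mono) (use kT(1)[OF QT] in simp)
    then show ?thesis unfolding zw by (intro vge_add[OF Q(1)] vge_mono[OF Dk[OF Q(2)]] kT(2)[OF QT])
  qed
  have "l \<le> l' * D" using D(1) by (cases D) (auto simp: l'_def)
  then have "0 < \<sigma> z" if "\<sigma> \<in> reals F" for \<sigma> using l that unfolding z_def by blast
  then have z: "z \<in> ray (lev m)" unfolding ray_lev_iff using z0 zU zT by blast
  have zp: "z ^ p \<in> ray (lev m)" by (rule ray_power[OF modulus_lev z])
  let ?q = "x * inverse (z ^ p)"
  have "x \<in> ray (lev m)" using x ray_antimono[OF modulus_lev modulus_lev mod_dvd_lev_mono[of m "Suc m"]] by auto
  then have q: "?q \<in> ray (lev m)" by (intro ray_mult[OF modulus_lev] ray_inverse[OF modulus_lev] zp)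
  have "vge P (int (e P) * (int (m + 2) + 2)) (?q - 1)" if PU: "P \<in> Ub" for P
  proof -
    note P = Ub(1)[OF PU]
    let ?E = "int (e P)" and ?n = "int (e P) * (int (m + 2) + 2)"
    have n: "?n = ?E * (int m + 4)" by simp
    have w0: "vge P 0 (z - 1)" by (rule vge_mono[OF zU[OF PU]]) simp
    obtain R where R: "vge P 0 R" "(1 + (z - 1)) ^ p = 1 + of_nat p * (z - 1) + (z - 1) * (z - 1) * R"
      using binomial_expansion[OF P w0, of p] by blast
    have xz: "x - z ^ p = of_nat p * (u - (z - 1)) - (z - 1) * (z - 1) * R"
      using R(2) pu by (simp add: algebra_simps)
    have u0: "vge P 0 u" by (rule vge_mono[OF uU[OF PU]]) simp
    \<comment> \<open>\<open>z - 1\<close> differs from \<open>u\<close> only by the error of the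
      idempotent and by the shift, both of order \<open>k\<close>, so the linear terms of
      \<open>x\<close> and \<open>z ^ p\<close> agree.\<close>
    have "u - (z - 1) = - ((\<epsilon> - 1) * u + of_nat D * of_nat l')" by (simp add: zw algebra_simps)
    moreover have "vge P (int k) ((\<epsilon> - 1) * u + of_nat D * of_nat l')"
      using \<epsilon>(2) PU u0 by (intro vge_add[OF P] vge_mult_int[OF P] Dk[OF Ub(2)[OF PU]]) auto
    ultimately have "vge P (int k) (u - (z - 1))" using vge_minus[OF P] by metis
    then have "vge P (int k) ((u - (z - 1)) * of_nat p)" by (rule vge_mult_int[OF P]) (simp add: vge_int[OF P])
    then have 1: "vge P ?n (of_nat p * (u - (z - 1)))" unfolding n mult.commute[of "of_nat p"] by (rule vge_mono[OF _ kU[OF PU]])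
    have "vge P (?E * (int m + 2) + ?E * (int m + 2)) ((z - 1) * (z - 1) * R)"
      by (rule vge_mult_int[OF P vge_mult[OF P zU[OF PU] zU[OF PU]] R(1)])
    moreover have "?E * (int m + 4) \<le> ?E * (int m + 2) + ?E * (int m + 2)"
      unfolding distrib_left[symmetric] by (rule e_times_le) simp
    ultimately have 2: "vge P ?n ((z - 1) * (z - 1) * R)" unfolding n by (rule vge_mono)
    have "prime_val P (z ^ p) = 0" using ray_unit[OF modulus_lev zp, of P] Ub(2)[OF PU] by simp
    then have "vge P 0 (inverse (z ^ p))" using prime_val_inverse[OF P, of "z ^ p"] z0 by (simp add: vge_def)
    then have "vge P ?n ((x - z ^ p) * inverse (z ^ p))"
      unfolding xz by (rule vge_mult_int[OF P vge_diff[OF P 1 2]])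
    moreover have "?q - 1 = (x - z ^ p) * inverse (z ^ p)" using z0 by (simp add: algebra_simps)
    ultimately show ?thesis by simp
  qed
  then have "?q \<in> ray (lev (m + 2))" using q unfolding ray_lev_iff by blast
  then show ?thesis using z by blast
qed

end

section \<open>The group of a pseudo-modulus\<close>

context numfield begin

lemma cs_carrier: "I \<in> A f \<Longrightarrow> cs f I \<in> carrier (RG f)"
  by (simp add: RG_carrier)

lemma RG_inv: assumes f: "modulus f" and I: "I \<in> A f" shows "inv\<^bsub>RG f\<^esub> (cs f I) = cs f (idinv I)"
proof -
  interpret RG: comm_group "RG f" by (rule comm_group_RG[OF f])
  have "cs f (idinv I) \<otimes>\<^bsub>RG f\<^esub> cs f I = \<one>\<^bsub>RG f\<^esub>"
    unfolding RG_mult[OF f A_closed(2)[OF I] I] idinv(3)[OF A_frac[OF I]] cs_one[OF f] RG_one ..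
  then show ?thesis by (rule RG.inv_equality) (intro cs_carrier A_closed I)+
qed

lemma cs_principal_pow:
  assumes f: "modulus f" and z: "principal (z :: 'k) \<in> A f"
  shows "principal (z ^ n) \<in> A f" "cs f (principal z) [^]\<^bsub>RG f\<^esub> n = cs f (principal (z ^ n))"
proof (induction n)
  case 0
  show "principal (z ^ 0) \<in> A f" "cs f (principal z) [^]\<^bsub>RG f\<^esub> (0::nat) = cs f (principal (z ^ 0))"
    using A_closed(3)[of f] cs_one[OF f] RG_one[of f] by simp_all
next
  case (Suc n)
  have eq: "principal (z ^ n) \<diamondop> principal z = principal (z ^ Suc n)" unfolding principal_mult by (simp add: mult.commute)
  show "principal (z ^ Suc n) \<in> A f" using A_closed(1)[OF Suc(1) z] unfolding eq .
  show "cs f (principal z) [^]\<^bsub>RG f\<^esub> Suc n = cs f (principal (z ^ Suc n))"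
    using RG_mult[OF f Suc(1) z] Suc(2) unfolding eq by simp
qed

end

context ray_class_setting begin

abbreviation M :: "'k modulus set" where "M \<equiv> moduli F"
abbreviation PRG :: "('k modulus \<Rightarrow> 'k set set) topgroup" where "PRG \<equiv> pro_ray_class_group F"

lemma PRG_carrier: "x \<in> carrier PRG \<longleftrightarrow> x \<in> (\<Pi>\<^sub>E f\<in>M. carrier (RG f)) \<and>
    (\<forall>f\<in>M. \<forall>f'\<in>M. mod_dvd f f' \<longrightarrow> ray_class_map f (x f') = x f)"
  by (simp add: pro_ray_class_group_def Let_def)

lemma PRG_mult: "x \<otimes>\<^bsub>PRG\<^esub> y = (\<lambda>f\<in>M. x f \<otimes>\<^bsub>RG f\<^esub> y f)"
  and PRG_one: "\<one>\<^bsub>PRG\<^esub> = (\<lambda>f\<in>M. \<one>\<^bsub>RG f\<^esub>)"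
  and PRG_topo: "topo PRG = subtopology (product_topology (\<lambda>f. discrete_topology (carrier (RG f))) M) (carrier PRG)"
  by (simp_all add: pro_ray_class_group_def Let_def)

lemma PRG_component: assumes "x \<in> carrier PRG" "f \<in> M" shows "x f \<in> carrier (RG f)"
  using assms unfolding PRG_carrier by (blast dest: PiE_mem)

lemma PRG_compat: "x \<in> carrier PRG \<Longrightarrow> f \<in> M \<Longrightarrow> f' \<in> M \<Longrightarrow> mod_dvd f f' \<Longrightarrow> ray_class_map f (x f') = x f"
  unfolding PRG_carrier by blast

lemma PRG_extensional: "x \<in> carrier PRG \<Longrightarrow> f \<notin> M \<Longrightarrow> x f = undefined"
  unfolding PRG_carrier by (blast dest: PiE_arb)

lemma PRG_I:
  assumes "\<And>f. f \<in> M \<Longrightarrow> x f \<in> carrier (RG f)"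
    and "\<And>f f'. f \<in> M \<Longrightarrow> f' \<in> M \<Longrightarrow> mod_dvd f f' \<Longrightarrow> ray_class_map f (x f') = x f"
  shows "restrict x M \<in> carrier PRG"
  unfolding PRG_carrier using assms by simp

lemma PRG_eqI: assumes "x \<in> carrier PRG" "y \<in> carrier PRG" "\<And>f. f \<in> M \<Longrightarrow> x f = y f" shows "x = y"
proof
  fix f show "x f = y f" using assms PRG_extensional by (cases "f \<in> M") metis+
qed

lemma ray_class_map_mult:
  assumes f: "f \<in> M" "f' \<in> M" "mod_dvd f f'" and ab: "a \<in> carrier (RG f')" "b \<in> carrier (RG f')"
  shows "ray_class_map f (a \<otimes>\<^bsub>RG f'\<^esub> b) = ray_class_map f a \<otimes>\<^bsub>RG f\<^esub> ray_class_map f b"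
proof -
  note mf = moduliD(1)[OF f(1)] and mf' = moduliD(1)[OF f(2)]
  note cs = ray_class_map_cs[OF mf mf' f(3)]
  obtain I J where I: "I \<in> A f'" "a = cs f' I" and J: "J \<in> A f'" "b = cs f' J" using ab unfolding RG_carrier by blast
  have "I \<in> A f" "J \<in> A f" using I J A_antimono[OF f(3)] by auto
  then show ?thesis unfolding I(2) J(2) RG_mult[OF mf' I(1) J(1)] cs by (simp only: RG_mult[OF mf])
qed

lemma ray_class_map_one:
  assumes f: "f \<in> M" "f' \<in> M" "mod_dvd f f'" shows "ray_class_map f (\<one>\<^bsub>RG f'\<^esub>) = \<one>\<^bsub>RG f\<^esub>"
  using ray_class_map_cs[OF moduliD(1)[OF f(1)] moduliD(1)[OF f(2)] f(3), of \<O>]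
  by (simp add: RG_one cs_one moduliD(1) f)

lemma ray_class_map_inv:
  assumes f: "f \<in> M" "f' \<in> M" "mod_dvd f f'" and a: "a \<in> carrier (RG f')"
  shows "ray_class_map f (inv\<^bsub>RG f'\<^esub> a) = inv\<^bsub>RG f\<^esub> (ray_class_map f a)"
proof -
  note mf = moduliD(1)[OF f(1)] and mf' = moduliD(1)[OF f(2)]
  obtain I where I: "I \<in> A f'" "a = cs f' I" using a unfolding RG_carrier by blast
  have "I \<in> A f" using I A_antimono[OF f(3)] by auto
  then show ?thesis unfolding I(2) RG_inv[OF mf' I(1)] ray_class_map_cs[OF mf mf' f(3)] by (simp only: RG_inv[OF mf])
qed

lemma comm_group_PRG: "comm_group PRG"
proof (rule comm_groupI)
  have g: "comm_group (RG f)" "monoid (RG f)" if "f \<in> M" for f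
    using comm_group_RG[OF moduliD(1)[OF that]] by (simp_all add: comm_group_def group_def)
  show "\<one>\<^bsub>PRG\<^esub> \<in> carrier PRG" unfolding PRG_one
    by (rule PRG_I) (simp_all add: monoid.one_closed[OF g(2)] ray_class_map_one)
  fix x y assume x: "x \<in> carrier PRG" and y: "y \<in> carrier PRG"
  show "x \<otimes>\<^bsub>PRG\<^esub> y \<in> carrier PRG" unfolding PRG_mult
    by (rule PRG_I) (use monoid.m_closed[OF g(2)] PRG_component[OF x] PRG_component[OF y] in \<open>simp_all add: ray_class_map_mult PRG_compat[OF x] PRG_compat[OF y]\<close>)
  show "x \<otimes>\<^bsub>PRG\<^esub> y = y \<otimes>\<^bsub>PRG\<^esub> x" unfolding PRG_mult
    by (rule restrict_ext) (use comm_monoid.m_comm[OF comm_group.axioms(1)[OF g(1)]] PRG_component[OF x] PRG_component[OF y] in blast)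
  show "x \<otimes>\<^bsub>PRG\<^esub> y \<otimes>\<^bsub>PRG\<^esub> z = x \<otimes>\<^bsub>PRG\<^esub> (y \<otimes>\<^bsub>PRG\<^esub> z)" if z: "z \<in> carrier PRG" for z
    unfolding PRG_mult
    by (rule restrict_ext) (simp add: monoid.m_assoc[OF g(2)] PRG_component[OF x] PRG_component[OF y] PRG_component[OF z])
  show "\<one>\<^bsub>PRG\<^esub> \<otimes>\<^bsub>PRG\<^esub> x = x"
  proof
    fix f show "(\<one>\<^bsub>PRG\<^esub> \<otimes>\<^bsub>PRG\<^esub> x) f = x f"
      by (cases "f \<in> M") (simp_all add: PRG_mult PRG_one monoid.l_one[OF g(2)] PRG_component[OF x] PRG_extensional[OF x])
  qed
  show "\<exists>y\<in>carrier PRG. y \<otimes>\<^bsub>PRG\<^esub> x = \<one>\<^bsub>PRG\<^esub>"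
  proof
    show "(\<lambda>f\<in>M. inv\<^bsub>RG f\<^esub> (x f)) \<in> carrier PRG"
      by (rule PRG_I) (use group.inv_closed[OF comm_group.axioms(2)[OF g(1)]] PRG_component[OF x] in \<open>simp_all add: ray_class_map_inv PRG_compat[OF x]\<close>)
    show "(\<lambda>f\<in>M. inv\<^bsub>RG f\<^esub> (x f)) \<otimes>\<^bsub>PRG\<^esub> x = \<one>\<^bsub>PRG\<^esub>"
      unfolding PRG_mult PRG_one
      by (rule restrict_ext) (simp add: group.l_inv[OF comm_group.axioms(2)[OF g(1)]] PRG_component[OF x])
  qed
qed

sublocale PRG: comm_group PRG
  by (rule comm_group_PRG)

lemma group_hom_component: assumes f: "f \<in> M" shows "group_hom PRG (RG f) (\<lambda>x. x f)"
proof -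
  interpret RG: comm_group "RG f" by (rule comm_group_RG[OF moduliD(1)[OF f]])
  show ?thesis
    by unfold_locales (use f PRG_component in \<open>auto simp: hom_def PRG_mult\<close>)
qed

definition K :: "nat \<Rightarrow> ('k modulus \<Rightarrow> 'k set set) set" where
  "K m = {x \<in> carrier PRG. x (lev m) = \<one>\<^bsub>RG (lev m)\<^esub>}"

lemma quotient_in_K:
  assumes x: "x \<in> carrier PRG" and y: "y \<in> carrier PRG"
  shows "x \<otimes>\<^bsub>PRG\<^esub> inv\<^bsub>PRG\<^esub> y \<in> K m \<longleftrightarrow> x (lev m) = y (lev m)"
proof -
  interpret h: group_hom PRG "RG (lev m)" "\<lambda>x. x (lev m)" by (rule group_hom_component[OF lev_moduli])
  have c: "x (lev m) \<in> carrier (RG (lev m))" "y (lev m) \<in> carrier (RG (lev m))" using h.hom_closed x y by auto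
  have "(x \<otimes>\<^bsub>PRG\<^esub> inv\<^bsub>PRG\<^esub> y) (lev m) = x (lev m) \<otimes>\<^bsub>RG (lev m)\<^esub> inv\<^bsub>RG (lev m)\<^esub> (y (lev m))"
    using h.hom_mult[OF x PRG.inv_closed[OF y]] h.hom_inv[OF y] by simp
  moreover have "x (lev m) \<otimes>\<^bsub>RG (lev m)\<^esub> inv\<^bsub>RG (lev m)\<^esub> (y (lev m)) = \<one>\<^bsub>RG (lev m)\<^esub> \<longleftrightarrow> x (lev m) = y (lev m)"
    using c h.H.inv_equality[of "x (lev m)" "inv\<^bsub>RG (lev m)\<^esub> (y (lev m))"] h.H.inv_inv[of "y (lev m)"] h.H.r_inv[of "y (lev m)"] by auto
  ultimately show ?thesis using x y by (simp add: K_def)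
qed

text \<open>An ideal prime to \<open>F\<close> has a class modulo every modulus dividing
  \<open>F\<close>, hence defines a point of the inverse limit.\<close>

definition ray_class :: "'k set \<Rightarrow> 'k modulus \<Rightarrow> 'k set set" where
  "ray_class I = (\<lambda>f\<in>M. cs f I)"

lemma ray_class_lev [simp]: "ray_class I (lev m) = cs (lev m) I"
  by (simp add: ray_class_def lev_moduli)

lemma ray_class: assumes I: "I \<in> A0" shows "ray_class I \<in> carrier PRG"
  unfolding ray_class_def
proof (rule PRG_I)
  show "cs f I \<in> carrier (RG f)" if "f \<in> M" for f using cs_carrier A0_sub[OF that] I by blast
  show "ray_class_map f (cs f' I) = cs f I" if "f \<in> M" "f' \<in> M" "mod_dvd f f'" for f f'
    using ray_class_map_cs[OF moduliD(1)[OF that(1)] moduliD(1)[OF that(2)] that(3)] .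
qed

lemma RG_lev_carrier: "carrier (RG (lev m)) = cs (lev m) ` A0"
  by (simp add: RG_carrier A_lev)

lemma PRG_lev: assumes "x \<in> carrier PRG" obtains I where "I \<in> A0" "x (lev m) = cs (lev m) I"
  using PRG_component[OF assms lev_moduli, of m] unfolding RG_lev_carrier by blast

lemma lev_determines:
  assumes x: "x \<in> carrier PRG" and y: "y \<in> carrier PRG" and eq: "x (lev m) = y (lev m)"
    and f: "f \<in> M" "mod_dvd f (lev m)"
  shows "x f = y f"
  using PRG_compat[OF x f(1) lev_moduli f(2)] PRG_compat[OF y f(1) lev_moduli f(2)] eq by simp

lemma one_lev: "\<one>\<^bsub>PRG\<^esub> f = \<one>\<^bsub>RG f\<^esub>" if "f \<in> M" for f
  using that by (simp add: PRG_one)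

lemma K_iff: "x \<in> K m \<longleftrightarrow> x \<in> carrier PRG \<and> x (lev m) = \<one>\<^bsub>PRG\<^esub> (lev m)"
  by (simp add: K_def one_lev lev_moduli)

lemma K_subgroup: "subgroup (K m) PRG"
proof -
  interpret h: group_hom PRG "RG (lev m)" "\<lambda>x. x (lev m)" by (rule group_hom_component[OF lev_moduli])
  have "K m = kernel PRG (RG (lev m)) (\<lambda>x. x (lev m))" by (auto simp: K_def kernel_def)
  then show ?thesis using h.subgroup_kernel by simp
qed

lemma lev_mono_eq:
  assumes x: "x \<in> carrier PRG" and y: "y \<in> carrier PRG" and "x (lev n) = y (lev n)" "m \<le> n"
  shows "x (lev m) = y (lev m)"
  using lev_determines[OF x y assms(3) lev_moduli mod_dvd_lev_mono[OF assms(4)]] .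

text \<open>By cofinality the component of the limit at \<open>f\<close> can be read from
  \<open>y (k f)\<close>, where \<open>f\<close> divides the level \<open>k f\<close>. By
  \<open>agree'\<close> another such level gives the same class, which yields compatibility.\<close>

lemma K_complete:
  assumes y: "\<And>n. y n \<in> carrier PRG" and c: "\<And>n. y (Suc n) \<otimes>\<^bsub>PRG\<^esub> inv\<^bsub>PRG\<^esub> (y n) \<in> K n"
  shows "\<exists>x\<in>carrier PRG. \<forall>n. x \<otimes>\<^bsub>PRG\<^esub> inv\<^bsub>PRG\<^esub> (y n) \<in> K n"
proof -
  have step: "y (Suc n) (lev n) = y n (lev n)" for n using c[of n] unfolding quotient_in_K[OF y y] .
  have stable: "y n' (lev n) = y n (lev n)" if "n \<le> n'" for n n'
    using that
  proof (induction n' rule: dec_induct)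
    case (step k) then show ?case using lev_mono_eq[OF y y \<open>y (Suc k) (lev k) = y k (lev k)\<close> step(1)] \<open>\<And>n. y (Suc n) (lev n) = y n (lev n)\<close> by simp
  qed simp
  have agree: "y n' f = y n f" if "f \<in> M" "mod_dvd f (lev n)" "n \<le> n'" for n n' f
    using lev_determines[OF y y stable[OF that(3)] that(1,2)] .
  have agree': "y n' f = y n f" if "f \<in> M" "mod_dvd f (lev n)" "mod_dvd f (lev n')" for n n' f
    using agree[OF that(1,2), of n'] agree[OF that(1,3), of n] by (cases "n \<le> n'") auto
  obtain k where k: "\<And>f. f \<in> M \<Longrightarrow> mod_dvd f (lev (k f))" using divides_lev by metis
  let ?x = "\<lambda>f\<in>M. y (k f) f"
  have x: "?x \<in> carrier PRG"
  proof (rule PRG_I)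
    show "y (k f) f \<in> carrier (RG f)" if "f \<in> M" for f by (rule PRG_component[OF y that])
    show "ray_class_map f (y (k f') f') = y (k f) f" if "f \<in> M" "f' \<in> M" "mod_dvd f f'" for f f'
      using PRG_compat[OF y that] agree'[OF that(1) k[OF that(1)] mod_dvd_trans[OF that(3) k[OF that(2)]]] by simp
  qed
  have "?x (lev n) = y n (lev n)" for n
    using agree'[OF lev_moduli mod_dvd_lev_mono k] lev_moduli by simp
  then show ?thesis using x quotient_in_K[OF x y] by blast
qed

text \<open>A basic open set of the product restricts finitely many components, and all of these are
  determined by one sufficiently high level of the tower.\<close>

lemma K_open:
  "openin (topo PRG) U \<longleftrightarrow>
    U \<subseteq> carrier PRG \<and> (\<forall>x\<in>U. \<exists>n. \<forall>y\<in>carrier PRG. y \<otimes>\<^bsub>PRG\<^esub> inv\<^bsub>PRG\<^esub> x \<in> K n \<longrightarrow> y \<in> U)"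
  (is "?L \<longleftrightarrow> ?R")
proof
  let ?T = "product_topology (\<lambda>f. discrete_topology (carrier (RG f))) M"
  assume ?L
  then obtain V where V: "openin ?T V" "U = V \<inter> carrier PRG" unfolding PRG_topo openin_subtopology by blast
  show ?R
  proof (intro conjI ballI)
    show "U \<subseteq> carrier PRG" using V(2) by blast
    fix x assume x: "x \<in> U"
    then have xc: "x \<in> carrier PRG" and "x \<in> V" using V(2) by auto
    then obtain W where W: "finite {f \<in> M. W f \<noteq> carrier (RG f)}" "x \<in> Pi\<^sub>E M W" "Pi\<^sub>E M W \<subseteq> V"
      using V(1) unfolding openin_product_topology_alt topspace_discrete_topology by meson
    let ?B = "{f \<in> M. W f \<noteq> carrier (RG f)}"
    obtain k where k: "\<And>f. f \<in> M \<Longrightarrow> mod_dvd f (lev (k f))" using divides_lev by metis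
    \<comment> \<open>The sum is an upper bound for the finitely many levels
      \<open>k f\<close>.\<close>
    define n where "n = (\<Sum>f\<in>?B. k f)"
    have "y \<in> U" if y: "y \<in> carrier PRG" and eq: "y (lev n) = x (lev n)" for y
    proof -
      have "y f \<in> W f" if f: "f \<in> M" for f
      proof (cases "W f = carrier (RG f)")
        case False
        then have "k f \<le> n" unfolding n_def using W(1) f by (intro member_le_sum) auto
        then have "mod_dvd f (lev n)" using mod_dvd_trans[OF k[OF f] mod_dvd_lev_mono] by blast
        then have "y f = x f" by (rule lev_determines[OF y xc eq f])
        then show ?thesis using PiE_mem[OF W(2) f] by simp
      qed (simp add: PRG_component[OF y f])
      then have "y \<in> Pi\<^sub>E M W" using PRG_extensional[OF y] by (intro PiE_I) auto
      then show ?thesis using W(3) V(2) y by blast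
    qed
    then show "\<exists>n. \<forall>y\<in>carrier PRG. y \<otimes>\<^bsub>PRG\<^esub> inv\<^bsub>PRG\<^esub> x \<in> K n \<longrightarrow> y \<in> U"
      using quotient_in_K[OF _ xc] by blast
  qed
next
  let ?T = "product_topology (\<lambda>f. discrete_topology (carrier (RG f))) M"
  assume R: ?R
  show ?L
  proof (subst openin_subopen, intro ballI)
    fix x assume x: "x \<in> U"
    then have xc: "x \<in> carrier PRG" using R by blast
    obtain n where n: "\<And>y. y \<in> carrier PRG \<Longrightarrow> y (lev n) = x (lev n) \<Longrightarrow> y \<in> U"
      using bspec[OF conjunct2[OF R] x] quotient_in_K[OF _ xc] by blast
    let ?V = "{y \<in> topspace ?T. y (lev n) \<in> {x (lev n)}}"
    have "continuous_map ?T (discrete_topology (carrier (RG (lev n)))) (\<lambda>y. y (lev n))"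
      by (rule continuous_map_product_projection[OF lev_moduli])
    moreover have "openin (discrete_topology (carrier (RG (lev n)))) {x (lev n)}"
      using PRG_component[OF xc lev_moduli] by simp
    ultimately have "openin ?T ?V" by (rule openin_continuous_map_preimage)
    then have "openin (topo PRG) (?V \<inter> carrier PRG)" unfolding PRG_topo openin_subtopology by blast
    moreover have "x \<in> ?V \<inter> carrier PRG" using xc PRG_carrier by (auto simp: topspace_product_topology)
    moreover have "?V \<inter> carrier PRG \<subseteq> U" using n by blast
    ultimately show "\<exists>T. openin (topo PRG) T \<and> x \<in> T \<and> T \<subseteq> U" by blast
  qed
qed

text \<open>An element trivial at level \<open>m\<close> is represented at level
  \<open>m + 1\<close> by an ideal whose class at level \<open>m\<close> is trivial, that is, by a
  principal ideal with a generator in the ray of level \<open>m\<close>. Through these generators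
  the power map becomes a question about field elements.\<close>

lemma K_principal:
  assumes "x \<in> K m" obtains z where "z \<in> ray (lev m)" "principal z \<in> A0" "x (lev (Suc m)) = cs (lev (Suc m)) (principal z)"
proof -
  have xc: "x \<in> carrier PRG" using assms by (simp add: K_def)
  obtain I where I: "I \<in> A0" "x (lev (Suc m)) = cs (lev (Suc m)) I" by (rule PRG_lev[OF xc])
  have c: "ray_class I \<in> carrier PRG" by (rule ray_class[OF I(1)])
  have xm: "x (lev m) = cs (lev m) I" using lev_mono_eq[OF xc c, of "Suc m" m] I(2) by simp
  then have "cs (lev m) I = cs (lev m) \<O>" using assms by (simp add: K_def RG_one cs_one[OF modulus_lev])
  then obtain z where z: "z \<in> ray (lev m)" "I = principal z \<diamondop> \<O>"
    using cs_eq_iff[OF modulus_lev, of I m \<O>] I(1) A_closed(3)[of "lev m"] by (auto simp: A_lev)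
  have "I = principal z" using z(2) ideal_mult_ring(2)[OF Omod_principal] by simp
  then show ?thesis using that z(1) I xm by blast
qed

lemma finite_rcosets_K: "finite (rcosets\<^bsub>PRG\<^esub> (K n))"
proof -
  have "finite ((\<lambda>x. K n #>\<^bsub>PRG\<^esub> x) ` carrier PRG)"
  proof (rule finite_image_factor[of "\<lambda>x. x (lev n)"])
    show "finite ((\<lambda>x. x (lev n)) ` carrier PRG)"
      by (rule finite_subset[OF _ finite_RG[OF modulus_lev]]) (use PRG_component lev_moduli in blast)
    fix x y assume x: "x \<in> carrier PRG" and y: "y \<in> carrier PRG" and "x (lev n) = y (lev n)"
    then have "y \<otimes>\<^bsub>PRG\<^esub> inv\<^bsub>PRG\<^esub> x \<in> K n" using quotient_in_K[OF y x] by simp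
    moreover have "(y \<otimes>\<^bsub>PRG\<^esub> inv\<^bsub>PRG\<^esub> x) \<otimes>\<^bsub>PRG\<^esub> x = y" using x y by (simp add: PRG.m_assoc)
    ultimately have "y \<in> K n #>\<^bsub>PRG\<^esub> x" unfolding r_coset_def by (intro UN_I singletonI) (auto intro: sym)
    then show "K n #>\<^bsub>PRG\<^esub> x = K n #>\<^bsub>PRG\<^esub> y" by (rule PRG.repr_independence[OF _ x K_subgroup])
  qed
  moreover have "rcosets\<^bsub>PRG\<^esub> (K n) = (\<lambda>x. K n #>\<^bsub>PRG\<^esub> x) ` carrier PRG" by (auto simp: RCOSETS_def)
  ultimately show ?thesis by simp
qed

lemma ray_A0: assumes "z \<in> ray (lev m)" shows "principal z \<in> A0"
  using NR_sub[OF modulus_lev[of m]] assms unfolding NR_eq A_lev by blast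

lemma cs_ray: assumes "z \<in> ray (lev m)" shows "cs (lev m) (principal z) = \<one>\<^bsub>RG (lev m)\<^esub>"
proof -
  have "principal z = principal z \<diamondop> \<O>" by (rule ideal_mult_ring(2)[OF Omod_principal, symmetric])
  then have "cs (lev m) (principal z) = cs (lev m) \<O>"
    using cs_eq_iff[OF modulus_lev, of "principal z" m \<O>] ray_A0[OF assms] assms A_closed(3)[of "lev m"] by (auto simp: A_lev)
  then show ?thesis by (simp add: RG_one cs_one[OF modulus_lev])
qed

lemma pow_component: assumes x: "x \<in> carrier PRG" and f: "f \<in> M" shows "(x [^]\<^bsub>PRG\<^esub> (n::nat)) f = x f [^]\<^bsub>RG f\<^esub> n"
proof -
  interpret h: group_hom PRG "RG f" "\<lambda>x. x f" by (rule group_hom_component[OF f])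
  show ?thesis by (rule h.hom_nat_pow[OF x])
qed

sublocale FG: p_filtered_group PRG K p
proof (intro p_filtered_group.intro filtered_group.intro filtered_group_axioms.intro padic.intro p_filtered_group_axioms.intro)
  show "comm_group PRG" by (rule comm_group_PRG)
next
  fix n show "subgroup (K n) PRG" by (rule K_subgroup)
  show "K (Suc n) \<subseteq> K n" using lev_mono_eq[OF _ PRG.one_closed, of _ "Suc n" n] by (auto simp: K_iff)
  show "finite (rcosets\<^bsub>PRG\<^esub> (K n))" by (rule finite_rcosets_K)
next
  show "(\<Inter>n. K n) \<subseteq> {\<one>\<^bsub>PRG\<^esub>}"
  proof
    fix x assume x: "x \<in> (\<Inter>n. K n)"
    have "x = \<one>\<^bsub>PRG\<^esub>"
    proof (rule PRG_eqI)
      show xc: "x \<in> carrier PRG" using x by (auto simp: K_def)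
      fix f assume f: "f \<in> M"
      obtain m where m: "mod_dvd f (lev m)" using divides_lev[OF f] by blast
      show "x f = \<one>\<^bsub>PRG\<^esub> f" by (rule lev_determines[OF xc PRG.one_closed _ f m]) (use x in \<open>simp add: K_iff\<close>)
    qed simp
    then show "x \<in> {\<one>\<^bsub>PRG\<^esub>}" by simp
  qed
next
  fix y n assume "\<And>n. y n \<in> carrier PRG" "\<And>n. y (Suc n) \<otimes>\<^bsub>PRG\<^esub> inv\<^bsub>PRG\<^esub> y n \<in> K n"
  then show "\<exists>x\<in>carrier PRG. \<forall>n. x \<otimes>\<^bsub>PRG\<^esub> inv\<^bsub>PRG\<^esub> y n \<in> K n" by (rule K_complete)
next
  fix U show "openin (topo PRG) U = (U \<subseteq> carrier PRG \<and> (\<forall>x\<in>U. \<exists>n. \<forall>y\<in>carrier PRG. y \<otimes>\<^bsub>PRG\<^esub> inv\<^bsub>PRG\<^esub> x \<in> K n \<longrightarrow> y \<in> U))"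
    by (rule K_open)
next
  show "Factorial_Ring.prime p" by (rule p)
next
  fix x n assume x: "x \<in> K n"
  have xc: "x \<in> carrier PRG" using x by (simp add: K_def)
  obtain z where z: "z \<in> ray (lev n)" "principal z \<in> A0" "x (lev (Suc n)) = cs (lev (Suc n)) (principal z)"
    by (rule K_principal[OF x])
  have "(x [^]\<^bsub>PRG\<^esub> p) (lev (Suc n)) = cs (lev (Suc n)) (principal (z ^ p))"
    unfolding pow_component[OF xc lev_moduli] z(3)
    by (rule cs_principal_pow(2)[OF modulus_lev]) (simp add: A_lev z(2))
  also have "\<dots> = \<one>\<^bsub>RG (lev (Suc n))\<^esub>" by (rule cs_ray[OF power_p_ray[OF z(1)]])
  finally show "x [^]\<^bsub>PRG\<^esub> p \<in> K (Suc n)" using xc by (simp add: K_def)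
next
  \<comment> \<open>With \<open>x\<close> representing \<open>y\<close> at level
    \<open>n + 2\<close> and \<open>z\<close> its approximate root, the class of \<open>z\<close> is
    the root sought: \<open>x * inverse (z ^ p)\<close> lies in the ray of level
    \<open>n + 2\<close>, so \<open>y\<close> and the \<open>p\<close>-th power agree there.\<close>
  fix y n assume y: "y \<in> K (Suc n)"
  have yc: "y \<in> carrier PRG" using y by (simp add: K_def)
  obtain x where x: "x \<in> ray (lev (Suc n))" "principal x \<in> A0" "y (lev (Suc (Suc n))) = cs (lev (Suc (Suc n))) (principal x)"
    by (rule K_principal[OF y])
  obtain z where z: "z \<in> ray (lev n)" "x * inverse (z ^ p) \<in> ray (lev (n + 2))" using approximate_root[OF x(1)] by blast
  let ?w = "ray_class (principal z)"
  have zA: "principal z \<in> A0" by (rule ray_A0[OF z(1)])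
  have wc: "?w \<in> carrier PRG" by (rule ray_class[OF zA])
  have zp: "principal (z ^ p) \<in> A0" using cs_principal_pow(1)[OF modulus_lev, of z "0" p] zA by (simp add: A_lev)
  have "?w \<in> K n" using wc cs_ray[OF z(1)] by (simp add: K_def)
  moreover have "y (lev (Suc (Suc n))) = (?w [^]\<^bsub>PRG\<^esub> p) (lev (Suc (Suc n)))"
  proof -
    have "(?w [^]\<^bsub>PRG\<^esub> p) (lev (Suc (Suc n))) = cs (lev (Suc (Suc n))) (principal (z ^ p))"
      unfolding pow_component[OF wc lev_moduli] ray_class_lev
      by (rule cs_principal_pow(2)[OF modulus_lev]) (simp add: A_lev zA)
    moreover have "principal x = principal (x * inverse (z ^ p)) \<diamondop> principal (z ^ p)"
      unfolding principal_mult using ray_nonzero[OF z(1)] by (simp add: field_simps)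
    ultimately show ?thesis
      unfolding x(3) using cs_eq_iff[OF modulus_lev, of "principal x" "Suc (Suc n)" "principal (z ^ p)"] z(2) x(2) zp
      by (auto simp: A_lev)
  qed
  ultimately show "\<exists>x\<in>K n. y \<otimes>\<^bsub>PRG\<^esub> inv\<^bsub>PRG\<^esub> (x [^]\<^bsub>PRG\<^esub> p) \<in> K (Suc (Suc n))"
    using quotient_in_K[OF yc PRG.nat_pow_closed[OF wc]] by blast
qed

end

section \<open>Ray class distributions\<close>

text \<open>The lattice is spanned by finitely many elements over the valuation ring, and a common
  lower bound for their valuations is one for the lattice.\<close>

lemma (in valued_field) lattice_bounded_below:
  assumes "is_lattice v (*) \<Lambda>"
  shows "\<exists>c::real. \<forall>x\<in>\<Lambda>. ereal c \<le> v x"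
proof -
  obtain B where B: "finite B" "\<Lambda> = {\<Sum>b\<in>B. a b * b | a. a ` B \<subseteq> val_ring v}" using assms unfolding is_lattice_def by blast
  have "\<exists>n::real. ereal n \<le> v b" for b
    using v_real[of b] by (cases "b = 0") auto
  then obtain n :: "'e \<Rightarrow> real" where n: "\<And>b. ereal (n b) \<le> v b" by metis
  \<comment> \<open>Minus the sum of absolute values lies below every \<open>n b\<close> and avoids
    a minimum over a possibly empty set.\<close>
  define c where "c = - (\<Sum>b\<in>B. \<bar>n b\<bar>)"
  have c: "ereal c \<le> v b" if "b \<in> B" for b
  proof -
    have "\<bar>n b\<bar> \<le> (\<Sum>b\<in>B. \<bar>n b\<bar>)" by (rule member_le_sum) (use that B in auto)
    then have "c \<le> n b" unfolding c_def by linarith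
    then show ?thesis using n[of b] by (meson ereal_less_eq(3) order_trans)
  qed
  have "ereal c \<le> v x" if "x \<in> \<Lambda>" for x
  proof -
    obtain a where a: "x = (\<Sum>b\<in>B. a b * b)" "a ` B \<subseteq> val_ring v" using \<open>x \<in> \<Lambda>\<close> unfolding B(2) by blast
    have "ereal c \<le> v (a b * b)" if b: "b \<in> B" for b
    proof -
      have "0 \<le> v (a b)" using a(2) b by (auto simp: val_ring_def)
      then have "0 + ereal c \<le> v (a b) + v b" using c[OF b] by (rule add_mono)
      then show ?thesis by (simp add: v_mult)
    qed
    then show ?thesis unfolding a(1) by (rule v_sum_ge)
  qed
  then show ?thesis by blast
qed

locale ray_distribution = ray_class_setting kt p F
  for kt :: "'k::field_char_0 itself" and p :: nat and F :: "'k modulus" +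
  fixes \<iota> :: "(nat \<Rightarrow> rat) set \<Rightarrow> 'e::field" and v :: "'e \<Rightarrow> ereal" and \<alpha> :: "'k set \<Rightarrow> 'e"
    and \<Theta> :: "'k modulus \<Rightarrow> 'k set set \<Rightarrow> 'e" and r :: real
  assumes ext: "padic_extension p \<iota> v"
    and \<Theta>: "ray_class_distribution v (*) F \<alpha> \<Theta>"
    and r_eq: "r = (\<Sum>P\<in>unbounded_primes F. real (ramification_index p P) * real_of_ereal (v (\<alpha> P)))"
begin

sublocale V: valued_field v
  using ext by unfold_locales (simp add: padic_extension_def)

text \<open>All points of a coset of \<open>K m\<close> have the same component at level
  \<open>m\<close>, so the coefficient does not depend on the sample point.\<close>

definition \<psi> :: "nat \<Rightarrow> ('k modulus \<Rightarrow> 'k set set) set \<Rightarrow> 'e" where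
  "\<psi> m C = \<Theta> (lev m) (FG.rep C (lev m))"

definition fibre :: "nat \<Rightarrow> 'k set set \<Rightarrow> ('k modulus \<Rightarrow> 'k set set) set" where
  "fibre m c = {x \<in> carrier PRG. x (lev m) = c}"

lemma eqv_iff: "FG.eqv m x y \<longleftrightarrow> x \<in> carrier PRG \<and> y \<in> carrier PRG \<and> x (lev m) = y (lev m)"
  using quotient_in_K[of x y m] by (auto simp: FG.eqv_def)

lemma r_coset_fibre: assumes "x \<in> carrier PRG" shows "K m #>\<^bsub>PRG\<^esub> x = fibre m (x (lev m))"
  using assms by (auto simp: FG.r_coset_iff eqv_iff fibre_def)

text \<open>A class at one level is represented by an ideal of \<open>A0\<close>, and this ideal
  defines compatible classes at all levels.\<close>

lemma fibre_point: assumes "c \<in> carrier (RG (lev m))" shows "\<exists>x\<in>carrier PRG. x (lev m) = c"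
proof -
  obtain I where I: "I \<in> A0" "c = cs (lev m) I" using assms unfolding RG_lev_carrier by blast
  then show ?thesis using ray_class[OF I(1)] ray_class_lev[of I m] by blast
qed

lemma rcosets_fibre: "rcosets\<^bsub>PRG\<^esub> (K m) = fibre m ` carrier (RG (lev m))"
proof -
  have "(\<lambda>x. x (lev m)) ` carrier PRG = carrier (RG (lev m))"
    using PRG_component[OF _ lev_moduli] fibre_point by blast
  then have "fibre m ` carrier (RG (lev m)) = (\<lambda>x. fibre m (x (lev m))) ` carrier PRG" by (metis image_image)
  then show ?thesis unfolding FG.rcosets_eq by (simp add: r_coset_fibre)
qed

lemma fibre_rcosets: "c \<in> carrier (RG (lev m)) \<Longrightarrow> fibre m c \<in> rcosets\<^bsub>PRG\<^esub> (K m)"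
  unfolding rcosets_fibre by (rule imageI)

lemma inj_fibre: "inj_on (fibre m) (carrier (RG (lev m)))"
proof (rule inj_onI)
  fix c d assume c: "c \<in> carrier (RG (lev m))" and eq: "fibre m c = fibre m d"
  obtain x where "x \<in> carrier PRG" "x (lev m) = c" using fibre_point[OF c] by blast
  then have "x \<in> fibre m d" unfolding eq[symmetric] by (simp add: fibre_def)
  then show "c = d" using \<open>x (lev m) = c\<close> by (simp add: fibre_def)
qed

lemma rep_fibre: assumes "c \<in> carrier (RG (lev m))" shows "FG.rep (fibre m c) \<in> carrier PRG" "FG.rep (fibre m c) (lev m) = c"
  using FG.rep(1)[OF fibre_rcosets[OF assms]] by (simp_all add: fibre_def)

lemma \<psi>_fibre: "c \<in> carrier (RG (lev m)) \<Longrightarrow> \<psi> m (fibre m c) = \<Theta> (lev m) c"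
  by (simp add: \<psi>_def rep_fibre)

text \<open>By \<open>finite_RG\<close> the fibre is finite, so the terms with coefficient 0 can be
  put back into the sum.\<close>

lemma \<Theta>_sum:
  assumes f: "f \<in> M" "f' \<in> M" "mod_dvd f f'" and c: "c \<in> carrier (RG f)"
  shows "\<Theta> f c = (\<Sum>d | d \<in> carrier (RG f') \<and> ray_class_map f d = c. \<Theta> f' d)"
proof -
  have "\<Theta> f c = (\<Sum>d | d \<in> carrier (RG f') \<and> \<Theta> f' d \<noteq> 0 \<and> ray_class_map f d = c. \<Theta> f' d)"
    using \<Theta> f c unfolding ray_class_distribution_def by blast
  also have "\<dots> = (\<Sum>d | d \<in> carrier (RG f') \<and> ray_class_map f d = c. \<Theta> f' d)"
    by (rule sum.mono_neutral_left) (use finite_RG[OF moduliD(1)[OF f(2)]] in auto)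
  finally show ?thesis .
qed

lemma fibre_sub_iff:
  assumes d: "d \<in> carrier (RG (lev (Suc m)))"
  shows "fibre (Suc m) d \<subseteq> fibre m c \<longleftrightarrow> ray_class_map (lev m) d = c"
proof -
  have low: "x (lev m) = ray_class_map (lev m) d" if "x \<in> fibre (Suc m) d" for x
    using PRG_compat[OF _ lev_moduli lev_moduli mod_dvd_lev_mono[of m "Suc m"], of x] that by (simp add: fibre_def)
  obtain x where x: "x \<in> fibre (Suc m) d" using fibre_point[OF d] by (auto simp: fibre_def)
  show ?thesis
  proof
    assume "fibre (Suc m) d \<subseteq> fibre m c"
    then have "x (lev m) = c" using x by (auto simp: fibre_def)
    then show "ray_class_map (lev m) d = c" using low[OF x] by simp
  next
    assume "ray_class_map (lev m) d = c"
    then show "fibre (Suc m) d \<subseteq> fibre m c" using low by (intro subsetI) (simp add: fibre_def)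
  qed
qed

sublocale FD: filtered_distribution PRG K v \<psi>
proof
  fix C n assume "C \<in> rcosets\<^bsub>PRG\<^esub> (K n)"
  then obtain c where c: "c \<in> carrier (RG (lev n))" "C = fibre n c" unfolding rcosets_fibre by blast
  let ?S = "{d \<in> carrier (RG (lev (Suc n))). ray_class_map (lev n) d = c}"
  have "{D. D \<in> rcosets\<^bsub>PRG\<^esub> (K (Suc n)) \<and> D \<subseteq> C} = fibre (Suc n) ` ?S"
    unfolding rcosets_fibre c(2) using fibre_sub_iff by blast
  then have "(\<Sum>D | D \<in> rcosets\<^bsub>PRG\<^esub> (K (Suc n)) \<and> D \<subseteq> C. \<psi> (Suc n) D) = (\<Sum>D\<in>fibre (Suc n) ` ?S. \<psi> (Suc n) D)"
    by simp
  also have "\<dots> = (\<Sum>d\<in>?S. \<psi> (Suc n) (fibre (Suc n) d))"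
    by (subst sum.reindex[OF inj_on_subset[OF inj_fibre]]) auto
  also have "\<dots> = (\<Sum>d\<in>?S. \<Theta> (lev (Suc n)) d)" by (rule sum.cong) (auto simp: \<psi>_fibre)
  also have "\<dots> = \<Theta> (lev n) c"
    using \<Theta>_sum[OF lev_moduli lev_moduli mod_dvd_lev_mono[of n "Suc n"] c(1)] by simp
  also have "\<dots> = \<psi> n C" using c by (simp add: \<psi>_fibre)
  finally show "\<psi> n C = (\<Sum>D | D \<in> rcosets\<^bsub>PRG\<^esub> (K (Suc n)) \<and> D \<subseteq> C. \<psi> (Suc n) D)" ..
qed

text \<open>\<open>ray_lc_distribution\<close> prescribes values for all moduli dividing
  \<open>F\<close>, while \<open>\<mu>\<close> is built from the tower alone. A level that is a
  multiple of \<open>f\<close> settles \<open>f\<close>, by compatibility of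
  \<open>\<Theta>\<close>.\<close>

lemma \<mu>_component:
  assumes f: "f \<in> M" and c: "c \<in> carrier (RG f)"
  shows "FD.\<mu> (char_fun PRG {x \<in> carrier PRG. x f = c}) = \<Theta> f c"
proof -
  let ?h = "char_fun PRG {x \<in> carrier PRG. x f = c} :: _ \<Rightarrow> 'e"
  obtain m where m: "mod_dvd f (lev m)" using divides_lev[OF f] by blast
  have h: "?h x = (if ray_class_map f (x (lev m)) = c then 1 else 0)" if "x \<in> carrier PRG" for x
    using PRG_compat[OF that f lev_moduli m] that by (simp add: char_fun_def)
  have "FG.invariant m ?h" unfolding FG.invariant_def eqv_iff using h by simp
  then have "FD.\<mu> ?h = FD.riemann_sum m ?h" by (rule FD.\<mu>_eq[OF FG.char_fun_extensional])
  also have "\<dots> = (\<Sum>d\<in>carrier (RG (lev m)). \<psi> m (fibre m d) * ?h (FG.rep (fibre m d)))"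
    unfolding FD.riemann_sum_def rcosets_fibre by (subst sum.reindex[OF inj_fibre]) simp
  also have "\<dots> = (\<Sum>d\<in>carrier (RG (lev m)). if ray_class_map f d = c then \<Theta> (lev m) d else 0)"
    by (rule sum.cong) (simp_all add: \<psi>_fibre h rep_fibre)
  also have "\<dots> = (\<Sum>d | d \<in> carrier (RG (lev m)) \<and> ray_class_map f d = c. \<Theta> (lev m) d)"
    by (rule sum.inter_filter[symmetric, OF finite_RG[OF modulus_lev]])
  also have "\<dots> = \<Theta> f c" by (rule \<Theta>_sum[OF f lev_moduli m c, symmetric])
  finally show ?thesis .
qed

text \<open>Existence and uniqueness behind the definite description: the levels of the tower are
  among the moduli, so the prescribed values determine the functional on all cosets.\<close>

lemma ray_lc_distribution_eq: "ray_lc_distribution F \<Theta> = FD.\<mu>"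
  unfolding ray_lc_distribution_def Let_def
proof (rule the_equality)
  show "lc_distribution PRG FD.\<mu> \<and> (\<forall>f\<in>M. \<forall>c\<in>carrier (RG f). FD.\<mu> (char_fun PRG {x \<in> carrier PRG. x f = c}) = \<Theta> f c)"
    using FD.lc_distribution_\<mu> \<mu>_component by blast
  fix L assume L: "lc_distribution PRG L \<and> (\<forall>f\<in>M. \<forall>c\<in>carrier (RG f). L (char_fun PRG {x \<in> carrier PRG. x f = c}) = \<Theta> f c)"
  show "L = FD.\<mu>"
  proof (rule FG.lc_distribution_unique[OF conjunct1[OF L] FD.lc_distribution_\<mu>])
    fix n C assume "C \<in> rcosets\<^bsub>PRG\<^esub> (K n)"
    then obtain c where c: "c \<in> carrier (RG (lev n))" "C = fibre n c" unfolding rcosets_fibre by blast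
    have "L (char_fun PRG (fibre n c)) = \<Theta> (lev n) c" using L lev_moduli c(1) unfolding fibre_def by blast
    also have "\<dots> = FD.\<mu> (char_fun PRG (fibre n c))" using \<mu>_component[OF lev_moduli c(1)] unfolding fibre_def ..
    finally show "L (char_fun PRG C) = FD.\<mu> (char_fun PRG C)" unfolding c(2) .
  qed
qed

lemma \<alpha>: assumes "P \<in> Ub" shows "\<alpha> P \<noteq> 0" "0 \<le> real_of_ereal (v (\<alpha> P))"
  using \<Theta> assms by (auto simp: ray_class_distribution_def growth_parameter_def val_ring_def real_of_ereal_pos)

lemma r_nonneg: "0 \<le> r"
  unfolding r_eq by (intro sum_nonneg mult_nonneg_nonneg \<alpha>) auto

text \<open>The exponent of \<open>P\<close> at level \<open>m\<close> is
  \<open>e P * (m + 2)\<close>, which is how the ramification indices enter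
  \<open>r\<close>.\<close>

lemma v_delta: "delta_at F \<alpha> (lev m) \<noteq> 0" "v (delta_at F \<alpha> (lev m)) = ereal (r * real (m + 2))"
proof -
  show "delta_at F \<alpha> (lev m) \<noteq> 0" using \<alpha>(1) finite_Ub by (simp add: delta_at_def)
  have "v (delta_at F \<alpha> (lev m)) = ereal (\<Sum>P\<in>Ub. real_of_ereal (v (\<alpha> P ^ ex (lev m) P)))"
    unfolding delta_at_def by (rule V.v_prod[OF finite_Ub]) (simp add: \<alpha>)
  also have "(\<Sum>P\<in>Ub. real_of_ereal (v (\<alpha> P ^ ex (lev m) P))) = (\<Sum>P\<in>Ub. real (e P) * real_of_ereal (v (\<alpha> P)) * real (m + 2))"
    by (rule sum.cong) (simp_all add: V.v_power \<alpha> exponent_lev algebra_simps)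
  also have "\<dots> = r * real (m + 2)" unfolding r_eq sum_distrib_right ..
  finally show "v (delta_at F \<alpha> (lev m)) = ereal (r * real (m + 2))" .
qed

lemma growth: "\<exists>c0. \<forall>n. \<forall>C\<in>rcosets\<^bsub>PRG\<^esub> (K n). ereal (c0 - r * real n) \<le> v (\<psi> n C)"
proof -
  obtain \<Lambda> where \<Lambda>: "is_lattice v (*) \<Lambda>" "\<And>f c. f \<in> M \<Longrightarrow> c \<in> carrier (RG f) \<Longrightarrow> \<Theta> f c \<in> (*) (inverse (delta_at F \<alpha> f)) ` \<Lambda>"
    using \<Theta> unfolding ray_class_distribution_def by blast
  obtain b where b: "\<And>x. x \<in> \<Lambda> \<Longrightarrow> ereal b \<le> v x" using V.lattice_bounded_below[OF \<Lambda>(1)] by blast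
  \<comment> \<open>\<open>b\<close> bounds the lattice from below, and \<open>- 2 * r\<close> comes
    from the offset 2 in the exponents of \<open>lev\<close>.\<close>
  have "ereal (b - 2 * r - r * real n) \<le> v (\<psi> n C)" if C: "C \<in> rcosets\<^bsub>PRG\<^esub> (K n)" for n C
  proof -
    obtain c where c: "c \<in> carrier (RG (lev n))" "C = fibre n c" using C unfolding rcosets_fibre by blast
    obtain x where x: "x \<in> \<Lambda>" "\<Theta> (lev n) c = inverse (delta_at F \<alpha> (lev n)) * x" using \<Lambda>(2)[OF lev_moduli c(1)] by blast
    have "v (\<Theta> (lev n) c) = ereal (- (r * real (n + 2))) + v x"
      unfolding x(2) V.v_mult V.v_inverse[OF v_delta(1)] v_delta(2) by simp
    moreover have "ereal (- (r * real (n + 2))) + ereal b \<le> ereal (- (r * real (n + 2))) + v x"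
      by (rule add_left_mono[OF b[OF x(1)]])
    moreover have "ereal (- (r * real (n + 2))) + ereal b = ereal (b - 2 * r - r * real n)" by (simp add: algebra_simps)
    ultimately show ?thesis using c by (simp only: \<psi>_fibre)
  qed
  then show ?thesis by blast
qed

text \<open>The \<open>p ^ m\<close>-th powers of \<open>K t\<close> form \<open>K (t + m)\<close>,
  so the measures in question are values of \<open>\<psi>\<close> at level \<open>t + m\<close>; the
  shift by \<open>t\<close> goes into the constant.\<close>

lemma growth_bounded_\<mu>: "growth_bounded p v PRG r FD.\<mu>"
proof -
  obtain c0 where c0: "\<And>n C. C \<in> rcosets\<^bsub>PRG\<^esub> (K n) \<Longrightarrow> ereal (c0 - r * real n) \<le> v (\<psi> n C)" using growth by blast
  obtain t where t: "open_Zp_subgroup p PRG (K t)" using FG.open_Zp_subgroup_K by blast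
  have "ereal (c0 - r * real t - r * real m)
      \<le> (INF a\<in>carrier PRG. v (FD.\<mu> (char_fun PRG (a <#\<^bsub>PRG\<^esub> p_multiples p m PRG (K t)))))" for m
  proof (rule INF_greatest)
    fix a assume a: "a \<in> carrier PRG"
    have "a <#\<^bsub>PRG\<^esub> K (t + m) = K (t + m) #>\<^bsub>PRG\<^esub> a"
      unfolding l_coset_def r_coset_def using a FG.K_carrier PRG.m_comm by auto
    then have C: "a <#\<^bsub>PRG\<^esub> p_multiples p m PRG (K t) \<in> rcosets\<^bsub>PRG\<^esub> (K (t + m))"
      unfolding FG.p_multiples_K using FG.rcoset_in[OF a] by simp
    have "ereal (c0 - r * real t - r * real m) = ereal (c0 - r * real (t + m))" by (simp add: algebra_simps)
    also have "\<dots> \<le> v (\<psi> (t + m) (a <#\<^bsub>PRG\<^esub> p_multiples p m PRG (K t)))" by (rule c0[OF C])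
    finally show "ereal (c0 - r * real t - r * real m) \<le> v (FD.\<mu> (char_fun PRG (a <#\<^bsub>PRG\<^esub> p_multiples p m PRG (K t))))"
      unfolding FD.\<mu>_char_fun[OF C] .
  qed
  then show ?thesis unfolding growth_bounded_def using FD.lc_distribution_\<mu> t by blast
qed

lemma unique_extension_\<mu>:
  assumes H: "open_Zp_subgroup p PRG H"
  shows "\<exists>!L. L \<in> Dr_space p v r PRG H \<and> restrict L (LC PRG) = FD.\<mu>"
proof -
  obtain c0 where c0: "\<And>n C. C \<in> rcosets\<^bsub>PRG\<^esub> (K n) \<Longrightarrow> ereal (c0 - r * real n) \<le> v (\<psi> n C)" using growth by blast
  obtain c where c: "\<And>m. K (c + m) \<subseteq> p_multiples p m PRG H" using FG.open_Zp_subgroup_contains_K[OF H] by blast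
  interpret GD: growth_distribution PRG K v \<psi> r c0 p H c
  proof (intro growth_distribution.intro growth_distribution_axioms.intro FD.filtered_distribution_axioms)
    show "\<exists>l. \<forall>N::real. \<exists>M. \<forall>n\<ge>M. ereal N \<le> v (x n - l)"
      if cauchy: "\<And>N::real. \<exists>M. \<forall>m\<ge>M. \<forall>n\<ge>M. ereal N \<le> v (x m - x n)" for x :: "nat \<Rightarrow> 'e"
      by (rule padic_extension_complete[OF p ext], rule cauchy)
    show "subgroup H PRG" using H by (simp add: open_Zp_subgroup_def)
  qed (use r_nonneg c0 c FG.open_Zp_subgroup_multiples_small[OF H] in auto)
  show ?thesis by (rule GD.unique_extension)
qed

end

theorem theorem3p3:
  fixes p :: nat
    and \<iota> :: "(nat \<Rightarrow> rat) set \<Rightarrow> 'e::field"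
    and v :: "'e \<Rightarrow> ereal"
    and \<FF> :: "'k::field_char_0 modulus"
    and \<alpha> :: "'k set \<Rightarrow> 'e"
    and \<Theta> :: "'k modulus \<Rightarrow> 'k set set \<Rightarrow> 'e"
    and r :: real
  assumes "Factorial_Ring.prime p"
    and "padic_extension p \<iota> v"
    and "number_field TYPE('k)"
    and "pseudo_modulus \<FF>"
    and "unbounded_primes \<FF> \<subseteq> primes_above p"
    and "ray_class_distribution v (*) \<FF> \<alpha> \<Theta>"
    and "r = (\<Sum>P\<in>unbounded_primes \<FF>. real (ramification_index p P) * real_of_ereal (v (\<alpha> P)))"
  shows "growth_bounded p v (pro_ray_class_group \<FF>) r (ray_lc_distribution \<FF> \<Theta>) \<and>
    (r < 1 \<longrightarrow>
      (\<forall>H. open_Zp_subgroup p (pro_ray_class_group \<FF>) H \<longrightarrow>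
        (\<exists>!L. L \<in> Dr_space p v r (pro_ray_class_group \<FF>) H \<and>
              restrict L (LC (pro_ray_class_group \<FF>)) = ray_lc_distribution \<FF> \<Theta>)))"
proof -
  interpret ray_distribution "TYPE('k)" p \<FF> \<iota> v \<alpha> \<Theta> r
    by unfold_locales (rule assms)+
  show ?thesis
    unfolding ray_lc_distribution_eq using growth_bounded_\<mu> unique_extension_\<mu> by blast
qed

end
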